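(* Let $\Gamma$ be a Riemann surface of genus $g$ with divisors $P=P_1+\dots+P_n$, $D=\gamma_1+\dots+\gamma_{g+l}$, $R=r+r_1+\dots+r_l$, with local parameters $k_i^{-1}$ in neighborhoods of $P_i$, $i=1,\dots,n$, and let $Q_1,\dots,Q_{n+1}$ be $n+1$ points on $\Gamma$. Let $\psi(u_1,\dots,u_n,S)$ be the $n$-point Baker--Akhiezer function corresponding to the spectral data $\{\Gamma,P_1,\dots,P_n,k_1,\dots,k_n,D,R\}$, with normalization constant $h=\psi(r)\neq 0$ at $r$ and $\psi(r_j)=0$ for $j=1,\dots,l$. Assume: (i) there exists a holomorphic involution $\sigma:\Gamma\to\Gamma$ with stationary points $Q_1,\dots,Q_{n+1},P_1,\dots,P_n$ and $r$, which in some neighborhood of $P_i$ acts as $\sigma(k_i)=-k_i$, $i=1,\dots,n$; (ii) there exists a 1-form $\Omega$ on $\Gamma$ with divisor $(\Omega)=D+\sigma D+P-Q_1-\dots-Q_{n+1}-R-\sigma r_1-\dots-\sigma r_l$; (iii) there exists an antiholomorphic involution $\tau$ of $\Gamma$ such that the points of the divisors $P,D,R$ and the points $Q_1,\dots,Q_{n+1}$ are stationary with respect to $\tau$, and in a neighborhood of $P_i$ it has the form $\tau(k_i)=\overline{k_i}$. Put $A_i=\operatorname{Res}_{Q_i}\Omega$, $B=\operatorname{Res}_r\Omega$; let $C_i$ be defined from the expansion $\big(-C_ik_i^{-1}+\dots\big)\,dk_i^{-1}$ of the form $\Omega$ in a neighborhood of $P_i$, $i=1,\dots,n$; and let $f_j(u_1,\dots,u_n)$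 be the first coefficient of the expansion $e^{-u_jk_j}\psi=f_j+\frac{g_j}{k_j}+\dots$ in a neighborhood of $P_j$, $j=1,\dots,n$. Assume that all $A_i$ are real, $A_i<0$ for $i=2,\dots,n+1$, $A_1>0$ and $h^2B=-1$. Then the functions $$x^i(u_1,\dots,u_n)=\sqrt{|A_i|}\,\psi(u_1,\dots,u_n,Q_i),\qquad i=1,\dots,n+1,$$ give an orthogonal coordinate system in $H^n$. Moreover, the Lamé coefficients $$H_i=\sqrt{-f_i^2C_i}$$ satisfy, with $\beta_{ij}=\frac{\partial_iH_j}{H_i}$ for $i\neq j$ and $\partial_i=\partial/\partial u_i$, the equations $$\partial_k\beta_{ij}=\beta_{ik}\beta_{kj},\qquad i\neq j\neq k,$$ $$\partial_i\beta_{ij}+\partial_j\beta_{ji}+\sum_{m\neq i,j}\beta_{mi}\beta_{mj}=-K H_iH_j$$ for $K=-1$.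
   Context: The $n$-point Baker--Akhiezer function $\psi(u_1,\dots,u_n,S)$ ($u_1,\dots,u_n$ real variables, $S\in\Gamma$) corresponding to spectral data $\{\Gamma,P_1,\dots,P_n,k_1,\dots,k_n,D,R\}$, where $D=\gamma_1+\dots+\gamma_{g+l}$ and $R=r+r_1+\dots+r_l$, is a function with the following properties: (1) in neighborhoods of $P_1,\dots,P_n$ it has essential singularities of the form $\psi=e^{k_ju_j}\left(f_j+\frac{g_j}{k_j}+\dots\right)$, $j=1,\dots,n$, with $f_j,g_j,\dots$ functions of $u_1,\dots,u_n$; (2) $\psi$ is meromorphic on $\Gamma\setminus\{P_1,\dots,P_n\}$ with simple poles on $D$; (3) $\psi(u_1,\dots,u_n,r)=h$, where $h$ is a nonzero constant, and $\psi(u_1,\dots,u_n,r_i)=0$ for $i=1,\dots,l$. The involution $\sigma$ acts on divisors pointwise. The model of the hyperbolic space $H^n$ is a sheet of the two-sheet hyperboloid $(x^1)^2-(x^2)^2-\dots-(x^{n+1})^2=1$ embedded in the Minkowski space $\mathbb R^{1,n}$. The Lamé coefficients $H_i$ of an orthogonal coordinate system $u_1,\dots,u_n$ are those for which the metric has the form $ds^2=H_1^2\,du_1^2+\dots+H_n^2\,du_n^2$. The displayed system for $\beta_{ij}$ is the one corresponding to a metric of this form having constant curvature $K$.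
   Formalization: The Lamé coefficients are taken as H_i = sqrt|-f_i^2 C_i|, since the hypotheses force -f_i^2 C_i <= 0 and the printed root is imaginary; h is assumed real, since imaginary h makes x^i imaginary; coordinates and equations are claimed on the dense open set where no H_i vanishes. *)

theory Defs
  imports "HOL-Complex_Analysis.Complex_Analysis" "HOL-Homology.Homology"
begin

section \<open>Riemann surfaces\<close>

text \<open>A chart is a coordinate neighbourhood with a coordinate function; the values of the latter
  outside the neighbourhood are irrelevant.\<close>

type_synonym 'a chart = "'a set \<times> ('a \<Rightarrow> complex)"

abbreviation chart_inv :: "'a chart \<Rightarrow> complex \<Rightarrow> 'a" where
  "chart_inv c \<equiv> inv_into (fst c) (snd c)"

definition chart_on :: "'a topology \<Rightarrow> 'a chart \<Rightarrow> bool" where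
  "chart_on X c \<longleftrightarrow> openin X (fst c) \<and> open (snd c ` fst c) \<and>
     homeomorphic_map (subtopology X (fst c)) (top_of_set (snd c ` fst c)) (snd c)"

definition transition :: "'a chart \<Rightarrow> 'a chart \<Rightarrow> complex \<Rightarrow> complex" where
  "transition c d = snd d \<circ> chart_inv c"

definition compatible :: "'a chart \<Rightarrow> 'a chart \<Rightarrow> bool" where
  "compatible c d \<longleftrightarrow>
     transition c d holomorphic_on snd c ` (fst c \<inter> fst d) \<and>
     transition d c holomorphic_on snd d ` (fst c \<inter> fst d)"

text \<open>The atlas is required to be maximal, so that its members are exactly the local
  holomorphic coordinates.\<close>

definition riemann_surface :: "'a topology \<Rightarrow> 'a chart set \<Rightarrow> bool" where
  "riemann_surface X \<A> \<longleftrightarrow>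
     topspace X \<noteq> {} \<and> Hausdorff_space X \<and> connected_space X \<and>
     (\<forall>c\<in>\<A>. chart_on X c) \<and> (\<Union>c\<in>\<A>. fst c) = topspace X \<and>
     (\<forall>c\<in>\<A>. \<forall>d\<in>\<A>. compatible c d) \<and>
     (\<forall>c. chart_on X c \<and> (\<forall>d\<in>\<A>. compatible c d) \<longrightarrow> c \<in> \<A>)"

text \<open>A closed orientable surface has genus \<open>g\<close> iff its first integral homology is free abelian
  of rank \<open>2 g\<close>.\<close>

definition compact_riemann_surface :: "'a topology \<Rightarrow> 'a chart set \<Rightarrow> nat \<Rightarrow> bool" where
  "compact_riemann_surface X \<A> g \<longleftrightarrow>
     riemann_surface X \<A> \<and> compact_space X \<and>
     homology_group 1 X \<cong> free_Abelian_group {..<2 * g}"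

definition holomorphic_self_map :: "'a topology \<Rightarrow> 'a chart set \<Rightarrow> ('a \<Rightarrow> 'a) \<Rightarrow> bool" where
  "holomorphic_self_map X \<A> f \<longleftrightarrow> continuous_map X X f \<and>
     (\<forall>c\<in>\<A>. \<forall>d\<in>\<A>. (\<lambda>z. snd d (f (chart_inv c z)))
        holomorphic_on snd c ` {p \<in> fst c. f p \<in> fst d})"

definition antiholomorphic_self_map :: "'a topology \<Rightarrow> 'a chart set \<Rightarrow> ('a \<Rightarrow> 'a) \<Rightarrow> bool" where
  "antiholomorphic_self_map X \<A> f \<longleftrightarrow> continuous_map X X f \<and>
     (\<forall>c\<in>\<A>. \<forall>d\<in>\<A>. (\<lambda>z. cnj (snd d (f (chart_inv c z))))
        holomorphic_on snd c ` {p \<in> fst c. f p \<in> fst d})"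

definition holomorphic_involution :: "'a topology \<Rightarrow> 'a chart set \<Rightarrow> ('a \<Rightarrow> 'a) \<Rightarrow> bool" where
  "holomorphic_involution X \<A> \<sigma> \<longleftrightarrow>
     holomorphic_self_map X \<A> \<sigma> \<and> (\<forall>p\<in>topspace X. \<sigma> (\<sigma> p) = p)"

definition antiholomorphic_involution :: "'a topology \<Rightarrow> 'a chart set \<Rightarrow> ('a \<Rightarrow> 'a) \<Rightarrow> bool" where
  "antiholomorphic_involution X \<A> \<tau> \<longleftrightarrow>
     antiholomorphic_self_map X \<A> \<tau> \<and> (\<forall>p\<in>topspace X. \<tau> (\<tau> p) = p)"


section \<open>Divisors and meromorphic 1-forms\<close>

text \<open>Divisors are elements of the free abelian group on points.\<close>

definition divisor_of :: "'a list \<Rightarrow> 'a \<Rightarrow>\<^sub>0 int" where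
  "divisor_of ps = (\<Sum>p\<leftarrow>ps. frag_of p)"

definition push_divisor :: "('a \<Rightarrow> 'a) \<Rightarrow> ('a \<Rightarrow>\<^sub>0 int) \<Rightarrow> 'a \<Rightarrow>\<^sub>0 int" where
  "push_divisor \<sigma> E = frag_extend (\<lambda>p. frag_of (\<sigma> p)) E"

text \<open>A meromorphic 1-form is given by its coefficient \<open>\<omega> c\<close> in every chart, so that it reads
  \<open>\<omega> c z dz\<close> there. The transformation law is only required off a sparse set, since values at
  poles carry no information.\<close>

type_synonym 'a form = "'a chart \<Rightarrow> complex \<Rightarrow> complex"

definition meromorphic_form :: "'a chart set \<Rightarrow> 'a form \<Rightarrow> bool" where
  "meromorphic_form \<A> \<omega> \<longleftrightarrow>
     (\<forall>c\<in>\<A>. \<omega> c meromorphic_on snd c ` fst c) \<and>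
     (\<forall>c\<in>\<A>. \<forall>d\<in>\<A>. \<forall>\<^sub>\<approx>z\<in>snd c ` (fst c \<inter> fst d).
        \<omega> c z = \<omega> d (transition c d z) * deriv (transition c d) z)"

text \<open>The library's \<^const>\<open>zorder\<close> is meaningful only for functions that do not vanish identically near
  the point, whence the frequently-clause.\<close>

definition has_divisor :: "'a chart set \<Rightarrow> 'a form \<Rightarrow> ('a \<Rightarrow>\<^sub>0 int) \<Rightarrow> bool" where
  "has_divisor \<A> \<omega> E \<longleftrightarrow>
     (\<forall>c\<in>\<A>. \<forall>p\<in>fst c. (\<exists>\<^sub>F z in at (snd c p). \<omega> c z \<noteq> 0) \<and>
        zorder (\<omega> c) (snd c p) = Poly_Mapping.lookup E p)"

text \<open>The residue does not depend on the chart.\<close>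

definition form_residue :: "'a chart set \<Rightarrow> 'a form \<Rightarrow> 'a \<Rightarrow> complex" where
  "form_residue \<A> \<omega> p = (let c = SOME c. c \<in> \<A> \<and> p \<in> fst c in residue (\<omega> c) (snd c p))"


section \<open>Baker--Akhiezer functions\<close>

text \<open>A local parameter \<open>k\<^sup>-\<^sup>1\<close> at \<open>p\<close> is a chart centred at \<open>p\<close>.\<close>

definition local_parameter :: "'a chart set \<Rightarrow> 'a \<Rightarrow> 'a chart \<Rightarrow> bool" where
  "local_parameter \<A> p c \<longleftrightarrow> c \<in> \<A> \<and> p \<in> fst c \<and> snd c p = 0"

text \<open>The function \<open>e\<^bsup>- u k\<^esup> \<phi>\<close> in terms of the local parameter \<open>z = k\<^sup>-\<^sup>1\<close>.\<close>

definition regular_factor :: "'a chart \<Rightarrow> real \<Rightarrow> ('a \<Rightarrow> complex) \<Rightarrow> complex \<Rightarrow> complex" where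
  "regular_factor c u \<phi> = (\<lambda>z. exp (- of_real u / z) * \<phi> (chart_inv c z))"

definition leading_coeff :: "'a chart \<Rightarrow> real \<Rightarrow> ('a \<Rightarrow> complex) \<Rightarrow> complex" where
  "leading_coeff c u \<phi> = fls_nth (laurent_expansion (regular_factor c u \<phi>) 0) 0"

text \<open>The defining properties for fixed \<open>u\<close>. As usual, the poles on \<open>\<gamma>s\<close> are at most simple
  (at \<open>u = 0\<close> the function may be constant); Laurent expansions ignore the value at the centre,
  so the values of \<open>\<phi>\<close> at its singularities do not matter.\<close>

definition baker_akhiezer_at ::
  "'a chart set \<Rightarrow> ('n::finite \<Rightarrow> 'a) \<Rightarrow> ('n \<Rightarrow> 'a chart) \<Rightarrow> 'a list \<Rightarrow> 'a \<Rightarrow> 'a list \<Rightarrow> complex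
    \<Rightarrow> real ^ 'n \<Rightarrow> ('a \<Rightarrow> complex) \<Rightarrow> bool" where
  "baker_akhiezer_at \<A> P \<kappa> \<gamma>s r rs h u \<phi> \<longleftrightarrow>
     (\<forall>j. \<exists>F. regular_factor (\<kappa> j) (u $ j) \<phi> has_laurent_expansion fps_to_fls F) \<and>
     (\<forall>c\<in>\<A>. (\<lambda>z. \<phi> (chart_inv c z)) holomorphic_on snd c ` (fst c - range P - set \<gamma>s)) \<and>
     (\<forall>c\<in>\<A>. \<forall>p\<in>fst c \<inter> set \<gamma>s. \<exists>F.
        (\<lambda>z. \<phi> (chart_inv c (snd c p + z))) has_laurent_expansion F \<and> -1 \<le> fls_subdegree F) \<and>
     \<phi> r = h \<and> (\<forall>q\<in>set rs. \<phi> q = 0)"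

text \<open>\<open>\<psi>\<close> is \<^emph>\<open>the\<close> Baker--Akhiezer function for parameters in \<open>U\<close>: it has the defining properties
  and is determined by them, as it is for a divisor \<open>\<gamma>s\<close> in general position.\<close>

definition baker_akhiezer ::
  "'a topology \<Rightarrow> 'a chart set \<Rightarrow> ('n::finite \<Rightarrow> 'a) \<Rightarrow> ('n \<Rightarrow> 'a chart) \<Rightarrow> 'a list \<Rightarrow> 'a \<Rightarrow> 'a list
    \<Rightarrow> complex \<Rightarrow> (real ^ 'n) set \<Rightarrow> (real ^ 'n \<Rightarrow> 'a \<Rightarrow> complex) \<Rightarrow> bool" where
  "baker_akhiezer X \<A> P \<kappa> \<gamma>s r rs h U \<psi> \<longleftrightarrow>
     (\<forall>u\<in>U. baker_akhiezer_at \<A> P \<kappa> \<gamma>s r rs h u (\<psi> u) \<and>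
        (\<forall>\<phi>. baker_akhiezer_at \<A> P \<kappa> \<gamma>s r rs h u \<phi> \<longrightarrow>
           (\<forall>p\<in>topspace X - range P - set \<gamma>s. \<phi> p = \<psi> u p)))"


section \<open>Orthogonal coordinates in hyperbolic space\<close>

definition partial :: "'n::finite \<Rightarrow> (real ^ 'n \<Rightarrow> 'b::real_normed_vector) \<Rightarrow> real ^ 'n \<Rightarrow> 'b" where
  "partial i f u = vector_derivative (\<lambda>t. f (u + t *\<^sub>R axis i 1)) (at 0)"

primrec Ck_on :: "nat \<Rightarrow> (real ^ 'n::finite) set \<Rightarrow> (real ^ 'n \<Rightarrow> 'b::real_normed_vector) \<Rightarrow> bool" where
  "Ck_on 0 W f \<longleftrightarrow> continuous_on W f"
| "Ck_on (Suc k) W f \<longleftrightarrow> (\<forall>u\<in>W. f differentiable at u) \<and> (\<forall>i. Ck_on k W (partial i f))"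

definition smooth_on :: "(real ^ 'n::finite) set \<Rightarrow> (real ^ 'n \<Rightarrow> 'b::real_normed_vector) \<Rightarrow> bool" where
  "smooth_on W f \<longleftrightarrow> (\<forall>k. Ck_on k W f)"

text \<open>Minkowski space of signature \<open>(1, n)\<close> is indexed by \<open>'n option\<close>, which has \<open>n + 1\<close> elements;
  \<open>None\<close> is the time-like coordinate.\<close>

definition minkowski :: "real ^ ('n::finite option) \<Rightarrow> real ^ ('n option) \<Rightarrow> real" where
  "minkowski x y = x $ None * y $ None - (\<Sum>i\<in>UNIV. x $ Some i * y $ Some i)"

text \<open>The sign \<open>s\<close> selects one of the two sheets, each of which is a model of hyperbolic space.\<close>

definition hyperbolic_space :: "real \<Rightarrow> (real ^ ('n::finite option)) set" where
  "hyperbolic_space s = {x. minkowski x x = 1 \<and> sgn (x $ None) = s}"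

text \<open>A regular local parametrization, smooth and locally a homeomorphism onto relatively open
  sets, with induced metric \<open>\<Sum>i. H\<^sub>i\<^sup>2 du\<^sub>i\<^sup>2\<close>. In the signature above, the Riemannian metric of
  the hyperboloid is the restriction of minus the Minkowski form.\<close>

definition orthogonal_coordinates ::
  "(real ^ ('n::finite option)) set \<Rightarrow> (real ^ 'n) set \<Rightarrow> (real ^ 'n \<Rightarrow> real ^ ('n option))
    \<Rightarrow> ('n \<Rightarrow> real ^ 'n \<Rightarrow> real) \<Rightarrow> bool" where
  "orthogonal_coordinates S W x H \<longleftrightarrow>
     open W \<and> smooth_on W x \<and> (\<forall>i. smooth_on W (H i)) \<and> x ` W \<subseteq> S \<and>
     (\<forall>u\<in>W. \<exists>V y. open V \<and> u \<in> V \<and> V \<subseteq> W \<and>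
        openin (top_of_set S) (x ` V) \<and> homeomorphism V (x ` V) x y) \<and>
     (\<forall>u\<in>W. \<forall>i. 0 < H i u) \<and>
     (\<forall>u\<in>W. \<forall>i j. - minkowski (partial i x u) (partial j x u) = (if i = j then (H i u)\<^sup>2 else 0))"

definition rotation_coeff ::
  "('n::finite \<Rightarrow> real ^ 'n \<Rightarrow> real) \<Rightarrow> 'n \<Rightarrow> 'n \<Rightarrow> real ^ 'n \<Rightarrow> real" where
  "rotation_coeff H i j u = partial i (H j) u / H i u"

definition lame_equations :: "real \<Rightarrow> (real ^ 'n::finite) set \<Rightarrow> ('n \<Rightarrow> real ^ 'n \<Rightarrow> real) \<Rightarrow> bool" where
  "lame_equations K W H \<longleftrightarrow>
     (let \<beta> = rotation_coeff H in \<forall>u\<in>W.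
        (\<forall>i j k. i \<noteq> j \<and> j \<noteq> k \<and> i \<noteq> k \<longrightarrow> partial k (\<beta> i j) u = \<beta> i k u * \<beta> k j u) \<and>
        (\<forall>i j. i \<noteq> j \<longrightarrow>
           partial i (\<beta> i j) u + partial j (\<beta> j i) u + (\<Sum>m\<in>UNIV - {i, j}. \<beta> m i u * \<beta> m j u)
             = - K * H i u * H j u))"

end

theory Submission
  imports Defs
begin

text \<open>By \<open>\<sigma>(k\<^sub>j) = -k\<^sub>j\<close> the essential singularities cancel in \<open>\<psi> (\<psi> \<circ> \<sigma>) \<Omega>\<close> and in
  \<open>\<partial>\<^sub>i\<psi> (\<partial>\<^sub>j\<psi> \<circ> \<sigma>) \<Omega>\<close>, and these forms have only simple poles, at \<open>Q\<^sub>l\<close>, \<open>r\<close> and \<open>P\<^sub>j\<close>. The residue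
  theorem for the first one says that \<open>x\<close> lies on the hyperboloid, for the others that the induced
  metric is diagonal with coefficients \<open>H\<^sub>i\<^sup>2\<close>; the reality of \<open>x\<close> follows from uniqueness of \<open>\<psi>\<close>
  applied to its conjugate under \<open>\<tau>\<close>. The equations for \<open>\<beta>\<^sub>i\<^sub>j\<close> are then the integrability
  conditions of the orthonormal frame.

  That \<open>\<psi>\<close> is smooth in \<open>u\<close> is a consequence of uniqueness alone: difference quotients solve the
  linear singular problem with convergent data, and a compactness argument (rescaling a divergent
  sequence to a nonzero solution of the homogeneous problem) shows that solutions converge with
  their data. If \<open>f\<^sub>i\<close> vanished on an open set, uniqueness would give \<open>\<partial>\<^sub>i\<psi> = 0\<close> there, hence
  \<open>\<psi> = 0\<close> near \<open>P\<^sub>i\<close> and so everywhere, against \<open>\<psi>(r) \<noteq> 0\<close>; thus the coordinates are regular on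
  a dense open set.\<close>

section \<open>Plane integrals of compactly supported derivatives\<close>

text \<open>The obstacle is that \<open>\<psi>\<close> is given by its defining properties and not
  by a formula that could be differentiated, and that its derivative leaves the class of
  Baker-Akhiezer functions: differentiating exp (u / z) in u brings down 1 / z, a pole on top of the
  essential singularity. The class is therefore enlarged to problems with arbitrary principal parts
  (\<open>fam\<close>). Differentiation maps this class to itself with one more pole order, and
  smoothness is an induction over it.

  The residue theorem is reached without contours or triangulations. A partition of unity turns it
  into plane integrals of \<open>dbar\<close> of a cutoff times the form, which are compactly
  supported in charts and are compared by change of variables. Every simple pole contributes its
  residue times one universal constant, \<open>pole_const\<close>, while the cutoffs add up to 1,
  whose \<open>dbar\<close> is zero.

  Limits are taken along filters, so that Tychonoff's theorem for pointwise values serves in place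
  of diagonal subsequences.\<close>

lemma integral_directional_derivative_eq_0:
  fixes g :: "'a::euclidean_space \<Rightarrow> 'b::{banach,second_countable_topology}"
  assumes der: "\<And>z. (g has_derivative g' z) (at z)"
    and cont: "continuous_on UNIV (\<lambda>z. g' z v)"
    and supp: "\<And>z. R \<le> norm z \<Longrightarrow> g z = 0"
  shows "integral\<^sup>L lborel (\<lambda>z. g' z v) = 0"
proof -
  \<comment> \<open>Difference quotients along \<open>v\<close> with step 1 / (n + 1): translation
    invariance of \<open>lborel\<close> makes each of their integrals vanish, and dominated
    convergence passes this on to the derivative.\<close>
  define h where "h = (\<lambda>n z. real (Suc n) *\<^sub>R (g (z + (1 / real (Suc n)) *\<^sub>R v) - g z))"
  define K where "K = cball (0::'a) (\<bar>R\<bar> + norm v)"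
  have gcont: "continuous_on UNIV g"
    using der by (meson continuous_on_eq_continuous_at has_derivative_continuous open_UNIV)
  have gint: "integrable lborel g"
  proof -
    have "integrable lborel (\<lambda>x. indicator (cball 0 \<bar>R\<bar>) x *\<^sub>R g x)"
      by (rule borel_integrable_compact) (auto intro: continuous_on_subset[OF gcont])
    moreover have "(\<lambda>x. indicator (cball 0 \<bar>R\<bar>) x *\<^sub>R g x) = g"
      using supp by (auto simp: indicator_def fun_eq_iff)
    ultimately show ?thesis by simp
  qed
  have shift: "integrable lborel (\<lambda>z. g (z + w))" "integral\<^sup>L lborel (\<lambda>z. g (z + w)) = integral\<^sup>L lborel g" for w
  proof -
    have *: "distr lborel borel ((+) w) = (lborel :: 'a measure)" by (rule lborel_distr_plus)
    have "integrable (distr lborel borel ((+) w)) g" using gint by (simp add: *)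
    then show "integrable lborel (\<lambda>z. g (z + w))"
      by (subst (asm) integrable_distr_eq) (use gcont in \<open>auto intro: borel_measurable_continuous_onI simp: add.commute\<close>)
    have "integral\<^sup>L (distr lborel borel ((+) w)) g = integral\<^sup>L lborel (\<lambda>z. g (w + z))"
      by (rule integral_distr) (use gcont in \<open>auto intro: borel_measurable_continuous_onI\<close>)
    then show "integral\<^sup>L lborel (\<lambda>z. g (z + w)) = integral\<^sup>L lborel g" by (simp add: * add.commute)
  qed
  have h0: "integral\<^sup>L lborel (h n) = 0" and hint: "integrable lborel (h n)" for n
    unfolding h_def using shift gint by auto
  \<comment> \<open>The radius leaves room for the whole segment from a point of \<open>K\<close> to
    its shift by at most \<open>v\<close>; the bound on this ball is the dominating
    constant.\<close>
  obtain B where B: "\<And>z. z \<in> cball 0 (\<bar>R\<bar> + 2 * norm v) \<Longrightarrow> norm (g' z v) \<le> B"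
  proof -
    have "compact ((\<lambda>z. g' z v) ` cball 0 (\<bar>R\<bar> + 2 * norm v))"
      by (intro compact_continuous_image continuous_on_subset[OF cont]) auto
    then have "bounded ((\<lambda>z. g' z v) ` cball 0 (\<bar>R\<bar> + 2 * norm v))" by (rule compact_imp_bounded)
    then obtain B where "\<forall>x\<in>(\<lambda>z. g' z v) ` cball 0 (\<bar>R\<bar> + 2 * norm v). norm x \<le> B"
      unfolding bounded_iff by blast
    then show ?thesis by (intro that[of B]) blast
  qed
  have bound: "norm (h n z) \<le> indicator K z * B" for n z
  proof (cases "z \<in> K")
    case True
    define t where "t = 1 / real (Suc n)"
    have t: "0 < t" "t \<le> 1" by (auto simp: t_def)
    have seg: "closed_segment z (z + t *\<^sub>R v) \<subseteq> cball 0 (\<bar>R\<bar> + 2 * norm v)"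
    proof -
      have "norm (t *\<^sub>R v) \<le> norm v" using t by (simp add: mult_left_le_one_le)
      then have "norm (z + t *\<^sub>R v) \<le> \<bar>R\<bar> + 2 * norm v"
        using True norm_triangle_ineq[of z "t *\<^sub>R v"] by (simp add: K_def)
      moreover have "norm z \<le> \<bar>R\<bar> + 2 * norm v" using True norm_ge_zero[of v] unfolding K_def mem_cball_0 by linarith
      ultimately show ?thesis by (intro closed_segment_subset) auto
    qed
    let ?f = "\<lambda>s. g (z + s *\<^sub>R v)"
    have "norm (?f t - ?f 0) \<le> B * norm (t - 0)"
    proof (rule differentiable_bound[where S = "{0..t}" and f' = "\<lambda>s x. x *\<^sub>R g' (z + s *\<^sub>R v) v"])
      show "convex {0..t}" by simp
      show "t \<in> {0..t}" "0 \<in> {0..t}" using t by auto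
      fix s assume s: "s \<in> {0..t}"
      have "(?f has_derivative (\<lambda>x. g' (z + s *\<^sub>R v) (x *\<^sub>R v))) (at s within {0..t})"
        by (rule has_derivative_compose[of "\<lambda>s. z + s *\<^sub>R v" "\<lambda>x. x *\<^sub>R v" s _ g, OF _ der])
           (auto intro!: derivative_eq_intros)
      moreover have "(\<lambda>x. g' (z + s *\<^sub>R v) (x *\<^sub>R v)) = (\<lambda>x. x *\<^sub>R g' (z + s *\<^sub>R v) v)"
        using linear_scale[OF has_derivative_linear[OF der]] by auto
      ultimately show "(?f has_derivative (\<lambda>x. x *\<^sub>R g' (z + s *\<^sub>R v) v)) (at s within {0..t})" by simp
      have "z + s *\<^sub>R v \<in> closed_segment z (z + t *\<^sub>R v)"
        using s t unfolding closed_segment_def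
        by (intro CollectI exI[of _ "s / t"]) (auto simp: scaleR_add_right simp flip: scaleR_add_left)
      then have "norm (g' (z + s *\<^sub>R v) v) \<le> B" using seg B by blast
      then show "onorm (\<lambda>x. x *\<^sub>R g' (z + s *\<^sub>R v) v) \<le> B"
        by (intro onorm_le) (simp add: mult_right_mono mult.commute[of B] mult_left_mono)
    qed
    then have "norm (g (z + t *\<^sub>R v) - g z) \<le> B * t" using t by simp
    then have "norm (h n z) \<le> B"
      using t unfolding h_def by (simp add: t_def pos_le_divide_eq mult.commute del: of_nat_Suc)
    then show ?thesis using True by simp
  next
    case False
    define t where "t = 1 / real (Suc n)"
    have t: "0 < t" "t \<le> 1" by (auto simp: t_def)
    have "norm (t *\<^sub>R v) \<le> norm v" using t by (simp add: mult_left_le_one_le)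
    moreover have "norm z - norm (t *\<^sub>R v) \<le> norm (z + t *\<^sub>R v)"
      using norm_triangle_ineq2[of z "- (t *\<^sub>R v)"] by simp
    moreover have "\<bar>R\<bar> + norm v < norm z" using False unfolding K_def mem_cball_0 by simp
    ultimately have "R \<le> norm (z + t *\<^sub>R v)" "R \<le> norm z"
      using norm_ge_zero[of v] by linarith+
    then show ?thesis using supp False unfolding h_def t_def by simp
  qed
  have "(\<lambda>n. integral\<^sup>L lborel (h n)) \<longlonglongrightarrow> integral\<^sup>L lborel (\<lambda>z. g' z v)"
  proof (rule integral_dominated_convergence[where w = "\<lambda>z. indicator K z * B"])
    show "(\<lambda>z. g' z v) \<in> borel_measurable lborel" 
      using cont by (simp add: borel_measurable_continuous_onI)
    show "\<And>n. h n \<in> borel_measurable lborel" using hint by auto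
    show "integrable lborel (\<lambda>z. indicator K z * B)"
      unfolding K_def by (intro integrable_mult_left integrable_real_indicator emeasure_bounded_finite) auto
    show "AE x in lborel. (\<lambda>n. h n x) \<longlonglongrightarrow> g' x v"
    proof (rule AE_I2)
      fix x
      have "((\<lambda>s. g (x + s *\<^sub>R v)) has_derivative (\<lambda>s. g' (x + 0 *\<^sub>R v) (s *\<^sub>R v))) (at 0)"
        by (rule has_derivative_compose[of "\<lambda>s. x + s *\<^sub>R v" "\<lambda>s. s *\<^sub>R v" 0 _ g, OF _ der])
           (auto intro!: derivative_eq_intros)
      then have "((\<lambda>s. g (x + s *\<^sub>R v)) has_vector_derivative g' x v) (at 0)"
        using linear_scale[OF has_derivative_linear[OF der[of x]]]
        by (simp add: has_vector_derivative_def)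
      then have *: "((\<lambda>s. norm (g (x + s *\<^sub>R v) - g x - s *\<^sub>R g' x v) / norm s) \<longlongrightarrow> 0) (at 0)"
        unfolding has_vector_derivative_def has_derivative_at by simp
      have "filterlim (\<lambda>n. 1 / real (Suc n)) (at 0) sequentially"
        unfolding filterlim_at using LIMSEQ_inverse_real_of_nat by (simp add: inverse_eq_divide)
      from filterlim_compose[OF * this]
      have "(\<lambda>n. norm (h n x - g' x v)) \<longlonglongrightarrow> 0"
      proof (rule Lim_transform_eventually, intro always_eventually allI)
        fix n
        define w where "w = g (x + (1 / real (Suc n)) *\<^sub>R v) - g x"
        have "h n x - g' x v = real (Suc n) *\<^sub>R (w - (1 / real (Suc n)) *\<^sub>R g' x v)"
          unfolding h_def w_def by (simp add: scaleR_diff_right)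
        then have "norm (h n x - g' x v) = real (Suc n) * norm (w - (1 / real (Suc n)) *\<^sub>R g' x v)"
          by simp
        then show "norm (g (x + (1 / real (Suc n)) *\<^sub>R v) - g x - (1 / real (Suc n)) *\<^sub>R g' x v) /
            norm (1 / real (Suc n)) = norm (h n x - g' x v)"
          unfolding w_def by (simp del: of_nat_Suc)
      qed
      then show "(\<lambda>n. h n x) \<longlonglongrightarrow> g' x v"
        using tendsto_norm_zero_iff LIM_zero_iff by blast
    qed
    show "\<And>n. AE x in lborel. norm (h n x) \<le> indicator K x * B" using bound by auto
  qed
  then show ?thesis by (simp add: h0 LIMSEQ_const_iff)
qed

section \<open>The complex plane as \<open>real^2\<close> and holomorphic change of
  variables\<close>

definition vec_cplx :: "real^2 \<Rightarrow> complex" where "vec_cplx v = Complex (v $ 1) (v $ 2)"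
definition cplx_vec :: "complex \<Rightarrow> real^2" where "cplx_vec z = vector [Re z, Im z]"

lemma vec_cplx_inverse [simp]: "cplx_vec (vec_cplx v) = v" "vec_cplx (cplx_vec z) = z"
  by (auto simp: vec_cplx_def cplx_vec_def vec_eq_iff forall_2 complex_eq_iff)

lemma bounded_linear_vec_cplx: "bounded_linear vec_cplx"
  by (intro linear_conv_bounded_linear[THEN iffD1] linearI) (auto simp: vec_cplx_def complex_eq_iff)

lemma bounded_linear_cplx_vec: "bounded_linear cplx_vec"
  by (intro linear_conv_bounded_linear[THEN iffD1] linearI)
     (auto simp: cplx_vec_def vec_eq_iff forall_2)

lemma continuous_on_vec_cplx: "continuous_on S vec_cplx" and continuous_on_cplx_vec: "continuous_on A cplx_vec"
  using bounded_linear_vec_cplx bounded_linear_cplx_vec linear_continuous_on by blast+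

lemma vec_cplx_image_eq: "vec_cplx ` S = cplx_vec -` S" and cplx_vec_image_eq: "cplx_vec ` A = vec_cplx -` A"
proof -
  show "vec_cplx ` S = cplx_vec -` S" by (auto simp: image_iff) (metis vec_cplx_inverse(2))
  show "cplx_vec ` A = vec_cplx -` A" by (auto simp: image_iff) (metis vec_cplx_inverse(1))
qed

text \<open>The change of variables formula with determinants is about maps of
  \<open>real^'n\<close>; this carries its integrals over to the complex plane. Lebesgue measure is
  pinned down by its values on boxes, and \<open>vec_cplx\<close> matches boxes with boxes of the
  same side lengths.\<close>

lemma lborel_distr_vec_cplx: "distr lborel borel vec_cplx = lborel"
proof (rule lborel_eqI[symmetric])
  fix l u :: complex assume lu: "\<And>b. b \<in> Basis \<Longrightarrow> l \<bullet> b \<le> u \<bullet> b"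
  have m: "vec_cplx \<in> borel_measurable lborel"
    using continuous_on_vec_cplx by (simp add: borel_measurable_continuous_onI)
  have le: "Re l \<le> Re u" "Im l \<le> Im u" using lu[of 1] lu[of \<i>] by (auto simp: Basis_complex_def)
  have v: "vec_cplx -` box l u = box (cplx_vec l) (cplx_vec u)"
    by (auto simp: box_def Basis_complex_def vec_cplx_def cplx_vec_def Basis_vec_def forall_2 inner_axis)
  have "emeasure (distr lborel borel vec_cplx) (box l u) = emeasure lborel (box (cplx_vec l) (cplx_vec u))"
    using m by (subst emeasure_distr) (auto simp: v)
  also have "\<dots> = ennreal (\<Prod>b\<in>Basis. (cplx_vec u - cplx_vec l) \<bullet> b)"
    by (rule emeasure_lborel_box) (use le forall_2[of "\<lambda>i. cplx_vec l $ i \<le> cplx_vec u $ i"] in \<open>auto simp: Basis_vec_def inner_axis cplx_vec_def\<close>)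
  also have "(\<Prod>b\<in>Basis. (cplx_vec u - cplx_vec l) \<bullet> b) = (Re u - Re l) * (Im u - Im l)"
  proof -
    have B: "(Basis :: (real^2) set) = {axis 1 1, axis 2 1}"
    proof -
      have "(Basis :: (real^2) set) = (\<lambda>i. axis i 1) ` UNIV" by (auto simp: Basis_vec_def)
      then show ?thesis by (simp add: UNIV_2)
    qed
    have "axis 1 1 \<noteq> (axis 2 1 :: real^2)" by (auto simp: axis_eq_axis)
    then show ?thesis unfolding B by (simp add: inner_axis cplx_vec_def)
  qed
  also have "\<dots> = (\<Prod>b\<in>Basis. (u - l) \<bullet> b)" by (simp add: Basis_complex_def)
  finally show "emeasure (distr lborel borel vec_cplx) (box l u) = ennreal (\<Prod>b\<in>Basis. (u - l) \<bullet> b)" .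
qed simp

lemma integral_lborel_vec_cplx:
  fixes h :: "complex \<Rightarrow> 'b::{banach,second_countable_topology}"
  assumes "h \<in> borel_measurable borel"
  shows "integral\<^sup>L lborel (\<lambda>x. h (vec_cplx x)) = integral\<^sup>L lborel h"
proof -
  have "integral\<^sup>L (distr lborel borel vec_cplx) h = integral\<^sup>L lborel (\<lambda>x. h (vec_cplx x))"
    by (rule integral_distr)
       (use assms continuous_on_vec_cplx in \<open>auto intro: borel_measurable_continuous_onI\<close>)
  then show ?thesis by (simp add: lborel_distr_vec_cplx)
qed

lemma integrable_continuous_compact_support:
  fixes f :: "'a::euclidean_space \<Rightarrow> 'b::{banach,second_countable_topology}"
  assumes "continuous_on UNIV f" "compact K" "\<And>x. x \<notin> K \<Longrightarrow> f x = 0"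
  shows "integrable lborel f"
proof -
  have "integrable lborel (\<lambda>x. indicator K x *\<^sub>R f x)"
    by (rule borel_integrable_compact) (use assms in \<open>auto intro: continuous_on_subset\<close>)
  moreover have "(\<lambda>x. indicator K x *\<^sub>R f x) = f"
    using assms(3) by (auto simp: indicator_def fun_eq_iff)
  ultimately show ?thesis by simp
qed

lemma integral_on_eq_lborel:
  fixes f :: "'a::euclidean_space \<Rightarrow> 'b::euclidean_space"
  assumes "integrable lborel f" "\<And>x. x \<notin> S \<Longrightarrow> f x = 0"
  shows "f absolutely_integrable_on S" "integral S f = integral\<^sup>L lborel f"
proof -
  have "f absolutely_integrable_on UNIV" 
    using assms(1) by (simp add: absolutely_integrable_on_def set_integrable_def integrable_completion)
  moreover have r: "(\<lambda>x. if x \<in> S then f x else 0) = f" using assms(2) by auto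
  ultimately show "f absolutely_integrable_on S"
    using absolutely_integrable_restrict_UNIV[of S f] by metis
  have "integral S f = integral UNIV f"
    using integral_restrict_UNIV[of S f] r by metis
  then show "integral S f = integral\<^sup>L lborel f"
    using integral_lborel[OF assms(1)] by simp
qed

text \<open>By the Cauchy-Riemann equations the real Jacobian of \<open>T\<close> is the squared
  modulus of its complex derivative. Compact support inside the image of \<open>V\<close> allows
  both integrals to be taken over the whole plane.\<close>

lemma integral_holomorphic_change_of_variables:
  fixes f :: "complex \<Rightarrow> complex"
  assumes V: "open V" and T: "T holomorphic_on V" and inj: "inj_on T V"
    and f: "continuous_on UNIV f" and K: "compact K" "K \<subseteq> T ` V" and f0: "\<And>w. w \<notin> K \<Longrightarrow> f w = 0"
  shows "integral\<^sup>L lborel f =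
    integral\<^sup>L lborel (\<lambda>z. if z \<in> V then of_real ((cmod (deriv T z))\<^sup>2) * f (T z) else 0)"
proof -
  define S where "S = vec_cplx -` V"
  define g where "g = (\<lambda>x. cplx_vec (T (vec_cplx x)))"
  define g' where "g' = (\<lambda>x h. cplx_vec (deriv T (vec_cplx x) * vec_cplx h))"
  define f2 where "f2 = (\<lambda>x. cplx_vec (f (vec_cplx x)))"
  have oS: "open S" unfolding S_def using V continuous_on_vec_cplx open_vimage by blast
  have der: "(g has_derivative g' x) (at x within S)" if "x \<in> S" for x
  proof -
    have "(T has_field_derivative deriv T (vec_cplx x)) (at (vec_cplx x))"
      using T V that holomorphic_derivI unfolding S_def by blast
    then have "(T has_derivative (\<lambda>h. deriv T (vec_cplx x) * h)) (at (vec_cplx x))"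
      by (simp add: has_field_derivative_def)
    from has_derivative_compose[OF bounded_linear_imp_has_derivative[OF bounded_linear_vec_cplx] this]
    show ?thesis unfolding g_def g'_def
      by (intro bounded_linear.has_derivative[OF bounded_linear_cplx_vec]) (simp add: has_derivative_at_withinI)
  qed
  \<comment> \<open>Multiplication by a + i b has the real matrix with rows (a, -b) and (b,
    a).\<close>
  have det: "\<bar>det (matrix (g' x))\<bar> = (cmod (deriv T (vec_cplx x)))\<^sup>2" for x
  proof -
    have a: "vec_cplx (axis 1 1) = 1" "vec_cplx (axis 2 1) = \<i>"
      by (auto simp: vec_cplx_def axis_def complex_eq_iff)
    show ?thesis
      unfolding cmod_power2 by (simp add: det_2 matrix_def g'_def a cplx_vec_def power2_eq_square)
  qed
  have injg: "inj_on g S"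
    unfolding g_def S_def by (rule inj_onI) (metis inj inj_onD vec_cplx_inverse vimageE)
  have gS: "g ` S = vec_cplx -` (T ` V)"
    unfolding g_def S_def by (auto simp: image_iff Bex_def) (metis vec_cplx_inverse)+
  have f2c: "continuous_on UNIV f2" unfolding f2_def
    by (intro continuous_on_compose2[OF continuous_on_cplx_vec[of UNIV]] continuous_on_compose2[OF f] continuous_on_vec_cplx) auto
  have K2: "compact (vec_cplx -` K)"
    unfolding cplx_vec_image_eq[symmetric] using K continuous_on_cplx_vec compact_continuous_image by blast
  have f2i: "integrable lborel f2"
    by (rule integrable_continuous_compact_support[OF f2c K2]) (auto simp: f2_def f0 cplx_vec_def vec_eq_iff forall_2)
  have c0: "cplx_vec 0 = 0" by (simp add: cplx_vec_def vec_eq_iff forall_2)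
  have f20: "f2 x = 0" if "x \<notin> g ` S" for x
    using that f0[of "vec_cplx x"] K(2) unfolding gS f2_def using c0 by (metis subsetD vimageI2)
  note f2I = integral_on_eq_lborel[OF f2i f20]
  have Sm: "S \<in> sets lebesgue" using oS by auto
  have "(\<lambda>x. \<bar>det (matrix (g' x))\<bar> *\<^sub>R f2 (g x)) absolutely_integrable_on S \<and>
     integral S (\<lambda>x. \<bar>det (matrix (g' x))\<bar> *\<^sub>R f2 (g x)) = integral (g ` S) f2"
    using has_absolute_integral_change_of_variables[OF Sm der injg, of f2] f2I(1) by blast
  moreover define F where "F = (\<lambda>z. if z \<in> V then of_real ((cmod (deriv T z))\<^sup>2) * f (T z) else 0)"
  have F2: "(\<lambda>x. if x \<in> S then \<bar>det (matrix (g' x))\<bar> *\<^sub>R f2 (g x) else 0) = (\<lambda>x. cplx_vec (F (vec_cplx x)))"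
    unfolding F_def S_def f2_def g_def det vec_cplx_inverse by (auto simp: fun_eq_iff c0) (auto simp: cplx_vec_def vec_eq_iff forall_2)
  ultimately have A: "(\<lambda>x. cplx_vec (F (vec_cplx x))) absolutely_integrable_on UNIV"
    and I: "integral UNIV (\<lambda>x. cplx_vec (F (vec_cplx x))) = integral\<^sup>L lborel f2"
    unfolding F2[symmetric] absolutely_integrable_restrict_UNIV integral_restrict_UNIV using f2I(2) by auto
  have Fm: "F \<in> borel_measurable borel"
  proof -
    have "continuous_on V (\<lambda>z. of_real ((cmod (deriv T z))\<^sup>2) * f (T z))"
      by (intro continuous_intros holomorphic_on_imp_continuous_on continuous_on_compose2[OF f] T holomorphic_deriv V) auto
    then have "(\<lambda>z. indicator V z *\<^sub>R (of_real ((cmod (deriv T z))\<^sup>2) * f (T z))) \<in> borel_measurable borel"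
      using V by (intro borel_measurable_continuous_on_indicator) auto
    moreover have "(\<lambda>z. indicator V z *\<^sub>R (of_real ((cmod (deriv T z))\<^sup>2) * f (T z))) = F"
      by (auto simp: F_def fun_eq_iff)
    ultimately show ?thesis by simp
  qed
  have cm: "(\<lambda>x. cplx_vec (F (vec_cplx x))) \<in> borel_measurable borel"
    by (intro measurable_compose[of vec_cplx borel borel "\<lambda>z. cplx_vec (F z)"] measurable_compose[OF Fm]
        borel_measurable_continuous_onI continuous_on_vec_cplx continuous_on_cplx_vec)
  have "integrable lborel (\<lambda>x. cplx_vec (F (vec_cplx x)))"
    using A cm by (simp add: absolutely_integrable_on_def set_integrable_def integrable_completion)
  then have "integral\<^sup>L lborel (\<lambda>x. cplx_vec (F (vec_cplx x))) = integral\<^sup>L lborel f2"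
    using I integral_lborel by metis
  then have "vec_cplx (integral\<^sup>L lborel (\<lambda>x. cplx_vec (F (vec_cplx x)))) = vec_cplx (integral\<^sup>L lborel f2)"
    by simp
  then have "integral\<^sup>L lborel (\<lambda>x. F (vec_cplx x)) = integral\<^sup>L lborel (\<lambda>x. f (vec_cplx x))"
    unfolding f2_def by (subst (asm) (1 2) integral_bounded_linear'[OF bounded_linear_vec_cplx bounded_linear_cplx_vec, symmetric])
      (auto simp: \<open>integrable lborel (\<lambda>x. cplx_vec (F (vec_cplx x)))\<close> f2i[unfolded f2_def])
  then show ?thesis
    using integral_lborel_vec_cplx[OF Fm] integral_lborel_vec_cplx[of f] f 
    by (simp add: borel_measurable_continuous_onI F_def)
qed

section \<open>Continuously differentiable functions and the operator \<open>dbar\<close>\<close>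

definition C1_on :: "complex set \<Rightarrow> (complex \<Rightarrow> complex) \<Rightarrow> bool" where
  "C1_on V f \<longleftrightarrow> (\<forall>z\<in>V. f differentiable at z) \<and> (\<forall>v. continuous_on V (\<lambda>z. frechet_derivative f (at z) v))"

text \<open>Twice the Wirtinger derivative with respect to the conjugate variable; the factor 2 is
  absorbed in \<open>pole_const\<close>.\<close>

definition dbar :: "(complex \<Rightarrow> complex) \<Rightarrow> complex \<Rightarrow> complex" where
  "dbar f z = frechet_derivative f (at z) 1 + \<i> * frechet_derivative f (at z) \<i>"

lemma frechet_derivative_eqI: "(f has_derivative D) (at z) \<Longrightarrow> frechet_derivative f (at z) = D"
  by (metis frechet_derivative_at)

lemma dbar_eq: "(f has_derivative D) (at z) \<Longrightarrow> dbar f z = D 1 + \<i> * D \<i>"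
  unfolding dbar_def by (simp add: frechet_derivative_eqI)

lemma C1_onI:
  assumes "\<And>z. z \<in> V \<Longrightarrow> (f has_derivative D z) (at z)" "\<And>v. continuous_on V (\<lambda>z. D z v)"
  shows "C1_on V f"
  unfolding C1_on_def
proof (intro conjI ballI allI)
  show "f differentiable at z" if "z \<in> V" for z using assms(1)[OF that] by (auto simp: differentiable_def)
  show "continuous_on V (\<lambda>z. frechet_derivative f (at z) v)" for v
    using assms(2)[of v] by (rule continuous_on_eq) (simp add: frechet_derivative_eqI[OF assms(1)])
qed

lemma C1_onD: "C1_on V f \<Longrightarrow> z \<in> V \<Longrightarrow> (f has_derivative frechet_derivative f (at z)) (at z)"
  by (simp add: C1_on_def frechet_derivative_works)

lemma C1_on_imp_continuous_on: "C1_on V f \<Longrightarrow> continuous_on V f"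
  unfolding C1_on_def by (simp add: continuous_at_imp_continuous_on differentiable_imp_continuous_within)

lemma continuous_on_dbar: "C1_on V f \<Longrightarrow> continuous_on V (dbar f)"
  unfolding dbar_def C1_on_def by (intro continuous_intros) auto

lemma C1_on_subset: "C1_on V f \<Longrightarrow> W \<subseteq> V \<Longrightarrow> C1_on W f"
  unfolding C1_on_def by (meson continuous_on_subset subsetD)

lemma frechet_derivative_cong_open:
  assumes "open V" "z \<in> V" "\<And>w. w \<in> V \<Longrightarrow> f w = g w"
  shows "(f has_derivative D) (at z) \<longleftrightarrow> (g has_derivative D) (at z)"
    and "frechet_derivative f (at z) = frechet_derivative g (at z)"
proof -
  show *: "(f has_derivative D) (at z) \<longleftrightarrow> (g has_derivative D) (at z)" for D
    using assms has_derivative_transform_within_open by metis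
  show "frechet_derivative f (at z) = frechet_derivative g (at z)"
    unfolding frechet_derivative_def * ..
qed

lemma dbar_cong_open:
  assumes "open V" "z \<in> V" "\<And>w. w \<in> V \<Longrightarrow> f w = g w"
  shows "dbar f z = dbar g z"
  unfolding dbar_def using frechet_derivative_cong_open(2)[of V z f g] assms by simp

lemma C1_on_cong_open:
  assumes "C1_on V f" "open V" "\<And>w. w \<in> V \<Longrightarrow> f w = g w"
  shows "C1_on V g"
proof (rule C1_onI)
  show "(g has_derivative frechet_derivative f (at z)) (at z)" if "z \<in> V" for z
    using has_derivative_transform_within_open[OF C1_onD[OF assms(1) that] assms(2) that assms(3)] .
  show "continuous_on V (\<lambda>z. frechet_derivative f (at z) v)" for v using assms(1) by (simp add: C1_on_def)
qed

lemma C1_on_Union: 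
  assumes "\<And>z. z \<in> W \<Longrightarrow> \<exists>V. open V \<and> z \<in> V \<and> C1_on V f"
  shows "C1_on W f"
  unfolding C1_on_def
proof (intro conjI ballI allI)
  show "f differentiable at z" if "z \<in> W" for z using assms[OF that] by (auto simp: C1_on_def)
  show "continuous_on W (\<lambda>z. frechet_derivative f (at z) v)" for v
  proof (rule continuous_at_imp_continuous_on, intro ballI)
    fix z assume "z \<in> W"
    then obtain V where V: "open V" "z \<in> V" "C1_on V f" using assms by blast
    then show "isCont (\<lambda>z. frechet_derivative f (at z) v) z"
      by (simp add: C1_on_def continuous_on_eq_continuous_at)
  qed
qed

lemma C1_on_const [simp]: "C1_on V (\<lambda>_. c)"
  by (rule C1_onI[where D = "\<lambda>_ _. 0"]) auto

lemma dbar_const [simp]: "dbar (\<lambda>_. c) z = 0"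
  by (simp add: dbar_eq[of _ "\<lambda>_. 0"])

lemma holomorphic_C1_on:
  assumes "f holomorphic_on V" "open V" shows "C1_on V f"
proof (rule C1_onI[where D = "\<lambda>z v. deriv f z * v"])
  show "(f has_derivative (*) (deriv f z)) (at z)" if "z \<in> V" for z
    using holomorphic_derivI[OF assms that, of UNIV] by (simp add: has_field_derivative_def)
  show "continuous_on V (\<lambda>z. deriv f z * v)" for v
    by (intro continuous_intros holomorphic_on_imp_continuous_on holomorphic_deriv assms)
qed

lemma dbar_holomorphic: 
  assumes "f holomorphic_on V" "open V" "z \<in> V" shows "dbar f z = 0"
proof -
  have "(f has_derivative (*) (deriv f z)) (at z)"
    using holomorphic_derivI[OF assms, of UNIV] by (simp add: has_field_derivative_def)
  from dbar_eq[OF this] show ?thesis by (simp add: algebra_simps)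
qed

lemma C1_on_mult: 
  assumes "C1_on V f" "C1_on V g" shows "C1_on V (\<lambda>z. f z * g z)"
proof (rule C1_onI)
  show "((\<lambda>z. f z * g z) has_derivative (\<lambda>h. f z * frechet_derivative g (at z) h + frechet_derivative f (at z) h * g z)) (at z)"
    if "z \<in> V" for z using that C1_onD[OF assms(1)] C1_onD[OF assms(2)] by (intro has_derivative_mult) 
  show "continuous_on V (\<lambda>z. f z * frechet_derivative g (at z) v + frechet_derivative f (at z) v * g z)" for v
    using assms C1_on_imp_continuous_on[of V] by (intro continuous_intros) (auto simp: C1_on_def)
qed

lemma dbar_mult: 
  assumes "C1_on V f" "C1_on V g" "z \<in> V" shows "dbar (\<lambda>z. f z * g z) z = dbar f z * g z + f z * dbar g z"
proof -
  from dbar_eq[OF has_derivative_mult[OF C1_onD[OF assms(1,3)] C1_onD[OF assms(2,3)]]]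
  show ?thesis by (simp add: dbar_def algebra_simps)
qed

lemma C1_on_sum:
  assumes "\<And>i. i \<in> I \<Longrightarrow> C1_on V (f i)" shows "C1_on V (\<lambda>z. \<Sum>i\<in>I. f i z)"
proof (rule C1_onI)
  show "((\<lambda>z. \<Sum>i\<in>I. f i z) has_derivative (\<lambda>h. \<Sum>i\<in>I. frechet_derivative (f i) (at z) h)) (at z)"
    if "z \<in> V" for z using that C1_onD[OF assms] by (intro has_derivative_sum) 
  show "continuous_on V (\<lambda>z. \<Sum>i\<in>I. frechet_derivative (f i) (at z) v)" for v
    using assms by (intro continuous_intros) (auto simp: C1_on_def)
qed

lemma dbar_sum: 
  assumes "\<And>i. i \<in> I \<Longrightarrow> C1_on V (f i)" "z \<in> V" 
  shows "dbar (\<lambda>z. \<Sum>i\<in>I. f i z) z = (\<Sum>i\<in>I. dbar (f i) z)"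
proof -
  have "((\<lambda>z. \<Sum>i\<in>I. f i z) has_derivative (\<lambda>h. \<Sum>i\<in>I. frechet_derivative (f i) (at z) h)) (at z)"
    using C1_onD[OF assms] by (intro has_derivative_sum)
  from dbar_eq[OF this] show ?thesis by (simp add: dbar_def sum.distrib sum_distrib_left)
qed

lemma C1_on_diff:
  assumes "C1_on V f" "C1_on V g" shows "C1_on V (\<lambda>z. f z - g z)"
proof (rule C1_onI)
  show "((\<lambda>z. f z - g z) has_derivative (\<lambda>h. frechet_derivative f (at z) h - frechet_derivative g (at z) h)) (at z)"
    if "z \<in> V" for z using that C1_onD[OF assms(1)] C1_onD[OF assms(2)] by (intro has_derivative_diff) 
  show "continuous_on V (\<lambda>z. frechet_derivative f (at z) v - frechet_derivative g (at z) v)" for v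
    using assms by (intro continuous_intros) (auto simp: C1_on_def)
qed

lemma dbar_diff: 
  assumes "C1_on V f" "C1_on V g" "z \<in> V" shows "dbar (\<lambda>z. f z - g z) z = dbar f z - dbar g z"
proof -
  from dbar_eq[OF has_derivative_diff[OF C1_onD[OF assms(1,3)] C1_onD[OF assms(2,3)]]]
  show ?thesis by (simp add: dbar_def algebra_simps)
qed

lemma C1_on_inverse:
  assumes "C1_on V f" "\<And>z. z \<in> V \<Longrightarrow> f z \<noteq> 0" shows "C1_on V (\<lambda>z. inverse (f z))"
proof (rule C1_onI)
  show "((\<lambda>z. inverse (f z)) has_derivative (\<lambda>h. - (inverse (f z) * frechet_derivative f (at z) h * inverse (f z)))) (at z)"
    if "z \<in> V" for z using Deriv.has_derivative_inverse[OF assms(2)[OF that] C1_onD[OF assms(1) that]] .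
  show "continuous_on V (\<lambda>z. - (inverse (f z) * frechet_derivative f (at z) v * inverse (f z)))" for v
    using assms C1_on_imp_continuous_on[of V] by (intro continuous_intros) (auto simp: C1_on_def)
qed

text \<open>A holomorphic inner map contributes only the conjugate of its derivative. Against the
  factor \<open>deriv T\<close> from the transformation law of a 1-form this yields the squared
  modulus, which is the Jacobian of the change of variables.\<close>

lemma
  assumes f: "C1_on W f" and T: "T holomorphic_on V" "open V" "T ` V \<subseteq> W"
  shows C1_on_compose_holomorphic: "C1_on V (\<lambda>z. f (T z))"
    and dbar_compose_holomorphic: "z \<in> V \<Longrightarrow> dbar (\<lambda>z. f (T z)) z = dbar f (T z) * cnj (deriv T z)"
proof -
  have der: "((\<lambda>z. f (T z)) has_derivative (\<lambda>h. frechet_derivative f (at (T z)) (deriv T z * h))) (at z)" 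
    if "z \<in> V" for z
  proof -
    have "(T has_derivative (*) (deriv T z)) (at z)"
      using holomorphic_derivI[OF T(1,2) that, of UNIV] by (simp add: has_field_derivative_def)
    moreover have "(f has_derivative frechet_derivative f (at (T z))) (at (T z))"
      using f that T(3) by (intro C1_onD[OF f]) auto
    ultimately show ?thesis by (rule has_derivative_compose)
  qed
  \<comment> \<open>The real differential need not be complex linear; it is recovered from its
    values at 1 and i, the two values that \<open>dbar\<close> combines.\<close>
  have lin: "frechet_derivative f (at (T z)) h = of_real (Re h) * frechet_derivative f (at (T z)) 1
      + of_real (Im h) * frechet_derivative f (at (T z)) \<i>" if "z \<in> V" for z h
  proof -
    interpret bounded_linear "frechet_derivative f (at (T z))"
      by (rule has_derivative_bounded_linear[OF C1_onD[OF f]]) (use that T(3) in auto)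
    have "h = Re h *\<^sub>R 1 + Im h *\<^sub>R \<i>" by (simp add: complex_eq_iff)
    then have "frechet_derivative f (at (T z)) h = frechet_derivative f (at (T z)) (Re h *\<^sub>R 1 + Im h *\<^sub>R \<i>)" by simp
    then show ?thesis by (simp only: add scaleR) (simp add: scaleR_conv_of_real)
  qed
  show "C1_on V (\<lambda>z. f (T z))"
  proof (rule C1_onI[OF der])
    fix v
    have c: "continuous_on V (\<lambda>z. frechet_derivative f (at (T z)) w)" for w
      by (rule continuous_on_compose2[OF _ holomorphic_on_imp_continuous_on[OF T(1)] T(3)])
         (use f in \<open>simp add: C1_on_def\<close>)
    have "continuous_on V (\<lambda>z. of_real (Re (deriv T z * v)) * frechet_derivative f (at (T z)) 1
      + of_real (Im (deriv T z * v)) * frechet_derivative f (at (T z)) \<i>)"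
      by (intro continuous_intros c holomorphic_on_imp_continuous_on[OF holomorphic_deriv[OF T(1,2)]])
    then show "continuous_on V (\<lambda>z. frechet_derivative f (at (T z)) (deriv T z * v))"
      by (rule continuous_on_eq) (rule lin[symmetric])
  qed
  show "dbar (\<lambda>z. f (T z)) z = dbar f (T z) * cnj (deriv T z)" if "z \<in> V"
    unfolding dbar_eq[OF der[OF that]] lin[OF that, of "deriv T z * 1"] lin[OF that, of "deriv T z * \<i>"] dbar_def[of f]
    by (simp add: complex_eq_iff algebra_simps)
qed

text \<open>Squaring the positive part rounds off the corner at 0. The resulting C1 regularity is
  enough to integrate one derivative, and all cutoffs below have this form.\<close>

lemma C1_on_max_square:
  assumes f: "\<And>z. (f has_derivative D z) (at z)" and D: "\<And>v. continuous_on UNIV (\<lambda>z. D z v)"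
  shows "((\<lambda>z. (max 0 (f z))\<^sup>2 :: real) has_derivative (\<lambda>h. 2 * max 0 (f z) * D z h)) (at (z::complex))"
    and "C1_on UNIV (\<lambda>z. of_real ((max 0 (f z))\<^sup>2))"
proof -
  have sq: "((\<lambda>t::real. (max 0 t)\<^sup>2) has_real_derivative 2 * max 0 t) (at t)" for t
  proof (cases t "0::real" rule: linorder_cases)
    case less
    have "((\<lambda>t::real. (max 0 t)\<^sup>2) has_real_derivative 0) (at t)"
      by (rule has_field_derivative_transform_within_open[of "\<lambda>_. 0" _ _ "{..<0}"]) (use less in auto)
    then show ?thesis using less by (simp add: max_def)
  next
    case equal
    have "((\<lambda>h. (max 0 h)\<^sup>2 / h) \<longlongrightarrow> 0) (at (0::real))"
    proof (rule Lim_null_comparison)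
      show "\<forall>\<^sub>F h in at 0. norm ((max 0 h)\<^sup>2 / h) \<le> \<bar>h\<bar>"
      proof (rule always_eventually, rule allI)
        fix h :: real
        show "norm ((max 0 h)\<^sup>2 / h) \<le> \<bar>h\<bar>"
          by (cases "h \<le> 0") (simp_all add: max_def power2_eq_square)
      qed
      show "((\<lambda>h. \<bar>h\<bar>) \<longlongrightarrow> 0) (at (0::real))" by (rule tendsto_rabs_zero) simp
    qed
    then show ?thesis using equal by (simp add: DERIV_def)
  next
    case greater
    have "((\<lambda>t::real. t\<^sup>2) has_real_derivative 2 * t) (at t)" by (auto intro!: derivative_eq_intros)
    then have "((\<lambda>t::real. (max 0 t)\<^sup>2) has_real_derivative 2 * t) (at t)"
      by (rule has_field_derivative_transform_within_open[of _ _ _ "{0<..}"]) (use greater in auto)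
    then show ?thesis using greater by (simp add: max_def)
  qed
  show 1: "((\<lambda>z. (max 0 (f z))\<^sup>2) has_derivative (\<lambda>h. 2 * max 0 (f z) * D z h)) (at z)" for z
    using has_derivative_compose[OF f sq[unfolded has_field_derivative_def]] .
  have fc: "continuous_on UNIV f"
    using f by (meson continuous_on_eq_continuous_at has_derivative_continuous open_UNIV)
  show "C1_on UNIV (\<lambda>z. of_real ((max 0 (f z))\<^sup>2))"
  proof (rule C1_onI)
    show "((\<lambda>z. complex_of_real ((max 0 (f z))\<^sup>2)) has_derivative (\<lambda>h. of_real (2 * max 0 (f z) * D z h))) (at z)" for z
      by (intro has_derivative_of_real 1)
    show "continuous_on UNIV (\<lambda>z. complex_of_real (2 * max 0 (f z) * D z v))" for v
      by (intro continuous_intros fc D)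
  qed
qed

lemma integral_dbar_eq_0:
  assumes "C1_on UNIV f" "compact K" "\<And>z. z \<notin> K \<Longrightarrow> f z = 0"
  shows "integral\<^sup>L lborel (dbar f) = 0"
proof -
  obtain R where R: "\<And>z. z \<in> K \<Longrightarrow> norm z < R"
  proof -
    obtain B where "\<forall>x\<in>K. norm x \<le> B" using compact_imp_bounded[OF assms(2)] unfolding bounded_iff by blast
    then show ?thesis by (intro that[of "B + 1"]) (metis less_add_one order.strict_trans1)
  qed
  have f0: "f z = 0" if "R \<le> norm z" for z using R[of z] assms(3)[of z] that by force
  have c: "continuous_on UNIV (\<lambda>z. frechet_derivative f (at z) v)" for v using assms(1) by (simp add: C1_on_def)
  have z: "integral\<^sup>L lborel (\<lambda>z. frechet_derivative f (at z) v) = 0" for v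
    by (rule integral_directional_derivative_eq_0[OF C1_onD[OF assms(1)] c f0]) auto
  have D0: "frechet_derivative f (at z) v = 0" if "z \<notin> K" for z v
  proof -
    have "open (- K)" using assms(2) by (simp add: compact_imp_closed open_Compl)
    then have "frechet_derivative f (at z) = frechet_derivative (\<lambda>_. 0) (at z)"
      using that assms(3) by (intro frechet_derivative_cong_open(2)[of "-K"]) auto
    then show ?thesis by (simp add: frechet_derivative_eqI[of _ "\<lambda>_. 0"])
  qed
  have i: "integrable lborel (\<lambda>z. frechet_derivative f (at z) v)" for v
    by (rule integrable_continuous_compact_support[OF c assms(2)]) (use D0 in auto)
  show ?thesis
    unfolding dbar_def using i z by (subst Bochner_Integration.integral_add) auto
qed

text \<open>\<open>w\<close> passes through \<open>dbar\<close> because it is holomorphic, so the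
  integrand is \<open>dbar\<close> of a compactly supported function. As \<open>K\<close> lies in
  \<open>B\<close>, extending that function by zero keeps it C1.\<close>

lemma integral_dbar_holomorphic_eq_0:
  assumes f: "C1_on UNIV f" and K: "compact K" "K \<subseteq> B" "\<And>z. z \<notin> K \<Longrightarrow> f z = 0"
    and w: "w holomorphic_on B" "open B"
  shows "integral\<^sup>L lborel (\<lambda>z. if z \<in> B then dbar f z * w z else 0) = 0"
proof -
  define g where "g = (\<lambda>z. if z \<in> B then f z * w z else 0)"
  have oK: "open (- K)" using K(1) by (simp add: compact_imp_closed open_Compl)
  have C1B: "C1_on B (\<lambda>z. f z * w z)"
    by (intro C1_on_mult C1_on_subset[OF f] holomorphic_C1_on w) auto
  have g1: "C1_on B g" by (rule C1_on_cong_open[OF C1B w(2)]) (auto simp: g_def)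
  have g2: "C1_on (- K) g" by (rule C1_on_cong_open[OF C1_on_const[of _ 0] oK]) (use K in \<open>auto simp: g_def\<close>)
  have g: "C1_on UNIV g"
  proof (rule C1_on_Union)
    show "\<exists>V. open V \<and> z \<in> V \<and> C1_on V g" for z
      using g1 g2 oK w(2) K(2) by (cases "z \<in> B") blast+
  qed
  have "dbar g z = (if z \<in> B then dbar f z * w z else 0)" for z
  proof (cases "z \<in> B")
    case True
    have "dbar g z = dbar (\<lambda>z. f z * w z) z" by (rule dbar_cong_open[OF w(2) True]) (auto simp: g_def)
    also have "\<dots> = dbar f z * w z + f z * dbar w z"
      by (rule dbar_mult[OF _ _ True]) (auto intro: C1_on_subset[OF f] holomorphic_C1_on w)
    finally show ?thesis using True dbar_holomorphic[OF w True] by simp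
  next
    case False
    have "dbar g z = dbar (\<lambda>_. 0) z" by (rule dbar_cong_open[OF oK]) (use False K in \<open>auto simp: g_def\<close>)
    then show ?thesis using False by simp
  qed
  then have "dbar g = (\<lambda>z. if z \<in> B then dbar f z * w z else 0)" by auto
  moreover have "integral\<^sup>L lborel (dbar g) = 0"
    by (rule integral_dbar_eq_0[OF g K(1)]) (use K in \<open>auto simp: g_def\<close>)
  ultimately show ?thesis by simp
qed

section \<open>The contribution of a simple pole\<close>

definition plateau :: "complex \<Rightarrow> complex" where
  "plateau z = of_real ((max 0 (1 - (max 0 ((norm z)\<^sup>2 - 1/4))\<^sup>2))\<^sup>2)"

text \<open>The two truncations make \<open>plateau\<close> radial, 1 near 0 and 0 far out. Being
  radial and decreasing, it has \<open>dbar\<close> equal to a nonpositive real multiple of z, which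
  fixes the sign of its integral against 1 / z.\<close>

lemma
  shows C1_on_plateau: "C1_on UNIV plateau"
    and dbar_plateau: "dbar plateau z =
      - of_real (8 * max 0 (1 - (max 0 ((norm z)\<^sup>2 - 1/4))\<^sup>2) * max 0 ((norm z)\<^sup>2 - 1/4)) * z"
    and plateau_eq_1: "norm z < 1/2 \<Longrightarrow> plateau z = 1"
    and plateau_eq_0: "2 \<le> norm z \<Longrightarrow> plateau z = 0"
proof -
  define g f where "g = (\<lambda>z::complex. (norm z)\<^sup>2 - 1/4)" and "f = (\<lambda>z. 1 - (max 0 (g z))\<^sup>2)"
  define G F where "G = (\<lambda>z h::complex. 2 * (z \<bullet> h))" and "F = (\<lambda>z h. - (2 * max 0 (g z) * G z h))"
  have g: "(g has_derivative G z) (at z)" for z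
    unfolding g_def G_def power2_norm_eq_inner
    by (auto intro!: derivative_eq_intros simp: inner_commute algebra_simps fun_eq_iff)
  have Gc: "continuous_on UNIV (\<lambda>z. G z v)" for v unfolding G_def by (intro continuous_intros)
  have gc: "continuous_on UNIV g" unfolding g_def by (intro continuous_intros)
  note g2 = C1_on_max_square(1)[OF g Gc]
  have f: "(f has_derivative F z) (at z)" for z
    unfolding f_def F_def by (rule derivative_eq_intros g2 refl)+ simp
  have Fc: "continuous_on UNIV (\<lambda>z. F z v)" for v unfolding F_def by (intro continuous_intros Gc gc)
  have eq: "plateau = (\<lambda>z. of_real ((max 0 (f z))\<^sup>2))" by (auto simp: plateau_def f_def g_def)
  show "C1_on UNIV plateau" unfolding eq by (rule C1_on_max_square(2)[OF f Fc])
  have "(plateau has_derivative (\<lambda>h. of_real (2 * max 0 (f z) * F z h))) (at z)"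
    unfolding eq by (intro has_derivative_of_real C1_on_max_square(1)[OF f Fc])
  from dbar_eq[OF this]
  have "dbar plateau z = of_real (2 * max 0 (f z) * F z 1) + \<i> * of_real (2 * max 0 (f z) * F z \<i>)" .
  also have "\<dots> = - of_real (8 * max 0 (f z) * max 0 (g z)) * z"
    by (simp add: F_def G_def complex_eq_iff inner_complex_def)
  finally show "dbar plateau z =
      - of_real (8 * max 0 (1 - (max 0 ((norm z)\<^sup>2 - 1/4))\<^sup>2) * max 0 ((norm z)\<^sup>2 - 1/4)) * z"
    unfolding f_def g_def .
  show "plateau z = 1" if "norm z < 1/2"
  proof -
    have "(norm z)\<^sup>2 \<le> (1/2)\<^sup>2" using that by (intro power_mono) auto
    then show ?thesis by (simp add: plateau_def power2_eq_square)
  qed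
  show "plateau z = 0" if "2 \<le> norm z"
  proof -
    have "2\<^sup>2 \<le> (norm z)\<^sup>2" using that by (intro power_mono) auto
    then have "1 \<le> (norm z)\<^sup>2 - 1/4" by simp
    then have "1\<^sup>2 \<le> (max 0 ((norm z)\<^sup>2 - 1/4))\<^sup>2" by (intro power_mono) auto
    then show ?thesis by (simp add: plateau_def)
  qed
qed

text \<open>The common factor of all simple poles; polar coordinates would give the value -2 pi, but
  the argument asks only that it be nonzero.\<close>

definition pole_const :: complex where
  "pole_const = integral\<^sup>L lborel (\<lambda>z. dbar plateau z / z)"

text \<open>Division by z cancels the factor z in \<open>dbar_plateau\<close>; what remains is minus
  a continuous nonnegative function that is positive at 1.\<close>

lemma pole_const_nonzero: "pole_const \<noteq> 0"
proof -
  define q where "q = (\<lambda>z::complex. 8 * max 0 (1 - (max 0 ((norm z)\<^sup>2 - 1/4))\<^sup>2) * max 0 ((norm z)\<^sup>2 - 1/4))"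
  have qc: "continuous_on UNIV q" unfolding q_def by (intro continuous_intros)
  have q0: "q z = 0" if "z \<notin> cball 0 2" for z
  proof -
    have "2\<^sup>2 \<le> (norm z)\<^sup>2" using that by (intro power_mono) auto
    then have "1 \<le> (norm z)\<^sup>2 - 1/4" by simp
    then have "1\<^sup>2 \<le> (max 0 ((norm z)\<^sup>2 - 1/4))\<^sup>2" by (intro power_mono) auto
    then show ?thesis by (simp add: q_def)
  qed
  have qi: "integrable lborel q"
    by (rule integrable_continuous_compact_support[OF qc compact_cball q0])
  have "dbar plateau z / z = - of_real (q z)" for z
    by (cases "z = 0") (auto simp: dbar_plateau q_def)
  then have "pole_const = - of_real (integral\<^sup>L lborel q)"
    unfolding pole_const_def by simp
  moreover have "integral\<^sup>L lborel q \<noteq> 0"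
  proof
    assume "integral\<^sup>L lborel q = 0"
    then have "AE z in lborel. q z = 0"
      using integral_nonneg_eq_0_iff_AE[OF qi] by (simp add: q_def)
    then have "AE z in lborel. z \<notin> {z. q z \<noteq> 0}" by simp
    moreover have op: "open {z. q z \<noteq> 0}"
      using open_Collect_neq[OF qc continuous_on_const[of UNIV 0]] by simp
    ultimately have "{z. q z \<noteq> 0} \<in> null_sets lborel"
      by (subst AE_iff_null_sets) auto
    then have "negligible {z. q z \<noteq> 0}"
      by (simp add: negligible_iff_null_sets null_sets_completionI)
    moreover have "1 \<in> {z. q z \<noteq> 0}" by (simp add: q_def power2_eq_square)
    ultimately show False using open_not_negligible[OF op] by blast
  qed
  ultimately show ?thesis by (metis neg_equal_0_iff_equal of_real_eq_0_iff)
qed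

lemma continuous_on_divide_zero_nhd:
  fixes h :: "complex \<Rightarrow> complex"
  assumes "continuous_on UNIV h" "0 < e" "\<And>z. z \<in> ball a e \<Longrightarrow> h z = 0"
  shows "continuous_on UNIV (\<lambda>z. h z / (z - a))"
proof -
  have "continuous_on (ball a e \<union> - {a}) (\<lambda>z. h z / (z - a))"
  proof (rule continuous_on_open_Un)
    show "continuous_on (ball a e) (\<lambda>z. h z / (z - a))"
      by (rule continuous_on_eq[of _ "\<lambda>_. 0"]) (use assms(3) in auto)
    show "continuous_on (- {a}) (\<lambda>z. h z / (z - a))"
      by (intro continuous_intros continuous_on_subset[OF assms(1)]) auto
  qed auto
  moreover have "ball a e \<union> - {a} = UNIV" using assms(2) by auto
  ultimately show ?thesis by simp
qed

lemma dbar_eq_0_ball: "(\<And>z. z \<in> ball a e \<Longrightarrow> f z = c) \<Longrightarrow> z \<in> ball a e \<Longrightarrow> dbar f z = 0"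
  using dbar_cong_open[of "ball a e" z f "\<lambda>_. c"] by simp

lemma dbar_eq_0_outside: "compact K \<Longrightarrow> (\<And>z. z \<notin> K \<Longrightarrow> f z = 0) \<Longrightarrow> z \<notin> K \<Longrightarrow> dbar f z = 0"
  using dbar_cong_open[of "-K" z f "\<lambda>_. 0"] by (simp add: compact_imp_closed open_Compl)

text \<open>Two reductions. Cutoffs that are 1 near \<open>a\<close> differ by a function vanishing
  there, against which 1 / (z - a) counts as holomorphic, so \<open>\<rho>\<close> may be replaced
  by a translated plateau. And \<open>H\<close> differs from its value at \<open>a\<close> by a
  multiple of z - a, which cancels the pole.\<close>

lemma integral_dbar_pole:
  assumes \<rho>: "C1_on UNIV \<rho>" and K: "compact K" "K \<subseteq> B" "\<And>z. z \<notin> K \<Longrightarrow> \<rho> z = 0"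
    and H: "H holomorphic_on B" "open B" and a: "0 < e" "\<And>z. z \<in> ball a e \<Longrightarrow> \<rho> z = 1"
  shows "integral\<^sup>L lborel (\<lambda>z. if z \<in> B then dbar \<rho> z * (H z / (z - a)) else 0) = pole_const * H a"
proof -
  have int: "integrable lborel (\<lambda>z. dbar f z / (z - a))"
    if "C1_on UNIV f" "compact L" "\<And>z. z \<notin> L \<Longrightarrow> f z = 0" "0 < d" "\<And>z. z \<in> ball a d \<Longrightarrow> f z = c" for f L d c
    by (rule integrable_continuous_compact_support[OF continuous_on_divide_zero_nhd[OF continuous_on_dbar[OF that(1)] that(4)] that(2)])
       (use dbar_eq_0_ball[OF that(5)] dbar_eq_0_outside[OF that(2,3)] in auto)
  define \<beta> where "\<beta> = (\<lambda>z. plateau (z - a))"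
  have h: "(\<lambda>z. z - a) holomorphic_on UNIV" by (intro holomorphic_intros)
  have \<beta>: "C1_on UNIV \<beta>" "dbar \<beta> z = dbar plateau (z - a)" for z
    unfolding \<beta>_def using C1_on_compose_holomorphic[OF C1_on_plateau h] dbar_compose_holomorphic[OF C1_on_plateau h] by auto
  have \<beta>1: "\<beta> z = 1" if "z \<in> ball a (1/2)" for z
    using that unfolding \<beta>_def by (intro plateau_eq_1) (simp add: dist_norm norm_minus_commute)
  have \<beta>0: "\<beta> z = 0" if "z \<notin> cball a 2" for z
    using that unfolding \<beta>_def by (intro plateau_eq_0) (simp add: dist_norm norm_minus_commute)
  have \<beta>c: "integral\<^sup>L lborel (\<lambda>z. dbar \<beta> z / (z - a)) = pole_const"
  proof -
    have c: "continuous_on UNIV (\<lambda>z. dbar plateau z / (z - 0))"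
      by (rule continuous_on_divide_zero_nhd[OF continuous_on_dbar[OF C1_on_plateau], of "1/2"])
         (auto intro!: dbar_eq_0_ball[of 0 "1/2" _ 1] plateau_eq_1)
    have "integral\<^sup>L (distr lborel borel ((+) (-a))) (\<lambda>z. dbar plateau z / z) = integral\<^sup>L lborel (\<lambda>z. dbar plateau (-a + z) / (-a + z))"
      by (rule integral_distr) (use c in \<open>auto intro: borel_measurable_continuous_onI\<close>)
    then show ?thesis by (simp add: pole_const_def lborel_distr_plus \<beta>(2))
  qed
  define d where "d = min e (1/2)"
  have d: "0 < d" "ball a d \<subseteq> ball a e" "ball a d \<subseteq> ball a (1/2)" using a(1) by (auto simp: d_def)
  have eq1: "\<rho> z = \<beta> z" if "dist a z < d" for z using a(2)[of z] \<beta>1[of z] that by (auto simp: d_def)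
  have eq0: "\<rho> z = \<beta> z" if "z \<notin> K" "\<not> dist a z \<le> 2" for z using K(3)[of z] \<beta>0[of z] that by auto
  have z: "integral\<^sup>L lborel (\<lambda>z. if z \<in> - {a} then dbar (\<lambda>z. \<rho> z - \<beta> z) z * inverse (z - a) else 0) = 0"
    by (rule integral_dbar_holomorphic_eq_0[OF C1_on_diff[OF \<rho> \<beta>(1)], of "(K \<union> cball a 2) - ball a d"])
       (use d a K(1) eq1 eq0 in \<open>auto intro!: holomorphic_intros compact_diff\<close>)
  have "integral\<^sup>L lborel (\<lambda>z. dbar \<rho> z / (z - a) - dbar \<beta> z / (z - a)) = 0"
  proof -
    have "dbar \<rho> z / (z - a) - dbar \<beta> z / (z - a) =
      (if z \<in> - {a} then dbar (\<lambda>z. \<rho> z - \<beta> z) z * inverse (z - a) else 0)" for z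
      by (simp add: dbar_diff[OF \<rho> \<beta>(1)] diff_divide_distrib divide_inverse left_diff_distrib)
    then show ?thesis using z by presburger
  qed
  then have \<rho>c: "integral\<^sup>L lborel (\<lambda>z. dbar \<rho> z / (z - a)) = pole_const"
    using int[OF \<rho> K(1,3) a] int[OF \<beta>(1) compact_cball \<beta>0 half_gt_zero[OF zero_less_one] \<beta>1] \<beta>c
    by (subst (asm) Bochner_Integration.integral_diff) auto
  define H1 where "H1 = (\<lambda>z. if z = a then deriv H a else (H z - H a) / (z - a))"
  have H1: "H1 holomorphic_on B" unfolding H1_def by (rule pole_lemma_open[OF H])
  have z1: "integral\<^sup>L lborel (\<lambda>z. if z \<in> B then dbar \<rho> z * H1 z else 0) = 0"
    by (rule integral_dbar_holomorphic_eq_0[OF \<rho> K H1 H(2)])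
  have i1: "integrable lborel (\<lambda>z. if z \<in> B then dbar \<rho> z * H1 z else 0)"
  proof (rule integrable_continuous_compact_support[OF _ K(1)])
    have "continuous_on (B \<union> - K) (\<lambda>z. if z \<in> B then dbar \<rho> z * H1 z else 0)"
    proof (rule continuous_on_open_Un)
      show "continuous_on B (\<lambda>z. if z \<in> B then dbar \<rho> z * H1 z else 0)"
        by (rule continuous_on_eq[of _ "\<lambda>z. dbar \<rho> z * H1 z"])
           (auto intro!: continuous_on_mult continuous_on_subset[OF continuous_on_dbar[OF \<rho>]] holomorphic_on_imp_continuous_on[OF H1])
      show "continuous_on (- K) (\<lambda>z. if z \<in> B then dbar \<rho> z * H1 z else 0)"
        by (rule continuous_on_eq[of _ "\<lambda>z. 0"]) (use dbar_eq_0_outside[OF K(1,3)] in auto)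
    qed (use K H in \<open>auto simp: compact_imp_closed open_Compl\<close>)
    then show "continuous_on UNIV (\<lambda>z. if z \<in> B then dbar \<rho> z * H1 z else 0)"
      by (rule continuous_on_subset) (use K(2) in auto)
  qed (use dbar_eq_0_outside[OF K(1,3)] in auto)
  have eq: "(if z \<in> B then dbar \<rho> z * (H z / (z - a)) else 0) =
      dbar \<rho> z / (z - a) * H a + (if z \<in> B then dbar \<rho> z * H1 z else 0)" for z
  proof (cases "z \<in> B")
    case True
    show ?thesis
    proof (cases "z = a")
      case True
      have "dbar \<rho> z = 0" using dbar_eq_0_ball[OF a(2)] True a(1) by auto
      then show ?thesis by simp
    next
      case False
      then show ?thesis using True by (simp add: H1_def add_divide_distrib[symmetric] flip: distrib_left)
    qed
  next
    case False
    then have "dbar \<rho> z = 0" using K(2) by (intro dbar_eq_0_outside[OF K(1,3)]) auto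
    then show ?thesis using False by simp
  qed
  have "integrable lborel (\<lambda>z. dbar \<rho> z / (z - a) * H a)" using int[OF \<rho> K(1,3) a] by (intro integrable_mult_left)
  from Bochner_Integration.integral_add[OF this i1] show ?thesis
    unfolding eq integral_mult_left_zero \<rho>c z1 by simp
qed

section \<open>The residue theorem on a compact surface\<close>

locale compact_surface =
  fixes X :: "'a topology" and \<A> :: "'a chart set"
  assumes rs: "riemann_surface X \<A>" and cpt: "compact_space X"
begin

abbreviation img :: "'a chart \<Rightarrow> complex set" where "img c \<equiv> snd c ` fst c"

lemma Haus: "Hausdorff_space X" using rs by (simp add: riemann_surface_def)

lemma chart_onD:
  assumes "c \<in> \<A>"
  shows openin_fst: "openin X (fst c)" and open_img: "open (img c)" and fst_subset: "fst c \<subseteq> topspace X"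
    and homeo_chart: "homeomorphic_map (subtopology X (fst c)) (top_of_set (img c)) (snd c)"
    and inj_chart: "inj_on (snd c) (fst c)" and topspace_chart: "topspace (subtopology X (fst c)) = fst c"
proof -
  have "chart_on X c" using rs assms by (simp add: riemann_surface_def)
  then show 1: "openin X (fst c)" "open (img c)" 
    and h: "homeomorphic_map (subtopology X (fst c)) (top_of_set (img c)) (snd c)"
    by (auto simp: chart_on_def)
  show 2: "fst c \<subseteq> topspace X" using 1 openin_subset by blast
  then show 3: "topspace (subtopology X (fst c)) = fst c" by auto
  show "inj_on (snd c) (fst c)" using homeomorphic_imp_injective_map[OF h] 3 by simp
qed

lemma chart_inv_simps:
  assumes "c \<in> \<A>"
  shows "z \<in> img c \<Longrightarrow> chart_inv c z \<in> fst c" "z \<in> img c \<Longrightarrow> snd c (chart_inv c z) = z"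
    "p \<in> fst c \<Longrightarrow> chart_inv c (snd c p) = p"
  using inj_chart[OF assms] by (simp_all add: inv_into_into f_inv_into_f inv_into_f_f)

lemma chart_exists: "p \<in> topspace X \<Longrightarrow> \<exists>c\<in>\<A>. p \<in> fst c"
  using rs unfolding riemann_surface_def by (metis UN_E)

lemma open_chart_image:
  assumes "c \<in> \<A>" "openin X W" shows "open (snd c ` (fst c \<inter> W))"
proof -
  have "openin (subtopology X (fst c)) (fst c \<inter> W)"
    using assms(2) openin_subtopology_Int2 by blast
  then have "openin (top_of_set (img c)) (snd c ` (fst c \<inter> W))"
    using homeomorphic_imp_open_map[OF homeo_chart[OF assms(1)]] by (simp add: open_map_def)
  then show ?thesis using open_img[OF assms(1)] openin_open_trans by blast
qed

lemma chart_inv_image_eq: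
  "c \<in> \<A> \<Longrightarrow> V \<subseteq> img c \<Longrightarrow> chart_inv c ` V = {p \<in> fst c. snd c p \<in> V}"
  using chart_inv_simps[of c] by (auto simp: image_iff) (metis subsetD)+

lemma openin_chart_inv_image:
  assumes "c \<in> \<A>" "open V" "V \<subseteq> img c" shows "openin X (chart_inv c ` V)"
proof -
  have "continuous_map (subtopology X (fst c)) (top_of_set (img c)) (snd c)"
    using homeo_chart[OF assms(1)] homeomorphic_imp_continuous_map by blast
  moreover have "openin (top_of_set (img c)) V" using assms(2,3) by (intro open_subset)
  ultimately have "openin (subtopology X (fst c)) {x \<in> topspace (subtopology X (fst c)). snd c x \<in> V}"
    by (rule openin_continuous_map_preimage)
  then have "openin (subtopology X (fst c)) {x \<in> fst c. snd c x \<in> V}"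
    unfolding topspace_chart[OF assms(1)] .
  then have "openin X {x \<in> fst c. snd c x \<in> V}"
    using openin_trans_full[OF _ openin_fst[OF assms(1)]] by blast
  then show ?thesis using chart_inv_image_eq assms by simp
qed

lemma compactin_chart_inv_image:
  assumes "c \<in> \<A>" "compact K" "K \<subseteq> img c"
  shows "compactin X (chart_inv c ` K)" "closedin X (chart_inv c ` K)"
proof -
  have sub: "chart_inv c ` K \<subseteq> fst c" using chart_inv_simps(1)[OF assms(1)] assms(3) by auto
  have "snd c ` chart_inv c ` K = K" using chart_inv_simps(2)[OF assms(1)] assms(3) by (force simp: image_iff)
  moreover have "compactin (top_of_set (img c)) K" using assms by (simp add: compactin_subtopology)
  ultimately have "compactin (subtopology X (fst c)) (chart_inv c ` K)"
    using homeomorphic_map_compactness[OF homeo_chart[OF assms(1)], of "chart_inv c ` K"] sub fst_subset[OF assms(1)] by simp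
  then show "compactin X (chart_inv c ` K)" by (simp add: compactin_subtopology)
  then show "closedin X (chart_inv c ` K)" using Haus compactin_imp_closedin by blast
qed

lemma compact_chart_image:
  assumes "c \<in> \<A>" "compactin X L" "L \<subseteq> fst c" shows "compact (snd c ` L)"
proof -
  have "compactin (subtopology X (fst c)) L" using assms by (simp add: compactin_subtopology)
  then have "compactin (top_of_set (img c)) (snd c ` L)"
    using homeomorphic_map_compactness[OF homeo_chart[OF assms(1)], of L] assms(3) fst_subset[OF assms(1)] by simp
  then show ?thesis by (simp add: compactin_subtopology)
qed

lemma closedin_finite: "finite S \<Longrightarrow> S \<subseteq> topspace X \<Longrightarrow> closedin X S"
  using Haus closedin_Hausdorff_finite by blast

lemma openin_Diff_finite: "openin X W \<Longrightarrow> finite S \<Longrightarrow> openin X (W - S)"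
proof -
  assume a: "openin X W" "finite S"
  have "openin X (W - (S \<inter> topspace X))" using a by (intro openin_diff closedin_finite) auto
  moreover have "W - (S \<inter> topspace X) = W - S" using openin_subset[OF a(1)] by auto
  ultimately show ?thesis by simp
qed

lemma open_chart_image_Diff:
  assumes "c \<in> \<A>" "finite S" shows "open (snd c ` (fst c - S))"
  using open_chart_image[OF assms(1) openin_Diff_finite[OF openin_fst[OF assms(1)] assms(2)]]
  by (metis Int_Diff Int_absorb)

lemma transition_holomorphic:
  assumes "c \<in> \<A>" "d \<in> \<A>"
  shows "(\<lambda>z. snd d (chart_inv c z)) holomorphic_on snd c ` (fst c \<inter> fst d)"
proof -
  have "compatible c d" using rs assms by (simp add: riemann_surface_def)
  then show ?thesis unfolding compatible_def transition_def comp_def by blast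
qed

lemma open_overlap: "c \<in> \<A> \<Longrightarrow> d \<in> \<A> \<Longrightarrow> open (snd c ` (fst c \<inter> fst d))"
  by (intro open_chart_image openin_fst)

text \<open>Coefficient functions related by the squared modulus of the transition derivative
  describe the same 2-form, so the plane integral is a quantity on the surface as long as the
  support lies in the overlap.\<close>

lemma integral_chart_invariant:
  fixes f g :: "complex \<Rightarrow> complex"
  assumes c: "c \<in> \<A>" and d: "d \<in> \<A>" and L: "compactin X L" "L \<subseteq> fst c \<inter> fst d"
    and f: "continuous_on UNIV f" "\<And>w. w \<notin> snd d ` L \<Longrightarrow> f w = 0"
    and g: "\<And>z. z \<in> snd c ` (fst c \<inter> fst d) \<Longrightarrow>
      g z = of_real ((cmod (deriv (transition c d) z))\<^sup>2) * f (transition c d z)"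
      "\<And>z. z \<notin> snd c ` (fst c \<inter> fst d) \<Longrightarrow> g z = 0"
  shows "integral\<^sup>L lborel g = integral\<^sup>L lborel f"
proof -
  define V where "V = snd c ` (fst c \<inter> fst d)"
  have T: "transition c d holomorphic_on V" 
    using transition_holomorphic[OF c d] by (simp add: V_def transition_def comp_def)
  have inj: "inj_on (transition c d) V"
  proof (rule inj_onI)
    fix z w assume "z \<in> V" "w \<in> V" and e: "transition c d z = transition c d w"
    then obtain p q where p: "z = snd c p" "p \<in> fst c" "p \<in> fst d" and q: "w = snd c q" "q \<in> fst c" "q \<in> fst d"
      unfolding V_def by blast
    then have "snd d p = snd d q" using e chart_inv_simps(3)[OF c] by (simp add: transition_def)
    then show "z = w" using inj_onD[OF inj_chart[OF d]] p q by blast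
  qed
  have sub: "snd d ` L \<subseteq> transition c d ` V"
  proof
    fix w assume "w \<in> snd d ` L"
    then obtain p where p: "p \<in> L" "w = snd d p" by blast
    then have "transition c d (snd c p) = w" "snd c p \<in> V"
      using L(2) chart_inv_simps(3)[OF c] by (auto simp: transition_def V_def)
    then show "w \<in> transition c d ` V" by blast
  qed
  have cL: "compact (snd d ` L)" using L by (intro compact_chart_image[OF d]) auto
  have "integral\<^sup>L lborel f = integral\<^sup>L lborel (\<lambda>z. if z \<in> V then of_real ((cmod (deriv (transition c d) z))\<^sup>2) * f (transition c d z) else 0)"
    by (rule integral_holomorphic_change_of_variables[OF _ T inj f(1) cL sub f(2)])
       (use open_overlap[OF c d] in \<open>auto simp: V_def\<close>)
  also have "(\<lambda>z. if z \<in> V then of_real ((cmod (deriv (transition c d) z))\<^sup>2) * f (transition c d z) else 0) = g"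
    using g by (auto simp: V_def)
  finally show ?thesis by simp
qed

text \<open>Raw material for a partition of unity. Only C1 regularity is aimed at, so a squared
  truncation takes the place of an exponential cutoff.\<close>

definition bump :: "'a chart \<Rightarrow> complex \<Rightarrow> real \<Rightarrow> 'a \<Rightarrow> real" where
  "bump c a R p = (if p \<in> fst c then (max 0 (R\<^sup>2 - (cmod (snd c p - a))\<^sup>2))\<^sup>2 else 0)"

lemma bump_nonneg: "0 \<le> bump c a R p"
  by (simp add: bump_def)

lemma bump_pos: "c \<in> \<A> \<Longrightarrow> ball a R \<subseteq> img c \<Longrightarrow> p \<in> chart_inv c ` ball a R \<Longrightarrow> 0 < bump c a R p"
proof -
  assume a: "c \<in> \<A>" "ball a R \<subseteq> img c" "p \<in> chart_inv c ` ball a R"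
  then have p: "p \<in> fst c" "cmod (snd c p - a) < R"
    using chart_inv_image_eq[OF a(1,2)] by (auto simp: dist_norm norm_minus_commute)
  then have "(cmod (snd c p - a))\<^sup>2 < R\<^sup>2" by (intro power_strict_mono) auto
  then show ?thesis using p by (simp add: bump_def)
qed

lemma bump_eq_0: 
  assumes "c \<in> \<A>" "0 \<le> R" "cball a R \<subseteq> img c" "p \<notin> chart_inv c ` cball a R" shows "bump c a R p = 0"
proof (cases "p \<in> fst c")
  case True
  then have "R < cmod (snd c p - a)"
    using assms(4) chart_inv_image_eq[OF assms(1,3)] by (auto simp: dist_norm norm_minus_commute)
  then have "R\<^sup>2 \<le> (cmod (snd c p - a))\<^sup>2" using assms(2) by (intro power_mono) auto
  then show ?thesis by (simp add: bump_def)
qed (simp add: bump_def)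

text \<open>The chart \<open>d\<close> is covered by its overlap with \<open>c\<close>, where the
  bump is a C1 function of a holomorphic transition, and by the complement of the compact disc,
  where it is zero. The Hausdorff property makes that complement open.\<close>

lemma C1_on_bump:
  assumes c: "c \<in> \<A>" and d: "d \<in> \<A>" and R: "0 \<le> R" "cball a R \<subseteq> img c"
  shows "C1_on (img d) (\<lambda>z. of_real (bump c a R (chart_inv d z)))"
proof (rule C1_on_Union)
  fix z assume z: "z \<in> img d"
  define p where "p = chart_inv d z"
  have p: "p \<in> fst d" "snd d p = z" using chart_inv_simps[OF d] z by (auto simp: p_def)
  define m where "m = (\<lambda>w. complex_of_real ((max 0 (R\<^sup>2 - (cmod (w - a))\<^sup>2))\<^sup>2))"
  have m: "C1_on UNIV m" unfolding m_def
  proof (rule C1_on_max_square(2))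
    show "((\<lambda>w. R\<^sup>2 - (cmod (w - a))\<^sup>2) has_derivative (\<lambda>h. - (2 * ((w - a) \<bullet> h)))) (at w)" for w
      unfolding power2_norm_eq_inner
      by (auto intro!: derivative_eq_intros simp: inner_commute algebra_simps fun_eq_iff)
    show "continuous_on UNIV (\<lambda>w. - (2 * ((w - a) \<bullet> v)))" for v by (intro continuous_intros)
  qed
  show "\<exists>V. open V \<and> z \<in> V \<and> C1_on V (\<lambda>z. of_real (bump c a R (chart_inv d z)))"
  proof (cases "p \<in> fst c")
    case True
    have o: "open (snd d ` (fst d \<inter> fst c))" by (rule open_overlap[OF d c])
    have "C1_on (snd d ` (fst d \<inter> fst c)) (\<lambda>z. m (snd c (chart_inv d z)))"
      by (rule C1_on_compose_holomorphic[OF m transition_holomorphic[OF d c] o]) auto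
    then have "C1_on (snd d ` (fst d \<inter> fst c)) (\<lambda>z. of_real (bump c a R (chart_inv d z)))"
      by (rule C1_on_cong_open[OF _ o]) (use chart_inv_simps(3)[OF d] in \<open>auto simp: m_def bump_def\<close>)
    moreover have "z \<in> snd d ` (fst d \<inter> fst c)" using True p by auto
    ultimately show ?thesis using o by blast
  next
    case False
    define W where "W = topspace X - chart_inv c ` cball a R"
    have "openin X W" unfolding W_def using compactin_chart_inv_image(2)[OF c _ R(2)] by auto
    then have o: "open (snd d ` (fst d \<inter> W))" by (rule open_chart_image[OF d])
    have "C1_on (snd d ` (fst d \<inter> W)) (\<lambda>z. of_real (bump c a R (chart_inv d z)))"
      by (rule C1_on_cong_open[OF C1_on_const[of _ 0] o])
         (use chart_inv_simps(3)[OF d] bump_eq_0[OF c R] in \<open>auto simp: W_def\<close>)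
    moreover have "p \<in> W" using False p chart_inv_image_eq[OF c R(2)] fst_subset[OF d] by (auto simp: W_def)
    then have "z \<in> snd d ` (fst d \<inter> W)" using p by auto
    ultimately show ?thesis using o by blast
  qed
qed

text \<open>\<open>H s\<close> at the centre is the residue at \<open>s\<close>. For a partition of
  unity, the integral of \<open>dbar\<close> of one member times the form is 0 if its disc is free
  of poles, and \<open>pole_const\<close> times the residue if the disc is centred at a pole. The
  members sum to 1, so the integrands should sum to 0; the difficulty is that each integral lives in
  its own chart.\<close>

theorem residue_theorem:
  fixes \<omega> :: "'a form" and ch :: "'a \<Rightarrow> 'a chart" and H :: "'a \<Rightarrow> complex \<Rightarrow> complex"
  assumes S: "finite S" "S \<subseteq> topspace X"
    and hol: "\<And>c. c \<in> \<A> \<Longrightarrow> \<omega> c holomorphic_on snd c ` (fst c - S)"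
    and trans: "\<And>c d z. c \<in> \<A> \<Longrightarrow> d \<in> \<A> \<Longrightarrow> z \<in> snd c ` (fst c \<inter> fst d - S) \<Longrightarrow>
       \<omega> c z = \<omega> d (transition c d z) * deriv (transition c d) z"
    and ch: "\<And>s. s \<in> S \<Longrightarrow> ch s \<in> \<A> \<and> s \<in> fst (ch s)"
    and e: "\<And>s. s \<in> S \<Longrightarrow> 0 < e s"
    and H: "\<And>s. s \<in> S \<Longrightarrow> H s holomorphic_on ball (snd (ch s) s) (e s)"
    and pole: "\<And>s z. s \<in> S \<Longrightarrow> z \<in> ball (snd (ch s) s) (e s) - {snd (ch s) s} \<Longrightarrow>
       \<omega> (ch s) z = H s z / (z - snd (ch s) s)"
  shows "(\<Sum>s\<in>S. H s (snd (ch s) s)) = 0"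
proof -
  \<comment> \<open>Each disc avoids all singular points except possibly its own centre. Hence a
    singular point can be covered only by the disc centred at it, and \<open>S\<close> lies in the
    finite index set \<open>I\<close>.\<close>
  have "\<exists>c R. c \<in> \<A> \<and> p \<in> fst c \<and> 0 < R \<and> cball (snd c p) R \<subseteq> snd c ` (fst c - (S - {p})) \<and>
      (p \<in> S \<longrightarrow> c = ch p \<and> cball (snd c p) R \<subseteq> ball (snd c p) (e p))" if p: "p \<in> topspace X" for p
  proof -
    obtain c where c: "c \<in> \<A>" "p \<in> fst c" "p \<in> S \<longrightarrow> c = ch p"
      using chart_exists[OF p] ch[of p] by metis
    define V where "V = snd c ` (fst c - (S - {p})) \<inter> (if p \<in> S then ball (snd c p) (e p) else UNIV)"
    have "open V" unfolding V_def using open_chart_image_Diff[OF c(1), of "S - {p}"] S(1) by auto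
    moreover have "snd c p \<in> V" unfolding V_def using c e by auto
    ultimately obtain R where "0 < R" "cball (snd c p) R \<subseteq> V" using open_contains_cball_eq by metis
    then show ?thesis using c unfolding V_def by (intro exI[of _ c] exI[of _ R]) (auto split: if_splits)
  qed
  then obtain c R where cR: "\<And>p. p \<in> topspace X \<Longrightarrow> c p \<in> \<A> \<and> p \<in> fst (c p) \<and> 0 < R p \<and>
      cball (snd (c p) p) (R p) \<subseteq> snd (c p) ` (fst (c p) - (S - {p})) \<and>
      (p \<in> S \<longrightarrow> c p = ch p \<and> cball (snd (c p) p) (R p) \<subseteq> ball (snd (c p) p) (e p))"
    by metis
  define a where "a p = snd (c p) p" for p
  define E where "E p = chart_inv (c p) ` cball (a p) (R p)" for p
  define D where "D p = chart_inv (c p) ` ball (a p) (R p)" for p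
  have cA: "c p \<in> \<A>" and pc: "p \<in> fst (c p)" and R: "0 < R p" and cb: "cball (a p) (R p) \<subseteq> img (c p)"
    and chp: "p \<in> S \<Longrightarrow> c p = ch p" "p \<in> S \<Longrightarrow> cball (a p) (R p) \<subseteq> ball (a p) (e p)" if "p \<in> topspace X" for p
    using cR[OF that] by (auto simp: a_def)
  have cb': "ball (a p) (R p) \<subseteq> img (c p)" if "p \<in> topspace X" for p
    using cb[OF that] ball_subset_cball by blast
  have ES: "E p \<inter> S \<subseteq> {p}" if pX: "p \<in> topspace X" for p
  proof
    fix q assume q: "q \<in> E p \<inter> S"
    then have "q \<in> fst (c p)" "snd (c p) q \<in> cball (a p) (R p)"
      using chart_inv_image_eq[OF cA[OF pX] cb[OF pX]] by (auto simp: E_def)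
    then obtain q' where "q' \<in> fst (c p) - (S - {p})" "snd (c p) q = snd (c p) q'"
      using cR[OF pX] unfolding a_def by blast
    then have "q \<notin> S - {p}" using inj_onD[OF inj_chart[OF cA[OF pX]]] \<open>q \<in> fst (c p)\<close> by blast
    then show "q \<in> {p}" using q by blast
  qed
  have DE: "D p \<subseteq> E p" for p unfolding D_def E_def using ball_subset_cball by blast
  have pD: "p \<in> D p" if "p \<in> topspace X" for p
    using chart_inv_simps(3)[OF cA[OF that] pc[OF that]] R[OF that] unfolding D_def a_def
    by (metis centre_in_ball imageI)
  have Dop: "openin X (D p)" if "p \<in> topspace X" for p
    unfolding D_def by (rule openin_chart_inv_image[OF cA[OF that] open_ball cb'[OF that]])
  have Ecp: "compactin X (E p)" "closedin X (E p)" if "p \<in> topspace X" for p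
    unfolding E_def using compactin_chart_inv_image[OF cA[OF that] compact_cball cb[OF that]] by auto
  have Esub: "E p \<subseteq> fst (c p)" if "p \<in> topspace X" for p
    using chart_inv_image_eq[OF cA[OF that] cb[OF that]] by (auto simp: E_def)
  have "\<exists>I. finite I \<and> I \<subseteq> topspace X \<and> topspace X \<subseteq> \<Union> (D ` I)"
  proof -
    obtain \<F> where F: "finite \<F>" "\<F> \<subseteq> D ` topspace X" "topspace X \<subseteq> \<Union> \<F>"
      using cpt[unfolded compact_space_alt, rule_format, of "D ` topspace X"] Dop pD by blast
    then obtain I where "I \<subseteq> topspace X" "finite I" "\<F> = D ` I" using finite_subset_image[OF F(1,2)] by blast
    then show ?thesis using F(3) by blast
  qed
  then obtain I where I: "finite I" "I \<subseteq> topspace X" "topspace X \<subseteq> \<Union> (D ` I)" by blast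
  have SI: "S \<subseteq> I"
  proof
    fix s assume s: "s \<in> S"
    then obtain p where "p \<in> I" "s \<in> D p" using S(2) I(3) by blast
    then show "s \<in> I" using ES[of p] DE[of p] s I(2) by blast
  qed
  define b where "b p = bump (c p) (a p) (R p)" for p
  define \<rho> where "\<rho> p q = complex_of_real (b p q) * inverse (\<Sum>p\<in>I. complex_of_real (b p q))" for p q
  have totpos: "(\<Sum>p\<in>I. complex_of_real (b p q)) \<noteq> 0" if qX: "q \<in> topspace X" for q
  proof -
    obtain p where p: "p \<in> I" "q \<in> D p" using qX I(3) by blast
    then have "0 < b p q" unfolding b_def D_def using I(2) cb' by (intro bump_pos cA) auto
    then have "0 < (\<Sum>p\<in>I. b p q)" using I(1) p(1) by (intro sum_pos2[of _ p]) (auto simp: b_def bump_nonneg)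
    then show ?thesis by (metis of_real_eq_0_iff of_real_sum less_irrefl)
  qed
  have \<rho>0: "\<rho> p q = 0" if "p \<in> I" "q \<notin> E p" for p q
    using bump_eq_0[OF cA _ cb, of p q] that I(2) R[of p] by (auto simp: \<rho>_def b_def E_def)
  have \<rho>sum: "(\<Sum>p\<in>I. \<rho> p q) = 1" if "q \<in> topspace X" for q
    unfolding \<rho>_def sum_distrib_right[symmetric] using totpos[OF that] by simp
  have \<rho>C1: "C1_on (img d) (\<lambda>z. \<rho> p (chart_inv d z))" if "p \<in> I" "d \<in> \<A>" for p d
    unfolding \<rho>_def
  proof (rule C1_on_mult, goal_cases)
    case 1 show ?case unfolding b_def using that I(2) R[of p] by (intro C1_on_bump cA cb) auto
  next
    case 2
    have "C1_on (img d) (\<lambda>z. \<Sum>p\<in>I. complex_of_real (b p (chart_inv d z)))"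
      unfolding b_def using that I(2) R less_imp_le by (intro C1_on_sum C1_on_bump cA cb) blast+
    then show ?case
      by (rule C1_on_inverse) (use totpos chart_inv_simps(1)[OF that(2)] fst_subset[OF that(2)] in blast)
  qed
  \<comment> \<open>Near \<open>s\<close> all other discs are absent, so \<open>\<rho> s\<close>
    alone carries the sum and equals 1. There \<open>dbar\<close> of every member vanishes, and the
    pole of the form is invisible to the integrands.\<close>
  define W where "W s = D s - (\<Union>p\<in>I - {s}. E p)" for s
  have Wop: "openin X (W s)" "s \<in> W s" if "s \<in> S" for s
  proof -
    show "openin X (W s)" unfolding W_def using that S(2) I
      by (intro openin_diff Dop closedin_Union) (auto intro!: Ecp)
    show "s \<in> W s" unfolding W_def using pD[of s] that S(2) ES I(2) by blast
  qed
  have W\<rho>: "\<rho> p q = (if p = s then 1 else 0)" if "s \<in> S" "q \<in> W s" "p \<in> I" for s q p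
  proof -
    have q: "q \<in> topspace X" using that Wop(1) openin_subset by blast
    have z: "\<rho> p' q = 0" if "p' \<in> I - {s}" for p' using that \<open>q \<in> W s\<close> by (intro \<rho>0) (auto simp: W_def)
    have "(\<Sum>p\<in>I. \<rho> p q) = \<rho> s q + (\<Sum>p\<in>I-{s}. \<rho> p q)"
      using I(1) SI that(1) by (intro sum.remove) auto
    then have "\<rho> s q = 1" using \<rho>sum[OF q] z by simp
    then show ?thesis using z that by auto
  qed
  have dW: "dbar (\<lambda>z. \<rho> p (chart_inv d z)) z = 0" if "s \<in> S" "d \<in> \<A>" "p \<in> I" "z \<in> snd d ` (fst d \<inter> W s)" for s d p z
  proof -
    have "dbar (\<lambda>z. \<rho> p (chart_inv d z)) z = dbar (\<lambda>z. if p = s then 1 else 0) z"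
      using that chart_inv_simps(3)[OF that(2)] W\<rho>[OF that(1) _ that(3)]
      by (intro dbar_cong_open[OF open_chart_image[OF that(2) Wop(1)[OF that(1)]] that(4)]) auto
    then show ?thesis by simp
  qed
  have dE: "dbar (\<lambda>z. \<rho> p (chart_inv d z)) z = 0" if "d \<in> \<A>" "p \<in> I" "z \<in> img d" "chart_inv d z \<notin> E p" for d p z
  proof -
    have o: "openin X (topspace X - E p)" using Ecp(2)[of p] that I(2) by blast
    have "z \<in> snd d ` (fst d \<inter> (topspace X - E p))"
      using that(3,4) chart_inv_simps[OF that(1)] fst_subset[OF that(1)] by (auto simp: image_iff)
    then have "dbar (\<lambda>z. \<rho> p (chart_inv d z)) z = dbar (\<lambda>z. 0) z"
      using that chart_inv_simps(3)[OF that(1)] \<rho>0[OF that(2)]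
      by (intro dbar_cong_open[OF open_chart_image[OF that(1) o]]) auto
    then show ?thesis by simp
  qed
  \<comment> \<open>The extra factor \<open>\<rho> q\<close> confines the support to two discs at
    once, so the term can be read in the chart of \<open>p\<close> and in that of
    \<open>q\<close>.\<close>
  define \<Phi> where "\<Phi> d p q z = (if z \<in> img d then \<rho> q (chart_inv d z) * dbar (\<lambda>z. \<rho> p (chart_inv d z)) z * \<omega> d z else 0)" for d p q z
  have \<Phi>0: "\<Phi> d p q z = 0" if "d \<in> \<A>" "p \<in> I" "q \<in> I" "z \<notin> snd d ` (E p \<inter> E q \<inter> fst d)" for d p q z
  proof (cases "z \<in> img d")
    case True
    then have "chart_inv d z \<notin> E p \<or> chart_inv d z \<notin> E q"
      using that(1,4) chart_inv_simps[OF that(1)] by (auto simp: image_iff)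
    then show ?thesis using dE[OF that(1,2) True] \<rho>0[OF that(3)] by (auto simp: \<Phi>_def)
  qed (simp add: \<Phi>_def)
  have \<Phi>cp: "compact (snd d ` (E p \<inter> E q))" if "d \<in> \<A>" "p \<in> I" "q \<in> I" "E p \<inter> E q \<subseteq> fst d" for d p q
    using that I(2) by (intro compact_chart_image compact_Int_closedin) (auto intro: Ecp)
  have \<Phi>c: "continuous_on UNIV (\<Phi> d p q)" if dpq: "d \<in> \<A>" "p \<in> I" "q \<in> I" "E p \<inter> E q \<subseteq> fst d" for d p q
  proof -
    \<comment> \<open>Away from the singular points the integrand is continuous; near them, and off
      the support, it vanishes. These three open sets cover the plane.\<close>
    define V1 V2 V3 where "V1 = snd d ` (fst d - S)" and "V2 = (\<Union>s\<in>S. snd d ` (fst d \<inter> W s))" and "V3 = - snd d ` (E p \<inter> E q)"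
    have o: "open V1" "open V2" "open V3"
      unfolding V1_def V2_def V3_def using open_chart_image_Diff[OF dpq(1) S(1)] open_chart_image[OF dpq(1) Wop(1)]
        \<Phi>cp[OF dpq] by (auto simp: compact_imp_closed open_Compl)
    have V1i: "V1 \<subseteq> img d" unfolding V1_def by auto
    have "continuous_on V1 (\<lambda>z. \<rho> q (chart_inv d z) * dbar (\<lambda>z. \<rho> p (chart_inv d z)) z * \<omega> d z)"
      by (intro continuous_on_mult continuous_on_subset[OF C1_on_imp_continuous_on[OF \<rho>C1] V1i] dpq
           continuous_on_subset[OF continuous_on_dbar[OF \<rho>C1] V1i] holomorphic_on_imp_continuous_on)
         (use hol[OF dpq(1)] V1_def in auto)
    then have 1: "continuous_on V1 (\<Phi> d p q)"
      by (rule continuous_on_eq) (use V1i in \<open>auto simp: \<Phi>_def\<close>)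
    have 2: "continuous_on V2 (\<Phi> d p q)"
    proof (rule continuous_on_eq[of _ "\<lambda>_. 0"])
      fix z assume "z \<in> V2"
      then obtain s where "s \<in> S" "z \<in> snd d ` (fst d \<inter> W s)" unfolding V2_def by blast
      then show "0 = \<Phi> d p q z" using dW[OF _ dpq(1,2)] by (simp add: \<Phi>_def)
    qed simp
    have 3: "continuous_on V3 (\<Phi> d p q)"
      by (rule continuous_on_eq[of _ "\<lambda>_. 0"]) (use \<Phi>0[OF dpq(1,2,3)] in \<open>auto simp: V3_def\<close>)
    have "continuous_on (V1 \<union> V2 \<union> V3) (\<Phi> d p q)"
      using 1 2 3 o by (intro continuous_on_open_Un open_Un)
    moreover have "V1 \<union> V2 \<union> V3 = UNIV"
      unfolding V1_def V2_def V3_def using dpq(4) Wop(2) by blast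
    ultimately show ?thesis by simp
  qed
  have int: "integrable lborel (\<Phi> d p q)" if "d \<in> \<A>" "p \<in> I" "q \<in> I" "E p \<inter> E q \<subseteq> fst d" for d p q
    by (rule integrable_continuous_compact_support[OF \<Phi>c[OF that] \<Phi>cp[OF that]])
       (use \<Phi>0[OF that(1-3)] that(4) in auto)
  have cI: "c p \<in> \<A>" "E p \<subseteq> fst (c p)" if "p \<in> I" for p using that I(2) cA Esub by auto
  have inv: "integral\<^sup>L lborel (\<Phi> (c p) p q) = integral\<^sup>L lborel (\<Phi> (c q) p q)" if pq: "p \<in> I" "q \<in> I" for p q
  proof (rule integral_chart_invariant[OF cI(1)[OF pq(1)] cI(1)[OF pq(2)], of "E p \<inter> E q"])
    show "compactin X (E p \<inter> E q)" using pq I(2) Ecp by (intro compact_Int_closedin) auto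
    show "E p \<inter> E q \<subseteq> fst (c p) \<inter> fst (c q)" using cI pq by blast
    show "continuous_on UNIV (\<Phi> (c q) p q)" using cI pq by (intro \<Phi>c) auto
    show "\<Phi> (c q) p q w = 0" if "w \<notin> snd (c q) ` (E p \<inter> E q)" for w
      using that by (intro \<Phi>0 cI pq) auto
    show "\<Phi> (c p) p q z = 0" if "z \<notin> snd (c p) ` (fst (c p) \<inter> fst (c q))" for z
      using that cI[OF pq(1)] cI[OF pq(2)] by (intro \<Phi>0 cI pq) blast
    fix z assume z: "z \<in> snd (c p) ` (fst (c p) \<inter> fst (c q))"
    define T where "T = transition (c p) (c q)"
    define V where "V = snd (c p) ` (fst (c p) \<inter> fst (c q))"
    obtain x where x: "x \<in> fst (c p)" "x \<in> fst (c q)" "z = snd (c p) x" using z by blast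
    have Tz: "T z = snd (c q) x" "chart_inv (c p) z = x" "chart_inv (c q) (T z) = x"
      using x chart_inv_simps(3)[OF cI(1)] pq by (auto simp: T_def transition_def)
    have im: "z \<in> img (c p)" "T z \<in> img (c q)" using x Tz by auto
    show "\<Phi> (c p) p q z = of_real ((cmod (deriv (transition (c p) (c q)) z))\<^sup>2) * \<Phi> (c q) p q (transition (c p) (c q) z)"
    proof (cases "x \<in> S")
      case True
      then have "dbar (\<lambda>z. \<rho> p (chart_inv (c p) z)) z = 0" "dbar (\<lambda>z. \<rho> p (chart_inv (c q) z)) (T z) = 0"
        using Wop(2)[OF True] x Tz by (auto intro!: dW[OF True] cI pq)
      then show ?thesis unfolding T_def by (simp add: \<Phi>_def)
    next
      case False
      have oV: "open V" unfolding V_def using cI pq by (intro open_overlap) auto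
      have TV: "T holomorphic_on V" "T ` V \<subseteq> img (c q)"
        unfolding V_def T_def transition_def comp_def
        using transition_holomorphic[OF cI(1)[OF pq(1)] cI(1)[OF pq(2)]] chart_inv_simps(3)[OF cI(1)[OF pq(1)]] by auto
      have zV: "z \<in> V" using z V_def by simp
      have "dbar (\<lambda>z. \<rho> p (chart_inv (c p) z)) z = dbar (\<lambda>z. \<rho> p (chart_inv (c q) (T z))) z"
        by (rule dbar_cong_open[OF oV zV])
           (use chart_inv_simps(3)[OF cI(1)] pq in \<open>auto simp: V_def T_def transition_def\<close>)
      also have "\<dots> = dbar (\<lambda>z. \<rho> p (chart_inv (c q) z)) (T z) * cnj (deriv T z)"
        by (rule dbar_compose_holomorphic[OF \<rho>C1[OF pq(1) cI(1)[OF pq(2)]] TV(1) oV TV(2) zV])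
      finally have db: "dbar (\<lambda>z. \<rho> p (chart_inv (c p) z)) z = dbar (\<lambda>z. \<rho> p (chart_inv (c q) z)) (T z) * cnj (deriv T z)" .
      have om: "\<omega> (c p) z = \<omega> (c q) (T z) * deriv T z"
        unfolding T_def using x False by (intro trans cI pq) auto
      show ?thesis unfolding T_def[symmetric] 
        using im Tz by (simp add: \<Phi>_def db om complex_norm_square mult_ac del: of_real_power)
    qed
  qed
  define G where "G p z = (if z \<in> img (c p) then dbar (\<lambda>z. \<rho> p (chart_inv (c p) z)) z * \<omega> (c p) z else 0)" for p z
  have sumq: "(\<Sum>q\<in>I. \<Phi> (c p) p q z) = G p z" if "p \<in> I" for p z
  proof (cases "z \<in> img (c p)")
    case True
    then have "chart_inv (c p) z \<in> topspace X" using cI[OF that] chart_inv_simps(1) fst_subset by blast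
    then show ?thesis using True \<rho>sum by (simp add: \<Phi>_def G_def mult.assoc flip: sum_distrib_right)
  qed (simp add: \<Phi>_def G_def)
  have sump: "(\<Sum>p\<in>I. \<Phi> (c q) p q z) = 0" if "q \<in> I" for q z
  proof (cases "z \<in> img (c q)")
    case True
    have "(\<Sum>p\<in>I. dbar (\<lambda>z. \<rho> p (chart_inv (c q) z)) z) = dbar (\<lambda>z. \<Sum>p\<in>I. \<rho> p (chart_inv (c q) z)) z"
      by (rule dbar_sum[symmetric, OF \<rho>C1 True]) (use cI that in auto)
    also have "\<dots> = dbar (\<lambda>z. 1) z"
      by (rule dbar_cong_open[OF open_img[OF cI(1)[OF that]] True])
         (use \<rho>sum chart_inv_simps(1)[OF cI(1)[OF that]] fst_subset[OF cI(1)[OF that]] in blast)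
    finally have z: "(\<Sum>p\<in>I. dbar (\<lambda>z. \<rho> p (chart_inv (c q) z)) z) = 0" by simp
    have "(\<Sum>p\<in>I. \<Phi> (c q) p q z) = \<rho> q (chart_inv (c q) z) * (\<Sum>p\<in>I. dbar (\<lambda>z. \<rho> p (chart_inv (c q) z)) z) * \<omega> (c q) z"
      using True by (simp add: \<Phi>_def sum_distrib_left sum_distrib_right)
    then show ?thesis using z by simp
  qed (simp add: \<Phi>_def)
  \<comment> \<open>Insert the sum of the \<open>\<rho> q\<close> in the chart of \<open>p\<close>,
    carry every term over to the chart of \<open>q\<close>, and exchange the sums: now the members
    under \<open>dbar\<close> share one chart and add up to the constant 1.\<close>
  have "(\<Sum>p\<in>I. integral\<^sup>L lborel (G p)) = (\<Sum>p\<in>I. \<Sum>q\<in>I. integral\<^sup>L lborel (\<Phi> (c p) p q))"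
  proof (rule sum.cong[OF refl])
    fix p assume p: "p \<in> I"
    have "integral\<^sup>L lborel (G p) = integral\<^sup>L lborel (\<lambda>z. \<Sum>q\<in>I. \<Phi> (c p) p q z)" using sumq[OF p] by presburger
    also have "\<dots> = (\<Sum>q\<in>I. integral\<^sup>L lborel (\<Phi> (c p) p q))"
      by (rule Bochner_Integration.integral_sum) (use cI p in \<open>auto intro!: int\<close>)
    finally show "integral\<^sup>L lborel (G p) = (\<Sum>q\<in>I. integral\<^sup>L lborel (\<Phi> (c p) p q))" .
  qed
  also have "\<dots> = (\<Sum>q\<in>I. \<Sum>p\<in>I. integral\<^sup>L lborel (\<Phi> (c q) p q))"
    by (subst sum.swap) (simp add: inv)
  also have "\<dots> = (\<Sum>q\<in>I. 0)"
  proof (rule sum.cong[OF refl])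
    fix q assume q: "q \<in> I"
    have "(\<Sum>p\<in>I. integral\<^sup>L lborel (\<Phi> (c q) p q)) = integral\<^sup>L lborel (\<lambda>z. \<Sum>p\<in>I. \<Phi> (c q) p q z)"
      by (rule Bochner_Integration.integral_sum[symmetric]) (use cI q in \<open>auto intro!: int\<close>)
    then show "(\<Sum>p\<in>I. integral\<^sup>L lborel (\<Phi> (c q) p q)) = 0" using sump[OF q] by simp
  qed
  finally have G0: "(\<Sum>p\<in>I. integral\<^sup>L lborel (G p)) = 0" by simp
  have Gp: "integral\<^sup>L lborel (G p) = (if p \<in> S then pole_const * H p (a p) else 0)" if p: "p \<in> I" for p
  proof -
    have pX: "p \<in> topspace X" using p I(2) by blast
    define r where "r z = (if z \<in> img (c p) then \<rho> p (chart_inv (c p) z) else 0)" for z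
    have oi: "open (img (c p))" by (rule open_img[OF cI(1)[OF p]])
    have r0: "r z = 0" if "z \<notin> cball (a p) (R p)" for z
    proof (cases "z \<in> img (c p)")
      case True
      then have "chart_inv (c p) z \<notin> E p"
        using that chart_inv_image_eq[OF cA[OF pX] cb[OF pX]] chart_inv_simps(2)[OF cA[OF pX] True] by (auto simp: E_def)
      then show ?thesis using \<rho>0[OF p] by (simp add: r_def)
    qed (simp add: r_def)
    have r1: "C1_on (img (c p)) r"
      by (rule C1_on_cong_open[OF \<rho>C1[OF p cI(1)[OF p]] oi]) (simp add: r_def)
    have r2: "C1_on (- cball (a p) (R p)) r"
      by (rule C1_on_cong_open[OF C1_on_const[of _ 0]]) (use r0 in auto)
    have r: "C1_on UNIV r"
    proof (rule C1_on_Union)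
      show "\<exists>V. open V \<and> z \<in> V \<and> C1_on V r" for z
      proof (cases "z \<in> img (c p)")
        case True then show ?thesis using r1 oi by blast
      next
        case False
        then show ?thesis using r2 cb[OF pX] by (intro exI[of _ "- cball (a p) (R p)"]) auto
      qed
    qed
    have dr: "dbar r z = dbar (\<lambda>z. \<rho> p (chart_inv (c p) z)) z" if "z \<in> img (c p)" for z
      by (rule dbar_cong_open[OF oi that]) (simp add: r_def)
    have dS: "dbar r z = 0" if "z \<in> img (c p)" "chart_inv (c p) z \<in> S" for z
    proof -
      have "z \<in> snd (c p) ` (fst (c p) \<inter> W (chart_inv (c p) z))"
        using that chart_inv_simps[OF cI(1)[OF p]] Wop(2)[OF that(2)] by (metis IntI imageI)
      from dW[OF that(2) cI(1)[OF p] p this] show ?thesis using dr[OF that(1)] by simp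
    qed
    have drout: "dbar r z = 0" if "z \<notin> cball (a p) (R p)" for z
      by (rule dbar_eq_0_outside[OF compact_cball r0 that])
    show ?thesis
    proof (cases "p \<in> S")
      case False
      define B where "B = snd (c p) ` (fst (c p) - S)"
      have BK: "cball (a p) (R p) \<subseteq> B"
        using cR[OF pX] False unfolding a_def B_def by (simp add: Diff_insert_absorb)
      have "G p z = (if z \<in> B then dbar r z * \<omega> (c p) z else 0)" for z
      proof (cases "z \<in> B")
        case True
        then show ?thesis using dr by (auto simp: G_def B_def)
      next
        case nB: False
        show ?thesis
        proof (cases "z \<in> img (c p)")
          case True
          then have "chart_inv (c p) z \<in> S"
            using nB chart_inv_simps[OF cI(1)[OF p] ] unfolding B_def by (metis DiffI imageI)
          then show ?thesis using dS[OF True] dr[OF True] nB by (simp add: G_def)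
        qed (use nB in \<open>simp add: G_def\<close>)
      qed
      then have "integral\<^sup>L lborel (G p) = integral\<^sup>L lborel (\<lambda>z. if z \<in> B then dbar r z * \<omega> (c p) z else 0)"
        by presburger
      also have "\<dots> = 0"
        by (rule integral_dbar_holomorphic_eq_0[OF r compact_cball BK r0])
           (use hol cI p open_chart_image_Diff S in \<open>auto simp: B_def\<close>)
      finally show ?thesis using False by simp
    next
      case True
      have ap: "a p = snd (ch p) p" "c p = ch p" using chp[OF pX True] by (auto simp: a_def)
      define B where "B = ball (a p) (e p)"
      have BK: "cball (a p) (R p) \<subseteq> B" using chp[OF pX True] by (simp add: B_def)
      have cpa: "chart_inv (c p) (a p) = p" "a p \<in> img (c p)"
        using chart_inv_simps(3)[OF cA[OF pX] pc[OF pX]] pc[OF pX] by (auto simp: a_def)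
      have eq: "G p z = (if z \<in> B then dbar r z * (H p z / (z - a p)) else 0)" for z
      proof (cases "z \<in> cball (a p) (R p)")
        case z: True
        then have zi: "z \<in> img (c p)" "z \<in> B" using cb[OF pX] BK by auto
        show ?thesis
        proof (cases "z = a p")
          case True
          then show ?thesis using dS[of "a p"] cpa \<open>p \<in> S\<close> dr by (auto simp: G_def)
        next
          case False
          then have "\<omega> (c p) z = H p z / (z - a p)" using pole[OF True, of z] zi(2) ap B_def by auto
          then show ?thesis using zi dr[OF zi(1)] by (simp add: G_def)
        qed
      next
        case False
        then show ?thesis using drout[OF False] dr by (auto simp: G_def)
      qed
      have "open (snd (c p) ` (fst (c p) \<inter> W p))" by (rule open_chart_image[OF cA[OF pX] Wop(1)[OF True]])
      moreover have "a p \<in> snd (c p) ` (fst (c p) \<inter> W p)" using pc[OF pX] Wop(2)[OF True] by (auto simp: a_def)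
      ultimately obtain e' where e': "0 < e'" "ball (a p) e' \<subseteq> snd (c p) ` (fst (c p) \<inter> W p)"
        using open_contains_ball_eq by metis
      have e1: "r z = 1" if zB: "z \<in> ball (a p) e'" for z
      proof -
        obtain x where x: "x \<in> fst (c p)" "x \<in> W p" "z = snd (c p) x" using zB e'(2) by blast
        then show ?thesis using W\<rho>[OF True x(2) p] chart_inv_simps(3)[OF cA[OF pX] x(1)] by (auto simp: r_def)
      qed
      have HB: "H p holomorphic_on B" using H[OF True] ap B_def by simp
      have "integral\<^sup>L lborel (G p) = pole_const * H p (a p)"
        unfolding eq by (rule integral_dbar_pole[OF r compact_cball BK r0 HB _ e'(1) e1]) (simp_all add: B_def)
      then show ?thesis using True by simp
    qed
  qed
  have "0 = (\<Sum>p\<in>I. if p \<in> S then pole_const * H p (a p) else 0)" using G0 Gp by simp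
  also have "\<dots> = (\<Sum>p\<in>S. pole_const * H p (a p))"
    using I(1) SI by (simp add: sum.If_cases Int_absorb1)
  also have "\<dots> = pole_const * (\<Sum>p\<in>S. H p (snd (ch p) p))"
    using chp S(2) by (simp add: sum_distrib_left a_def subset_iff)
  finally show ?thesis using pole_const_nonzero by simp
qed

end

section \<open>Finer filters and bounded families of holomorphic functions\<close>

lemma inf_filtercomap_not_bot:
  assumes "inf (nhds x) (filtermap f F) \<noteq> bot"
  shows "inf F (filtercomap f (nhds x)) \<noteq> bot"
proof
  assume "inf F (filtercomap f (nhds x)) = bot"
  then have "eventually (\<lambda>_. False) (inf F (filtercomap f (nhds x)))" by simp
  then obtain P Q where PQ: "eventually P F" "eventually Q (filtercomap f (nhds x))" "\<And>i. P i \<and> Q i \<Longrightarrow> False"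
    unfolding eventually_inf by blast
  then obtain R where R: "eventually R (nhds x)" "\<And>i. R (f i) \<Longrightarrow> Q i" unfolding eventually_filtercomap by blast
  have "eventually (\<lambda>y. \<not> R y) (filtermap f F)"
    unfolding eventually_filtermap using PQ(1) by (rule eventually_mono) (use PQ(3) R(2) in blast)
  then have "eventually (\<lambda>y. False) (inf (nhds x) (filtermap f F))"
    unfolding eventually_inf using R(1) by blast
  then show False using assms by (simp add: trivial_limit_def)
qed

text \<open>Tychonoff's theorem, phrased as the passage to a finer filter.\<close>

lemma pointwise_cluster_filter:
  fixes f :: "'i \<Rightarrow> 'p \<Rightarrow> complex"
  assumes F: "F \<noteq> bot" and bd: "\<And>p. p \<in> V \<Longrightarrow> \<exists>M. \<forall>\<^sub>F i in F. norm (f i p) \<le> M"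
  shows "\<exists>F' g. F' \<le> F \<and> F' \<noteq> bot \<and> (\<forall>p\<in>V. ((\<lambda>i. f i p) \<longlongrightarrow> g p) F')"
proof -
  obtain M where M: "\<And>p. p \<in> V \<Longrightarrow> \<forall>\<^sub>F i in F. norm (f i p) \<le> M p" using bd by metis
  \<comment> \<open>Values beyond the bound are replaced by 0, so that every \<open>h i\<close> lies
    in the compact product; at each single point of \<open>V\<close> this eventually changes
    nothing.\<close>
  define h where "h i p = (if p \<in> V \<and> norm (f i p) \<le> M p then f i p else 0)" for i p
  define C where "C = (PiE UNIV (\<lambda>p. cball (0::complex) \<bar>M p\<bar>))"
  have "compactin (product_topology (\<lambda>_. euclidean) UNIV) C"
    unfolding C_def by (subst compactin_PiE) auto
  then have "compact C"
    by (simp add: euclidean_product_topology)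
  moreover have "filtermap h F \<noteq> bot" using F by (simp add: filtermap_bot_iff)
  moreover have "\<forall>\<^sub>F x in filtermap h F. x \<in> C"
    unfolding eventually_filtermap C_def by (rule always_eventually) (auto simp: h_def PiE_def)
  ultimately obtain g where g: "inf (nhds g) (filtermap h F) \<noteq> bot" unfolding compact_filter by blast
  \<comment> \<open>A cluster point \<open>g\<close> of the maps \<open>h i\<close> is turned into a
    proper filter on the indices along which \<open>h\<close> converges to \<open>g\<close>.\<close>
  define F' where "F' = inf F (filtercomap h (nhds g))"
  have lim: "filterlim h (nhds g) F'" 
    unfolding F'_def by (rule filterlim_mono[OF filterlim_filtercomap order_refl]) simp
  have "((\<lambda>i. f i p) \<longlongrightarrow> g p) F'" if p: "p \<in> V" for p
  proof -
    have "((\<lambda>i. h i p) \<longlongrightarrow> g p) F'"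
      by (rule continuous_on_tendsto_compose[OF continuous_on_product_coordinates lim]) auto
    moreover have "\<forall>\<^sub>F i in F'. h i p = f i p"
    proof -
      have "\<forall>\<^sub>F i in F. h i p = f i p" using M[OF p] by (rule eventually_mono) (simp add: h_def p)
      then show ?thesis unfolding F'_def by (rule filter_leD[OF inf_le1])
    qed
    ultimately show ?thesis by (rule Lim_transform_eventually)
  qed
  then show ?thesis using inf_filtercomap_not_bot[OF g] unfolding F'_def by (intro exI[of _ F'] exI[of _ g]) (auto simp: F'_def)
qed

text \<open>Cauchy's inequality turns the common bound into a common Lipschitz constant, and then
  pointwise convergence on a finite net is uniform convergence. The radius r / 3 leaves room for
  Cauchy circles of radius r / 2 inside the ball.\<close>

lemma bounded_holomorphic_uniform_limit:
  fixes f :: "'i \<Rightarrow> complex \<Rightarrow> complex"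
  assumes F: "F \<noteq> bot" and r: "0 < r"
    and hol: "\<forall>\<^sub>F i in F. f i holomorphic_on ball a r \<and> (\<forall>z\<in>ball a r. norm (f i z) \<le> M)"
    and lim: "\<And>z. z \<in> ball a r \<Longrightarrow> ((\<lambda>i. f i z) \<longlongrightarrow> g z) F"
  shows "uniform_limit (cball a (r / 3)) f g F" "g holomorphic_on ball a (r / 3)"
proof -
  define L where "L = \<bar>M\<bar> / (r / 2) + 1"
  have Lpos: "0 < L" using r by (auto simp: L_def intro!: add_nonneg_pos divide_nonneg_pos)
  have sub: "cball z (r/2) \<subseteq> ball a r" if "z \<in> cball a (r/3)" for z
    using that r by (auto simp: subset_iff) (smt (verit) dist_triangle field_sum_of_halves)
  have lip: "norm (h z - h w) \<le> L * norm (z - w)"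
    if h: "h holomorphic_on ball a r" "\<And>z. z \<in> ball a r \<Longrightarrow> norm (h z) \<le> M" and zw: "z \<in> cball a (r/3)" "w \<in> cball a (r/3)" for h z w
  proof (rule field_differentiable_bound[where S = "cball a (r/3)" and f = h and f' = "deriv h"])
    show "convex (cball a (r/3))" by simp
    fix x assume x: "x \<in> cball a (r/3)"
    then have xb: "x \<in> ball a r" using r by (auto)
    show "(h has_field_derivative deriv h x) (at x within cball a (r/3))"
      using holomorphic_derivI[OF h(1) open_ball xb] has_field_derivative_at_within by blast
    have "norm ((deriv ^^ 1) h x) \<le> fact 1 * \<bar>M\<bar> / (r/2) ^ 1"
    proof (rule Cauchy_inequality)
      show "h holomorphic_on ball x (r/2)" using sub[OF x] ball_subset_cball holomorphic_on_subset[OF h(1)] by blast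
      show "continuous_on (cball x (r/2)) h"
        using sub[OF x] holomorphic_on_imp_continuous_on[OF h(1)] continuous_on_subset by blast
      show "norm (h y) \<le> \<bar>M\<bar>" if "norm (x - y) = r/2" for y
        using h(2)[of y] sub[OF x] that by (auto simp: dist_norm subset_iff)
    qed (use r in auto)
    then show "norm (deriv h x) \<le> L" by (simp add: L_def)
  qed (use zw in auto)
  have glip: "norm (g z - g w) \<le> L * norm (z - w)" if zw: "z \<in> cball a (r/3)" "w \<in> cball a (r/3)" for z w
  proof -
    have "((\<lambda>i. norm (f i z - f i w)) \<longlongrightarrow> norm (g z - g w)) F"
      using zw r by (intro tendsto_intros lim) auto
    then show ?thesis
      by (rule tendsto_upperbound[OF _ _ F]) (use hol lip zw in \<open>auto elim!: eventually_mono\<close>)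
  qed
  show ul: "uniform_limit (cball a (r / 3)) f g F"
    unfolding uniform_limit_iff
  proof (intro allI impI)
    fix \<epsilon> :: real assume e: "0 < \<epsilon>"
    \<comment> \<open>With this mesh, moving to a nearby net point costs less than a quarter of
      \<open>\<epsilon>\<close> for \<open>f i\<close> and for \<open>g\<close>, and the comparison
      on the net costs another quarter.\<close>
    define \<delta> where "\<delta> = \<epsilon> / (4 * L)"
    have d: "0 < \<delta>" using e Lpos by (simp add: \<delta>_def)
    have "\<exists>T. finite T \<and> T \<subseteq> cball a (r/3) \<and> cball a (r/3) \<subseteq> (\<Union>t\<in>T. ball t \<delta>)"
    proof -
      have "cball a (r/3) \<subseteq> (\<Union>t\<in>cball a (r/3). ball t \<delta>)" using d by auto
      then show ?thesis
        using compactE_image[OF compact_cball, of "cball a (r/3)" "\<lambda>t. ball t \<delta>" a "r/3"] by (metis open_ball)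
    qed
    then obtain T where T: "finite T" "T \<subseteq> cball a (r/3)" "cball a (r/3) \<subseteq> (\<Union>t\<in>T. ball t \<delta>)" by blast
    have "\<forall>\<^sub>F i in F. \<forall>t\<in>T. dist (f i t) (g t) < \<epsilon> / 4"
      using T(1)
    proof (rule eventually_ball_finite, intro ballI)
      fix t assume "t \<in> T"
      then have "t \<in> ball a r" using T(2) r by auto
      from tendstoD[OF lim[OF this], of "\<epsilon>/4"] show "\<forall>\<^sub>F i in F. dist (f i t) (g t) < \<epsilon> / 4" using e by simp
    qed
    then show "\<forall>\<^sub>F i in F. \<forall>z\<in>cball a (r / 3). dist (f i z) (g z) < \<epsilon>"
      using hol
    proof eventually_elim
      fix i assume 1: "\<forall>t\<in>T. dist (f i t) (g t) < \<epsilon> / 4"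
        and 2: "f i holomorphic_on ball a r \<and> (\<forall>z\<in>ball a r. norm (f i z) \<le> M)"
      show "\<forall>z\<in>cball a (r / 3). dist (f i z) (g z) < \<epsilon>"
      proof
        fix z assume z: "z \<in> cball a (r/3)"
        then obtain t where t: "t \<in> T" "dist t z < \<delta>" using T(3) by auto
        have tc: "t \<in> cball a (r/3)" using t T(2) by blast
        have nd: "norm (z - t) < \<delta>" using t by (simp add: dist_norm norm_minus_commute)
        have Ld: "L * norm (z - t) < \<epsilon> / 4"
          using mult_strict_left_mono[OF nd Lpos] Lpos by (simp add: \<delta>_def)
        have "norm (f i z - f i t) \<le> L * norm (z - t)" using lip[of "f i"] 2 z tc by blast
        moreover have "norm (g z - g t) \<le> L * norm (z - t)" using glip z tc by blast
        moreover have "norm (f i t - g t) < \<epsilon> / 4" using 1 t(1) by (simp add: dist_norm)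
        moreover have "f i z - g z = (f i z - f i t) + (f i t - g t) - (g z - g t)" by simp
        then have "norm (f i z - g z) \<le> norm (f i z - f i t) + norm (f i t - g t) + norm (g z - g t)"
          by (metis (no_types, lifting) norm_triangle_ineq norm_triangle_ineq4 order_trans add_right_mono)
        ultimately show "dist (f i z) (g z) < \<epsilon>" using Ld e by (simp add: dist_norm)
      qed
    qed
  qed
  have ev: "\<forall>\<^sub>F i in F. continuous_on (cball a (r/3)) (f i) \<and> f i holomorphic_on ball a (r/3)"
    using hol
  proof eventually_elim
    case (elim i)
    have "cball a (r/3) \<subseteq> ball a r" "ball a (r/3) \<subseteq> ball a r" using r by auto
    then show ?case using elim holomorphic_on_imp_continuous_on holomorphic_on_subset continuous_on_subset by metis
  qed
  show "g holomorphic_on ball a (r / 3)" using holomorphic_uniform_limit[OF ev ul F] by metis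
qed

lemma maximum_modulus_cball:
  assumes "continuous_on (cball a r) g" "g holomorphic_on ball a r" "0 < r"
    and "\<And>z. z \<in> sphere a r \<Longrightarrow> norm (g z) \<le> B" "z \<in> cball a r"
  shows "norm (g z) \<le> B"
proof (rule maximum_modulus_frontier[of g "cball a r"])
  show "g holomorphic_on interior (cball a r)" using assms by simp
  show "continuous_on (closure (cball a r)) g" using assms by simp
  show "\<And>z. z \<in> frontier (cball a r) \<Longrightarrow> norm (g z) \<le> B" using assms(4) by simp
qed (use assms in auto)

text \<open>The maximum principle is applied to differences of two members, not to the limit, whose
  holomorphy is still unknown: closeness on the sphere makes the family uniformly Cauchy on the
  disc, and the pointwise limit is then taken in the second index.\<close>

lemma uniform_limit_cball_of_sphere:
  fixes f :: "'i \<Rightarrow> complex \<Rightarrow> complex"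
  assumes F: "F \<noteq> bot" and r: "0 < r"
    and hol: "\<forall>\<^sub>F i in F. continuous_on (cball a r) (f i) \<and> f i holomorphic_on ball a r"
    and ul: "uniform_limit (sphere a r) f g F"
    and lim: "\<And>z. z \<in> cball a r \<Longrightarrow> ((\<lambda>i. f i z) \<longlongrightarrow> g z) F"
  shows "uniform_limit (cball a r) f g F" "continuous_on (cball a r) g" "g holomorphic_on ball a r"
proof -
  show u: "uniform_limit (cball a r) f g F"
    unfolding uniform_limit_iff
  proof (intro allI impI)
    fix \<epsilon> :: real assume e: "0 < \<epsilon>"
    have ev: "\<forall>\<^sub>F i in F. (\<forall>z\<in>sphere a r. dist (f i z) (g z) < \<epsilon> / 4) \<and> continuous_on (cball a r) (f i) \<and> f i holomorphic_on ball a r"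
      by (rule eventually_conj[OF uniform_limitD[OF ul] hol]) (use e in simp)
    then show "\<forall>\<^sub>F i in F. \<forall>z\<in>cball a r. dist (f i z) (g z) < \<epsilon>"
    proof (rule eventually_mono, intro ballI)
      fix i z assume i: "(\<forall>z\<in>sphere a r. dist (f i z) (g z) < \<epsilon> / 4) \<and> continuous_on (cball a r) (f i) \<and> f i holomorphic_on ball a r"
        and z: "z \<in> cball a r"
      have "\<forall>\<^sub>F j in F. dist (f i z) (f j z) \<le> \<epsilon> / 2"
        using ev
      proof (rule eventually_mono)
        fix j assume j: "(\<forall>z\<in>sphere a r. dist (f j z) (g z) < \<epsilon> / 4) \<and> continuous_on (cball a r) (f j) \<and> f j holomorphic_on ball a r"
        have "norm (f i z - f j z) \<le> \<epsilon> / 2"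
        proof (rule maximum_modulus_cball[where r = r and a = a and g = "\<lambda>z. f i z - f j z"])
          fix w assume w: "w \<in> sphere a r"
          have "dist (f i w) (f j w) \<le> dist (f i w) (g w) + dist (f j w) (g w)" by (rule dist_triangle2)
          moreover have "dist (f i w) (g w) < \<epsilon> / 4" "dist (f j w) (g w) < \<epsilon> / 4" using i j w by auto
          ultimately show "norm (f i w - f j w) \<le> \<epsilon> / 2" by (simp add: dist_norm)
        qed (use i j r z in \<open>auto intro!: continuous_intros holomorphic_intros\<close>)
        then show "dist (f i z) (f j z) \<le> \<epsilon> / 2" by (simp add: dist_norm)
      qed
      moreover have "((\<lambda>j. dist (f i z) (f j z)) \<longlongrightarrow> dist (f i z) (g z)) F"
        by (intro tendsto_intros lim z)
      ultimately have "dist (f i z) (g z) \<le> \<epsilon> / 2" using tendsto_upperbound F by blast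
      then show "dist (f i z) (g z) < \<epsilon>" using e by simp
    qed
  qed
  show "continuous_on (cball a r) g" "g holomorphic_on ball a r"
    using holomorphic_uniform_limit[OF hol u F] by metis+
qed

text \<open>The filter form of the subsequence principle: if \<open>P\<close> failed frequently, the
  filter restricted to the failures would be proper, and \<open>P\<close> could not hold eventually
  along any proper filter below it.\<close>

lemma tendsto_by_subfilters:
  assumes "\<And>F'. F' \<le> F \<Longrightarrow> F' \<noteq> bot \<Longrightarrow> \<exists>F''\<le>F'. F'' \<noteq> bot \<and> eventually P F''"
  shows "eventually P F"
proof (rule ccontr)
  assume n: "\<not> eventually P F"
  define F' where "F' = inf F (principal {i. \<not> P i})"
  have "F' \<noteq> bot" unfolding F'_def
    using n by (auto simp: trivial_limit_def eventually_inf_principal)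
  then obtain F'' where F'': "F'' \<le> F'" "F'' \<noteq> bot" "eventually P F''" using assms[of F'] by (auto simp: F'_def)
  have "eventually (\<lambda>i. \<not> P i) F'" by (simp add: F'_def eventually_inf_principal)
  then have "eventually (\<lambda>i. \<not> P i) F''" using F''(1) filter_leD by blast
  then have "eventually (\<lambda>i. False) F''" using F''(3) by eventually_elim simp
  then show False using F''(2) by (simp add: trivial_limit_def)
qed

section \<open>Functions with prescribed singular parts\<close>

locale punctured_surface = compact_surface X \<A> for X :: "'a topology" and \<A> +
  fixes SP :: "'a set" and ch :: "'a \<Rightarrow> 'a chart" and e :: "'a \<Rightarrow> real"
  assumes SP: "finite SP" "SP \<subseteq> topspace X"
    and ch: "s \<in> SP \<Longrightarrow> ch s \<in> \<A>" "s \<in> SP \<Longrightarrow> s \<in> fst (ch s)"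
    and e: "s \<in> SP \<Longrightarrow> 0 < e s" "s \<in> SP \<Longrightarrow> cball (snd (ch s) s) (e s) \<subseteq> img (ch s)"
    and disj: "s \<in> SP \<Longrightarrow> t \<in> SP \<Longrightarrow> s \<noteq> t \<Longrightarrow>
      chart_inv (ch s) ` cball (snd (ch s) s) (e s) \<inter> chart_inv (ch t) ` cball (snd (ch t) t) (e t) = {}"
begin

abbreviation ctr :: "'a \<Rightarrow> complex" where "ctr s \<equiv> snd (ch s) s"
definition disc :: "'a \<Rightarrow> 'a set" where "disc s = chart_inv (ch s) ` cball (ctr s) (e s)"
definition odisc :: "'a \<Rightarrow> 'a set" where "odisc s = chart_inv (ch s) ` ball (ctr s) (e s)"
definition core :: "'a set" where "core = topspace X - (\<Union>s\<in>SP. odisc s)"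

definition holo :: "('a \<Rightarrow> complex) \<Rightarrow> bool" where
  "holo \<phi> \<longleftrightarrow> (\<forall>c\<in>\<A>. (\<lambda>z. \<phi> (chart_inv c z)) holomorphic_on snd c ` (fst c - SP))"

definition ext :: "'a \<Rightarrow> (complex \<Rightarrow> complex) \<Rightarrow> bool" where
  "ext s g \<longleftrightarrow> continuous_on (cball (ctr s) (e s)) g \<and> g holomorphic_on ball (ctr s) (e s)"

text \<open>\<open>m s\<close> removes the singularity at \<open>s\<close> (later an exponential or
  a linear factor), \<open>T s\<close> is the prescribed singular part and \<open>G s\<close> the
  remainder that extends over the centre. For fixed \<open>m\<close> the problem is linear in
  \<open>T\<close>, \<open>G\<close> and \<open>\<phi>\<close>; the values of \<open>\<phi>\<close>
  on \<open>SP\<close> are left free.\<close>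

definition germs :: "('a \<Rightarrow> complex \<Rightarrow> complex) \<Rightarrow> ('a \<Rightarrow> complex \<Rightarrow> complex) \<Rightarrow> ('a \<Rightarrow> complex \<Rightarrow> complex) \<Rightarrow> ('a \<Rightarrow> complex) \<Rightarrow> bool" where
  "germs m T G \<phi> \<longleftrightarrow> holo \<phi> \<and> (\<forall>s\<in>SP. ext s (G s) \<and>
     (\<forall>z\<in>cball (ctr s) (e s) - {ctr s}. m s z * \<phi> (chart_inv (ch s) z) = T s z + G s z))"

text \<open>Multipliers and singular parts may blow up at the centres, so convergence is asked only
  on compact subsets of the punctured closed discs. These include the bounding circles, where the
  maximum principle needs it.\<close>

definition conv :: "('i \<Rightarrow> 'a \<Rightarrow> complex \<Rightarrow> complex) \<Rightarrow> ('a \<Rightarrow> complex \<Rightarrow> complex) \<Rightarrow> 'i filter \<Rightarrow> bool" where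
  "conv m m0 F \<longleftrightarrow> (\<forall>s\<in>SP. continuous_on (cball (ctr s) (e s) - {ctr s}) (m0 s) \<and>
     (\<forall>C. compact C \<and> C \<subseteq> cball (ctr s) (e s) - {ctr s} \<longrightarrow> uniform_limit C (\<lambda>i. m i s) (m0 s) F))"

lemma conv_mono: "conv m m0 F \<Longrightarrow> F' \<le> F \<Longrightarrow> conv m m0 F'"
  unfolding conv_def using filterlim_mono by blast

lemma disc_eq: "s \<in> SP \<Longrightarrow> disc s = {p \<in> fst (ch s). snd (ch s) p \<in> cball (ctr s) (e s)}"
  and odisc_eq: "s \<in> SP \<Longrightarrow> odisc s = {p \<in> fst (ch s). snd (ch s) p \<in> ball (ctr s) (e s)}"
proof -
  assume s: "s \<in> SP"
  show "disc s = {p \<in> fst (ch s). snd (ch s) p \<in> cball (ctr s) (e s)}"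
    unfolding disc_def by (rule chart_inv_image_eq[OF ch(1)[OF s] e(2)[OF s]])
  have "ball (ctr s) (e s) \<subseteq> img (ch s)" using e(2)[OF s] ball_subset_cball by blast
  then show "odisc s = {p \<in> fst (ch s). snd (ch s) p \<in> ball (ctr s) (e s)}"
    unfolding odisc_def by (rule chart_inv_image_eq[OF ch(1)[OF s]])
qed

lemma openin_odisc: "s \<in> SP \<Longrightarrow> openin X (odisc s)"
  unfolding odisc_def by (rule openin_chart_inv_image) (use ch e ball_subset_cball in blast)+

lemma closedin_disc: "s \<in> SP \<Longrightarrow> closedin X (disc s)"
  unfolding disc_def by (rule compactin_chart_inv_image) (use ch e in auto)

lemma self_odisc: "s \<in> SP \<Longrightarrow> s \<in> odisc s"
  using ch e by (simp add: odisc_eq)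

lemma odisc_disc: "odisc s \<subseteq> disc s"
  unfolding odisc_def disc_def using ball_subset_cball by blast

lemma disc_disjoint: "s \<in> SP \<Longrightarrow> t \<in> SP \<Longrightarrow> p \<in> disc s \<Longrightarrow> p \<in> disc t \<Longrightarrow> s = t"
  using disj[of s t] unfolding disc_def by blast

lemma compactin_core: "compactin X core"
proof -
  have "closedin X core" unfolding core_def
    using SP(1) openin_odisc by (intro closedin_diff) (auto intro: openin_Union)
  then show ?thesis using cpt closedin_compact_space by blast
qed

lemma core_subset: "core \<subseteq> topspace X - SP"
  unfolding core_def using self_odisc by blast

text \<open>The reason why a bound on the core controls the remainders on whole discs. Disjointness
  of the closed discs keeps the bounding circle out of all other open discs.\<close>

lemma sphere_core: "s \<in> SP \<Longrightarrow> z \<in> sphere (ctr s) (e s) \<Longrightarrow> chart_inv (ch s) z \<in> core"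
proof -
  assume s: "s \<in> SP" and z: "z \<in> sphere (ctr s) (e s)"
  have zi: "z \<in> img (ch s)" using e(2)[OF s] z by auto
  have "chart_inv (ch s) z \<in> disc s" unfolding disc_def using z by auto
  moreover have "chart_inv (ch s) z \<notin> odisc s"
    unfolding odisc_eq[OF s] using chart_inv_simps(2)[OF ch(1)[OF s] zi] z by auto
  moreover have "chart_inv (ch s) z \<in> topspace X" using chart_inv_simps(1)[OF ch(1)[OF s] zi] fst_subset[OF ch(1)[OF s]] by blast
  ultimately show ?thesis unfolding core_def using disc_disjoint[OF s] odisc_disc by blast
qed

lemma punctured_disc_img:
  assumes s: "s \<in> SP" and z: "z \<in> cball (ctr s) (e s) - {ctr s}"
  shows "z \<in> snd (ch s) ` (fst (ch s) - SP)" "chart_inv (ch s) z \<in> topspace X - SP"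
proof -
  have zi: "z \<in> img (ch s)" using e(2)[OF s] z by auto
  have "chart_inv (ch s) z \<in> disc s" unfolding disc_def using z by auto
  then have "chart_inv (ch s) z \<notin> SP - {s}"
    using disc_disjoint[OF s, of "chart_inv (ch s) z" "chart_inv (ch s) z"] odisc_disc[THEN subsetD, OF self_odisc] by auto
  moreover have "chart_inv (ch s) z \<noteq> s" using chart_inv_simps(2)[OF ch(1)[OF s] zi] z by auto
  ultimately have n: "chart_inv (ch s) z \<in> fst (ch s) - SP" using chart_inv_simps(1)[OF ch(1)[OF s] zi] by blast
  then show "z \<in> snd (ch s) ` (fst (ch s) - SP)" using chart_inv_simps(2)[OF ch(1)[OF s] zi] by (metis imageI)
  show "chart_inv (ch s) z \<in> topspace X - SP" using n fst_subset[OF ch(1)[OF s]] by blast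
qed

lemma core_finite_cover:
  assumes "\<And>p. p \<in> core \<Longrightarrow> c p \<in> \<A> \<and> p \<in> fst (c p) \<and> 0 < r p \<and> ball (snd (c p) p) (r p) \<subseteq> img (c p)"
  obtains T where "finite T" "T \<subseteq> core" "\<And>q. q \<in> core \<Longrightarrow> \<exists>p\<in>T. q \<in> fst (c p) \<and> snd (c p) q \<in> ball (snd (c p) p) (r p)"
proof -
  define N where "N p = chart_inv (c p) ` ball (snd (c p) p) (r p)" for p
  have N: "N p = {q \<in> fst (c p). snd (c p) q \<in> ball (snd (c p) p) (r p)}" if "p \<in> core" for p
    unfolding N_def using assms[OF that] by (intro chart_inv_image_eq) auto
  have op: "openin X U" if "U \<in> N ` core" for U
    using that assms unfolding N_def by (auto intro!: openin_chart_inv_image)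
  have "core \<subseteq> \<Union> (N ` core)" using N assms by force
  from compactinD[OF compactin_core op this]
  obtain \<F> where F: "finite \<F>" "\<F> \<subseteq> N ` core" "core \<subseteq> \<Union> \<F>" by auto
  obtain T where T: "T \<subseteq> core" "finite T" "\<F> = N ` T" using finite_subset_image[OF F(1,2)] by blast
  show thesis
  proof (rule that[OF T(2,1)])
    fix q assume "q \<in> core"
    then obtain p where "p \<in> T" "q \<in> N p" using F(3) T(3) by blast
    then show "\<exists>p\<in>T. q \<in> fst (c p) \<and> snd (c p) q \<in> ball (snd (c p) p) (r p)" using N T(1) by blast
  qed
qed

lemma open_regular_img: "c \<in> \<A> \<Longrightarrow> open (snd c ` (fst c - SP))"
  by (rule open_chart_image_Diff[OF _ SP(1)])

text \<open>Finiteness of the supremum norm over the core, by which \<open>germs_convergence\<close>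
  rescales.\<close>

lemma holo_bounded_core:
  assumes "holo \<phi>" obtains B where "\<And>q. q \<in> core \<Longrightarrow> norm (\<phi> q) \<le> B"
proof -
  have "\<exists>c r B. c \<in> \<A> \<and> p \<in> fst c \<and> 0 < r \<and> ball (snd c p) r \<subseteq> img c \<and> (\<forall>q\<in>fst c. snd c q \<in> ball (snd c p) r \<longrightarrow> norm (\<phi> q) \<le> B)"
    if p: "p \<in> core" for p
  proof -
    obtain c where c: "c \<in> \<A>" "p \<in> fst c" using chart_exists p core_subset by blast
    have "snd c p \<in> snd c ` (fst c - SP)" using c p core_subset by blast
    then obtain r where r: "0 < r" "cball (snd c p) r \<subseteq> snd c ` (fst c - SP)"
      using open_regular_img[OF c(1)] open_contains_cball_eq by metis
    have "continuous_on (cball (snd c p) r) (\<lambda>z. \<phi> (chart_inv c z))"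
      using assms c(1) r(2) holomorphic_on_imp_continuous_on continuous_on_subset unfolding holo_def by blast
    then have "bounded ((\<lambda>z. \<phi> (chart_inv c z)) ` cball (snd c p) r)"
      by (intro compact_imp_bounded compact_continuous_image) auto
    then obtain B where B: "\<forall>x\<in>(\<lambda>z. \<phi> (chart_inv c z)) ` cball (snd c p) r. norm x \<le> B" unfolding bounded_iff by blast
    have "norm (\<phi> q) \<le> B" if "q \<in> fst c" "snd c q \<in> ball (snd c p) r" for q
    proof -
      have "snd c q \<in> cball (snd c p) r" using that by auto
      then have "norm (\<phi> (chart_inv c (snd c q))) \<le> B" using B by blast
      then show ?thesis using chart_inv_simps(3)[OF c(1) that(1)] by simp
    qed
    moreover have "ball (snd c p) r \<subseteq> img c" using r(2) ball_subset_cball by blast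
    ultimately show ?thesis using c r(1) by blast
  qed
  then obtain c r B where cr: "\<And>p. p \<in> core \<Longrightarrow> c p \<in> \<A> \<and> p \<in> fst (c p) \<and> 0 < r p \<and> ball (snd (c p) p) (r p) \<subseteq> img (c p) \<and>
      (\<forall>q\<in>fst (c p). snd (c p) q \<in> ball (snd (c p) p) (r p) \<longrightarrow> norm (\<phi> q) \<le> B p)"
    by metis
  have cr': "c p \<in> \<A> \<and> p \<in> fst (c p) \<and> 0 < r p \<and> ball (snd (c p) p) (r p) \<subseteq> img (c p)" if "p \<in> core" for p
    using cr[OF that] by blast
  obtain T where T: "finite T" "T \<subseteq> core" "\<And>q. q \<in> core \<Longrightarrow> \<exists>p\<in>T. q \<in> fst (c p) \<and> snd (c p) q \<in> ball (snd (c p) p) (r p)"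
    by (rule core_finite_cover[OF cr']) auto
  show thesis
  proof (rule that)
    fix q assume "q \<in> core"
    then obtain p where p: "p \<in> T" "q \<in> fst (c p)" "snd (c p) q \<in> ball (snd (c p) p) (r p)" using T(3) by blast
    then have "norm (\<phi> q) \<le> B p" using cr T(2) by blast
    also have "B p \<le> (\<Sum>p\<in>T. \<bar>B p\<bar>)" using T(1) p(1) by (meson abs_ge_self abs_ge_zero member_le_sum order_trans)
    finally show "norm (\<phi> q) \<le> (\<Sum>p\<in>T. \<bar>B p\<bar>)" .
  qed
qed

lemma holo_localI:
  assumes "\<And>p. p \<in> topspace X - SP \<Longrightarrow> \<exists>c\<in>\<A>. \<exists>r>0. p \<in> fst c \<and> ball (snd c p) r \<subseteq> img c \<and>
     (\<lambda>z. \<phi> (chart_inv c z)) holomorphic_on ball (snd c p) r"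
  shows "holo \<phi>"
  unfolding holo_def
proof
  fix d assume d: "d \<in> \<A>"
  show "(\<lambda>z. \<phi> (chart_inv d z)) holomorphic_on snd d ` (fst d - SP)"
  proof (rule analytic_imp_holomorphic, unfold analytic_on_def, rule ballI)
    fix w assume "w \<in> snd d ` (fst d - SP)"
    then obtain p where p: "p \<in> fst d - SP" "w = snd d p" by blast
    then obtain c r where c: "c \<in> \<A>" "0 < r" "p \<in> fst c" "ball (snd c p) r \<subseteq> img c"
        "(\<lambda>z. \<phi> (chart_inv c z)) holomorphic_on ball (snd c p) r"
      using assms[of p] fst_subset[OF d] by blast
    define N where "N = chart_inv c ` ball (snd c p) r"
    have N: "openin X N" "N = {q \<in> fst c. snd c q \<in> ball (snd c p) r}"
      unfolding N_def by (rule openin_chart_inv_image[OF c(1) open_ball c(4)], rule chart_inv_image_eq[OF c(1,4)])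
    define V where "V = snd d ` (fst d \<inter> N)"
    have V: "open V" "w \<in> V" unfolding V_def using open_chart_image[OF d N(1)] p N(2) c by auto
    have Vs: "V \<subseteq> snd d ` (fst d \<inter> fst c)" using N(2) V_def by auto
    have "(\<lambda>z. \<phi> (chart_inv c (snd c (chart_inv d z)))) holomorphic_on V"
    proof -
      have "(\<lambda>z. snd c (chart_inv d z)) ` V \<subseteq> ball (snd c p) r"
        using chart_inv_simps(3)[OF d] N(2) unfolding V_def by auto
      from holomorphic_on_compose_gen[OF holomorphic_on_subset[OF transition_holomorphic[OF d c(1)] Vs] c(5) this]
      show ?thesis by (simp add: comp_def)
    qed
    then have "(\<lambda>z. \<phi> (chart_inv d z)) holomorphic_on V"
      by (rule holomorphic_transform) (use chart_inv_simps(3)[OF d] chart_inv_simps(3)[OF c(1)] Vs in auto)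
    moreover obtain \<epsilon> where "0 < \<epsilon>" "ball w \<epsilon> \<subseteq> V" using V open_contains_ball_eq by metis
    ultimately show "\<exists>\<epsilon>>0. (\<lambda>z. \<phi> (chart_inv d z)) holomorphic_on ball w \<epsilon>"
      using holomorphic_on_subset by blast
  qed
qed

lemma germsD:
  assumes "germs m T G \<phi>"
  shows "holo \<phi>" "s \<in> SP \<Longrightarrow> ext s (G s)"
    "s \<in> SP \<Longrightarrow> z \<in> cball (ctr s) (e s) \<Longrightarrow> z \<noteq> ctr s \<Longrightarrow> m s z * \<phi> (chart_inv (ch s) z) = T s z + G s z"
  using assms unfolding germs_def by auto

lemma conv_point:
  assumes "conv m m0 F" "s \<in> SP" "z \<in> cball (ctr s) (e s) - {ctr s}"
  shows "((\<lambda>i. m i s z) \<longlongrightarrow> m0 s z) F"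
proof -
  have "compact {z}" "{z} \<subseteq> cball (ctr s) (e s) - {ctr s}" using assms(3) by auto
  then have "uniform_limit {z} (\<lambda>i. m i s) (m0 s) F" using assms(1,2) unfolding conv_def by blast
  then show ?thesis by (rule tendsto_uniform_limitI) simp
qed

lemma conv_bounded:
  assumes cv: "conv m m0 F" and s: "s \<in> SP" and C: "compact C" "C \<subseteq> cball (ctr s) (e s) - {ctr s}"
  shows "\<exists>B. \<forall>\<^sub>F i in F. \<forall>z\<in>C. norm (m i s z) \<le> B"
proof -
  have "continuous_on C (m0 s)" using cv s C(2) continuous_on_subset unfolding conv_def by blast
  then have "bounded (m0 s ` C)" using C(1) compact_continuous_image compact_imp_bounded by blast
  then obtain B where B: "\<forall>x\<in>m0 s ` C. norm x \<le> B" unfolding bounded_iff by blast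
  have "uniform_limit C (\<lambda>i. m i s) (m0 s) F" using cv s C unfolding conv_def by blast
  from uniform_limitD[OF this zero_less_one]
  have "\<forall>\<^sub>F i in F. \<forall>z\<in>C. norm (m i s z) \<le> B + 1"
  proof (rule eventually_mono, intro ballI)
    fix i z assume a: "\<forall>z\<in>C. dist (m i s z) (m0 s z) < 1" and z: "z \<in> C"
    have "norm (m i s z) \<le> norm (m0 s z) + norm (m i s z - m0 s z)" by (rule norm_triangle_sub)
    also have "norm (m i s z - m0 s z) < 1" using a z by (simp add: dist_norm)
    finally show "norm (m i s z) \<le> B + 1" using B z by (smt (verit) imageI)
  qed
  then show ?thesis by blast
qed

text \<open>The bound is half the minimum of the limit over \<open>C\<close>; it makes division by
  the multipliers uniformly harmless away from the centres.\<close>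

lemma conv_lower_bound:
  assumes cv: "conv m m0 F" and s: "s \<in> SP" and C: "compact C" "C \<subseteq> cball (ctr s) (e s) - {ctr s}"
    and nz: "\<And>z. z \<in> C \<Longrightarrow> m0 s z \<noteq> 0"
  shows "\<exists>\<delta>>0. \<forall>\<^sub>F i in F. \<forall>z\<in>C. \<delta> \<le> norm (m i s z)"
proof (cases "C = {}")
  case True then show ?thesis by (intro exI[of _ 1]) auto
next
  case False
  have "continuous_on C (\<lambda>z. norm (m0 s z))" using cv s C(2) continuous_on_subset unfolding conv_def by (intro continuous_intros) blast
  then obtain w where w: "w \<in> C" "\<And>z. z \<in> C \<Longrightarrow> norm (m0 s w) \<le> norm (m0 s z)"
    using continuous_attains_inf[OF C(1) False] by blast
  define \<delta> where "\<delta> = norm (m0 s w) / 2"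
  have d: "0 < \<delta>" using nz[OF w(1)] by (simp add: \<delta>_def)
  have "uniform_limit C (\<lambda>i. m i s) (m0 s) F" using cv s C unfolding conv_def by blast
  from uniform_limitD[OF this d]
  have "\<forall>\<^sub>F i in F. \<forall>z\<in>C. \<delta> \<le> norm (m i s z)"
  proof (rule eventually_mono, intro ballI)
    fix i z assume a: "\<forall>z\<in>C. dist (m i s z) (m0 s z) < \<delta>" and z: "z \<in> C"
    have "norm (m0 s z) \<le> norm (m i s z) + norm (m0 s z - m i s z)" by (rule norm_triangle_sub)
    moreover have "norm (m0 s z - m i s z) < \<delta>" using a z by (simp add: dist_norm norm_minus_commute)
    moreover have "2 * \<delta> \<le> norm (m0 s z)" using w(2)[OF z] by (simp add: \<delta>_def)
    ultimately show "\<delta> \<le> norm (m i s z)" by linarith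
  qed
  then show ?thesis using d by blast
qed

lemma compact_sphere_punctured: "s \<in> SP \<Longrightarrow> sphere (ctr s) (e s) \<subseteq> cball (ctr s) (e s) - {ctr s}"
  using e(1)[of s] by auto

text \<open>Bounds on the core propagate into the punctured discs by the maximum principle for the regular parts.\<close>

lemma bounded_on_discs:
  assumes m: "conv m m0 F" and nz: "\<And>s z. s \<in> SP \<Longrightarrow> z \<in> cball (ctr s) (e s) - {ctr s} \<Longrightarrow> m0 s z \<noteq> 0"
    and T: "conv T T0 F" and g: "\<forall>\<^sub>F i in F. germs (m i) (T i) (G i) (\<phi> i)"
    and bd: "\<forall>\<^sub>F i in F. \<forall>q\<in>core. norm (\<phi> i q) \<le> M" and s: "s \<in> SP"
  shows "\<exists>B. \<forall>\<^sub>F i in F. \<forall>z\<in>cball (ctr s) (e s). norm (G i s z) \<le> B"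
    and "compact C \<Longrightarrow> C \<subseteq> cball (ctr s) (e s) - {ctr s} \<Longrightarrow> \<exists>B. \<forall>\<^sub>F i in F. \<forall>z\<in>C. norm (\<phi> i (chart_inv (ch s) z)) \<le> B"
proof -
  obtain Bm where Bm: "\<forall>\<^sub>F i in F. \<forall>z\<in>sphere (ctr s) (e s). norm (m i s z) \<le> Bm"
    using conv_bounded[OF m s compact_sphere compact_sphere_punctured[OF s]] by blast
  obtain BT where BT: "\<forall>\<^sub>F i in F. \<forall>z\<in>sphere (ctr s) (e s). norm (T i s z) \<le> BT"
    using conv_bounded[OF T s compact_sphere compact_sphere_punctured[OF s]] by blast
  have B: "\<forall>\<^sub>F i in F. \<forall>z\<in>cball (ctr s) (e s). norm (G i s z) \<le> \<bar>Bm\<bar> * \<bar>M\<bar> + \<bar>BT\<bar>"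
    using g bd Bm BT
  proof eventually_elim
    case (elim i)
    show ?case
    proof
      fix z assume z: "z \<in> cball (ctr s) (e s)"
      show "norm (G i s z) \<le> \<bar>Bm\<bar> * \<bar>M\<bar> + \<bar>BT\<bar>"
      proof (rule maximum_modulus_cball[OF _ _ e(1)[OF s] _ z])
        show "continuous_on (cball (ctr s) (e s)) (G i s)" "G i s holomorphic_on ball (ctr s) (e s)"
          using germsD(2)[OF elim(1) s] by (auto simp: ext_def)
        fix w assume w: "w \<in> sphere (ctr s) (e s)"
        have "m i s w * \<phi> i (chart_inv (ch s) w) = T i s w + G i s w"
          using w compact_sphere_punctured[OF s] by (intro germsD(3)[OF elim(1) s]) auto
        then have "G i s w = m i s w * \<phi> i (chart_inv (ch s) w) - T i s w" by simp
        then have "norm (G i s w) \<le> norm (m i s w) * norm (\<phi> i (chart_inv (ch s) w)) + norm (T i s w)"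
          by (metis norm_mult norm_triangle_ineq4)
        also have "\<dots> \<le> \<bar>Bm\<bar> * \<bar>M\<bar> + \<bar>BT\<bar>"
          using elim(2,3,4) w sphere_core[OF s w] by (intro add_mono mult_mono) (auto intro: order_trans[OF _ abs_ge_self])
        finally show "norm (G i s w) \<le> \<bar>Bm\<bar> * \<bar>M\<bar> + \<bar>BT\<bar>" .
      qed
    qed
  qed
  then show "\<exists>B. \<forall>\<^sub>F i in F. \<forall>z\<in>cball (ctr s) (e s). norm (G i s z) \<le> B" by blast
  assume C: "compact C" "C \<subseteq> cball (ctr s) (e s) - {ctr s}"
  obtain B' where B': "\<forall>\<^sub>F i in F. \<forall>z\<in>C. norm (T i s z) \<le> B'" using conv_bounded[OF T s C] by blast
  obtain \<delta> where d: "0 < \<delta>" "\<forall>\<^sub>F i in F. \<forall>z\<in>C. \<delta> \<le> norm (m i s z)"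
    using conv_lower_bound[OF m s C] nz[OF s] C(2) by blast
  define B where "B = \<bar>Bm\<bar> * \<bar>M\<bar> + \<bar>BT\<bar>"
  have "\<forall>\<^sub>F i in F. \<forall>z\<in>C. norm (\<phi> i (chart_inv (ch s) z)) \<le> (\<bar>B'\<bar> + B) / \<delta>"
    using g B[folded B_def] B' d(2)
  proof eventually_elim
    case (elim i)
    show ?case
    proof
      fix z assume z: "z \<in> C"
      then have zc: "z \<in> cball (ctr s) (e s)" "z \<noteq> ctr s" using C(2) by auto
      have "m i s z * \<phi> i (chart_inv (ch s) z) = T i s z + G i s z" by (rule germsD(3)[OF elim(1) s zc])
      then have "norm (m i s z) * norm (\<phi> i (chart_inv (ch s) z)) \<le> norm (T i s z) + norm (G i s z)"
        by (metis norm_mult norm_triangle_ineq)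
      also have "\<dots> \<le> \<bar>B'\<bar> + B" using elim(2,3) z zc(1) by (intro add_mono) (auto intro: order_trans[OF _ abs_ge_self])
      finally have "norm (m i s z) * norm (\<phi> i (chart_inv (ch s) z)) \<le> \<bar>B'\<bar> + B" .
      moreover have "\<delta> * norm (\<phi> i (chart_inv (ch s) z)) \<le> norm (m i s z) * norm (\<phi> i (chart_inv (ch s) z))"
        using elim(4) z by (intro mult_right_mono) auto
      ultimately show "norm (\<phi> i (chart_inv (ch s) z)) \<le> (\<bar>B'\<bar> + B) / \<delta>"
        using d(1) by (simp add: field_simps)
    qed
  qed
  then show "\<exists>B. \<forall>\<^sub>F i in F. \<forall>z\<in>C. norm (\<phi> i (chart_inv (ch s) z)) \<le> B" by blast
qed

lemma closedin_discs: "T \<subseteq> SP \<Longrightarrow> closedin X (\<Union>t\<in>T. disc t)"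
  using closedin_disc finite_subset[OF _ SP(1)] by (intro closedin_Union) auto

text \<open>A point of a closed disc may lie on its boundary, so its neighbourhoods can meet both
  the disc, where \<open>bounded_on_discs\<close> applies, and the core; the bound is the larger of
  the two.\<close>

lemma locally_bounded:
  assumes m: "conv m m0 F" and nz: "\<And>s z. s \<in> SP \<Longrightarrow> z \<in> cball (ctr s) (e s) - {ctr s} \<Longrightarrow> m0 s z \<noteq> 0"
    and T: "conv T T0 F" and g: "\<forall>\<^sub>F i in F. germs (m i) (T i) (G i) (\<phi> i)"
    and bd: "\<forall>\<^sub>F i in F. \<forall>q\<in>core. norm (\<phi> i q) \<le> M" and p: "p \<in> topspace X - SP"
  shows "\<exists>c\<in>\<A>. \<exists>r>0. \<exists>B. p \<in> fst c \<and> ball (snd c p) r \<subseteq> snd c ` (fst c - SP) \<and>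
    (\<forall>\<^sub>F i in F. \<forall>z\<in>ball (snd c p) r. norm (\<phi> i (chart_inv c z)) \<le> B)"
proof (cases "\<exists>s\<in>SP. p \<in> disc s")
  case True
  then obtain s where s: "s \<in> SP" "p \<in> disc s" by blast
  define z0 where "z0 = snd (ch s) p"
  have pf: "p \<in> fst (ch s)" and z0: "z0 \<in> cball (ctr s) (e s)" using s disc_eq[OF s(1)] by (auto simp: z0_def)
  have z0n: "z0 \<noteq> ctr s" using inj_onD[OF inj_chart[OF ch(1)[OF s(1)]], of p s] pf ch(2)[OF s(1)] p s(1) by (auto simp: z0_def)
  define N where "N = topspace X - SP - (\<Union>t\<in>SP-{s}. disc t)"
  have N: "openin X N" unfolding N_def
    by (intro openin_diff openin_Diff_finite SP openin_topspace closedin_discs) auto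
  have pN: "p \<in> N" unfolding N_def using p s disc_disjoint[OF s(1)] by blast
  define V where "V = snd (ch s) ` (fst (ch s) \<inter> N)"
  have V: "open V" "z0 \<in> V" unfolding V_def using open_chart_image[OF ch(1)[OF s(1)] N] pf pN by (auto simp: z0_def)
  then obtain r0 where r0: "0 < r0" "ball z0 r0 \<subseteq> V" using open_contains_ball_eq by metis
  define r where "r = min r0 (norm (z0 - ctr s) / 2)"
  have r: "0 < r" "ball z0 r \<subseteq> V" using r0 z0n by (auto simp: r_def)
  \<comment> \<open>Half the distance from \<open>z0\<close> to the centre is kept free, so the
    multipliers are bounded below on \<open>C\<close>, and points of the disc near \<open>z0\<close>
    belong to it.\<close>
  define C where "C = cball (ctr s) (e s) - ball (ctr s) (norm (z0 - ctr s) / 2)"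
  have C: "compact C" "C \<subseteq> cball (ctr s) (e s) - {ctr s}"
    unfolding C_def using z0n by (auto intro!: compact_diff)
  obtain B where B: "\<forall>\<^sub>F i in F. \<forall>z\<in>C. norm (\<phi> i (chart_inv (ch s) z)) \<le> B"
    using bounded_on_discs(2)[OF m nz T g bd s(1) C] by blast
  have "\<forall>\<^sub>F i in F. \<forall>z\<in>ball z0 r. norm (\<phi> i (chart_inv (ch s) z)) \<le> max B M"
    using bd B
  proof eventually_elim
    case (elim i)
    show ?case
    proof
      fix z assume z: "z \<in> ball z0 r"
      obtain q where q: "q \<in> fst (ch s)" "q \<in> N" "z = snd (ch s) q" using z r(2) V_def by blast
      have qz: "chart_inv (ch s) z = q" using chart_inv_simps(3)[OF ch(1)[OF s(1)] q(1)] q(3) by simp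
      show "norm (\<phi> i (chart_inv (ch s) z)) \<le> max B M"
      proof (cases "z \<in> cball (ctr s) (e s)")
        case True
        have "norm (z0 - ctr s) \<le> norm (z0 - z) + norm (z - ctr s)" by (metis norm_triangle_ineq diff_add_cancel add_diff_eq)
        moreover have "norm (z0 - z) < norm (z0 - ctr s) / 2" using z by (simp add: r_def dist_norm)
        ultimately have "z \<in> C" unfolding C_def using True by (simp add: dist_norm norm_minus_commute)
        then show ?thesis using elim(2) by (simp add: le_max_iff_disj)
      next
        case False
        then have "q \<notin> odisc s" using q(3) odisc_eq[OF s(1)] by auto
        then have "q \<in> core" using q(2) odisc_disc unfolding core_def N_def by blast
        then show ?thesis using elim(1) qz by (simp add: le_max_iff_disj)
      qed
    qed
  qed
  moreover have "V \<subseteq> snd (ch s) ` (fst (ch s) - SP)" unfolding V_def N_def by blast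
  ultimately show ?thesis using ch(1)[OF s(1)] pf r unfolding z0_def by blast
next
  case False
  define N where "N = topspace X - SP - (\<Union>t\<in>SP. disc t)"
  have N: "openin X N" unfolding N_def
    by (intro openin_diff openin_Diff_finite SP openin_topspace closedin_discs) auto
  obtain c where c: "c \<in> \<A>" "p \<in> fst c" using chart_exists p by blast
  define V where "V = snd c ` (fst c \<inter> N)"
  have V: "open V" "snd c p \<in> V" unfolding V_def using open_chart_image[OF c(1) N] c p False by (auto simp: N_def)
  then obtain r where r: "0 < r" "ball (snd c p) r \<subseteq> V" using open_contains_ball_eq by metis
  have core: "chart_inv c z \<in> core" if "z \<in> V" for z
    using that chart_inv_simps(3)[OF c(1)] odisc_disc unfolding V_def N_def core_def by auto blast
  have "\<forall>\<^sub>F i in F. \<forall>z\<in>ball (snd c p) r. norm (\<phi> i (chart_inv c z)) \<le> M"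
    using bd by eventually_elim (use core r(2) in blast)
  moreover have "V \<subseteq> snd c ` (fst c - SP)" unfolding V_def N_def by blast
  ultimately show ?thesis using c r by blast
qed

text \<open>Montel's theorem for the singular problem: cluster pointwise, then improve to uniform
  convergence on the core by Cauchy estimates and on the discs by the maximum principle for the
  remainders.\<close>

lemma bounded_germs_cluster:
  assumes F: "F \<noteq> bot"
    and m: "conv m m0 F" and nz: "\<And>s z. s \<in> SP \<Longrightarrow> z \<in> cball (ctr s) (e s) - {ctr s} \<Longrightarrow> m0 s z \<noteq> 0"
    and T: "conv T T0 F" and g: "\<forall>\<^sub>F i in F. germs (m i) (T i) (G i) (\<phi> i)"
    and bd: "\<forall>\<^sub>F i in F. \<forall>q\<in>core. norm (\<phi> i q) \<le> M"
  shows "\<exists>F' \<phi>0 G0. F' \<le> F \<and> F' \<noteq> bot \<and> germs m0 T0 G0 \<phi>0 \<and>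
    (\<forall>p\<in>topspace X - SP. ((\<lambda>i. \<phi> i p) \<longlongrightarrow> \<phi>0 p) F') \<and> uniform_limit core \<phi> \<phi>0 F' \<and>
    (\<forall>s\<in>SP. uniform_limit (cball (ctr s) (e s)) (\<lambda>i. G i s) (G0 s) F')"
proof -
  have lb: "\<exists>c\<in>\<A>. \<exists>r>0. \<exists>B. p \<in> fst c \<and> ball (snd c p) r \<subseteq> snd c ` (fst c - SP) \<and>
    (\<forall>\<^sub>F i in F. \<forall>z\<in>ball (snd c p) r. norm (\<phi> i (chart_inv c z)) \<le> B)" if "p \<in> topspace X - SP" for p
    by (rule locally_bounded[OF m nz T g bd that])
  \<comment> \<open>The value of a remainder at its centre is not determined by a value of
    \<open>\<phi>\<close> at one regular point, so it is added as a further coordinate before the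
    cluster point is taken.\<close>
  define h where "h i x = (case x of Inl p \<Rightarrow> \<phi> i p | Inr s \<Rightarrow> G i s (ctr s))" for i and x :: "'a + 'a"
  have bdd: "\<exists>M. \<forall>\<^sub>F i in F. norm (h i x) \<le> M" if x: "x \<in> Inl ` (topspace X - SP) \<union> Inr ` SP" for x
  proof (cases x)
    case (Inl p)
    then have p: "p \<in> topspace X - SP" using x by auto
    obtain c r B where c: "c \<in> \<A>" "0 < r" "p \<in> fst c" "\<forall>\<^sub>F i in F. \<forall>z\<in>ball (snd c p) r. norm (\<phi> i (chart_inv c z)) \<le> B"
      using lb[OF p] by blast
    have "\<forall>\<^sub>F i in F. norm (\<phi> i p) \<le> B" using c(4)
    proof eventually_elim
      case (elim i)
      have "snd c p \<in> ball (snd c p) r" using c(2) by simp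
      then have "norm (\<phi> i (chart_inv c (snd c p))) \<le> B" using elim by blast
      then show ?case using chart_inv_simps(3)[OF c(1,3)] by simp
    qed
    then show ?thesis using Inl by (auto simp: h_def)
  next
    case (Inr s)
    then have s: "s \<in> SP" using x by auto
    obtain B where "\<forall>\<^sub>F i in F. \<forall>z\<in>cball (ctr s) (e s). norm (G i s z) \<le> B"
      using bounded_on_discs(1)[OF m nz T g bd s] by blast
    then have "\<forall>\<^sub>F i in F. norm (G i s (ctr s)) \<le> B"
      by eventually_elim (use e(1)[OF s] in auto)
    then show ?thesis using Inr by (auto simp: h_def)
  qed
  have "\<exists>F' g. F' \<le> F \<and> F' \<noteq> bot \<and> (\<forall>x\<in>Inl ` (topspace X - SP) \<union> Inr ` SP. ((\<lambda>i. h i x) \<longlongrightarrow> g x) F')"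
    by (rule pointwise_cluster_filter[OF F]) (rule bdd)
  then obtain F' g0 where F': "F' \<le> F" "F' \<noteq> bot"
    and lim0': "\<forall>x\<in>Inl ` (topspace X - SP) \<union> Inr ` SP. ((\<lambda>i. h i x) \<longlongrightarrow> g0 x) F'"
    by (elim exE conjE)
  note lim0 = bspec[OF lim0']
  define \<phi>0 where "\<phi>0 p = g0 (Inl p)" for p
  define G0 where "G0 s z = (if z = ctr s then g0 (Inr s) else m0 s z * \<phi>0 (chart_inv (ch s) z) - T0 s z)" for s z
  have lim: "((\<lambda>i. \<phi> i p) \<longlongrightarrow> \<phi>0 p) F'" if "p \<in> topspace X - SP" for p
    using lim0[of "Inl p"] that by (simp add: h_def \<phi>0_def)
  note g' = filter_leD[OF F'(1) g] and m' = conv_mono[OF m F'(1)] and T' = conv_mono[OF T F'(1)]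
  have nhd: "\<exists>c r. c \<in> \<A> \<and> p \<in> fst c \<and> 0 < r \<and> ball (snd c p) r \<subseteq> img c \<and>
      uniform_limit (cball (snd c p) r) (\<lambda>i z. \<phi> i (chart_inv c z)) (\<lambda>z. \<phi>0 (chart_inv c z)) F' \<and>
      (\<lambda>z. \<phi>0 (chart_inv c z)) holomorphic_on ball (snd c p) r" if p: "p \<in> topspace X - SP" for p
  proof -
    obtain c r B where c: "c \<in> \<A>" "0 < r" "p \<in> fst c" "ball (snd c p) r \<subseteq> snd c ` (fst c - SP)"
      and B: "\<forall>\<^sub>F i in F. \<forall>z\<in>ball (snd c p) r. norm (\<phi> i (chart_inv c z)) \<le> B"
      using lb[OF p] by blast
    have reg: "chart_inv c z \<in> topspace X - SP" if z: "z \<in> ball (snd c p) r" for z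
    proof -
      obtain q where "q \<in> fst c - SP" "z = snd c q" using z c(4) by blast
      then show ?thesis using chart_inv_simps(3)[OF c(1)] fst_subset[OF c(1)] by auto
    qed
    have ev: "\<forall>\<^sub>F i in F'. (\<lambda>z. \<phi> i (chart_inv c z)) holomorphic_on ball (snd c p) r \<and> (\<forall>z\<in>ball (snd c p) r. norm (\<phi> i (chart_inv c z)) \<le> B)"
      using g' filter_leD[OF F'(1) B]
    proof eventually_elim
      case (elim i)
      then show ?case using germsD(1)[OF elim(1)] c(1) holomorphic_on_subset[OF _ c(4)] unfolding holo_def by blast
    qed
    have l: "((\<lambda>i. \<phi> i (chart_inv c z)) \<longlongrightarrow> \<phi>0 (chart_inv c z)) F'" if "z \<in> ball (snd c p) r" for z
      by (rule lim[OF reg[OF that]])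
    have "ball (snd c p) (r / 3) \<subseteq> ball (snd c p) r" using c(2) by (intro subset_ball) simp
    then have "ball (snd c p) (r / 3) \<subseteq> img c" using c(4) by blast
    then show ?thesis
      using bounded_holomorphic_uniform_limit[OF F'(2) c(2) ev l] c by (intro exI[of _ c] exI[of _ "r/3"]) auto
  qed
  have h0: "holo \<phi>0"
    by (rule holo_localI) (use nhd in blast)
  have uc: "uniform_limit core \<phi> \<phi>0 F'"
  proof -
    obtain c r where cr: "\<And>p. p \<in> core \<Longrightarrow> c p \<in> \<A> \<and> p \<in> fst (c p) \<and> 0 < r p \<and> ball (snd (c p) p) (r p) \<subseteq> img (c p) \<and>
      uniform_limit (cball (snd (c p) p) (r p)) (\<lambda>i z. \<phi> i (chart_inv (c p) z)) (\<lambda>z. \<phi>0 (chart_inv (c p) z)) F'"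
    proof -
      have "\<exists>c r. c \<in> \<A> \<and> p \<in> fst c \<and> 0 < r \<and> ball (snd c p) r \<subseteq> img c \<and>
      uniform_limit (cball (snd c p) r) (\<lambda>i z. \<phi> i (chart_inv c z)) (\<lambda>z. \<phi>0 (chart_inv c z)) F'" if "p \<in> core" for p
        using nhd[of p] that core_subset by blast
      then show ?thesis using that by metis
    qed
    have cr': "c p \<in> \<A> \<and> p \<in> fst (c p) \<and> 0 < r p \<and> ball (snd (c p) p) (r p) \<subseteq> img (c p)" if "p \<in> core" for p
      using cr[OF that] by blast
    obtain K where K: "finite K" "K \<subseteq> core" "\<And>q. q \<in> core \<Longrightarrow> \<exists>p\<in>K. q \<in> fst (c p) \<and> snd (c p) q \<in> ball (snd (c p) p) (r p)"
      by (rule core_finite_cover[OF cr']) auto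
    show ?thesis
      unfolding uniform_limit_iff
    proof (intro allI impI)
      fix \<epsilon> :: real assume "0 < \<epsilon>"
      then have "\<forall>\<^sub>F i in F'. \<forall>p\<in>K. \<forall>z\<in>cball (snd (c p) p) (r p). dist (\<phi> i (chart_inv (c p) z)) (\<phi>0 (chart_inv (c p) z)) < \<epsilon>"
        using cr K(2) by (intro eventually_ball_finite[OF K(1)] ballI) (auto simp: uniform_limit_iff)
      then show "\<forall>\<^sub>F i in F'. \<forall>q\<in>core. dist (\<phi> i q) (\<phi>0 q) < \<epsilon>"
      proof (rule eventually_mono, intro ballI)
        fix i q assume a: "\<forall>p\<in>K. \<forall>z\<in>cball (snd (c p) p) (r p). dist (\<phi> i (chart_inv (c p) z)) (\<phi>0 (chart_inv (c p) z)) < \<epsilon>"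
          and q: "q \<in> core"
        obtain p where p: "p \<in> K" "q \<in> fst (c p)" "snd (c p) q \<in> ball (snd (c p) p) (r p)" using K(3)[OF q] by blast
        then have "dist (\<phi> i (chart_inv (c p) (snd (c p) q))) (\<phi>0 (chart_inv (c p) (snd (c p) q))) < \<epsilon>" using a by auto
        moreover have "chart_inv (c p) (snd (c p) q) = q" using cr' K(2) p chart_inv_simps(3) by blast
        ultimately show "dist (\<phi> i q) (\<phi>0 q) < \<epsilon>" by simp
      qed
    qed
  qed
  have disc: "uniform_limit (cball (ctr s) (e s)) (\<lambda>i. G i s) (G0 s) F' \<and> ext s (G0 s)" if s: "s \<in> SP" for s
  proof -
    have hol: "\<forall>\<^sub>F i in F'. continuous_on (cball (ctr s) (e s)) (G i s) \<and> G i s holomorphic_on ball (ctr s) (e s)"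
      using g' by eventually_elim (use germsD(2) s ext_def in blast)
    have Geq: "\<forall>\<^sub>F i in F'. \<forall>z\<in>cball (ctr s) (e s) - {ctr s}. m i s z * \<phi> i (chart_inv (ch s) z) - T i s z = G i s z"
      using g' by eventually_elim (use germsD(3)[OF _ s] in auto)
    let ?S = "sphere (ctr s) (e s)"
    have Sp: "?S \<subseteq> cball (ctr s) (e s) - {ctr s}" by (rule compact_sphere_punctured[OF s])
    have um: "uniform_limit ?S (\<lambda>i. m i s) (m0 s) F'" "uniform_limit ?S (\<lambda>i. T i s) (T0 s) F'"
      using m' T' s Sp unfolding conv_def by auto
    have u\<phi>: "uniform_limit ?S (\<lambda>i z. \<phi> i (chart_inv (ch s) z)) (\<lambda>z. \<phi>0 (chart_inv (ch s) z)) F'"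
      using uc sphere_core[OF s] unfolding uniform_limit_iff by (fastforce elim!: eventually_mono)
    have "continuous_on ?S (m0 s)" using m s Sp continuous_on_subset unfolding conv_def by blast
    then have b1: "bounded (m0 s ` ?S)" using compact_continuous_image compact_imp_bounded compact_sphere by blast
    have "continuous_on ?S (\<lambda>z. \<phi>0 (chart_inv (ch s) z))"
    proof -
      have "?S \<subseteq> snd (ch s) ` (fst (ch s) - SP)" using punctured_disc_img(1)[OF s] Sp by blast
      moreover have "(\<lambda>z. \<phi>0 (chart_inv (ch s) z)) holomorphic_on snd (ch s) ` (fst (ch s) - SP)"
        using h0 ch(1)[OF s] unfolding holo_def by (rule bspec)
      ultimately show ?thesis using holomorphic_on_imp_continuous_on continuous_on_subset by blast
    qed
    then have b2: "bounded ((\<lambda>z. \<phi>0 (chart_inv (ch s) z)) ` ?S)" using compact_continuous_image compact_imp_bounded compact_sphere by blast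
    have "uniform_limit ?S (\<lambda>i z. m i s z * \<phi> i (chart_inv (ch s) z) - T i s z) (\<lambda>z. m0 s z * \<phi>0 (chart_inv (ch s) z) - T0 s z) F'"
      by (intro uniform_limit_intros um u\<phi> b1 b2)
    then have ul: "uniform_limit ?S (\<lambda>i. G i s) (G0 s) F'"
    proof (rule uniform_limit_cong[THEN iffD1, rotated 2])
      show "\<forall>\<^sub>F i in F'. \<forall>z\<in>?S. m i s z * \<phi> i (chart_inv (ch s) z) - T i s z = G i s z"
        using Geq by eventually_elim (use Sp in blast)
      show "\<And>z. z \<in> ?S \<Longrightarrow> m0 s z * \<phi>0 (chart_inv (ch s) z) - T0 s z = G0 s z"
        using Sp by (auto simp: G0_def)
    qed
    have lim: "((\<lambda>i. G i s z) \<longlongrightarrow> G0 s z) F'" if z: "z \<in> cball (ctr s) (e s)" for z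
    proof (cases "z = ctr s")
      case True
      then show ?thesis using lim0[of "Inr s"] s by (simp add: h_def G0_def)
    next
      case False
      then have zp: "z \<in> cball (ctr s) (e s) - {ctr s}" using z by simp
      have "((\<lambda>i. m i s z) \<longlongrightarrow> m0 s z) F'" "((\<lambda>i. T i s z) \<longlongrightarrow> T0 s z) F'"
        by (rule conv_point[OF m' s zp], rule conv_point[OF T' s zp])
      then have "((\<lambda>i. m i s z * \<phi> i (chart_inv (ch s) z) - T i s z) \<longlongrightarrow> m0 s z * \<phi>0 (chart_inv (ch s) z) - T0 s z) F'"
        using punctured_disc_img(2)[OF s zp] by (intro tendsto_intros lim)
      then have "((\<lambda>i. m i s z * \<phi> i (chart_inv (ch s) z) - T i s z) \<longlongrightarrow> G0 s z) F'" using False by (simp add: G0_def)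
      then show ?thesis
        by (rule Lim_transform_eventually) (use Geq zp in \<open>auto elim: eventually_mono\<close>)
    qed
    show ?thesis unfolding ext_def
      using uniform_limit_cball_of_sphere[OF F'(2) e(1)[OF s] hol ul lim] by blast
  qed
  have "germs m0 T0 G0 \<phi>0"
    unfolding germs_def using h0 disc by (auto simp: G0_def)
  then show ?thesis using F' lim uc disc by blast
qed

lemma conv_scaled_0:
  assumes T: "conv T T0 F" and N: "filterlim N at_top F"
  shows "conv (\<lambda>i s z. T i s z / of_real (N i)) (\<lambda>_ _. 0) F"
  unfolding conv_def
proof (intro ballI conjI allI impI)
  fix s C assume s: "s \<in> SP" and C: "compact C \<and> C \<subseteq> cball (ctr s) (e s) - {ctr s}"
  obtain B where B: "\<forall>\<^sub>F i in F. \<forall>z\<in>C. norm (T i s z) \<le> B" using conv_bounded[OF T s] C by blast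
  show "uniform_limit C (\<lambda>i z. T i s z / of_real (N i)) (\<lambda>_. 0) F"
    unfolding uniform_limit_iff
  proof (intro allI impI)
    fix \<epsilon> :: real assume e: "0 < \<epsilon>"
    have "\<forall>\<^sub>F i in F. (\<bar>B\<bar> + 1) / \<epsilon> + 1 \<le> N i" using N unfolding filterlim_at_top by blast
    then show "\<forall>\<^sub>F i in F. \<forall>z\<in>C. dist (T i s z / of_real (N i)) 0 < \<epsilon>"
      using B
    proof eventually_elim
      case (elim i)
      have "0 \<le> (\<bar>B\<bar> + 1) / \<epsilon>" using e by simp
      then have N: "0 < N i" "(\<bar>B\<bar> + 1) / \<epsilon> < N i" using elim(1) by linarith+
      show ?case
      proof
        fix z assume "z \<in> C"
        then have "norm (T i s z) < \<bar>B\<bar> + 1" using elim(2) by fastforce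
        also have "\<dots> < N i * \<epsilon>" using N(2) e by (simp add: pos_divide_less_eq)
        finally show "dist (T i s z / of_real (N i)) 0 < \<epsilon>"
          using N(1) by (simp add: norm_divide pos_divide_less_eq mult.commute)
      qed
    qed
  qed
qed auto

lemma ext_scale: "ext s g \<Longrightarrow> ext s (\<lambda>z. g z / c)"
  unfolding ext_def by (cases "c = 0") (auto intro!: continuous_intros holomorphic_intros)

lemma germs_scale: "germs m T G \<phi> \<Longrightarrow> germs m (\<lambda>s z. T s z / c) (\<lambda>s z. G s z / c) (\<lambda>p. \<phi> p / c)"
proof -
  assume g: "germs m T G \<phi>"
  have "holo (\<lambda>p. \<phi> p / c)"
    using germsD(1)[OF g] unfolding holo_def by (cases "c = 0") (auto intro!: holomorphic_intros)
  then show ?thesis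
    unfolding germs_def using germsD(2,3)[OF g] by (auto intro!: ext_scale simp flip: add_divide_distrib)
qed

lemma germs_diff: "germs m T G \<phi> \<Longrightarrow> germs m T G' \<phi>' \<Longrightarrow> germs m (\<lambda>_ _. 0) (\<lambda>s z. G s z - G' s z) (\<lambda>p. \<phi> p - \<phi>' p)"
  unfolding germs_def holo_def ext_def by (auto intro!: holomorphic_intros continuous_intros simp: algebra_simps)

text \<open>If the homogeneous problem for the limit data has only the trivial solution, then solutions
  converge whenever their data do: otherwise, rescaling by the sup norm over the core would produce
  a nontrivial solution of the homogeneous problem in the limit.\<close>

theorem germs_convergence:
  assumes m: "conv m m0 F" and nz: "\<And>s z. s \<in> SP \<Longrightarrow> z \<in> cball (ctr s) (e s) - {ctr s} \<Longrightarrow> m0 s z \<noteq> 0"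
    and T: "conv T T0 F" and g: "\<forall>\<^sub>F i in F. germs (m i) (T i) (G i) (\<phi> i)"
    and Z: "Z \<subseteq> topspace X - SP" and b: "\<And>q. q \<in> Z \<Longrightarrow> ((\<lambda>i. \<phi> i q) \<longlongrightarrow> b q) F"
    and uniq: "\<And>\<phi> G. germs m0 (\<lambda>_ _. 0) G \<phi> \<Longrightarrow> (\<forall>q\<in>Z. \<phi> q = 0) \<Longrightarrow> \<forall>p\<in>topspace X - SP. \<phi> p = 0"
    and F: "F \<noteq> bot"
  shows "\<exists>\<phi>0 G0. germs m0 T0 G0 \<phi>0 \<and> (\<forall>q\<in>Z. \<phi>0 q = b q) \<and>
    (\<forall>p\<in>topspace X - SP. ((\<lambda>i. \<phi> i p) \<longlongrightarrow> \<phi>0 p) F) \<and>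
    (\<forall>s\<in>SP. uniform_limit (cball (ctr s) (e s)) (\<lambda>i. G i s) (G0 s) F)"
proof -
  have "\<exists>M. \<forall>\<^sub>F i in F. \<forall>q\<in>core. norm (\<phi> i q) \<le> M"
  proof (rule ccontr)
    assume nb: "\<nexists>M. \<forall>\<^sub>F i in F. \<forall>q\<in>core. norm (\<phi> i q) \<le> M"
    define N where "N i = (SUP q\<in>core. norm (\<phi> i q))" for i
    have cne: "core \<noteq> {}" using nb by auto
    have Nb: "\<forall>\<^sub>F i in F. (\<forall>q\<in>core. norm (\<phi> i q) \<le> N i) \<and> (\<forall>M. (\<forall>q\<in>core. norm (\<phi> i q) \<le> M) \<longrightarrow> N i \<le> M)"
      using g
    proof eventually_elim
      case (elim i)
      obtain B where "\<And>q. q \<in> core \<Longrightarrow> norm (\<phi> i q) \<le> B" by (rule holo_bounded_core[OF germsD(1)[OF elim]]) blast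
      then have "bdd_above ((\<lambda>q. norm (\<phi> i q)) ` core)" by (auto intro!: bdd_aboveI)
      then show ?case unfolding N_def using cne by (auto intro: cSUP_upper cSUP_least)
    qed
    \<comment> \<open>The coarsest refinement of \<open>F\<close> along which the norms tend to
      infinity; it is proper because the norms are not eventually bounded.\<close>
    define F1 where "F1 = inf F (filtercomap N at_top)"
    have F1: "F1 \<noteq> bot"
    proof
      assume "F1 = bot"
      then have "eventually (\<lambda>_. False) (inf F (filtercomap N at_top))" by (simp add: F1_def)
      then obtain P Q where PQ: "eventually P F" "eventually Q (filtercomap N at_top)" "\<And>i. P i \<and> Q i \<Longrightarrow> False"
        unfolding eventually_inf by blast
      then obtain M where M: "\<And>i. M < N i \<Longrightarrow> Q i"
        unfolding eventually_filtercomap eventually_at_top_dense by blast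
      have "\<forall>\<^sub>F i in F. \<forall>q\<in>core. norm (\<phi> i q) \<le> M"
        using PQ(1) Nb 
      proof eventually_elim
        case (elim i)
        then have "\<not> Q i" using PQ(3) by blast
        then have "N i \<le> M" using M[of i] by (meson not_le)
        then show ?case using elim(2) order_trans by blast
      qed
      then show False using nb by blast
    qed
    have F1le: "F1 \<le> F" by (simp add: F1_def)
    have N: "filterlim N at_top F1"
      unfolding F1_def by (rule filterlim_mono[OF filterlim_filtercomap order_refl]) simp
    have Npos: "\<forall>\<^sub>F i in F1. 0 < N i" using N by (auto simp: filterlim_at_top_dense)
    have T1: "conv (\<lambda>i s z. T i s z / of_real (N i)) (\<lambda>_ _. 0) F1"
      by (rule conv_scaled_0[OF conv_mono[OF T F1le] N])
    have g1: "\<forall>\<^sub>F i in F1. germs (m i) (\<lambda>s z. T i s z / of_real (N i)) (\<lambda>s z. G i s z / of_real (N i)) (\<lambda>p. \<phi> i p / of_real (N i))"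
      using filter_leD[OF F1le g] by eventually_elim (rule germs_scale)
    have b1: "\<forall>\<^sub>F i in F1. \<forall>q\<in>core. norm (\<phi> i q / of_real (N i)) \<le> 1"
      using filter_leD[OF F1le Nb] Npos by eventually_elim (auto simp: norm_divide)
    obtain F2 \<phi>0 G0 where F2: "F2 \<le> F1" "F2 \<noteq> bot" and g0: "germs m0 (\<lambda>_ _. 0) G0 \<phi>0"
      and l0: "\<forall>p\<in>topspace X - SP. ((\<lambda>i. \<phi> i p / of_real (N i)) \<longlongrightarrow> \<phi>0 p) F2"
      and u0: "uniform_limit core (\<lambda>i p. \<phi> i p / of_real (N i)) \<phi>0 F2"
      using bounded_germs_cluster[OF F1 conv_mono[OF m F1le] nz T1 g1 b1] by blast
    have "\<phi>0 q = 0" if q: "q \<in> Z" for q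
    proof -
      have "((\<lambda>i. \<phi> i q) \<longlongrightarrow> b q) F2" using tendsto_mono[OF order_trans[OF F2(1) F1le] b[OF q]] .
      moreover have "filterlim (\<lambda>i. complex_of_real (N i)) at_infinity F2"
        by (rule filterlim_compose[OF filterlim_of_real_at_infinity filterlim_mono[OF N order_refl F2(1)]])
      ultimately have "((\<lambda>i. \<phi> i q / of_real (N i)) \<longlongrightarrow> 0) F2" by (rule tendsto_divide_0)
      then show ?thesis using tendsto_unique[OF F2(2)] l0 Z q by blast
    qed
    \<comment> \<open>The limit solves the homogeneous problem and is zero on \<open>Z\<close>,
      hence zero on the core; but convergence there is uniform, and the rescaled functions have
      supremum 1.\<close>
    then have z: "\<phi>0 p = 0" if "p \<in> core" for p using uniq[OF g0] core_subset that by blast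
    have "\<forall>\<^sub>F i in F2. \<forall>p\<in>core. dist (\<phi> i p / of_real (N i)) (\<phi>0 p) < 1 / 2"
      using uniform_limitD[OF u0, of "1/2"] by simp
    then have "\<forall>\<^sub>F i in F2. False"
      using filter_leD[OF F2(1) Npos] filter_leD[OF order_trans[OF F2(1) F1le] Nb]
    proof eventually_elim
      case (elim i)
      have "norm (\<phi> i q) \<le> N i / 2" if "q \<in> core" for q
        using elim(1,2) z[OF that] that by (auto simp: norm_divide divide_simps split: if_splits)
      then have "N i \<le> N i / 2" using elim(3) by blast
      then show ?case using elim(2) by simp
    qed
    then show False using F2(2) by (simp add: trivial_limit_def)
  qed
  then obtain M where bd: "\<forall>\<^sub>F i in F. \<forall>q\<in>core. norm (\<phi> i q) \<le> M" by blast
  have cl: "\<exists>F'' \<phi>0 G0. F'' \<le> F' \<and> F'' \<noteq> bot \<and> germs m0 T0 G0 \<phi>0 \<and> (\<forall>q\<in>Z. \<phi>0 q = b q) \<and>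
    (\<forall>p\<in>topspace X - SP. ((\<lambda>i. \<phi> i p) \<longlongrightarrow> \<phi>0 p) F'') \<and>
    (\<forall>s\<in>SP. uniform_limit (cball (ctr s) (e s)) (\<lambda>i. G i s) (G0 s) F'')" if F': "F' \<le> F" "F' \<noteq> bot" for F'
  proof -
    obtain F'' \<phi>0 G0 where F'': "F'' \<le> F'" "F'' \<noteq> bot" and g0: "germs m0 T0 G0 \<phi>0"
      and l0: "\<forall>p\<in>topspace X - SP. ((\<lambda>i. \<phi> i p) \<longlongrightarrow> \<phi>0 p) F''"
      and u0: "\<forall>s\<in>SP. uniform_limit (cball (ctr s) (e s)) (\<lambda>i. G i s) (G0 s) F''"
      using bounded_germs_cluster[OF F'(2) conv_mono[OF m F'(1)] nz conv_mono[OF T F'(1)] filter_leD[OF F'(1) g] filter_leD[OF F'(1) bd]]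
      by blast
    have "\<phi>0 q = b q" if q: "q \<in> Z" for q
      using tendsto_unique[OF F''(2)] l0 Z q tendsto_mono[OF order_trans[OF F''(1) F'(1)] b[OF q]] by blast
    then show ?thesis using F'' g0 l0 u0 by blast
  qed
  \<comment> \<open>One cluster limit is fixed. By uniqueness the cluster limits along all other
    subfilters equal it, which is what \<open>tendsto_by_subfilters\<close> asks for.\<close>
  obtain \<phi>0 G0 where g0: "germs m0 T0 G0 \<phi>0" "\<forall>q\<in>Z. \<phi>0 q = b q"
    using cl[OF order_refl F] by blast
  have same: "\<phi>1 p = \<phi>0 p" if "germs m0 T0 G1 \<phi>1" "\<forall>q\<in>Z. \<phi>1 q = b q" "p \<in> topspace X - SP" for \<phi>1 G1 p
    using uniq[OF germs_diff[OF that(1) g0(1)]] that(2,3) g0(2) by simp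
  have sameG: "G1 s z = G0 s z" if "germs m0 T0 G1 \<phi>1" "\<forall>q\<in>Z. \<phi>1 q = b q" "s \<in> SP" "z \<in> cball (ctr s) (e s)" for \<phi>1 G1 s z
  proof -
    have eq: "G1 s z = G0 s z" if "z \<in> cball (ctr s) (e s) - {ctr s}" for z
      using germsD(3)[OF g0(1) \<open>s \<in> SP\<close>, of z] germsD(3)[OF \<open>germs m0 T0 G1 \<phi>1\<close> \<open>s \<in> SP\<close>, of z] that
        same[OF \<open>germs m0 T0 G1 \<phi>1\<close> \<open>\<forall>q\<in>Z. \<phi>1 q = b q\<close> punctured_disc_img(2)[OF \<open>s \<in> SP\<close> that]] by auto
    show ?thesis
    proof (cases "z = ctr s")
      case True
      \<comment> \<open>At the centre the equation for \<open>\<phi>\<close> says nothing; the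
        remainders agree there by continuity.\<close>
      have c: "isCont (G1 s) (ctr s)" "isCont (G0 s) (ctr s)"
        using germsD(2)[OF g0(1) that(3)] germsD(2)[OF that(1,3)] e(1)[OF that(3)]
        unfolding ext_def by (auto intro!: continuous_on_interior[of "cball (ctr s) (e s)"])
      have "((\<lambda>z. G0 s z) \<longlongrightarrow> G1 s (ctr s)) (at (ctr s))"
        using c(1)[unfolded isCont_def]
      proof (rule Lim_transform_eventually)
        have "\<forall>\<^sub>F w in at (ctr s). w \<in> ball (ctr s) (e s)"
          using e(1)[OF that(3)] by (intro eventually_at_in_open') auto
        then show "\<forall>\<^sub>F w in at (ctr s). G1 s w = G0 s w"
          using eventually_neq_at_within[of "ctr s" "ctr s"] by eventually_elim (auto intro!: eq)
      qed
      then show ?thesis using c(2)[unfolded isCont_def] tendsto_unique[OF at_neq_bot] True by blast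
    qed (use eq that in auto)
  qed
  have "((\<lambda>i. \<phi> i p) \<longlongrightarrow> \<phi>0 p) F" if p: "p \<in> topspace X - SP" for p
  proof (rule tendstoI, rule tendsto_by_subfilters)
    fix \<epsilon> :: real and F' assume "0 < \<epsilon>" and F': "F' \<le> F" "F' \<noteq> bot"
    obtain F'' \<phi>1 G1 where F'': "F'' \<le> F'" "F'' \<noteq> bot" and g1: "germs m0 T0 G1 \<phi>1" "\<forall>q\<in>Z. \<phi>1 q = b q"
      and l1: "\<forall>p\<in>topspace X - SP. ((\<lambda>i. \<phi> i p) \<longlongrightarrow> \<phi>1 p) F''"
      using cl[OF F'] by blast
    have "\<forall>\<^sub>F i in F''. dist (\<phi> i p) (\<phi>1 p) < \<epsilon>" using l1 p \<open>0 < \<epsilon>\<close> tendstoD by blast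
    then show "\<exists>F''\<le>F'. F'' \<noteq> bot \<and> (\<forall>\<^sub>F i in F''. dist (\<phi> i p) (\<phi>0 p) < \<epsilon>)"
      using F'' same[OF g1 p] by auto
  qed
  moreover have "uniform_limit (cball (ctr s) (e s)) (\<lambda>i. G i s) (G0 s) F" if s: "s \<in> SP" for s
    unfolding uniform_limit_iff
  proof (intro allI impI, rule tendsto_by_subfilters)
    fix \<epsilon> :: real and F' assume e: "0 < \<epsilon>" and F': "F' \<le> F" "F' \<noteq> bot"
    obtain F'' \<phi>1 G1 where F'': "F'' \<le> F'" "F'' \<noteq> bot" and g1: "germs m0 T0 G1 \<phi>1" "\<forall>q\<in>Z. \<phi>1 q = b q"
      and u1: "\<forall>s\<in>SP. uniform_limit (cball (ctr s) (e s)) (\<lambda>i. G i s) (G1 s) F''"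
      using cl[OF F'] by blast
    have "\<forall>\<^sub>F i in F''. \<forall>z\<in>cball (ctr s) (e s). dist (G i s z) (G1 s z) < \<epsilon>"
      using u1 s e by (simp add: uniform_limit_iff)
    then have "\<forall>\<^sub>F i in F''. \<forall>z\<in>cball (ctr s) (e s). dist (G i s z) (G0 s z) < \<epsilon>"
      by eventually_elim (simp add: sameG[OF g1 s])
    then show "\<exists>F''\<le>F'. F'' \<noteq> bot \<and> (\<forall>\<^sub>F i in F''. \<forall>z\<in>cball (ctr s) (e s). dist (G i s z) (G0 s z) < \<epsilon>)"
      using F'' by blast
  qed
  ultimately show ?thesis using g0 by blast
qed

end

section \<open>Functions of class \<open>C\<^sup>k\<close>\<close>

lemma partial_eqI:
  "((\<lambda>t. f (u + t *\<^sub>R axis i 1)) has_vector_derivative D) (at 0) \<Longrightarrow> partial i f u = D"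
  unfolding partial_def by (rule vector_derivative_at)

lemma has_derivative_imp_partial:
  assumes "(f has_derivative D) (at u)"
  shows "((\<lambda>t. f (u + t *\<^sub>R axis i 1)) has_vector_derivative D (axis i 1)) (at 0)"
proof -
  have "((\<lambda>t. f (u + t *\<^sub>R axis i 1)) has_derivative (\<lambda>t. D (t *\<^sub>R axis i 1))) (at 0)"
    by (rule has_derivative_compose[of "\<lambda>t. u + t *\<^sub>R axis i 1" "\<lambda>t. t *\<^sub>R axis i 1" 0 _ f])
       (use assms in \<open>auto intro!: derivative_eq_intros\<close>)
  then show ?thesis
    unfolding has_vector_derivative_def using linear_scale[OF has_derivative_linear[OF assms]] by simp
qed

lemma has_derivative_partial:
  "(f has_derivative D) (at u) \<Longrightarrow> partial i f u = D (axis i 1)"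
  by (rule partial_eqI[OF has_derivative_imp_partial])

lemma differentiable_has_partial:
  assumes "f differentiable at u"
  shows "((\<lambda>t. f (u + t *\<^sub>R axis i 1)) has_vector_derivative partial i f u) (at 0)"
proof -
  obtain D where "(f has_derivative D) (at u)" using assms by (auto simp: differentiable_def)
  then show ?thesis using has_derivative_imp_partial has_derivative_partial by metis
qed

lemma differentiable_has_partial_line:
  assumes "f differentiable at (v + s *\<^sub>R axis i 1)"
  shows "((\<lambda>t. f (v + t *\<^sub>R axis i 1)) has_vector_derivative partial i f (v + s *\<^sub>R axis i 1)) (at s)"
proof -
  obtain D where D: "(f has_derivative D) (at (v + s *\<^sub>R axis i 1))" using assms by (auto simp: differentiable_def)
  have "((\<lambda>t. f (v + t *\<^sub>R axis i 1)) has_derivative (\<lambda>t. D (t *\<^sub>R axis i 1))) (at s)"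
    by (rule has_derivative_compose[of "\<lambda>t. v + t *\<^sub>R axis i 1" "\<lambda>t. t *\<^sub>R axis i 1" s _ f])
       (use D in \<open>auto intro!: derivative_eq_intros\<close>)
  then show ?thesis
    unfolding has_vector_derivative_def using linear_scale[OF has_derivative_linear[OF D]] has_derivative_partial[OF D] by simp
qed

lemma eventually_line_in_open:
  fixes u v :: "'a::real_normed_vector"
  assumes "open W" "u \<in> W" shows "\<forall>\<^sub>F t in nhds 0. u + t *\<^sub>R v \<in> W"
proof -
  have "((\<lambda>t. u + t *\<^sub>R v) \<longlongrightarrow> u + 0 *\<^sub>R v) (nhds 0)"
    by (intro tendsto_intros filterlim_ident)
  then show ?thesis using assms topological_tendstoD[of "\<lambda>t. u + t *\<^sub>R v" "u + 0 *\<^sub>R v" "nhds 0" W] by simp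
qed

lemma partial_cong_open:
  assumes "open W" "u \<in> W" "\<And>v. v \<in> W \<Longrightarrow> f v = g v"
  shows "partial i f u = partial i g u"
proof -
  have ev: "\<forall>\<^sub>F t in nhds 0. f (u + t *\<^sub>R axis i 1) = g (u + t *\<^sub>R axis i 1)"
    using eventually_line_in_open[OF assms(1,2)] by eventually_elim (rule assms(3))
  show ?thesis unfolding partial_def
    by (rule vector_derivative_cong_eq) (use ev assms(2,3) in \<open>auto elim: eventually_mono\<close>)
qed

lemma Ck_on_cong:
  assumes "open W"
  shows "(\<And>v. v \<in> W \<Longrightarrow> f v = g v) \<Longrightarrow> Ck_on k W f \<Longrightarrow> Ck_on k W g"
proof (induction k arbitrary: f g)
  case 0 then show ?case using continuous_on_cong by force
next
  case (Suc k)
  have "g differentiable at u" if u: "u \<in> W" for u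
  proof -
    obtain D where D: "(f has_derivative D) (at u)" using Suc.prems(2) u by (auto simp: differentiable_def)
    have "(g has_derivative D) (at u)"
      by (rule has_derivative_transform_within_open[OF D assms u]) (rule Suc.prems(1))
    then show ?thesis by (auto simp: differentiable_def)
  qed
  moreover have "Ck_on k W (partial i g)" for i
  proof (rule Suc.IH)
    show "partial i f v = partial i g v" if "v \<in> W" for v
      by (rule partial_cong_open[OF assms that Suc.prems(1)])
    show "Ck_on k W (partial i f)" using Suc.prems(2) by simp
  qed
  ultimately show ?case by simp
qed

lemma Ck_on_imp_continuous: "Ck_on k W f \<Longrightarrow> continuous_on W f"
proof (cases k)
  case (Suc n)
  assume "Ck_on k W f"
  then show ?thesis using Suc
    by (auto intro!: continuous_at_imp_continuous_on differentiable_imp_continuous_within)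
qed auto

lemma Ck_on_SucD: "Ck_on (Suc k) W f \<Longrightarrow> Ck_on k W f"
proof (induction k arbitrary: f)
  case 0 then show ?case using Ck_on_imp_continuous by (metis Ck_on.simps(1))
next
  case (Suc k) then show ?case using Ck_on.simps(2) by blast
qed

lemma Ck_on_subset: "Ck_on k W f \<Longrightarrow> V \<subseteq> W \<Longrightarrow> Ck_on k V f"
  by (induction k arbitrary: f) (auto intro: continuous_on_subset)

lemma Ck_on_const [simp]: "Ck_on k W (\<lambda>_::real^'n::finite. c)"
proof (induction k arbitrary: c)
  case (Suc k)
  have "partial i (\<lambda>_::real^'n. c) = (\<lambda>_. 0)" for i by (rule ext) (simp add: partial_def)
  then show ?case using Suc by simp
qed auto

lemma Ck_on_add:
  assumes "open W" shows "Ck_on k W f \<Longrightarrow> Ck_on k W g \<Longrightarrow> Ck_on k W (\<lambda>u. f u + g u)"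
proof (induction k arbitrary: f g)
  case (Suc k)
  have "Ck_on k W (partial i (\<lambda>u. f u + g u))" for i
  proof (rule Ck_on_cong[OF assms])
    show "Ck_on k W (\<lambda>u. partial i f u + partial i g u)" using Suc by simp
    show "partial i f v + partial i g v = partial i (\<lambda>u. f u + g u) v" if "v \<in> W" for v
      by (rule partial_eqI[symmetric], intro has_vector_derivative_add differentiable_has_partial) (use Suc.prems that in auto)
  qed
  then show ?case using Suc.prems by (simp add: differentiable_add)
qed (auto intro!: continuous_intros)

lemma Ck_on_bounded_linear:
  assumes "open W" "bounded_linear h" shows "Ck_on k W f \<Longrightarrow> Ck_on k W (\<lambda>u. h (f u))"
proof (induction k arbitrary: f)
  case 0 then show ?case using bounded_linear.continuous_on[OF assms(2)] by auto
next
  case (Suc k)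
  have "Ck_on k W (partial i (\<lambda>u. h (f u)))" for i
  proof (rule Ck_on_cong[OF assms(1)])
    show "Ck_on k W (\<lambda>u. h (partial i f u))" using Suc by simp
    show "h (partial i f v) = partial i (\<lambda>u. h (f u)) v" if "v \<in> W" for v
      by (rule partial_eqI[symmetric], rule bounded_linear.has_vector_derivative[OF assms(2)], rule differentiable_has_partial)
         (use Suc.prems that in auto)
  qed
  moreover have "(\<lambda>u. h (f u)) differentiable at u" if "u \<in> W" for u
    using Suc.prems that bounded_linear.has_derivative[OF assms(2)] by (auto simp: differentiable_def) blast
  ultimately show ?case by simp
qed

lemma Ck_on_bilinear:
  assumes "open W" "bounded_bilinear pr"
  shows "Ck_on k W f \<Longrightarrow> Ck_on k W g \<Longrightarrow> Ck_on k W (\<lambda>u. pr (f u) (g u))"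
proof (induction k arbitrary: f g)
  case 0 then show ?case using bounded_bilinear.continuous_on[OF assms(2)] by auto
next
  case (Suc k)
  have "Ck_on k W (partial i (\<lambda>u. pr (f u) (g u)))" for i
  proof (rule Ck_on_cong[OF assms(1)])
    show "Ck_on k W (\<lambda>u. pr (f u) (partial i g u) + pr (partial i f u) (g u))"
      using Suc Ck_on_SucD[OF Suc.prems(1)] Ck_on_SucD[OF Suc.prems(2)] by (intro Ck_on_add[OF assms(1)] Suc.IH) auto
    show "pr (f v) (partial i g v) + pr (partial i f v) (g v) = partial i (\<lambda>u. pr (f u) (g u)) v" if "v \<in> W" for v
    proof (rule partial_eqI[symmetric])
      have "f differentiable at v" "g differentiable at v" using Suc.prems that by auto
      then show "((\<lambda>t. pr (f (v + t *\<^sub>R axis i 1)) (g (v + t *\<^sub>R axis i 1))) has_vector_derivative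
          pr (f v) (partial i g v) + pr (partial i f v) (g v)) (at 0)"
        using bounded_bilinear.has_vector_derivative[OF assms(2) differentiable_has_partial differentiable_has_partial, of f v g v i i] by simp
    qed
  qed
  moreover have "(\<lambda>u. pr (f u) (g u)) differentiable at u" if "u \<in> W" for u
    using Suc.prems that bounded_bilinear.FDERIV[OF assms(2)] by (auto simp: differentiable_def) blast
  ultimately show ?case by simp
qed

lemma Ck_on_sum:
  assumes "open W" "\<And>i. i \<in> I \<Longrightarrow> Ck_on k W (f i)" shows "Ck_on k W (\<lambda>u. \<Sum>i\<in>I. f i u)"
  using assms(2) by (induction I rule: infinite_finite_induct) (auto intro: Ck_on_add[OF assms(1)])

text \<open>The partial derivatives are products of the inverse itself with partials of
  \<open>f\<close>, so the induction hypothesis for the inverse closes the induction. The square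
  root below follows the same pattern.\<close>

lemma Ck_on_inverse:
  fixes f :: "real^'n::finite \<Rightarrow> real"
  assumes "open W" "\<And>u. u \<in> W \<Longrightarrow> f u \<noteq> 0" shows "Ck_on k W f \<Longrightarrow> Ck_on k W (\<lambda>u. inverse (f u))"
proof (induction k)
  case 0 then show ?case using assms by (auto intro!: continuous_intros)
next
  case (Suc k)
  have IH: "Ck_on k W (\<lambda>u. inverse (f u))" by (rule Suc.IH[OF Ck_on_SucD[OF Suc.prems]])
  have "Ck_on k W (partial i (\<lambda>u. inverse (f u)))" for i
  proof (rule Ck_on_cong[OF assms(1)])
    show "Ck_on k W (\<lambda>u. - (inverse (f u) * partial i f u * inverse (f u)))"
      using Suc.prems IH
      by (intro Ck_on_bounded_linear[OF assms(1) bounded_linear_minus[OF bounded_linear_ident]] Ck_on_bilinear[OF assms(1) bounded_bilinear_mult]) auto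
    show "- (inverse (f v) * partial i f v * inverse (f v)) = partial i (\<lambda>u. inverse (f u)) v" if "v \<in> W" for v
    proof (rule partial_eqI[symmetric])
      have "((\<lambda>t. f (v + t *\<^sub>R axis i 1)) has_real_derivative partial i f v) (at 0)"
        using differentiable_has_partial[of f v i] Suc.prems that by (simp add: has_real_derivative_iff_has_vector_derivative)
      then have "((\<lambda>t. inverse (f (v + t *\<^sub>R axis i 1))) has_real_derivative - (inverse (f (v + 0 *\<^sub>R axis i 1)) * partial i f v * inverse (f (v + 0 *\<^sub>R axis i 1)))) (at 0)"
        by (rule DERIV_inverse') (use assms(2)[OF that] in simp)
      then show "((\<lambda>t. inverse (f (v + t *\<^sub>R axis i 1))) has_vector_derivative - (inverse (f v) * partial i f v * inverse (f v))) (at 0)"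
        by (simp add: has_real_derivative_iff_has_vector_derivative)
    qed
  qed
  moreover have "(\<lambda>u. inverse (f u)) differentiable at u" if "u \<in> W" for u
    using Suc.prems that assms(2) by (intro differentiable_inverse) auto
  ultimately show ?case by simp
qed

lemma Ck_on_sqrt:
  fixes f :: "real^'n::finite \<Rightarrow> real"
  assumes "open W" "\<And>u. u \<in> W \<Longrightarrow> 0 < f u" shows "Ck_on k W f \<Longrightarrow> Ck_on k W (\<lambda>u. sqrt (f u))"
proof (induction k)
  case 0 then show ?case using assms by (auto intro!: continuous_intros)
next
  case (Suc k)
  have nz: "sqrt (f u) \<noteq> 0" if "u \<in> W" for u using assms(2)[OF that] by simp
  have IH: "Ck_on k W (\<lambda>u. sqrt (f u))" by (rule Suc.IH[OF Ck_on_SucD[OF Suc.prems]])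
  have "Ck_on k W (partial i (\<lambda>u. sqrt (f u)))" for i
  proof (rule Ck_on_cong[OF assms(1)])
    show "Ck_on k W (\<lambda>u. partial i f u * (inverse (sqrt (f u)) * (1/2)))"
      using Suc.prems IH nz
      by (intro Ck_on_bilinear[OF assms(1) bounded_bilinear_mult] Ck_on_inverse[OF assms(1)]) auto
    show "partial i f v * (inverse (sqrt (f v)) * (1/2)) = partial i (\<lambda>u. sqrt (f u)) v" if "v \<in> W" for v
    proof (rule partial_eqI[symmetric])
      have "((\<lambda>t. f (v + t *\<^sub>R axis i 1)) has_real_derivative partial i f v) (at 0)"
        using differentiable_has_partial[of f v i] Suc.prems that by (simp add: has_real_derivative_iff_has_vector_derivative)
      moreover have "(sqrt has_real_derivative inverse (sqrt (f v)) / 2) (at (f (v + 0 *\<^sub>R axis i 1)))"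
        using DERIV_real_sqrt[OF assms(2)[OF that]] by simp
      ultimately have "((\<lambda>t. sqrt (f (v + t *\<^sub>R axis i 1))) has_real_derivative inverse (sqrt (f v)) / 2 * partial i f v) (at 0)"
        by (rule DERIV_chain2[rotated])
      then show "((\<lambda>t. sqrt (f (v + t *\<^sub>R axis i 1))) has_vector_derivative partial i f v * (inverse (sqrt (f v)) * (1/2))) (at 0)"
        by (simp add: has_real_derivative_iff_has_vector_derivative mult.commute)
    qed
  qed
  moreover have "(\<lambda>u. sqrt (f u)) differentiable at u" if "u \<in> W" for u
  proof -
    have "f differentiable at u" using Suc.prems that by simp
    then obtain D where D: "(f has_derivative D) (at u)" unfolding differentiable_def by blast
    then show ?thesis using has_derivative_real_sqrt[OF assms(2)[OF that] D] unfolding differentiable_def by blast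
  qed
  ultimately show ?case by simp
qed

text \<open>The increment is telescoped one coordinate at a time, as an induction over sets of
  coordinates. Each one-variable increment is compared with its linear part by the mean value
  inequality and continuity of the partials.\<close>

lemma continuous_partials_imp_has_derivative:
  fixes f :: "real^'n::finite \<Rightarrow> 'b::real_normed_vector"
  assumes W: "open W" "u \<in> W"
    and par: "\<And>v i. v \<in> W \<Longrightarrow> ((\<lambda>t. f (v + t *\<^sub>R axis i 1)) has_vector_derivative f' i v) (at 0)"
    and cont: "\<And>i. continuous_on W (f' i)"
  shows "(f has_derivative (\<lambda>h. \<Sum>i\<in>UNIV. (h $ i) *\<^sub>R f' i u)) (at u)"
proof -
  have line: "((\<lambda>t. f (v + t *\<^sub>R axis i 1)) has_vector_derivative f' i (v + s *\<^sub>R axis i 1)) (at s)"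
    if "v + s *\<^sub>R axis i 1 \<in> W" for v s i
  proof -
    have "((\<lambda>t. f ((v + s *\<^sub>R axis i 1) + t *\<^sub>R axis i 1)) has_vector_derivative f' i (v + s *\<^sub>R axis i 1)) (at (s - s))"
      using par[OF that] by simp
    then have "(((\<lambda>t. f ((v + s *\<^sub>R axis i 1) + t *\<^sub>R axis i 1)) \<circ> (\<lambda>t. t - s)) has_vector_derivative (1 *\<^sub>R f' i (v + s *\<^sub>R axis i 1))) (at s)"
      by (intro vector_diff_chain_at) (auto intro!: derivative_eq_intros)
    then show ?thesis by (simp add: comp_def algebra_simps)
  qed
  have key: "\<exists>\<delta>>0. \<forall>h. norm h < \<delta> \<longrightarrow> norm (f (u + (\<Sum>i\<in>S. (h $ i) *\<^sub>R axis i 1)) - f u - (\<Sum>i\<in>S. (h $ i) *\<^sub>R f' i u)) \<le> \<epsilon> * norm h"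
    if "0 < \<epsilon>" "finite S" for S :: "'n set" and \<epsilon> :: real
    using that(2,1)
  proof (induction S arbitrary: \<epsilon> rule: finite_induct)
    case empty then show ?case by (intro exI[of _ 1]) auto
  next
    case (insert i S)
    obtain d1 where d1: "0 < d1" "\<And>h. norm h < d1 \<Longrightarrow>
        norm (f (u + (\<Sum>i\<in>S. (h $ i) *\<^sub>R axis i 1)) - f u - (\<Sum>i\<in>S. (h $ i) *\<^sub>R f' i u)) \<le> \<epsilon> / 2 * norm h"
      using insert.IH[of "\<epsilon>/2"] insert.prems by auto
    obtain d2 where d2: "0 < d2" "ball u d2 \<subseteq> W" using W open_contains_ball_eq by metis
    have "isCont (f' i) u" using cont W by (simp add: continuous_on_eq_continuous_at)
    then obtain d3 where d3: "0 < d3" "\<And>v. dist v u < d3 \<Longrightarrow> dist (f' i v) (f' i u) < \<epsilon> / 2"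
      using insert.prems unfolding continuous_at_eps_delta by (metis half_gt_zero)
    \<comment> \<open>Every intermediate point differs from \<open>u\<close> by at most this many
      vectors, each of norm at most that of \<open>h\<close>.\<close>
    define n where "n = real (CARD('n)) + 1"
    define \<delta> where "\<delta> = min d1 (min d2 d3 / n)"
    have n: "1 \<le> n" by (simp add: n_def)
    have pos: "0 < \<delta>" using d1 d2 d3 n by (simp add: \<delta>_def)
    show ?case
    proof (intro exI[of _ \<delta>] conjI pos allI impI)
      fix h :: "real^'n" assume h: "norm h < \<delta>"
      define v where "v = u + (\<Sum>i\<in>S. (h $ i) *\<^sub>R axis i (1::real))"
      have small: "dist (v + s *\<^sub>R axis i 1) u < min d2 d3" if "s \<in> closed_segment 0 (h $ i)" for s
      proof -
        have s: "\<bar>s\<bar> \<le> norm h" using that component_le_norm_cart[of h i]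
          by (auto simp: closed_segment_eq_real_ivl split: if_splits)
        have "norm (v + s *\<^sub>R axis i 1 - u) \<le> norm (\<Sum>i\<in>S. (h $ i) *\<^sub>R axis i (1::real)) + norm (s *\<^sub>R axis i (1::real))"
        proof -
          have "v + s *\<^sub>R axis i 1 - u = (\<Sum>i\<in>S. (h $ i) *\<^sub>R axis i (1::real)) + s *\<^sub>R axis i (1::real)"
            by (simp add: v_def)
          then show ?thesis by (simp only: norm_triangle_ineq)
        qed
        also have "\<dots> \<le> (\<Sum>i\<in>S. norm h) + norm h"
          by (intro add_mono order_trans[OF norm_sum] sum_mono) (use s in \<open>auto simp: norm_axis_1 component_le_norm_cart\<close>)
        also have "\<dots> \<le> n * norm h"
        proof -
          have "real (card S) * norm h \<le> real CARD('n) * norm h"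
            using card_mono[of UNIV S] by (intro mult_right_mono) auto
          then show ?thesis by (simp add: n_def algebra_simps)
        qed
        also have "\<dots> < n * (min d2 d3 / n)" using h n by (intro mult_strict_left_mono) (auto simp: \<delta>_def)
        finally show ?thesis using n by (simp add: dist_norm)
      qed
      \<comment> \<open>Subtracting the linear part leaves a function of one variable whose
        derivative is a difference of nearby values of \<open>f' i\<close>, hence small.\<close>
      define g where "g s = f (v + s *\<^sub>R axis i 1) - s *\<^sub>R f' i u" for s
      have "norm (g (h $ i) - g 0) \<le> \<epsilon> / 2 * norm (h $ i - 0)"
      proof (rule differentiable_bound[where S = "closed_segment 0 (h $ i)" and f = g and f' = "\<lambda>s x. x *\<^sub>R (f' i (v + s *\<^sub>R axis i 1) - f' i u)"])
        fix s assume s: "s \<in> closed_segment 0 (h $ i)"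
        have "v + s *\<^sub>R axis i 1 \<in> W" using small[OF s] d2(2) by (auto simp: dist_commute subset_iff)
        then have "(g has_vector_derivative f' i (v + s *\<^sub>R axis i 1) - f' i u) (at s within closed_segment 0 (h $ i))"
          unfolding g_def by (intro has_vector_derivative_diff has_vector_derivative_at_within[OF line])
            (auto intro!: derivative_eq_intros)
        then show "(g has_derivative (\<lambda>x. x *\<^sub>R (f' i (v + s *\<^sub>R axis i 1) - f' i u))) (at s within closed_segment 0 (h $ i))"
          by (simp add: has_vector_derivative_def)
        have b: "norm (f' i (v + s *\<^sub>R axis i 1) - f' i u) \<le> \<epsilon> / 2" using d3(2) small[OF s] by (auto simp: dist_norm less_imp_le)
        show "onorm (\<lambda>x. x *\<^sub>R (f' i (v + s *\<^sub>R axis i 1) - f' i u)) \<le> \<epsilon> / 2"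
        proof (rule onorm_le)
          fix x :: real
          show "norm (x *\<^sub>R (f' i (v + s *\<^sub>R axis i 1) - f' i u)) \<le> \<epsilon> / 2 * norm x"
            using mult_left_mono[OF b abs_ge_zero[of x]] by (simp add: mult.commute)
        qed
      qed auto
      also have "\<dots> \<le> \<epsilon> / 2 * norm h"
        using component_le_norm_cart[of h i] insert.prems by simp
      finally have 1: "norm (f (v + (h $ i) *\<^sub>R axis i 1) - f v - (h $ i) *\<^sub>R f' i u) \<le> \<epsilon> / 2 * norm h"
        by (simp add: g_def algebra_simps)
      have 2: "norm (f v - f u - (\<Sum>i\<in>S. (h $ i) *\<^sub>R f' i u)) \<le> \<epsilon> / 2 * norm h"
        unfolding v_def using h by (intro d1(2)) (simp add: \<delta>_def)
      have "norm ((f (v + (h $ i) *\<^sub>R axis i 1) - f v - (h $ i) *\<^sub>R f' i u) + (f v - f u - (\<Sum>i\<in>S. (h $ i) *\<^sub>R f' i u))) \<le> \<epsilon> * norm h"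
        by (rule order_trans[OF norm_triangle_ineq], rule order_trans[OF add_mono[OF 1 2]]) simp
      moreover have "v + (h $ i) *\<^sub>R axis i 1 = u + (\<Sum>i\<in>insert i S. (h $ i) *\<^sub>R axis i 1)"
        using insert.hyps by (simp add: v_def algebra_simps)
      ultimately show "norm (f (u + (\<Sum>i\<in>insert i S. (h $ i) *\<^sub>R axis i 1)) - f u - (\<Sum>i\<in>insert i S. (h $ i) *\<^sub>R f' i u)) \<le> \<epsilon> * norm h"
        using insert.hyps by (simp add: algebra_simps)
    qed
  qed
  have sum_axis: "(\<Sum>i\<in>UNIV. (h $ i) *\<^sub>R axis i 1) = h" for h :: "real^'n"
    using basis_expansion[of h] by (simp add: scalar_mult_eq_scaleR)
  show ?thesis
    unfolding has_derivative_at_alt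
  proof (intro conjI allI impI)
    show "bounded_linear (\<lambda>h. \<Sum>i\<in>UNIV. (h $ i) *\<^sub>R f' i u)"
      by (intro bounded_linear_sum bounded_linear_scaleR_const bounded_linear_vec_nth)
    fix \<epsilon> :: real assume "0 < \<epsilon>"
    from key[OF this finite[of UNIV], unfolded sum_axis] obtain \<delta> where d: "0 < \<delta>"
      "\<forall>h. norm h < \<delta> \<longrightarrow> norm (f (u + h) - f u - (\<Sum>i\<in>UNIV. (h $ i) *\<^sub>R f' i u)) \<le> \<epsilon> * norm h"
      by (elim exE conjE)
    show "\<exists>d>0. \<forall>y. norm (y - u) < d \<longrightarrow> norm (f y - f u - (\<Sum>i\<in>UNIV. ((y - u) $ i) *\<^sub>R f' i u)) \<le> \<epsilon> * norm (y - u)"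
    proof (intro exI[of _ \<delta>] conjI d(1) allI impI)
      fix y assume "norm (y - u) < \<delta>"
      with d(2)[rule_format, of "y - u"]
      show "norm (f y - f u - (\<Sum>i\<in>UNIV. ((y - u) $ i) *\<^sub>R f' i u)) \<le> \<epsilon> * norm (y - u)" by simp
    qed
  qed
qed

text \<open>The second difference of \<open>f\<close> over a square of side t is symmetric in the
  two directions. Two applications of the mean value theorem turn it into t * t times either mixed
  partial at a nearby point, and continuity lets the square shrink.\<close>

lemma partial_commute_real:
  fixes f :: "real^'n::finite \<Rightarrow> real"
  assumes W: "open W" "u \<in> W" and C: "Ck_on 2 W f"
  shows "partial i (partial j f) u = partial j (partial i f) u"
proof -
  have C': "f differentiable at v" "partial k f differentiable at v" "continuous_on W (partial l (partial k f))" if "v \<in> W" for v k l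
    using C that by (auto simp: numeral_2_eq_2)
  obtain d where d: "0 < d" "ball u d \<subseteq> W" using W open_contains_ball_eq by metis
  have quad: "\<exists>x y. 0 < x \<and> x < t \<and> 0 < y \<and> y < t \<and>
      f (u + t *\<^sub>R axis k 1 + t *\<^sub>R axis l 1) - f (u + t *\<^sub>R axis k 1) - f (u + t *\<^sub>R axis l 1) + f u
      = t * t * partial k (partial l f) (u + x *\<^sub>R axis k 1 + y *\<^sub>R axis l 1)"
    if t: "0 < t" "t < d / 2" for t k l
  proof -
    have inW: "u + x *\<^sub>R axis k 1 + y *\<^sub>R axis l 1 \<in> W" if "0 \<le> x" "x \<le> t" "0 \<le> y" "y \<le> t" for x y
    proof -
      have "norm (x *\<^sub>R axis k (1::real) + y *\<^sub>R axis l 1) \<le> x + y"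
        using that norm_triangle_ineq[of "x *\<^sub>R axis k (1::real)" "y *\<^sub>R axis l 1"] by (simp add: norm_axis_1)
      moreover have "dist u (u + x *\<^sub>R axis k 1 + y *\<^sub>R axis l 1) = norm (x *\<^sub>R axis k (1::real) + y *\<^sub>R axis l 1)"
        by (metis add.assoc add_diff_cancel_left' dist_commute dist_norm)
      ultimately show ?thesis using that t by (intro subsetD[OF d(2)]) simp
    qed
    define g where "g y = f (u + t *\<^sub>R axis k 1 + y *\<^sub>R axis l 1) - f (u + 0 *\<^sub>R axis k 1 + y *\<^sub>R axis l 1)" for y
    have "\<exists>y. 0 < y \<and> y < t \<and> g t - g 0 = (t - 0) * (partial l f (u + t *\<^sub>R axis k 1 + y *\<^sub>R axis l 1) - partial l f (u + 0 *\<^sub>R axis k 1 + y *\<^sub>R axis l 1))"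
    proof (rule MVT2[OF t(1)])
      fix y assume y: "0 \<le> y" "y \<le> t"
      show "(g has_real_derivative partial l f (u + t *\<^sub>R axis k 1 + y *\<^sub>R axis l 1) - partial l f (u + 0 *\<^sub>R axis k 1 + y *\<^sub>R axis l 1)) (at y)"
        unfolding g_def using inW[of t y] inW[of 0 y] y t
        by (intro DERIV_diff) (auto simp: has_real_derivative_iff_has_vector_derivative intro!: differentiable_has_partial_line C'(1))
    qed
    then obtain y where y: "0 < y" "y < t" "g t - g 0 = t * (partial l f (u + t *\<^sub>R axis k 1 + y *\<^sub>R axis l 1) - partial l f (u + 0 *\<^sub>R axis k 1 + y *\<^sub>R axis l 1))" by auto
    have "\<exists>x. 0 < x \<and> x < t \<and> partial l f (u + y *\<^sub>R axis l 1 + t *\<^sub>R axis k 1) - partial l f (u + y *\<^sub>R axis l 1 + 0 *\<^sub>R axis k 1)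
        = (t - 0) * partial k (partial l f) (u + y *\<^sub>R axis l 1 + x *\<^sub>R axis k 1)"
    proof (rule MVT2[OF t(1)])
      fix x assume x: "0 \<le> x" "x \<le> t"
      have "u + y *\<^sub>R axis l 1 + x *\<^sub>R axis k 1 \<in> W" using inW[of x y] x y by (simp add: ac_simps)
      then show "((\<lambda>x. partial l f (u + y *\<^sub>R axis l 1 + x *\<^sub>R axis k 1)) has_real_derivative
          partial k (partial l f) (u + y *\<^sub>R axis l 1 + x *\<^sub>R axis k 1)) (at x)"
        unfolding has_real_derivative_iff_has_vector_derivative by (intro differentiable_has_partial_line C'(2))
    qed
    then obtain x where x: "0 < x" "x < t" "partial l f (u + t *\<^sub>R axis k 1 + y *\<^sub>R axis l 1) - partial l f (u + 0 *\<^sub>R axis k 1 + y *\<^sub>R axis l 1)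
        = t * partial k (partial l f) (u + x *\<^sub>R axis k 1 + y *\<^sub>R axis l 1)" by (auto simp: ac_simps)
    show ?thesis
      using x y by (intro exI[of _ x] exI[of _ y]) (auto simp: g_def)
  qed
  have near: "\<bar>partial k (partial l f) (u + x *\<^sub>R axis k 1 + y *\<^sub>R axis l 1) - partial k (partial l f) u\<bar> < \<epsilon>"
    if "0 < x" "x < t" "0 < y" "y < t" "2 * t < \<delta>" "\<And>v. dist v u < \<delta> \<Longrightarrow> dist (partial k (partial l f) v) (partial k (partial l f) u) < \<epsilon>"
    for x y t \<delta> \<epsilon> k l
  proof -
    have "norm (x *\<^sub>R axis k (1::real) + y *\<^sub>R axis l 1) \<le> x + y"
      using that norm_triangle_ineq[of "x *\<^sub>R axis k (1::real)" "y *\<^sub>R axis l 1"] by (simp add: norm_axis_1)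
    then have "dist (u + x *\<^sub>R axis k 1 + y *\<^sub>R axis l 1) u < \<delta>" using that by (simp add: dist_norm add.assoc)
    from that(6)[OF this] show ?thesis by (simp add: dist_real_def)
  qed
  have "\<bar>partial i (partial j f) u - partial j (partial i f) u\<bar> \<le> 0"
  proof (rule field_le_epsilon)
    fix \<epsilon> :: real assume e: "0 < \<epsilon>"
    have c: "isCont (partial k (partial l f)) u" for k l using C'(3)[OF W(2)] W by (simp add: continuous_on_eq_continuous_at)
    obtain d1 where d1: "0 < d1" "\<And>v. dist v u < d1 \<Longrightarrow> dist (partial i (partial j f) v) (partial i (partial j f) u) < \<epsilon> / 2"
      using c[of i j] e unfolding continuous_at_eps_delta by (metis half_gt_zero)
    obtain d2 where d2: "0 < d2" "\<And>v. dist v u < d2 \<Longrightarrow> dist (partial j (partial i f) v) (partial j (partial i f) u) < \<epsilon> / 2"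
      using c[of j i] e unfolding continuous_at_eps_delta by (metis half_gt_zero)
    define t where "t = min d (min d1 d2) / 3"
    have t: "0 < t" "t < d / 2" "2 * t < d1" "2 * t < d2" using d(1) d1(1) d2(1) by (auto simp: t_def min_def)
    obtain x y where xy: "0 < x" "x < t" "0 < y" "y < t" "f (u + t *\<^sub>R axis i 1 + t *\<^sub>R axis j 1) - f (u + t *\<^sub>R axis i 1) - f (u + t *\<^sub>R axis j 1) + f u
      = t * t * partial i (partial j f) (u + x *\<^sub>R axis i 1 + y *\<^sub>R axis j 1)" using quad[OF t(1,2)] by blast
    obtain x' y' where xy': "0 < x'" "x' < t" "0 < y'" "y' < t" "f (u + t *\<^sub>R axis j 1 + t *\<^sub>R axis i 1) - f (u + t *\<^sub>R axis j 1) - f (u + t *\<^sub>R axis i 1) + f u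
      = t * t * partial j (partial i f) (u + x' *\<^sub>R axis j 1 + y' *\<^sub>R axis i 1)" using quad[OF t(1,2)] by blast
    have "t * t * partial i (partial j f) (u + x *\<^sub>R axis i 1 + y *\<^sub>R axis j 1) = t * t * partial j (partial i f) (u + x' *\<^sub>R axis j 1 + y' *\<^sub>R axis i 1)"
      using xy(5) xy'(5) by (simp add: algebra_simps)
    then have "partial i (partial j f) (u + x *\<^sub>R axis i 1 + y *\<^sub>R axis j 1) = partial j (partial i f) (u + x' *\<^sub>R axis j 1 + y' *\<^sub>R axis i 1)"
      using t(1) by simp
    moreover have "\<bar>partial i (partial j f) (u + x *\<^sub>R axis i 1 + y *\<^sub>R axis j 1) - partial i (partial j f) u\<bar> < \<epsilon> / 2"
      by (rule near[OF xy(1-4) t(3) d1(2)])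
    moreover have "\<bar>partial j (partial i f) (u + x' *\<^sub>R axis j 1 + y' *\<^sub>R axis i 1) - partial j (partial i f) u\<bar> < \<epsilon> / 2"
      by (rule near[OF xy'(1-4) t(4) d2(2)])
    ultimately show "\<bar>partial i (partial j f) u - partial j (partial i f) u\<bar> \<le> 0 + \<epsilon>" by linarith
  qed
  then show ?thesis by simp
qed

section \<open>Dependence on the parameters\<close>

lemma uniform_limit_compact_joint:
  fixes f :: "'x::t2_space \<Rightarrow> complex \<Rightarrow> complex"
  assumes c: "continuous_on (UNIV \<times> C) (\<lambda>(x, z). f x z)" and C: "compact C"
  shows "uniform_limit C f (f x0) (at x0)"
  unfolding uniform_limit_iff
proof (intro allI impI)
  fix \<epsilon> :: real assume e: "0 < \<epsilon>"
  obtain X0 where X0: "x0 \<in> X0" "open X0" "\<forall>x\<in>X0 \<inter> UNIV. \<forall>t\<in>C. dist ((\<lambda>(x, z). f x z) (x, t)) ((\<lambda>(x, z). f x z) (x0, t)) \<le> \<epsilon> / 2"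
    by (rule continuous_on_prod_compactE[OF c C UNIV_I half_gt_zero[OF e]])
  have "\<forall>\<^sub>F x in at x0. x \<in> X0" using X0(1,2) by (simp add: eventually_at_topological) blast
  then show "\<forall>\<^sub>F x in at x0. \<forall>z\<in>C. dist (f x z) (f x0 z) < \<epsilon>"
    by eventually_elim (use X0(3) e in fastforce)
qed

text \<open>The divided difference at 0, completed by the derivative: it drops the constant term and
  shifts the Taylor series by one.\<close>

definition quot0 :: "(complex \<Rightarrow> complex) \<Rightarrow> complex \<Rightarrow> complex" where
  "quot0 g z = (if z = 0 then deriv g 0 else (g z - g 0) / z)"

lemma quot0_holomorphic: "g holomorphic_on S \<Longrightarrow> open S \<Longrightarrow> quot0 g holomorphic_on S"
  using pole_lemma_open[of g S 0] unfolding quot0_def[abs_def] diff_zero .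

text \<open>Leibniz' rule for g = g 0 + z * quot0 g: of all derivatives of the factor z only the
  first survives at 0, with binomial coefficient m + 1.\<close>

lemma higher_deriv_quot0:
  assumes g: "g holomorphic_on S" "open S" "0 \<in> S"
  shows "(deriv ^^ m) (quot0 g) 0 = (deriv ^^ Suc m) g 0 / of_nat (Suc m)"
proof -
  have q: "quot0 g holomorphic_on S" by (rule quot0_holomorphic[OF g(1,2)])
  have h: "(\<lambda>z. z * quot0 g z) holomorphic_on S" by (intro holomorphic_intros q)
  have "(deriv ^^ Suc m) g 0 = (deriv ^^ Suc m) (\<lambda>z. g 0 + z * quot0 g z) 0"
    by (rule higher_deriv_transform_within_open[OF g(1) _ g(2,3)])
       (intro holomorphic_on_add holomorphic_on_const h, simp add: quot0_def)
  also have "\<dots> = (deriv ^^ Suc m) (\<lambda>z. g 0) 0 + (deriv ^^ Suc m) (\<lambda>z. z * quot0 g z) 0"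
    by (rule higher_deriv_add[OF _ h g(2,3)]) auto
  also have "(deriv ^^ Suc m) (\<lambda>z. g 0) 0 = 0" by simp
  also have "(deriv ^^ Suc m) (\<lambda>z. z * quot0 g z) 0 =
      (\<Sum>i = 0..Suc m. of_nat (Suc m choose i) * (deriv ^^ i) (\<lambda>w. w) 0 * (deriv ^^ (Suc m - i)) (quot0 g) 0)"
    by (rule higher_deriv_mult[OF _ q g(2,3)]) auto
  also have "\<dots> = (\<Sum>i\<in>{1}. of_nat (Suc m choose i) * (deriv ^^ i) (\<lambda>w. w) 0 * (deriv ^^ (Suc m - i)) (quot0 g) 0)"
    by (rule sum.mono_neutral_right) auto
  also have "\<dots> = of_nat (Suc m) * (deriv ^^ m) (quot0 g) 0" by simp
  finally show ?thesis by (simp add: field_simps del: of_nat_Suc funpow.simps)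
qed

locale ba_family = punctured_surface X \<A> SP ch e
  for X :: "'a topology" and \<A> SP ch e +
  fixes P :: "'n::finite \<Rightarrow> 'a" and Z :: "'a set" and U :: "(real ^ 'n) set"
  assumes injP: "inj P" and PSP: "range P \<subseteq> SP" and ctrP: "\<And>j. snd (ch (P j)) (P j) = 0"
    and Z: "Z \<subseteq> topspace X - SP" and U: "open U"
begin

text \<open>The factor that makes a Baker-Akhiezer function with parameter \<open>u\<close> regular:
  the inverse of the essential singularity at the points of \<open>P\<close>, and a linear factor at
  the simple poles, which are the remaining points of \<open>SP\<close>.\<close>

definition mlt :: "real^'n \<Rightarrow> 'a \<Rightarrow> complex \<Rightarrow> complex" where
  "mlt u s z = (if s \<in> range P then exp (- of_real (u $ inv_into UNIV P s) / z) else z - ctr s)"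

definition pp :: "nat \<Rightarrow> ('n \<Rightarrow> nat \<Rightarrow> complex) \<Rightarrow> 'a \<Rightarrow> complex \<Rightarrow> complex" where
  "pp N a s z = (if s \<in> range P then \<Sum>m<N. a (inv_into UNIV P s) m / z ^ Suc m else 0)"

lemma inv_P [simp]: "inv_into UNIV P (P j) = j" using injP by simp

lemma ctr_range: "s \<in> range P \<Longrightarrow> ctr s = 0" using ctrP by auto

lemma P_SP [simp]: "P j \<in> SP" using PSP by blast

lemma mlt_nonzero: "z \<noteq> ctr s \<Longrightarrow> mlt u s z \<noteq> 0" by (simp add: mlt_def)

lemma conv_const:
  "(\<And>s. s \<in> SP \<Longrightarrow> continuous_on (cball (ctr s) (e s) - {ctr s}) (m0 s)) \<Longrightarrow> conv (\<lambda>_. m0) m0 F"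
  unfolding conv_def by (auto intro: uniform_limit_const)

lemma continuous_on_mlt_const: "continuous_on (cball (ctr s) (e s) - {ctr s}) (mlt u s)"
  by (cases "s \<in> range P") (auto simp: mlt_def[abs_def] ctr_range intro!: continuous_intros)

lemma conv_mlt: "conv mlt (mlt u) (at u)"
  unfolding conv_def
proof (intro ballI conjI allI impI continuous_on_mlt_const)
  fix s C assume s: "s \<in> SP" and C: "compact C \<and> C \<subseteq> cball (ctr s) (e s) - {ctr s}"
  show "uniform_limit C (\<lambda>i. mlt i s) (mlt u s) (at u)"
  proof (cases "s \<in> range P")
    case True
    have "continuous_on (UNIV \<times> C) (\<lambda>(x::real^'n, z). exp (- of_real (x $ inv_into UNIV P s) / z))"
      unfolding split_beta using C ctr_range[OF True] by (auto intro!: continuous_intros)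
    from uniform_limit_compact_joint[OF this, of u] show ?thesis using C True by (simp add: mlt_def[abs_def])
  next
    case False
    then show ?thesis by (simp add: mlt_def[abs_def] uniform_limit_const)
  qed
qed

lemma continuous_on_pp: "continuous_on (cball (ctr s) (e s) - {ctr s}) (pp N a s)"
  by (cases "s \<in> range P") (auto simp: pp_def[abs_def] ctr_range intro!: continuous_intros)

lemma conv_pp:
  assumes "\<And>j m. m < N \<Longrightarrow> ((\<lambda>i. a i j m) \<longlongrightarrow> a0 j m) F"
  shows "conv (\<lambda>i. pp N (a i)) (pp N a0) F"
  unfolding conv_def
proof (intro ballI conjI allI impI continuous_on_pp)
  fix s C assume s: "s \<in> SP" and C: "compact C \<and> C \<subseteq> cball (ctr s) (e s) - {ctr s}"
  show "uniform_limit C (\<lambda>i. pp N (a i) s) (pp N a0 s) F"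
  proof (cases "s \<in> range P")
    case True
    have C0: "0 \<notin> C" using C ctr_range[OF True] by auto
    have "uniform_limit C (\<lambda>i z. \<Sum>m<M. a i (inv_into UNIV P s) m / z ^ Suc m) (\<lambda>z. \<Sum>m<M. a0 (inv_into UNIV P s) m / z ^ Suc m) F" if "M \<le> N" for M
      using that
    proof (induction M)
      case (Suc M)
      have "uniform_limit C (\<lambda>i z. a i (inv_into UNIV P s) M) (\<lambda>z. a0 (inv_into UNIV P s) M) F"
        using tendstoD[OF assms[of M "inv_into UNIV P s"]] Suc.prems unfolding uniform_limit_iff by (auto elim!: eventually_mono)
      moreover have "uniform_limit C (\<lambda>i z. 1 / z ^ Suc M) (\<lambda>z. 1 / z ^ Suc M) F" by (rule uniform_limit_const)
      moreover have "bounded ((\<lambda>z. 1 / z ^ Suc M) ` C)"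
        using C C0 by (intro compact_imp_bounded compact_continuous_image continuous_intros) auto
      moreover have "bounded ((\<lambda>z. a0 (inv_into UNIV P s) M) ` C)" by (rule finite_imp_bounded, rule finite_subset[of _ "{a0 (inv_into UNIV P s) M}"]) auto
      ultimately have "uniform_limit C (\<lambda>i z. a i (inv_into UNIV P s) M * (1 / z ^ Suc M)) (\<lambda>z. a0 (inv_into UNIV P s) M * (1 / z ^ Suc M)) F"
        by (intro uniform_lim_mult)
      from uniform_limit_add[OF Suc.IH this] Suc.prems show ?case by simp
    qed (simp add: uniform_limit_const)
    from this[OF order_refl] show ?thesis using True by (simp add: pp_def[abs_def])
  qed (simp add: pp_def[abs_def] uniform_limit_const)
qed

lemma ext_holomorphic_ball: "ext s g \<Longrightarrow> g holomorphic_on ball (ctr s) (e s)"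
  by (simp add: ext_def)

lemma zero_in_ball: "0 \<in> ball (ctr (P j)) (e (P j))"
  using e(1)[of "P j"] by (simp add: ctrP)

lemma tendsto_higher_deriv:
  assumes "uniform_limit (cball (ctr s) (e s)) G0 g F" "\<forall>\<^sub>F i in F. ext s (G0 i)" "F \<noteq> bot" "z \<in> ball (ctr s) (e s)"
  shows "((\<lambda>i. (deriv ^^ m) (G0 i) z) \<longlongrightarrow> (deriv ^^ m) g z) F"
proof (rule higher_deriv_complex_uniform_limit[OF _ _ assms(3) open_ball assms(4)])
  show "uniform_limit (ball (ctr s) (e s)) G0 g F" using assms(1) ball_subset_cball uniform_limit_on_subset by blast
  show "\<forall>\<^sub>F i in F. G0 i holomorphic_on ball (ctr s) (e s)" using assms(2) by eventually_elim (rule ext_holomorphic_ball)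
qed

end

text \<open>Uniqueness in homogeneous form; by linearity it serves both the compactness argument and
  the identification of limits.\<close>

locale ba_unique = ba_family X \<A> SP ch e P Z U
  for X :: "'a topology" and \<A> SP ch e and P :: "'n::finite \<Rightarrow> 'a" and Z and U :: "(real ^ 'n) set" +
  assumes uniq: "\<And>u G \<phi>. u \<in> U \<Longrightarrow> germs (mlt u) (\<lambda>_ _. 0) G \<phi> \<Longrightarrow> \<forall>q\<in>Z. \<phi> q = 0 \<Longrightarrow> \<forall>p\<in>topspace X - SP. \<phi> p = 0"
begin

text \<open>\<open>\<phi> u\<close> solves the problem with essential singularities \<open>exp (u\<^sub>j / z)\<close>, principal parts
  \<open>\<Sum>m<N. a j m u / z\<^bsup>m+1\<^esup>\<close> and prescribed values \<open>b q u\<close> at the points \<open>q\<close> of \<open>Z\<close>.\<close>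

definition fam :: "nat \<Rightarrow> ('n \<Rightarrow> nat \<Rightarrow> real^'n \<Rightarrow> complex) \<Rightarrow> ('a \<Rightarrow> real^'n \<Rightarrow> complex) \<Rightarrow>
    (real^'n \<Rightarrow> 'a \<Rightarrow> complex \<Rightarrow> complex) \<Rightarrow> (real^'n \<Rightarrow> 'a \<Rightarrow> complex) \<Rightarrow> bool" where
  "fam N a b G \<phi> \<longleftrightarrow> (\<forall>u\<in>U. germs (mlt u) (pp N (\<lambda>j m. a j m u)) (G u) (\<phi> u) \<and> (\<forall>q\<in>Z. \<phi> u q = b q u))"

lemma germs_unique:
  assumes u: "u \<in> U" and g: "germs (mlt u) T G \<phi>" "germs (mlt u) T G' \<phi>'" and Z: "\<forall>q\<in>Z. \<phi> q = \<phi>' q"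
  shows "p \<in> topspace X - SP \<Longrightarrow> \<phi> p = \<phi>' p"
    and "s \<in> SP \<Longrightarrow> z \<in> cball (ctr s) (e s) \<Longrightarrow> G s z = G' s z"
proof -
  show 1: "\<phi> p = \<phi>' p" if "p \<in> topspace X - SP" for p
    using uniq[OF u germs_diff[OF g]] Z that by auto
  assume s: "s \<in> SP" and z: "z \<in> cball (ctr s) (e s)"
  have eq: "G s z = G' s z" if zz: "z \<in> cball (ctr s) (e s) - {ctr s}" for z
    using germsD(3)[OF g(1) s, of z] germsD(3)[OF g(2) s, of z] 1[OF punctured_disc_img(2)[OF s zz]] zz by auto
  show "G s z = G' s z"
  proof (cases "z = ctr s")
    case True
    have c: "isCont (G s) (ctr s)" "isCont (G' s) (ctr s)"
      using germsD(2)[OF g(1) s] germsD(2)[OF g(2) s] e(1)[OF s]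
      unfolding ext_def by (auto intro!: continuous_on_interior[of "cball (ctr s) (e s)"])
    have "((\<lambda>z. G' s z) \<longlongrightarrow> G s (ctr s)) (at (ctr s))"
      using c(1)[unfolded isCont_def]
    proof (rule Lim_transform_eventually)
      have "\<forall>\<^sub>F w in at (ctr s). w \<in> ball (ctr s) (e s)"
        using e(1)[OF s] by (intro eventually_at_in_open') auto
      then show "\<forall>\<^sub>F w in at (ctr s). G s w = G' s w"
        using eventually_neq_at_within[of "ctr s" "ctr s"] by eventually_elim (auto intro!: eq)
    qed
    then show ?thesis using c(2)[unfolded isCont_def] tendsto_unique[OF at_neq_bot] True by blast
  qed (use eq z in auto)
qed

text \<open>The convergence theorem is applied with the filter at \<open>u\<close> itself. It
  produces some solution for the data at \<open>u\<close>, which uniqueness identifies with the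
  given one; uniform convergence of the remainders carries over to their derivatives.\<close>

lemma fam_continuous:
  assumes f: "fam N a b G \<phi>" and a: "\<And>j m. m < N \<Longrightarrow> continuous_on U (a j m)" and b: "\<And>q. q \<in> Z \<Longrightarrow> continuous_on U (b q)"
    and u: "u \<in> U"
  shows "p \<in> topspace X - SP \<Longrightarrow> ((\<lambda>v. \<phi> v p) \<longlongrightarrow> \<phi> u p) (at u)"
    and "s \<in> SP \<Longrightarrow> uniform_limit (cball (ctr s) (e s)) (\<lambda>v. G v s) (G u s) (at u)"
    and "s \<in> SP \<Longrightarrow> z \<in> ball (ctr s) (e s) \<Longrightarrow> ((\<lambda>v. (deriv ^^ m) (G v s) z) \<longlongrightarrow> (deriv ^^ m) (G u s) z) (at u)"
proof -
  have lim: "(h \<longlongrightarrow> h u) (at u)" if "continuous_on U h" for h :: "real^'n \<Rightarrow> complex"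
    using that u U by (simp add: continuous_on_eq_continuous_at isCont_def)
  have evU: "\<forall>\<^sub>F v in at u. v \<in> U" using u U by (intro eventually_at_in_open') auto
  have g: "\<forall>\<^sub>F v in at u. germs (mlt v) (pp N (\<lambda>j m. a j m v)) (G v) (\<phi> v)"
    using evU by eventually_elim (use f in \<open>auto simp: fam_def\<close>)
  have bq: "((\<lambda>v. \<phi> v q) \<longlongrightarrow> b q u) (at u)" if "q \<in> Z" for q
    using lim[OF b[OF that]] by (rule Lim_transform_eventually) (use evU f that in \<open>auto simp: fam_def elim!: eventually_mono\<close>)
  have "\<exists>\<phi>0 G0. germs (mlt u) (pp N (\<lambda>j m. a j m u)) G0 \<phi>0 \<and> (\<forall>q\<in>Z. \<phi>0 q = b q u) \<and>
    (\<forall>p\<in>topspace X - SP. ((\<lambda>v. \<phi> v p) \<longlongrightarrow> \<phi>0 p) (at u)) \<and>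
    (\<forall>s\<in>SP. uniform_limit (cball (ctr s) (e s)) (\<lambda>v. G v s) (G0 s) (at u))"
  proof (rule germs_convergence[OF conv_mlt _ _ g Z bq _ at_neq_bot])
    show "conv (\<lambda>v. pp N (\<lambda>j m. a j m v)) (pp N (\<lambda>j m. a j m u)) (at u)" by (intro conv_pp lim a)
  qed (use uniq[OF u] mlt_nonzero in auto)
  then obtain \<phi>0 G0 where g0: "germs (mlt u) (pp N (\<lambda>j m. a j m u)) G0 \<phi>0" "\<forall>q\<in>Z. \<phi>0 q = b q u"
    and l0: "\<forall>p\<in>topspace X - SP. ((\<lambda>v. \<phi> v p) \<longlongrightarrow> \<phi>0 p) (at u)"
    and u0: "\<forall>s\<in>SP. uniform_limit (cball (ctr s) (e s)) (\<lambda>v. G v s) (G0 s) (at u)" by blast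
  have gu: "germs (mlt u) (pp N (\<lambda>j m. a j m u)) (G u) (\<phi> u)" "\<forall>q\<in>Z. \<phi> u q = b q u" using f u by (auto simp: fam_def)
  have same: "\<forall>q\<in>Z. \<phi>0 q = \<phi> u q" using gu(2) g0(2) by simp
  show "((\<lambda>v. \<phi> v p) \<longlongrightarrow> \<phi> u p) (at u)" if "p \<in> topspace X - SP" for p
    using l0[rule_format, OF that] germs_unique(1)[OF u g0(1) gu(1) same that] by simp
  show ul: "uniform_limit (cball (ctr s) (e s)) (\<lambda>v. G v s) (G u s) (at u)" if s: "s \<in> SP" for s
    using u0[rule_format, OF s] germs_unique(2)[OF u g0(1) gu(1) same s]
    by (subst uniform_limit_cong'[of _ "\<lambda>v. G v s" "\<lambda>v. G v s" _ "G0 s"]) auto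
  show "((\<lambda>v. (deriv ^^ m) (G v s) z) \<longlongrightarrow> (deriv ^^ m) (G u s) z) (at u)" if s: "s \<in> SP" "z \<in> ball (ctr s) (e s)"
    by (rule tendsto_higher_deriv[OF ul[OF s(1)] _ at_neq_bot s(2)])
       (use g in eventually_elim, use germsD(2)[OF _ s(1)] in blast)
qed

end

text \<open>The origin of the factor 1 / z in the parameter derivative. Written as 1 / z times
  \<open>quot0 exp\<close> at t / z, the difference quotient is jointly continuous, also at t =
  0.\<close>

lemma uniform_limit_exp_quotient:
  fixes C :: "complex set"
  assumes C: "compact C" "0 \<notin> C"
  shows "uniform_limit C (\<lambda>t z. (exp (of_real t / z) - 1) / of_real t) (\<lambda>z. 1 / z) (at (0::real))"
proof -
  have q0: "quot0 exp 0 = 1" using DERIV_imp_deriv[OF DERIV_exp[of "0::complex"]] by (simp add: quot0_def)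
  have "quot0 exp holomorphic_on UNIV" by (rule quot0_holomorphic) (auto intro!: holomorphic_intros)
  then have c: "continuous_on UNIV (quot0 exp)" by (rule holomorphic_on_imp_continuous_on)
  have "continuous_on (UNIV \<times> C) (\<lambda>(t::real, z). 1 / z * quot0 exp (of_real t / z))"
    unfolding split_beta using C(2) by (auto intro!: continuous_intros continuous_on_compose2[OF c])
  from uniform_limit_compact_joint[OF this C(1), of 0]
  have "uniform_limit C (\<lambda>t z. 1 / z * quot0 exp (of_real t / z)) (\<lambda>z. 1 / z) (at (0::real))"
    by (simp add: q0)
  then show ?thesis
  proof (rule uniform_limit_cong[THEN iffD1, rotated 2])
    show "\<forall>\<^sub>F t in at (0::real). \<forall>z\<in>C. 1 / z * quot0 exp (of_real t / z) = (exp (of_real t / z) - 1) / of_real t"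
      using eventually_neq_at_within[of "0::real" 0]
      by eventually_elim (use C(2) in \<open>auto simp: quot0_def field_simps\<close>)
  qed simp
qed

context ba_unique
begin

lemma filterlim_line: "filterlim (\<lambda>t. u + t *\<^sub>R axis i 1) (at u) (at (0::real))"
  for u :: "real^'n"
proof -
  have "((\<lambda>t. u + t *\<^sub>R axis i 1) \<longlongrightarrow> u + 0 *\<^sub>R axis i 1) (at (0::real))" by (intro tendsto_intros)
  moreover have "\<forall>\<^sub>F t in at (0::real). u + t *\<^sub>R axis i 1 \<noteq> u"
    using eventually_neq_at_within[of "0::real" 0] by eventually_elim (simp add: axis_eq_0_iff)
  ultimately show ?thesis by (simp add: filterlim_at)
qed

lemma vector_derivative_quotient_limit:
  fixes h :: "real \<Rightarrow> complex"
  shows "((\<lambda>t. (h t - h 0) / of_real t) \<longlongrightarrow> D) (at 0) \<longleftrightarrow> (h has_vector_derivative D) (at 0)"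
proof -
  have "(h has_vector_derivative D) (at 0) \<longleftrightarrow> ((\<lambda>t. norm (h (0 + t) - h 0 - t *\<^sub>R D) / norm t) \<longlongrightarrow> 0) (at 0)"
    unfolding has_vector_derivative_def has_derivative_at using bounded_linear_scaleR_left[of D] by blast
  also have "\<dots> \<longleftrightarrow> ((\<lambda>t. norm ((h t - h 0) / of_real t - D)) \<longlongrightarrow> 0) (at 0)"
  proof (rule filterlim_cong[OF refl refl])
    show "\<forall>\<^sub>F t in at 0. norm (h (0 + t) - h 0 - t *\<^sub>R D) / norm t = norm ((h t - h 0) / of_real t - D)"
      using eventually_neq_at_within[of "0::real" 0]
    proof eventually_elim
      case (elim t)
      have "(h t - h 0) / of_real t - D = (h t - h 0 - of_real t * D) / of_real t" using elim by (simp add: field_simps)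
      then show ?case by (simp add: norm_divide scaleR_conv_of_real)
    qed
  qed
  also have "\<dots> \<longleftrightarrow> ((\<lambda>t. (h t - h 0) / of_real t) \<longlongrightarrow> D) (at 0)"
    unfolding tendsto_norm_zero_iff by (rule LIM_zero_iff)
  finally show ?thesis by (rule sym)
qed

text \<open>Coefficients of the singular part of a derivative: the differentiated coefficients and,
  at the point with index \<open>i\<close>, the old expansion multiplied by 1 / z. The value
  \<open>g\<close> of the remainder at 0 becomes the coefficient of 1 / z.\<close>

definition shift_data :: "nat \<Rightarrow> 'n \<Rightarrow> ('n \<Rightarrow> nat \<Rightarrow> complex) \<Rightarrow> ('n \<Rightarrow> nat \<Rightarrow> complex) \<Rightarrow> complex \<Rightarrow> 'n \<Rightarrow> nat \<Rightarrow> complex" where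
  "shift_data N i a a' g j m = (if m < N then a' j m else 0) + (if j = i then (if m = 0 then g else a j (m - 1)) else 0)"

lemma pp_shift:
  assumes "z \<noteq> 0"
  shows "pp (Suc N) (shift_data N i a a' g) (P j) z = pp N a' (P j) z + (if j = i then (pp N a (P i) z + g) / z else 0)"
proof -
  have "(\<Sum>m<Suc N. (if m < N then a' j m else 0) / z ^ Suc m) = (\<Sum>m<N. a' j m / z ^ Suc m)" by simp
  moreover have "(\<Sum>m<Suc N. (if m = 0 then g else a j (m - 1)) / z ^ Suc m) = g / z + (\<Sum>m<N. a j m / z ^ Suc m) / z"
    unfolding sum.lessThan_Suc_shift by (simp add: sum_divide_distrib field_simps)
  ultimately show ?thesis
    by (auto simp: pp_def shift_data_def add_divide_distrib sum.distrib simp del: sum.lessThan_Suc)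
qed

text \<open>Differentiating \<open>\<phi>\<close> in the direction \<open>i\<close> multiplies its singular part at \<open>P\<^sub>i\<close> by \<open>1 / z\<close>.\<close>

lemma fam_partial:
  assumes f: "fam N a b G \<phi>" and a: "\<And>j m. m < N \<Longrightarrow> continuous_on U (a j m)" and b: "\<And>q. q \<in> Z \<Longrightarrow> continuous_on U (b q)"
    and u: "u \<in> U"
    and a': "\<And>j m. m < N \<Longrightarrow> ((\<lambda>t. a j m (u + t *\<^sub>R axis i 1)) has_vector_derivative a' j m) (at 0)"
    and b': "\<And>q. q \<in> Z \<Longrightarrow> ((\<lambda>t. b q (u + t *\<^sub>R axis i 1)) has_vector_derivative b' q) (at 0)"
  shows "\<exists>\<xi> G'. germs (mlt u) (pp (Suc N) (shift_data N i (\<lambda>j m. a j m u) a' (G u (P i) 0))) G' \<xi> \<and> (\<forall>q\<in>Z. \<xi> q = b' q) \<and>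
    (\<forall>p\<in>topspace X - SP. ((\<lambda>t. \<phi> (u + t *\<^sub>R axis i 1) p) has_vector_derivative \<xi> p) (at 0)) \<and>
    (\<forall>j m. ((\<lambda>t. (deriv ^^ m) (G (u + t *\<^sub>R axis i 1) (P j)) 0) has_vector_derivative
        (deriv ^^ m) (G' (P j)) 0 - (if j = i then (deriv ^^ Suc m) (G u (P i)) 0 / of_nat (Suc m) else 0)) (at 0))"
proof -
  define w where "w t = u + t *\<^sub>R axis i (1::real)" for t
  have w0: "w 0 = u" by (simp add: w_def)
  have wl: "filterlim w (at u) (at 0)" unfolding w_def[abs_def] by (rule filterlim_line)
  have evU: "\<forall>\<^sub>F t in at 0. w t \<in> U"
    using filterlim_iff[THEN iffD1, OF wl, rule_format, of "\<lambda>v. v \<in> U"] u U by (simp add: eventually_at_in_open')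
  have ev0: "\<forall>\<^sub>F t in at (0::real). t \<noteq> 0" by (rule eventually_neq_at_within)
  define A where "A t = (\<lambda>j m. a j m (w t))" for t
  \<comment> \<open>The multiplier moves with t as well. Keeping it fixed at \<open>u\<close> makes
    all difference quotients solve problems with one multiplier; the price is the factor exp (t / z)
    - 1 against the moving expansion at \<open>P i\<close>.\<close>
  define T where "T t s z = (if s \<in> range P then (if s = P i then (exp (of_real t / z) - 1) / of_real t * (pp N (A t) s z + G (w t) s z) else 0)
      + pp N (\<lambda>j m. (A t j m - A 0 j m) / of_real t) s z else 0)" for t s z
  define T0 where "T0 s z = (if s \<in> range P then (if s = P i then 1 / z * (pp N (A 0) s z + G u s z) else 0) + pp N a' s z else 0)" for s z
  have gu: "germs (mlt u) (pp N (A 0)) (G u) (\<phi> u)" "\<forall>q\<in>Z. \<phi> u q = b q u" using f u by (auto simp: fam_def A_def w0)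
  have gw: "germs (mlt (w t)) (pp N (A t)) (G (w t)) (\<phi> (w t))" "\<forall>q\<in>Z. \<phi> (w t) q = b q (w t)" if "w t \<in> U" for t
    using f that by (auto simp: fam_def A_def)
  have ag: "((\<lambda>t. A t j m) \<longlongrightarrow> A 0 j m) (at 0)" if "m < N" for j m
    using a[OF that] u U by (auto simp: A_def w0 continuous_on_eq_continuous_at isCont_def intro!: filterlim_compose[OF _ wl])
  have cT: "conv T T0 (at 0)"
    unfolding conv_def
  proof (intro ballI conjI allI impI)
    fix s assume s: "s \<in> SP"
    have Gc: "continuous_on (cball (ctr s) (e s) - {ctr s}) (G u s)"
      using germsD(2)[OF gu(1) s] unfolding ext_def by (auto intro: continuous_on_subset)
    show "continuous_on (cball (ctr s) (e s) - {ctr s}) (T0 s)"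
      using continuous_on_pp[of s] Gc ctr_range[of s]
      by (cases "s \<in> range P"; cases "s = P i") (auto simp: T0_def[abs_def] intro!: continuous_intros)
    fix C assume C: "compact C \<and> C \<subseteq> cball (ctr s) (e s) - {ctr s}"
    show "uniform_limit C (\<lambda>t. T t s) (T0 s) (at 0)"
    proof (cases "s \<in> range P")
      case True
      have C0: "compact C" "0 \<notin> C" using C ctr_range[OF True] by auto
      have "conv (\<lambda>t. pp N (\<lambda>j m. (A t j m - A 0 j m) / of_real t)) (pp N a') (at 0)"
        using a' vector_derivative_quotient_limit[of "\<lambda>t. A t _ _"] by (intro conv_pp) (simp add: A_def w_def)
      then have 1: "uniform_limit C (\<lambda>t. pp N (\<lambda>j m. (A t j m - A 0 j m) / of_real t) s) (pp N a' s) (at 0)"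
        using s C unfolding conv_def by blast
      have "conv (\<lambda>t. pp N (A t)) (pp N (A 0)) (at 0)" by (intro conv_pp ag)
      then have 2: "uniform_limit C (\<lambda>t. pp N (A t) s) (pp N (A 0) s) (at 0)" using s C unfolding conv_def by blast
      have "uniform_limit (cball (ctr s) (e s)) (\<lambda>v. G v s) (G u s) (at u)"
        by (rule fam_continuous(2)[OF f a b u s])
      from filterlim_compose[OF this wl]
      have "uniform_limit (cball (ctr s) (e s)) (\<lambda>t. G (w t) s) (G u s) (at 0)" .
      then have 3: "uniform_limit C (\<lambda>t. G (w t) s) (G u s) (at 0)" using C uniform_limit_on_subset by blast
      have bd: "bounded ((\<lambda>z. 1 / z) ` C)" "bounded ((\<lambda>z. pp N (A 0) s z + G u s z) ` C)"
        using C0 C by (auto intro!: compact_imp_bounded compact_continuous_image continuous_intros continuous_on_subset[OF Gc] continuous_on_subset[OF continuous_on_pp])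
      have "uniform_limit C (\<lambda>t z. (exp (of_real t / z) - 1) / of_real t * (pp N (A t) s z + G (w t) s z)) (\<lambda>z. 1 / z * (pp N (A 0) s z + G u s z)) (at 0)"
        by (intro uniform_lim_mult uniform_limit_exp_quotient C0 uniform_limit_add 2 3 bd)
      from uniform_limit_add[OF this 1] 1 show ?thesis using True by (cases "s = P i") (simp_all add: T_def[abs_def] T0_def[abs_def])
    qed (simp add: T_def[abs_def] T0_def[abs_def] uniform_limit_const)
  qed
  have ge: "\<forall>\<^sub>F t in at 0. germs (mlt u) (T t) (\<lambda>s z. (G (w t) s z - G u s z) / of_real t) (\<lambda>p. (\<phi> (w t) p - \<phi> u p) / of_real t)"
    using evU ev0
  proof eventually_elim
    case (elim t)
    have g: "germs (mlt (w t)) (pp N (A t)) (G (w t)) (\<phi> (w t))" by (rule gw(1)[OF elim(1)])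
    have nz: "complex_of_real t \<noteq> 0" using elim(2) by simp
    have h: "holo (\<lambda>p. (\<phi> (w t) p - \<phi> u p) / of_real t)"
      using germsD(1)[OF g] germsD(1)[OF gu(1)] nz unfolding holo_def by (auto intro!: holomorphic_intros)
    have x: "ext s (\<lambda>z. (G (w t) s z - G u s z) / of_real t)" if "s \<in> SP" for s
      using germsD(2)[OF g that] germsD(2)[OF gu(1) that] nz unfolding ext_def by (auto intro!: holomorphic_intros continuous_intros)
    have "mlt u s z * ((\<phi> (w t) (chart_inv (ch s) z) - \<phi> u (chart_inv (ch s) z)) / of_real t) = T t s z + (G (w t) s z - G u s z) / of_real t"
      if s: "s \<in> SP" and z: "z \<in> cball (ctr s) (e s)" "z \<noteq> ctr s" for s z
    proof -
      define x y where "x = \<phi> (w t) (chart_inv (ch s) z)" and "y = \<phi> u (chart_inv (ch s) z)"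
      have 1: "mlt (w t) s z * x = pp N (A t) s z + G (w t) s z" unfolding x_def by (rule germsD(3)[OF g s z])
      have 2: "mlt u s z * y = pp N (A 0) s z + G u s z" unfolding y_def by (rule germsD(3)[OF gu(1) s z])
      show ?thesis unfolding x_def[symmetric] y_def[symmetric]
      proof (cases "s \<in> range P")
        case True
        then obtain j where j: "s = P j" by blast
        have z0: "z \<noteq> 0" using z(2) ctr_range[OF True] by simp
        have wj: "w t $ j = u $ j + (if j = i then t else 0)" by (simp add: w_def axis_def)
        have ppd: "pp N (\<lambda>j m. (A t j m - A 0 j m) / of_real t) s z = (pp N (A t) s z - pp N (A 0) s z) / of_real t"
          using True by (simp add: pp_def sum_subtractf[symmetric] sum_divide_distrib) (intro sum.cong refl, simp add: diff_divide_distrib mult_ac)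
        \<comment> \<open>Only the i-th coordinate of \<open>w t\<close> differs from that of
          \<open>u\<close>, by t, so returning to the multiplier of \<open>u\<close> costs exp (t /
          z), at \<open>P i\<close> alone.\<close>
        have m: "mlt u s z = (if s = P i then exp (of_real t / z) else 1) * mlt (w t) s z"
        proof (cases "j = i")
          case True
          have "exp (- of_real (u $ i) / z) = exp (of_real t / z) * exp (- of_real (u $ i + t) / z)"
            unfolding exp_add[symmetric] by (simp add: add_divide_distrib[symmetric] diff_divide_distrib)
          then show ?thesis using True j wj by (simp add: mlt_def)
        next
          case False
          then have "s \<noteq> P i" using j injP by (auto dest: injD)
          then show ?thesis using False j wj by (simp add: mlt_def)
        qed
        have "mlt u s z * ((x - y) / of_real t) = ((if s = P i then exp (of_real t / z) else 1) * (mlt (w t) s z * x) - mlt u s z * y) / of_real t"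
        proof -
          have "mlt u s z * x = (if s = P i then exp (of_real t / z) else 1) * (mlt (w t) s z * x)" unfolding m by simp
          then show ?thesis by (simp only: right_diff_distrib times_divide_eq_right)
        qed
        also have "\<dots> = T t s z + (G (w t) s z - G u s z) / of_real t"
          unfolding 1 2 T_def ppd using True nz by (simp add: field_simps)
        finally show "mlt u s z * ((x - y) / of_real t) = T t s z + (G (w t) s z - G u s z) / of_real t" .
      next
        case False
        then have "mlt (w t) s z = mlt u s z" "pp N (A t) s z = 0" "pp N (A 0) s z = 0" "T t s z = 0" by (auto simp: mlt_def pp_def T_def)
        then show "mlt u s z * ((x - y) / of_real t) = T t s z + (G (w t) s z - G u s z) / of_real t"
          using 1 2 by (simp add: right_diff_distrib diff_divide_distrib)
      qed
    qed
    then show ?case unfolding germs_def using h x by auto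
  qed
  have bq: "((\<lambda>t. (\<phi> (w t) q - \<phi> u q) / of_real t) \<longlongrightarrow> b' q) (at 0)" if q: "q \<in> Z" for q
  proof -
    have "((\<lambda>t. (b q (w t) - b q (w 0)) / of_real t) \<longlongrightarrow> b' q) (at 0)"
      using b'[OF q] vector_derivative_quotient_limit[of "\<lambda>t. b q (w t)"] by (simp add: w_def)
    then show ?thesis
      by (rule Lim_transform_eventually) (use evU in eventually_elim, use gw(2) gu(2) q w0 in auto)
  qed
  have "\<exists>\<xi> G0. germs (mlt u) T0 G0 \<xi> \<and> (\<forall>q\<in>Z. \<xi> q = b' q) \<and>
    (\<forall>p\<in>topspace X - SP. ((\<lambda>t. (\<phi> (w t) p - \<phi> u p) / of_real t) \<longlongrightarrow> \<xi> p) (at 0)) \<and>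
    (\<forall>s\<in>SP. uniform_limit (cball (ctr s) (e s)) (\<lambda>t z. (G (w t) s z - G u s z) / of_real t) (G0 s) (at 0))"
    by (rule germs_convergence[OF conv_const _ cT ge Z bq _ at_neq_bot])
       (use uniq[OF u] mlt_nonzero continuous_on_mlt_const in auto)
  then obtain \<xi> G0 where g0: "germs (mlt u) T0 G0 \<xi>" "\<forall>q\<in>Z. \<xi> q = b' q"
    and l0: "\<forall>p\<in>topspace X - SP. ((\<lambda>t. (\<phi> (w t) p - \<phi> u p) / of_real t) \<longlongrightarrow> \<xi> p) (at 0)"
    and u0: "\<forall>s\<in>SP. uniform_limit (cball (ctr s) (e s)) (\<lambda>t z. (G (w t) s z - G u s z) / of_real t) (G0 s) (at 0)"
    by (elim exE conjE)
  \<comment> \<open>The limit data contain 1 / z times the remainder at \<open>P i\<close>. Its pole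
    joins the principal part as the entry \<open>G u (P i) 0\<close>; the rest \<open>q\<close> is
    regular and moves into the new remainder \<open>G'\<close>.\<close>
  define q where "q = quot0 (G u (P i))"
  define G' where "G' s z = G0 s z + (if s = P i then q z else 0)" for s z
  let ?B = "ball (ctr (P i)) (e (P i))"
  have Gh: "G u (P j) holomorphic_on ball (ctr (P j)) (e (P j))" for j
    by (rule ext_holomorphic_ball[OF germsD(2)[OF gu(1) P_SP]])
  have qh: "q holomorphic_on ?B" unfolding q_def by (rule quot0_holomorphic[OF Gh open_ball])
  have qc: "continuous_on (cball (ctr (P i)) (e (P i))) q"
  proof -
    have "continuous_on (ball (ctr (P i)) (e (P i)) \<union> (cball (ctr (P i)) (e (P i)) - {0})) q"
    proof (rule continuous_on_Un_local_open)
      show "continuous_on ?B q" by (rule holomorphic_on_imp_continuous_on[OF qh])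
      have "continuous_on (cball (ctr (P i)) (e (P i))) (G u (P i))" using germsD(2)[OF gu(1) P_SP] by (simp add: ext_def)
      then have "continuous_on (cball (ctr (P i)) (e (P i)) - {0}) (\<lambda>z. (G u (P i) z - G u (P i) 0) / z)"
        by (auto intro!: continuous_intros elim: continuous_on_subset)
      then show "continuous_on (cball (ctr (P i)) (e (P i)) - {0}) q"
        by (rule continuous_on_eq) (simp add: q_def quot0_def)
      have Q: "?B \<union> (cball (ctr (P i)) (e (P i)) - {0}) = cball (ctr (P i)) (e (P i))" using zero_in_ball[of i] by auto
      show "openin (top_of_set (?B \<union> (cball (ctr (P i)) (e (P i)) - {0}))) ?B"
        unfolding Q by (rule open_subset) auto
      show "openin (top_of_set (?B \<union> (cball (ctr (P i)) (e (P i)) - {0}))) (cball (ctr (P i)) (e (P i)) - {0})"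
        unfolding Q by (simp add: openin_delete)
    qed
    moreover have "?B \<union> (cball (ctr (P i)) (e (P i)) - {0}) = cball (ctr (P i)) (e (P i))" using zero_in_ball[of i] by auto
    ultimately show ?thesis by simp
  qed
  have g': "germs (mlt u) (pp (Suc N) (shift_data N i (\<lambda>j m. a j m u) a' (G u (P i) 0))) G' \<xi>"
    unfolding germs_def
  proof (intro conjI ballI)
    show "holo \<xi>" by (rule germsD(1)[OF g0(1)])
    fix s assume s: "s \<in> SP"
    show "ext s (G' s)"
      using germsD(2)[OF g0(1) s] qh qc unfolding ext_def G'_def by (cases "s = P i") (auto intro!: continuous_intros holomorphic_intros)
    fix z assume z: "z \<in> cball (ctr s) (e s) - {ctr s}"
    have 1: "mlt u s z * \<xi> (chart_inv (ch s) z) = T0 s z + G0 s z" using germsD(3)[OF g0(1) s] z by auto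
    show "mlt u s z * \<xi> (chart_inv (ch s) z) = pp (Suc N) (shift_data N i (\<lambda>j m. a j m u) a' (G u (P i) 0)) s z + G' s z"
    proof (cases "s \<in> range P")
      case True
      then obtain j where j: "s = P j" by blast
      have z0: "z \<noteq> 0" using z ctr_range[OF True] by auto
      have A0: "A 0 = (\<lambda>j m. a j m u)" by (simp add: A_def w0)
      show ?thesis
      proof (cases "j = i")
        case True
        have "q z = (G u (P i) z - G u (P i) 0) / z" using z0 by (simp add: q_def quot0_def)
        then show ?thesis unfolding 1 using True j z0 by (simp add: pp_shift T0_def G'_def A0 field_simps)
      next
        case False
        then have "P j \<noteq> P i" using injP by (auto dest: injD)
        then show ?thesis unfolding 1 using False j z0 by (simp add: pp_shift T0_def G'_def)
      qed
    next
      case False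
      then have "s \<noteq> P i" by auto
      then show ?thesis unfolding 1 using False by (simp add: T0_def pp_def G'_def)
    qed
  qed
  have "((\<lambda>t. \<phi> (u + t *\<^sub>R axis i 1) p) has_vector_derivative \<xi> p) (at 0)" if "p \<in> topspace X - SP" for p
    using l0[rule_format, OF that] vector_derivative_quotient_limit[of "\<lambda>t. \<phi> (w t) p"] by (simp add: w_def)
  moreover have "((\<lambda>t. (deriv ^^ m) (G (u + t *\<^sub>R axis i 1) (P j)) 0) has_vector_derivative
        (deriv ^^ m) (G' (P j)) 0 - (if j = i then (deriv ^^ Suc m) (G u (P i)) 0 / of_nat (Suc m) else 0)) (at 0)" for j m
  proof -
    let ?Bj = "ball (ctr (P j)) (e (P j))"
    have ex: "\<forall>\<^sub>F t in at 0. ext (P j) (\<lambda>z. (G (w t) (P j) z - G u (P j) z) / of_real t)"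
      using ge by eventually_elim (use germsD(2) P_SP in blast)
    have "((\<lambda>t. (deriv ^^ m) (\<lambda>z. (G (w t) (P j) z - G u (P j) z) / of_real t) 0) \<longlongrightarrow> (deriv ^^ m) (G0 (P j)) 0) (at 0)"
      by (rule tendsto_higher_deriv[OF u0[rule_format, OF P_SP] ex at_neq_bot zero_in_ball])
    then have "((\<lambda>t. ((deriv ^^ m) (G (w t) (P j)) 0 - (deriv ^^ m) (G (w 0) (P j)) 0) / of_real t) \<longlongrightarrow> (deriv ^^ m) (G0 (P j)) 0) (at 0)"
    proof (rule Lim_transform_eventually)
      show "\<forall>\<^sub>F t in at 0. (deriv ^^ m) (\<lambda>z. (G (w t) (P j) z - G u (P j) z) / of_real t) 0 =
          ((deriv ^^ m) (G (w t) (P j)) 0 - (deriv ^^ m) (G (w 0) (P j)) 0) / of_real t"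
        using evU
      proof eventually_elim
        case (elim t)
        have h: "G (w t) (P j) holomorphic_on ?Bj" by (rule ext_holomorphic_ball[OF germsD(2)[OF gw(1)[OF elim] P_SP]])
        have "(deriv ^^ m) (\<lambda>z. (1 / of_real t) * (G (w t) (P j) z - G u (P j) z)) 0 = (1 / of_real t) * (deriv ^^ m) (\<lambda>z. G (w t) (P j) z - G u (P j) z) 0"
          by (rule higher_deriv_cmult[OF _ zero_in_ball[of j] open_ball]) (intro holomorphic_intros h Gh)
        also have "(deriv ^^ m) (\<lambda>z. G (w t) (P j) z - G u (P j) z) 0 = (deriv ^^ m) (G (w t) (P j)) 0 - (deriv ^^ m) (G u (P j)) 0"
          by (rule higher_deriv_diff[OF h Gh open_ball zero_in_ball])
        finally show ?case by (simp add: w0)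
      qed
    qed
    then have d: "((\<lambda>t. (deriv ^^ m) (G (w t) (P j)) 0) has_vector_derivative (deriv ^^ m) (G0 (P j)) 0) (at 0)"
      using vector_derivative_quotient_limit[of "\<lambda>t. (deriv ^^ m) (G (w t) (P j)) 0"] by blast
    \<comment> \<open>The parameter derivative of the old remainder is \<open>G0\<close>, whereas
      \<open>\<xi>\<close> has the remainder \<open>G'\<close>. They differ by \<open>q\<close>,
      whose Taylor coefficients are the shifted ones of \<open>G u (P i)\<close>; this is the
      subtracted term in the claim.\<close>
    have "(deriv ^^ m) (G' (P j)) 0 = (deriv ^^ m) (G0 (P j)) 0 + (if j = i then (deriv ^^ Suc m) (G u (P i)) 0 / of_nat (Suc m) else 0)"
    proof (cases "j = i")
      case True
      have "(deriv ^^ m) (\<lambda>z. G0 (P i) z + q z) 0 = (deriv ^^ m) (G0 (P i)) 0 + (deriv ^^ m) q 0"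
        by (rule higher_deriv_add[OF ext_holomorphic_ball[OF germsD(2)[OF g0(1) P_SP]] qh open_ball zero_in_ball])
      moreover have "(deriv ^^ m) q 0 = (deriv ^^ Suc m) (G u (P i)) 0 / of_nat (Suc m)"
        unfolding q_def by (rule higher_deriv_quot0[OF Gh open_ball zero_in_ball])
      ultimately show ?thesis using True by (simp add: G'_def[abs_def] del: of_nat_Suc funpow.simps)
    next
      case False
      then have "P j \<noteq> P i" using injP by (auto dest: injD)
      then show ?thesis using False by (simp add: G'_def[abs_def])
    qed
    then show ?thesis using d by (simp add: w_def)
  qed
  ultimately show ?thesis using g' g0(2) by (intro exI[of _ \<xi>] exI[of _ G']) blast
qed

end

lemma Ck_on_SucI:
  fixes f :: "real^'n::finite \<Rightarrow> 'b::real_normed_vector"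
  assumes W: "open W" and par: "\<And>v i. v \<in> W \<Longrightarrow> ((\<lambda>t. f (v + t *\<^sub>R axis i 1)) has_vector_derivative f' i v) (at 0)"
    and C: "\<And>i. Ck_on k W (f' i)"
  shows "Ck_on (Suc k) W f"
proof -
  have "f differentiable at u" if "u \<in> W" for u
  proof -
    have c: "continuous_on W (f' i)" for i by (rule Ck_on_imp_continuous[OF C])
    from continuous_partials_imp_has_derivative[OF W that par c] show ?thesis by (rule differentiableI)
  qed
  moreover have "Ck_on k W (partial i f)" for i
    by (rule Ck_on_cong[OF W _ C[of i]]) (use partial_eqI[OF par] in simp)
  ultimately show ?thesis by simp
qed

context ba_unique
begin

text \<open>The new principal parts contain the value at 0 of the old remainder. Its regularity
  comes from the induction hypothesis for the original family, which is why values and Taylor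
  coefficients are treated together and the hypothesis is used twice.\<close>

theorem fam_Ck:
  assumes "fam N a b G \<phi>" "\<And>j m. m < N \<Longrightarrow> Ck_on k U (a j m)" "\<And>q. q \<in> Z \<Longrightarrow> Ck_on k U (b q)"
  shows "(\<forall>p\<in>topspace X - SP. Ck_on k U (\<lambda>u. \<phi> u p)) \<and> (\<forall>j m. Ck_on k U (\<lambda>u. (deriv ^^ m) (G u (P j)) 0))"
  using assms
proof (induction k arbitrary: N a b G \<phi>)
  case 0
  have a: "\<And>j m. m < N \<Longrightarrow> continuous_on U (a j m)" and b: "\<And>q. q \<in> Z \<Longrightarrow> continuous_on U (b q)"
    using 0(2,3) by simp_all
  have c: "continuous_on U h" if "\<And>u. u \<in> U \<Longrightarrow> (h \<longlongrightarrow> h u) (at u)" for h :: "real^'n \<Rightarrow> complex"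
    using that by (auto intro!: continuous_at_imp_continuous_on simp: isCont_def)
  show ?case
  proof (intro conjI ballI allI)
    show "Ck_on 0 U (\<lambda>u. \<phi> u p)" if "p \<in> topspace X - SP" for p
      using c[OF fam_continuous(1)[OF 0(1) a b _ that]] by simp
    show "Ck_on 0 U (\<lambda>u. (deriv ^^ m) (G u (P j)) 0)" for j m
      using c[OF fam_continuous(3)[OF 0(1) a b _ P_SP zero_in_ball]] by simp
  qed
next
  case (Suc k)
  have aS: "\<And>j m. m < N \<Longrightarrow> Ck_on k U (a j m)" and bS: "\<And>q. q \<in> Z \<Longrightarrow> Ck_on k U (b q)"
    by (rule Ck_on_SucD[OF Suc.prems(2)], assumption, rule Ck_on_SucD[OF Suc.prems(3)])
  have IH0: "\<And>p. p \<in> topspace X - SP \<Longrightarrow> Ck_on k U (\<lambda>u. \<phi> u p)" "\<And>j m. Ck_on k U (\<lambda>u. (deriv ^^ m) (G u (P j)) 0)"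
    using Suc.IH[OF Suc.prems(1) aS bS] by auto
  have ac: "\<And>j m. m < N \<Longrightarrow> continuous_on U (a j m)" and bc: "\<And>q. q \<in> Z \<Longrightarrow> continuous_on U (b q)"
    by (rule Ck_on_imp_continuous[OF aS], assumption, rule Ck_on_imp_continuous[OF bS])
  define a' where "a' i j m u = shift_data N i (\<lambda>j m. a j m u) (\<lambda>j m. partial i (a j m) u) (G u (P i) 0) j m" for i j m u
  define R where "R i u \<xi> G' \<longleftrightarrow> germs (mlt u) (pp (Suc N) (\<lambda>j m. a' i j m u)) G' \<xi> \<and> (\<forall>q\<in>Z. \<xi> q = partial i (b q) u) \<and>
    (\<forall>p\<in>topspace X - SP. ((\<lambda>t. \<phi> (u + t *\<^sub>R axis i 1) p) has_vector_derivative \<xi> p) (at 0)) \<and>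
    (\<forall>j m. ((\<lambda>t. (deriv ^^ m) (G (u + t *\<^sub>R axis i 1) (P j)) 0) has_vector_derivative
        (deriv ^^ m) (G' (P j)) 0 - (if j = i then (deriv ^^ Suc m) (G u (P i)) 0 / of_nat (Suc m) else 0)) (at 0))" for i u \<xi> G'
  have exR: "\<exists>\<xi> G'. R i u \<xi> G'" if u: "u \<in> U" for i u
    unfolding R_def a'_def
    by (rule fam_partial[OF Suc.prems(1) ac bc u])
       (use Suc.prems(2,3) u in \<open>auto intro!: differentiable_has_partial\<close>)
  \<comment> \<open>Derivative and remainder are only known to exist at each single
    \<open>u\<close>; a choice turns them into families to which the induction hypothesis
    applies.\<close>
  define W where "W i u = (SOME p. R i u (fst p) (snd p))" for i u
  define \<xi> G' where "\<xi> i u = fst (W i u)" and "G' i u = snd (W i u)" for i u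
  have R: "R i u (\<xi> i u) (G' i u)" if u: "u \<in> U" for i u
  proof -
    obtain x y where "R i u x y" using exR[OF u, of i] by blast
    then have "R i u (fst (x, y)) (snd (x, y))" by simp
    then show ?thesis unfolding \<xi>_def G'_def W_def by (rule someI)
  qed
  note x = R[unfolded R_def]
  have fx: "fam (Suc N) (a' i) (\<lambda>q. partial i (b q)) (G' i) (\<xi> i)" for i
    using x unfolding fam_def by blast
  have a'C: "Ck_on k U (a' i j m)" if "m < Suc N" for i j m
  proof -
    have "Ck_on k U (\<lambda>u. if m < N then partial i (a j m) u else 0)" using Suc.prems(2)[of m j] by (cases "m < N") auto
    moreover have "Ck_on k U (\<lambda>u. if j = i then (if m = 0 then G u (P i) 0 else a j (m - 1) u) else 0)"
      using IH0(2)[of 0 i] aS[of "m - 1" j] that by (cases "j = i"; cases "m = 0") auto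
    ultimately show ?thesis unfolding a'_def[abs_def] shift_data_def by (rule Ck_on_add[OF U])
  qed
  have IH1: "\<And>p. p \<in> topspace X - SP \<Longrightarrow> Ck_on k U (\<lambda>u. \<xi> i u p)" "\<And>j m. Ck_on k U (\<lambda>u. (deriv ^^ m) (G' i u (P j)) 0)" for i
    using Suc.IH[OF fx[of i] a'C] Suc.prems(3) by auto
  show ?case
  proof (intro conjI ballI allI)
    fix p assume p: "p \<in> topspace X - SP"
    show "Ck_on (Suc k) U (\<lambda>u. \<phi> u p)"
    proof (rule Ck_on_SucI[OF U _ IH1(1)[OF p]])
      fix v i assume "v \<in> U"
      from x[OF this, of i] show "((\<lambda>t. \<phi> (v + t *\<^sub>R axis i 1) p) has_vector_derivative \<xi> i v p) (at 0)"
        using p by (elim conjE) (erule bspec)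
    qed
  next
    fix j m
    define D where "D i u = (deriv ^^ m) (G' i u (P j)) 0 - (if j = i then (deriv ^^ Suc m) (G u (P i)) 0 / of_nat (Suc m) else 0)" for i u
    have "Ck_on k U (\<lambda>u. (if j = i then (deriv ^^ Suc m) (G u (P i)) 0 / of_nat (Suc m) else 0))" for i
      using Ck_on_bounded_linear[OF U bounded_linear_divide[of "of_nat (Suc m)"] IH0(2)[of "Suc m" i]]
      by (cases "j = i") (auto simp del: funpow.simps of_nat_Suc)
    from Ck_on_add[OF U IH1(2) Ck_on_bounded_linear[OF U bounded_linear_minus[OF bounded_linear_ident] this]]
    have DC: "Ck_on k U (D i)" for i unfolding D_def[abs_def] by simp
    show "Ck_on (Suc k) U (\<lambda>u. (deriv ^^ m) (G u (P j)) 0)"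
    proof (rule Ck_on_SucI[OF U _ DC])
      fix v i assume "v \<in> U"
      from x[OF this, of i] show "((\<lambda>t. (deriv ^^ m) (G (v + t *\<^sub>R axis i 1) (P j)) 0) has_vector_derivative D i v) (at 0)"
        unfolding D_def by (elim conjE) (erule allE[where x = j], erule allE[where x = m])
    qed
  qed
qed

end

section \<open>Orthogonal nets in hyperbolic space\<close>

lemma bounded_bilinear_minkowski: "bounded_bilinear (minkowski :: real^('n::finite option) \<Rightarrow> real^('n option) \<Rightarrow> real)"
proof -
  have "bilinear (minkowski :: real^('n option) \<Rightarrow> real^('n option) \<Rightarrow> real)"
    unfolding bilinear_def minkowski_def
    by (auto intro!: linearI simp: algebra_simps sum.distrib sum_distrib_left)
  then show ?thesis by (simp add: bilinear_conv_bounded_bilinear)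
qed

interpretation mink: bounded_bilinear "minkowski :: real^('n::finite option) \<Rightarrow> real^('n option) \<Rightarrow> real"
  by (rule bounded_bilinear_minkowski)

lemma minkowski_commute: "minkowski x y = minkowski y x"
  by (simp add: minkowski_def mult.commute)

lemma minkowski_nondegenerate:
  assumes "\<And>y. minkowski v y = 0" shows "v = 0"
proof -
  have "v $ l = 0" for l
  proof (cases l)
    case None
    have "minkowski v (axis None 1) = v $ None" by (simp add: minkowski_def axis_def)
    then show ?thesis using assms None by simp
  next
    case (Some i)
    have "minkowski v (axis (Some i) 1) = - v $ Some i"
      by (simp add: minkowski_def axis_def if_distrib[of "\<lambda>x. _ * x"] cong: if_cong)
    then show ?thesis using assms[of "axis (Some i) 1"] Some by simp
  qed
  then show ?thesis by (simp add: vec_eq_iff)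
qed

text \<open>The frame spans by counting dimensions.\<close>

lemma minkowski_frame_complete:
  fixes b :: "'n::finite option \<Rightarrow> real^('n option)"
  assumes gram: "\<And>k l. minkowski (b k) (b l) = (if k = l then g k else 0)" and g: "\<And>k. g k \<noteq> 0"
    and v: "\<And>k. minkowski v (b k) = 0"
  shows "v = 0"
proof -
  have inj: "inj b"
  proof (rule injI, rule ccontr)
    fix k l assume "b k = b l" "k \<noteq> l"
    then have "g k = 0" using gram[of k k] gram[of k l] by simp
    then show False using g by simp
  qed
  have ind: "independent (range b)"
  proof (subst independent_explicit, intro conjI allI impI ballI)
    fix c w assume s: "(\<Sum>v\<in>range b. c v *\<^sub>R v) = 0" and w: "w \<in> range b"
    then obtain k where k: "w = b k" by blast
    have "0 = minkowski (\<Sum>l\<in>UNIV. c (b l) *\<^sub>R b l) (b k)"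
      using s by (simp add: sum.reindex[OF inj] o_def mink.zero_left)
    also have "\<dots> = (\<Sum>l\<in>UNIV. c (b l) * minkowski (b l) (b k))" by (simp add: mink.sum_left mink.scaleR_left)
    also have "\<dots> = c (b k) * g k" by (simp add: gram if_distrib[of "\<lambda>x. _ * x"] cong: if_cong)
    finally show "c w = 0" using g k by simp
  qed simp
  have "card (range b) = CARD('n option)" using inj by (simp add: card_image)
  then have "UNIV \<subseteq> span (range b)"
    by (intro card_ge_dim_independent ind) auto
  then have sp: "y \<in> span (range b)" for y by blast
  have "minkowski v y = 0" for y
    using sp[of y] by (induction rule: span_induct_alt) (auto simp: mink.zero_right mink.add_right mink.scaleR_right v)
  then show ?thesis by (rule minkowski_nondegenerate)
qed

text \<open>A reversed Cauchy-Schwarz inequality: the time component of \<open>x\<close> dominates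
  its space part, and orthogonality expresses the product of the time components as an inner product
  of the space parts.\<close>

lemma minkowski_orthogonal_spacelike:
  assumes x: "minkowski x x = 1" and xy: "minkowski x y = 0"
  shows "minkowski y y \<le> 0"
proof -
  define a b where "a = (\<chi> i. x $ Some i)" and "b = (\<chi> i. y $ Some i)"
  have 1: "(x $ None)\<^sup>2 = 1 + a \<bullet> a" and 2: "x $ None * y $ None = a \<bullet> b" and 3: "minkowski y y = (y $ None)\<^sup>2 - b \<bullet> b"
    using x xy by (auto simp: minkowski_def a_def b_def inner_vec_def power2_eq_square)
  have "(x $ None)\<^sup>2 * (y $ None)\<^sup>2 = (a \<bullet> b)\<^sup>2" using 2 by (metis power_mult_distrib)
  also have "\<dots> \<le> (a \<bullet> a) * (b \<bullet> b)" by (rule Cauchy_Schwarz_ineq)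
  also have "\<dots> \<le> (x $ None)\<^sup>2 * (b \<bullet> b)" using 1 by (intro mult_right_mono) auto
  finally have "(x $ None)\<^sup>2 * (y $ None)\<^sup>2 \<le> (x $ None)\<^sup>2 * (b \<bullet> b)" .
  moreover have "0 < (x $ None)\<^sup>2" using 1 inner_ge_zero[of a] by linarith
  ultimately show ?thesis using 3 by simp
qed

lemma partial_bilinear:
  assumes "bounded_bilinear pr" "f differentiable at u" "g differentiable at u"
  shows "partial k (\<lambda>u. pr (f u) (g u)) u = pr (f u) (partial k g u) + pr (partial k f u) (g u)"
proof (rule partial_eqI)
  show "((\<lambda>t. pr (f (u + t *\<^sub>R axis k 1)) (g (u + t *\<^sub>R axis k 1))) has_vector_derivative
      pr (f u) (partial k g u) + pr (partial k f u) (g u)) (at 0)"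
    using bounded_bilinear.has_vector_derivative[OF assms(1) differentiable_has_partial[OF assms(2)] differentiable_has_partial[OF assms(3)], of k k] by simp
qed

lemma partial_commute:
  fixes f :: "real^'n::finite \<Rightarrow> real^'m::finite"
  assumes W: "open W" "u \<in> W" and C: "Ck_on 2 W f"
  shows "partial i (partial j f) u = partial j (partial i f) u"
proof -
  have d: "f differentiable at v" "partial k f differentiable at v" if "v \<in> W" for v k
    using C that by (auto simp: numeral_2_eq_2)
  have n: "partial k (\<lambda>u. h u $ l) v = partial k h v $ l" if "h differentiable at v" for h :: "real^'n \<Rightarrow> real^'m" and v k l
    by (rule partial_eqI, rule bounded_linear.has_vector_derivative[OF bounded_linear_vec_nth differentiable_has_partial[OF that]])
  have n2: "partial k (partial k' (\<lambda>u. f u $ l)) u = partial k (partial k' f) u $ l" for k k' l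
  proof -
    have "partial k (partial k' (\<lambda>u. f u $ l)) u = partial k (\<lambda>v. partial k' f v $ l) u"
      by (rule partial_cong_open[OF W]) (rule n[OF d(1)])
    also have "\<dots> = partial k (partial k' f) u $ l" by (rule n[OF d(2)[OF W(2)]])
    finally show ?thesis .
  qed
  have "partial i (partial j (\<lambda>u. f u $ l)) u = partial j (partial i (\<lambda>u. f u $ l)) u" for l
    by (rule partial_commute_real[OF W Ck_on_bounded_linear[OF W(1) bounded_linear_vec_nth C]])
  then show ?thesis by (simp add: n2 vec_eq_iff)
qed

lemma smooth_onD: "smooth_on W f \<Longrightarrow> Ck_on k W f" by (simp add: smooth_on_def)

lemma smooth_on_differentiable: "smooth_on W f \<Longrightarrow> u \<in> W \<Longrightarrow> f differentiable at u"
  using smooth_onD[of W f 1] by simp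

lemma smooth_on_partial: "smooth_on W f \<Longrightarrow> smooth_on W (partial i f)"
  unfolding smooth_on_def by (metis Ck_on.simps(2))

locale hyperbolic_net =
  fixes W :: "(real^'n::finite) set" and x :: "real^'n \<Rightarrow> real^('n option)" and H :: "'n \<Rightarrow> real^'n \<Rightarrow> real"
  assumes W: "open W" and sx: "smooth_on W x" and xx: "\<And>u. u \<in> W \<Longrightarrow> minkowski (x u) (x u) = 1"
    and gram: "\<And>u i j. u \<in> W \<Longrightarrow> minkowski (partial i x u) (partial j x u) = (if i = j then - (H i u)\<^sup>2 else 0)"
    and Hpos: "\<And>u i. u \<in> W \<Longrightarrow> 0 < H i u"
begin

lemma smooth_mink: "smooth_on W f \<Longrightarrow> smooth_on W g \<Longrightarrow> smooth_on W (\<lambda>u. minkowski (f u) (g u))"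
  unfolding smooth_on_def by (auto intro: Ck_on_bilinear[OF W bounded_bilinear_minkowski])

lemma smooth_H: "smooth_on W (H i)"
  unfolding smooth_on_def
proof
  fix k
  have "Ck_on k W (\<lambda>u. - minkowski (partial i x u) (partial i x u))"
    by (intro Ck_on_bounded_linear[OF W bounded_linear_minus[OF bounded_linear_ident]] smooth_onD smooth_mink smooth_on_partial sx)
  then have "Ck_on k W (\<lambda>u. sqrt (- minkowski (partial i x u) (partial i x u)))"
  proof (rule Ck_on_sqrt[OF W, rotated])
    show "0 < - minkowski (partial i x u) (partial i x u)" if "u \<in> W" for u
      using gram[OF that, of i i] Hpos[OF that, of i] by simp
  qed
  then show "Ck_on k W (H i)"
  proof (rule Ck_on_cong[OF W, rotated])
    show "sqrt (- minkowski (partial i x u) (partial i x u)) = H i u" if "u \<in> W" for u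
      using gram[OF that, of i i] Hpos[OF that, of i] by simp
  qed
qed

definition fr :: "'n \<Rightarrow> real^'n \<Rightarrow> real^('n option)" where "fr i u = inverse (H i u) *\<^sub>R partial i x u"
abbreviation \<beta> where "\<beta> \<equiv> rotation_coeff H"

lemma smooth_inv_H: "smooth_on W (\<lambda>u. inverse (H i u))"
  unfolding smooth_on_def by (intro allI Ck_on_inverse[OF W] smooth_onD smooth_H) (rule less_imp_neq[OF Hpos, THEN not_sym])

lemma smooth_fr: "smooth_on W (fr i)"
  unfolding smooth_on_def fr_def[abs_def]
  by (intro allI Ck_on_bilinear[OF W bounded_bilinear_scaleR] smooth_onD smooth_inv_H smooth_on_partial sx)

lemma smooth_\<beta>: "smooth_on W (\<beta> i j)"
  unfolding smooth_on_def rotation_coeff_def[abs_def] divide_inverse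
  by (intro allI Ck_on_bilinear[OF W bounded_bilinear_mult] smooth_onD smooth_inv_H smooth_on_partial smooth_H)

lemma partial_x: "u \<in> W \<Longrightarrow> partial i x u = H i u *\<^sub>R fr i u"
  using Hpos[of u i] by (simp add: fr_def)

lemma fr_gram: "u \<in> W \<Longrightarrow> minkowski (fr i u) (fr j u) = (if i = j then -1 else 0)"
  using Hpos[of u i] Hpos[of u j] by (simp add: fr_def mink.scaleR_left mink.scaleR_right gram power2_eq_square field_simps)

lemma partial_minkowski:
  assumes "smooth_on W f" "smooth_on W g" "u \<in> W"
  shows "partial k (\<lambda>u. minkowski (f u) (g u)) u = minkowski (f u) (partial k g u) + minkowski (partial k f u) (g u)"
  using assms by (intro partial_bilinear[OF bounded_bilinear_minkowski] smooth_on_differentiable)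

lemma partial_minkowski_const:
  assumes "smooth_on W f" "smooth_on W g" "u \<in> W" "\<And>v. v \<in> W \<Longrightarrow> minkowski (f v) (g v) = c"
  shows "minkowski (f u) (partial k g u) + minkowski (partial k f u) (g u) = 0"
proof -
  have "partial k (\<lambda>u. minkowski (f u) (g u)) u = partial k (\<lambda>_. c) u"
    by (rule partial_cong_open[OF W assms(3,4)])
  then show ?thesis using partial_minkowski[OF assms(1-3)] by (simp add: partial_def)
qed

lemma x_partial: "u \<in> W \<Longrightarrow> minkowski (x u) (partial i x u) = 0"
  using partial_minkowski_const[OF sx sx _ xx, of u i] by (simp add: minkowski_commute)

lemma x_fr: "u \<in> W \<Longrightarrow> minkowski (x u) (fr i u) = 0"
  by (simp add: fr_def mink.scaleR_right x_partial)

text \<open>\<open>x\<close> and the unit tangents are an orthogonal basis with squares 1 and -1, so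
  formulas for derivatives of the frame can be verified by components.\<close>

lemma frame_zero:
  assumes u: "u \<in> W" and v: "minkowski v (x u) = 0" "\<And>k. minkowski v (fr k u) = 0"
  shows "v = 0"
proof (rule minkowski_frame_complete[where b = "\<lambda>k. case k of None \<Rightarrow> x u | Some i \<Rightarrow> fr i u" and g = "\<lambda>k. case k of None \<Rightarrow> 1 | Some i \<Rightarrow> -1"])
  show "minkowski (case k of None \<Rightarrow> x u | Some i \<Rightarrow> fr i u) (case l of None \<Rightarrow> x u | Some i \<Rightarrow> fr i u) =
      (if k = l then case k of None \<Rightarrow> 1 | Some i \<Rightarrow> - 1 else 0)" for k l
    using x_fr[OF u] minkowski_commute[of "fr _ u" "x u"] by (cases k; cases l) (simp_all add: xx[OF u] fr_gram[OF u])
qed (use v in \<open>auto split: option.splits\<close>)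

text \<open>Connection coefficients of the frame. As the tangents have square -1, they are minus the
  components along \<open>fr k\<close>.\<close>

definition \<omega> where "\<omega> i j k u = minkowski (partial i (fr j) u) (fr k u)"

lemma \<omega>_antisym: "u \<in> W \<Longrightarrow> \<omega> i j k u = - \<omega> i k j u"
  using partial_minkowski_const[OF smooth_fr smooth_fr _ fr_gram, of u j i k]
  by (simp add: \<omega>_def minkowski_commute)

lemma \<omega>_x: "u \<in> W \<Longrightarrow> minkowski (partial i (fr j) u) (x u) = (if i = j then H i u else 0)"
  using partial_minkowski_const[OF smooth_fr sx _ , of u j 0 i] x_fr
  by (cases "i = j") (simp_all add: minkowski_commute[of _ "x _"] partial_x mink.scaleR_right fr_gram)

lemma partial_partial_x:
  assumes u: "u \<in> W" shows "partial i (partial j x) u = H j u *\<^sub>R partial i (fr j) u + partial i (H j) u *\<^sub>R fr j u"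
proof -
  have "partial i (partial j x) u = partial i (\<lambda>v. H j v *\<^sub>R fr j v) u"
    by (rule partial_cong_open[OF W u]) (rule partial_x)
  also have "\<dots> = H j u *\<^sub>R partial i (fr j) u + partial i (H j) u *\<^sub>R fr j u"
    using u by (intro partial_bilinear[OF bounded_bilinear_scaleR] smooth_on_differentiable[OF smooth_H] smooth_on_differentiable[OF smooth_fr])
  finally show ?thesis .
qed

lemma frame_symmetry:
  assumes u: "u \<in> W"
  shows "H j u * \<omega> i j k u + partial i (H j) u * minkowski (fr j u) (fr k u) =
    H i u * \<omega> j i k u + partial j (H i) u * minkowski (fr i u) (fr k u)"
proof -
  have "partial i (partial j x) u = partial j (partial i x) u" by (rule partial_commute[OF W u smooth_onD[OF sx]])
  then have "minkowski (partial i (partial j x) u) (fr k u) = minkowski (partial j (partial i x) u) (fr k u)" by simp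
  then show ?thesis unfolding partial_partial_x[OF u] by (simp add: mink.add_left mink.scaleR_left \<omega>_def)
qed

text \<open>Divided by \<open>H i\<close>, the coefficient is symmetric in its first two indices,
  because second derivatives of \<open>x\<close> commute, and antisymmetric in the last two, because
  the frame is orthonormal. Six alternating exchanges return to the start with the opposite
  sign.\<close>

lemma \<omega>_distinct:
  assumes u: "u \<in> W" and d: "i \<noteq> j" "j \<noteq> k" "i \<noteq> k"
  shows "\<omega> i j k u = 0"
proof -
  have s: "\<omega> i j k u / H i u = \<omega> j i k u / H j u" if "i \<noteq> j" "j \<noteq> k" "i \<noteq> k" for i j k
    using frame_symmetry[OF u, of j i k] that Hpos[OF u, of i] Hpos[OF u, of j] by (simp add: fr_gram[OF u] field_simps)
  have a: "\<omega> i j k u / H i u = - (\<omega> i k j u / H i u)" for i j k using \<omega>_antisym[OF u, of i j k] by simp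
  have "\<omega> i j k u / H i u = - (\<omega> i j k u / H i u)"
    using a[of i j k] s[of i k j] a[of k i j] s[of k j i] a[of j k i] s[of j i k] d by simp
  then show ?thesis using Hpos[OF u, of i] by simp
qed

lemma \<omega>_\<beta>: "u \<in> W \<Longrightarrow> i \<noteq> j \<Longrightarrow> \<omega> i j i u = - \<beta> j i u"
  using frame_symmetry[of u j i i] \<omega>_antisym[of u j i i] Hpos[of u j]
  by (simp add: fr_gram rotation_coeff_def field_simps)

lemma \<omega>_same: "u \<in> W \<Longrightarrow> \<omega> i j j u = 0"
  using \<omega>_antisym[of u i j j] by simp

lemma partial_fr:
  assumes u: "u \<in> W" and ij: "i \<noteq> j" shows "partial i (fr j) u = \<beta> j i u *\<^sub>R fr i u"
proof -
  have "partial i (fr j) u - \<beta> j i u *\<^sub>R fr i u = 0"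
  proof (rule frame_zero[OF u])
    show "minkowski (partial i (fr j) u - \<beta> j i u *\<^sub>R fr i u) (x u) = 0"
    proof -
      have "minkowski (fr i u) (x u) = 0" using x_fr[OF u] minkowski_commute by metis
      then show ?thesis using ij by (simp add: mink.diff_left mink.scaleR_left \<omega>_x[OF u])
    qed
    have "minkowski (partial i (fr j) u - \<beta> j i u *\<^sub>R fr i u) (fr k u) = \<omega> i j k u + (if k = i then \<beta> j i u else 0)" for k
      by (simp add: mink.diff_left mink.scaleR_left \<omega>_def fr_gram[OF u])
    then show "minkowski (partial i (fr j) u - \<beta> j i u *\<^sub>R fr i u) (fr k u) = 0" for k
      using \<omega>_distinct[OF u ij, of k] \<omega>_same[OF u] \<omega>_\<beta>[OF u ij] ij by (cases "k = i"; cases "k = j") auto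
  qed
  then show ?thesis by simp
qed

text \<open>The component along \<open>x\<close> comes from differentiating the orthogonality of
  \<open>x\<close> and \<open>fr i\<close>. It is the source of the term \<open>H i * H j\<close>,
  and so of the curvature -1.\<close>

lemma partial_fr_same:
  assumes u: "u \<in> W" shows "partial i (fr i) u = H i u *\<^sub>R x u - (\<Sum>k\<in>UNIV-{i}. \<beta> k i u *\<^sub>R fr k u)"
proof -
  have "partial i (fr i) u - (H i u *\<^sub>R x u - (\<Sum>k\<in>UNIV-{i}. \<beta> k i u *\<^sub>R fr k u)) = 0" (is "?v = 0")
  proof (rule frame_zero[OF u])
    have fx: "minkowski (fr k u) (x u) = 0" for k using x_fr[OF u] minkowski_commute by metis
    show "minkowski ?v (x u) = 0"
      by (simp add: mink.diff_left mink.sum_left mink.scaleR_left \<omega>_x[OF u] xx[OF u] fx)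
    fix l
    have "minkowski ?v (fr l u) = \<omega> i i l u + (\<Sum>k\<in>UNIV-{i}. \<beta> k i u * (if k = l then -1 else 0))"
      by (simp add: mink.diff_left mink.sum_left mink.scaleR_left \<omega>_def fr_gram[OF u] x_fr[OF u])
    also have "(\<Sum>k\<in>UNIV-{i}. \<beta> k i u * (if k = l then -1 else 0)) = (if l = i then 0 else - \<beta> l i u)"
      by (simp add: if_distrib[of "\<lambda>x. _ * x"] cong: if_cong)
    also have "\<omega> i i l u + (if l = i then 0 else - \<beta> l i u) = 0"
      using \<omega>_same[OF u] \<omega>_\<beta>[OF u, of i l] \<omega>_antisym[OF u, of i i l] by (cases "l = i") auto
    finally show "minkowski ?v (fr l u) = 0" .
  qed
  then show ?thesis by simp
qed

lemma partial_partial_fr: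
  assumes u: "u \<in> W" and ij: "i \<noteq> j"
  shows "partial k (partial i (fr j)) u = \<beta> j i u *\<^sub>R partial k (fr i) u + partial k (\<beta> j i) u *\<^sub>R fr i u"
proof -
  have "partial k (partial i (fr j)) u = partial k (\<lambda>v. \<beta> j i v *\<^sub>R fr i v) u"
    by (rule partial_cong_open[OF W u]) (rule partial_fr[OF _ ij])
  also have "\<dots> = \<beta> j i u *\<^sub>R partial k (fr i) u + partial k (\<beta> j i) u *\<^sub>R fr i u"
    using u by (intro partial_bilinear[OF bounded_bilinear_scaleR] smooth_on_differentiable[OF smooth_\<beta>] smooth_on_differentiable[OF smooth_fr])
  finally show ?thesis .
qed

lemma commute_fr: "u \<in> W \<Longrightarrow> partial i (partial j (fr k)) u = partial j (partial i (fr k)) u"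
  by (rule partial_commute[OF W _ smooth_onD[OF smooth_fr]])

text \<open>Both equations are components of the integrability condition \<open>\<partial>\<^sub>i \<partial>\<^sub>j e = \<partial>\<^sub>j \<partial>\<^sub>i e\<close> for the frame vectors.\<close>

theorem lame: "lame_equations (-1) W H"
  unfolding lame_equations_def Let_def
proof (intro ballI conjI allI impI)
  fix u and i j k :: 'n assume u: "u \<in> W" and d: "i \<noteq> j \<and> j \<noteq> k \<and> i \<noteq> k"
  have ne: "j \<noteq> i" "k \<noteq> i" "j \<noteq> k" using d by auto
  \<comment> \<open>Pairing with \<open>fr j\<close> isolates the derivative of one rotation
    coefficient: the other term pairs \<open>fr j\<close> with its own derivative, which gives
    zero.\<close>
  have "minkowski (partial k (partial j (fr i)) u) (fr j u) = minkowski (partial j (partial k (fr i)) u) (fr j u)"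
    using commute_fr[OF u] by simp
  moreover have "minkowski (partial k (partial j (fr i)) u) (fr j u) = - partial k (\<beta> i j) u"
    using \<omega>_same[OF u, of k j, unfolded \<omega>_def]
    by (simp add: partial_partial_fr[OF u ne(1)] mink.add_left mink.scaleR_left fr_gram[OF u])
  moreover have "minkowski (partial j (partial k (fr i)) u) (fr j u) = - (\<beta> i k u * \<beta> k j u)"
    using ne(3)[symmetric] by (simp add: partial_partial_fr[OF u ne(2)] partial_fr[OF u ne(3)] mink.add_left mink.scaleR_left fr_gram[OF u])
  ultimately show "partial k (\<beta> i j) u = \<beta> i k u * \<beta> k j u" by simp
next
  fix u and i j :: 'n assume u: "u \<in> W" and ij: "i \<noteq> j"
  have 1: "minkowski (partial i (partial j (fr i)) u) (fr j u) = - partial i (\<beta> i j) u"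
    using \<omega>_same[OF u, of i j, unfolded \<omega>_def]
    by (simp add: partial_partial_fr[OF u ij[symmetric]] mink.add_left mink.scaleR_left fr_gram[OF u])
  \<comment> \<open>Differentiating the component \<open>\<beta> j i\<close> by the product rule
    avoids differentiating the full expansion of \<open>partial_fr_same\<close>.\<close>
  have "partial j (\<lambda>u. minkowski (partial i (fr i) u) (fr j u)) u = partial j (\<beta> j i) u"
  proof (rule partial_cong_open[OF W u])
    fix v assume v: "v \<in> W"
    have "minkowski (partial i (fr i) v) (fr j v) = \<omega> i i j v" by (simp add: \<omega>_def)
    then show "minkowski (partial i (fr i) v) (fr j v) = \<beta> j i v" using \<omega>_antisym[OF v, of i i j] \<omega>_\<beta>[OF v ij] by simp
  qed
  then have 2: "minkowski (partial i (fr i) u) (partial j (fr j) u) + minkowski (partial j (partial i (fr i)) u) (fr j u) = partial j (\<beta> j i) u"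
    using partial_minkowski[OF smooth_on_partial[OF smooth_fr] smooth_fr u, of j i i j] by simp
  have fx: "minkowski (fr k u) (x u) = 0" for k using x_fr[OF u] minkowski_commute by metis
  define A where "A i = (\<Sum>k\<in>UNIV-{i}. \<beta> k i u *\<^sub>R fr k u)" for i
  have xA: "minkowski (x u) (A i) = 0" "minkowski (A i) (x u) = 0" for i
    by (simp_all add: A_def mink.sum_left mink.sum_right mink.scaleR_left mink.scaleR_right x_fr[OF u] fx)
  have frA: "minkowski (fr k u) (A j) = (if k = j then 0 else - \<beta> k j u)" for k
  proof -
    have "minkowski (fr k u) (A j) = (\<Sum>l\<in>UNIV-{j}. if k = l then - \<beta> l j u else 0)"
      unfolding A_def mink.sum_right by (intro sum.cong refl) (simp add: mink.scaleR_right fr_gram[OF u])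
    then show ?thesis by simp
  qed
  have "minkowski (A i) (A j) = (\<Sum>k\<in>UNIV-{i}. if k = j then 0 else - (\<beta> k i u * \<beta> k j u))"
    unfolding A_def[of i] mink.sum_left by (intro sum.cong refl) (simp add: mink.scaleR_left frA)
  also have "\<dots> = (\<Sum>k\<in>UNIV-{i,j}. - (\<beta> k i u * \<beta> k j u))"
    by (rule sum.mono_neutral_cong_right) auto
  finally have AA: "minkowski (A i) (A j) = - (\<Sum>k\<in>UNIV-{i,j}. \<beta> k i u * \<beta> k j u)" by (simp add: sum_negf)
  have 3: "minkowski (partial i (fr i) u) (partial j (fr j) u) = H i u * H j u - (\<Sum>k\<in>UNIV-{i,j}. \<beta> k i u * \<beta> k j u)"
    unfolding partial_fr_same[OF u] A_def[symmetric]
    by (simp add: mink.diff_left mink.diff_right mink.scaleR_left mink.scaleR_right xx[OF u] xA AA)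
  show "partial i (\<beta> i j) u + partial j (\<beta> j i) u + (\<Sum>m\<in>UNIV-{i,j}. \<beta> m i u * \<beta> m j u) = - (-1) * H i u * H j u"
    using 1 2 3 commute_fr[OF u, of i j i] by simp
qed

definition spat :: "real^('n option) \<Rightarrow> real^'n" where "spat y = (\<chi> i. y $ Some i)"

lemma bounded_linear_spat: "bounded_linear spat"
  by (intro linear_conv_bounded_linear[THEN iffD1] linearI) (auto simp: spat_def vec_eq_iff)

lemma spat_inner: "minkowski y y = (y $ None)\<^sup>2 - spat y \<bullet> spat y"
  by (simp add: minkowski_def spat_def inner_vec_def power2_eq_square)

text \<open>Each sheet is a graph over the spatial hyperplane, so it suffices to invert the spatial part of \<open>x\<close>.\<close>

lemma sheet_eq:
  assumes "y \<in> hyperbolic_space s" "z \<in> hyperbolic_space s" "spat y = spat z"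
  shows "y = z"
proof -
  have "(y $ None)\<^sup>2 = (z $ None)\<^sup>2" "sgn (y $ None) = sgn (z $ None)"
    using assms spat_inner[of y] spat_inner[of z] by (auto simp: hyperbolic_space_def)
  then have "y $ None = z $ None" by (auto simp: power2_eq_iff sgn_if split: if_splits)
  moreover have "y $ Some i = z $ Some i" for i using assms(3) by (auto simp: spat_def vec_eq_iff)
  ultimately show ?thesis by (auto simp: vec_eq_iff) (metis option.exhaust)
qed

text \<open>The spatial part of \<open>x\<close> has injective differential: a tangent vector
  without spatial part is orthogonal to \<open>x\<close>, whose time component is nonzero, so it
  vanishes; and the tangents are independent because their Gram matrix is diagonal with nonzero
  entries. Hence the inverse function theorem applies.\<close>

theorem orthogonal_coordinates:
  assumes s: "\<And>u. u \<in> W \<Longrightarrow> x u \<in> hyperbolic_space s"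
  shows "orthogonal_coordinates (hyperbolic_space s) W x H"
proof -
  define F where "F = (\<lambda>u. spat (x u))"
  define f' where "f' u = (\<lambda>h. \<Sum>i\<in>UNIV. (h $ i) *\<^sub>R spat (partial i x u))" for u
  have blf: "bounded_linear (f' u)" for u
    unfolding f'_def by (intro bounded_linear_sum bounded_linear_scaleR_const bounded_linear_vec_nth)
  have dx: "(x has_derivative (\<lambda>h. \<Sum>i\<in>UNIV. (h $ i) *\<^sub>R partial i x u)) (at u)" if "u \<in> W" for u
    by (rule continuous_partials_imp_has_derivative[OF W that])
       (rule differentiable_has_partial[OF smooth_on_differentiable[OF sx]], assumption,
        rule Ck_on_imp_continuous[OF smooth_onD[OF smooth_on_partial[OF sx], of 0]])
  have dF: "(F has_derivative f' u) (at u)" if "u \<in> W" for u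
  proof -
    have "(F has_derivative (\<lambda>h. spat (\<Sum>i\<in>UNIV. (h $ i) *\<^sub>R partial i x u))) (at u)"
      unfolding F_def by (rule bounded_linear.has_derivative[OF bounded_linear_spat dx[OF that]])
    then show ?thesis
      using bounded_linear_spat by (simp add: f'_def linear_sum[OF bounded_linear.linear] linear_scale[OF bounded_linear.linear])
  qed
  have inj: "inj (f' u)" if u: "u \<in> W" for u
  proof (rule linear_injective_0[THEN iffD2, OF bounded_linear.linear[OF blf], rule_format])
    fix h assume h: "f' u h = 0"
    define y where "y = (\<Sum>i\<in>UNIV. (h $ i) *\<^sub>R partial i x u)"
    have "spat y = 0"
      using h bounded_linear_spat by (simp add: y_def f'_def linear_sum[OF bounded_linear.linear] linear_scale[OF bounded_linear.linear])
    then have ys: "y $ Some i = 0" for i by (simp add: spat_def vec_eq_iff)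
    have "minkowski (x u) y = 0" by (simp add: y_def mink.sum_right mink.scaleR_right x_partial[OF u])
    then have "x u $ None * y $ None = 0" by (simp add: minkowski_def ys)
    moreover have "x u $ None \<noteq> 0"
    proof
      assume "x u $ None = 0"
      then have "1 = - (spat (x u) \<bullet> spat (x u))" using spat_inner[of "x u"] xx[OF u] by simp
      then show False using inner_ge_zero[of "spat (x u)"] by linarith
    qed
    ultimately have y0: "y = 0" using ys by (auto simp: vec_eq_iff) (metis option.exhaust)
    have "h $ j = 0" for j
    proof -
      have "0 = minkowski y (partial j x u)" by (simp add: y0 mink.zero_left)
      also have "\<dots> = (\<Sum>i\<in>UNIV. if i = j then - (h $ i * (H i u)\<^sup>2) else 0)"
        unfolding y_def mink.sum_left by (intro sum.cong refl) (simp add: mink.scaleR_left gram[OF u])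
      also have "\<dots> = - (h $ j * (H j u)\<^sup>2)" by simp
      finally show ?thesis using Hpos[OF u, of j] by simp
    qed
    then show "h = 0" by (simp add: vec_eq_iff)
  qed
  define B where "B u = Blinfun (f' u)" for u
  have B: "blinfun_apply (B u) = f' u" for u unfolding B_def by (rule bounded_linear_Blinfun_apply[OF blf])
  have cB: "continuous_on W B"
  proof (rule continuous_on_blinfun_componentwise)
    fix i :: "real^'n"
    have "continuous_on W (\<lambda>u. spat (partial k x u))" for k
      using bounded_linear.continuous_on[OF bounded_linear_spat Ck_on_imp_continuous[OF smooth_onD[OF smooth_on_partial[OF sx], of 0]]] .
    then show "continuous_on W (\<lambda>u. blinfun_apply (B u) i)" unfolding B f'_def by (intro continuous_intros)
  qed
  have "\<exists>V y. open V \<and> u \<in> V \<and> V \<subseteq> W \<and> openin (top_of_set (hyperbolic_space s)) (x ` V) \<and> homeomorphism V (x ` V) x y"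
    if u: "u \<in> W" for u
  proof -
    obtain g where g: "linear g" "g \<circ> f' u = id"
      using linear_injective_left_inverse[OF bounded_linear.linear[OF blf] inj[OF u]] by blast
    have "Blinfun g o\<^sub>L B u = id_blinfun"
      using g by (intro blinfun_eqI) (simp add: B bounded_linear_Blinfun_apply linear_conv_bounded_linear[symmetric] fun_eq_iff)
    from inverse_function_theorem[OF W, of F B, unfolded B, OF dF cB u this]
    obtain U' V g where U': "open U'" "U' \<subseteq> W" "u \<in> U'" "open V" "homeomorphism U' V F g" by metis
    \<comment> \<open>The image is cut out of the sheet by an open condition on the spatial part,
      hence relatively open.\<close>
    have xU: "x ` U' = hyperbolic_space s \<inter> spat -` V"
    proof (intro subset_antisym subsetI)
      fix y assume "y \<in> x ` U'"
      then show "y \<in> hyperbolic_space s \<inter> spat -` V"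
        using U'(2,5) s by (auto simp: homeomorphism_def F_def)
    next
      fix y assume y: "y \<in> hyperbolic_space s \<inter> spat -` V"
      then have "g (spat y) \<in> U'" "F (g (spat y)) = spat y" using U'(5) by (auto simp: homeomorphism_def)
      then have "x (g (spat y)) = y" using y s U'(2) by (intro sheet_eq[of _ s]) (auto simp: F_def)
      then show "y \<in> x ` U'" using \<open>g (spat y) \<in> U'\<close> by (metis imageI)
    qed
    have "open (spat -` V)"
      using U'(4) bounded_linear_spat by (intro open_vimage linear_continuous_on)
    then have op: "openin (top_of_set (hyperbolic_space s)) (x ` U')"
      unfolding xU by (rule openin_open_Int)
    have xc: "continuous_on U' x"
      using Ck_on_imp_continuous[OF smooth_onD[OF sx, of 0]] continuous_on_subset U'(2) by blast
    have "homeomorphism U' (x ` U') x (\<lambda>y. g (spat y))"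
    proof (rule homeomorphismI[OF xc])
      show "continuous_on (x ` U') (\<lambda>y. g (spat y))"
        by (rule continuous_on_compose2[OF homeomorphism_cont2[OF U'(5)] linear_continuous_on[OF bounded_linear_spat]])
           (use xU in auto)
      show "(\<lambda>y. g (spat y)) ` x ` U' \<subseteq> U'" "\<And>v. v \<in> U' \<Longrightarrow> g (spat (x v)) = v"
        using U'(5) by (auto simp: homeomorphism_def F_def)
      then show "\<And>y. y \<in> x ` U' \<Longrightarrow> x (g (spat y)) = y" by auto
    qed auto
    then show ?thesis using U' op by blast
  qed
  then show ?thesis
    unfolding orthogonal_coordinates_def using W sx smooth_H s Hpos by (auto simp: gram)
qed

end

section \<open>Baker--Akhiezer functions as solutions of the singular problem\<close>

text \<open>Finitely many points are separated pairwise; intersecting the separating sets gives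
  neighbourhoods that are disjoint all at once, and the closed discs are taken inside them.\<close>

lemma (in compact_surface) exists_radii:
  assumes SP: "finite SP" "SP \<subseteq> topspace X" and ch: "\<And>s. s \<in> SP \<Longrightarrow> ch s \<in> \<A> \<and> s \<in> fst (ch s)"
  shows "\<exists>e. punctured_surface X \<A> SP ch e"
proof -
  have "\<exists>U V. openin X U \<and> openin X V \<and> s \<in> U \<and> t \<in> V \<and> disjnt U V" if "s \<in> SP" "t \<in> SP" "s \<noteq> t" for s t
  proof -
    have "s \<in> topspace X" "t \<in> topspace X" using that SP(2) by auto
    then show ?thesis using Haus that(3) unfolding Hausdorff_space_def by metis
  qed
  then obtain U V where UV: "\<And>s t. s \<in> SP \<Longrightarrow> t \<in> SP \<Longrightarrow> s \<noteq> t \<Longrightarrow>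
      openin X (U s t) \<and> openin X (V s t) \<and> s \<in> U s t \<and> t \<in> V s t \<and> disjnt (U s t) (V s t)" by metis
  define N where "N s = topspace X \<inter> (\<Inter>t\<in>SP-{s}. U s t \<inter> V t s)" for s
  have N: "openin X (N s)" "s \<in> N s" if s: "s \<in> SP" for s
  proof -
    have "openin X (topspace X \<inter> (\<Inter>t\<in>SP-{s}. U s t \<inter> V t s))"
    proof (cases "SP - {s} = {}")
      case False
      then show ?thesis using UV s SP(1) by (intro openin_Int openin_topspace openin_INT2) auto
    next
      case True
      show ?thesis unfolding True by simp
    qed
    then show "openin X (N s)" by (simp add: N_def)
    show "s \<in> N s" unfolding N_def using UV s SP(2) by auto
  qed
  have "\<exists>e>0. cball (snd (ch s) s) e \<subseteq> snd (ch s) ` (fst (ch s) \<inter> N s)" if s: "s \<in> SP" for s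
  proof -
    have "open (snd (ch s) ` (fst (ch s) \<inter> N s))" using open_chart_image[OF _ N(1)[OF s]] ch[OF s] by blast
    moreover have "snd (ch s) s \<in> snd (ch s) ` (fst (ch s) \<inter> N s)" using ch[OF s] N(2)[OF s] by blast
    ultimately show ?thesis using open_contains_cball_eq by metis
  qed
  then obtain e where e: "\<And>s. s \<in> SP \<Longrightarrow> 0 < e s \<and> cball (snd (ch s) s) (e s) \<subseteq> snd (ch s) ` (fst (ch s) \<inter> N s)" by metis
  have inN: "chart_inv (ch s) ` cball (snd (ch s) s) (e s) \<subseteq> N s" if s: "s \<in> SP" for s
  proof
    fix p assume "p \<in> chart_inv (ch s) ` cball (snd (ch s) s) (e s)"
    then obtain q where "q \<in> fst (ch s)" "q \<in> N s" "p = chart_inv (ch s) (snd (ch s) q)" using e[OF s] by blast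
    then show "p \<in> N s" using chart_inv_simps(3) ch[OF s] by auto
  qed
  have dj: "N s \<inter> N t = {}" if "s \<in> SP" "t \<in> SP" "s \<noteq> t" for s t
  proof -
    have "N s \<subseteq> U s t" "N t \<subseteq> V s t" unfolding N_def using that by auto
    then show ?thesis using UV[OF that] unfolding disjnt_def by blast
  qed
  have "punctured_surface X \<A> SP ch e"
  proof (unfold_locales)
    show "cball (snd (ch s) s) (e s) \<subseteq> img (ch s)" if "s \<in> SP" for s using e[OF that] by blast
    show "chart_inv (ch s) ` cball (snd (ch s) s) (e s) \<inter> chart_inv (ch t) ` cball (snd (ch t) t) (e t) = {}"
      if "s \<in> SP" "t \<in> SP" "s \<noteq> t" for s t using inN[OF that(1)] inN[OF that(2)] dj[OF that] by blast
  qed (use SP ch e in auto)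
  then show ?thesis by blast
qed

lemma (in punctured_surface) punctured_ball_image:
  assumes s: "s \<in> SP" obtains V where "open V" "cball (ctr s) (e s) \<subseteq> V" "V - {ctr s} \<subseteq> snd (ch s) ` (fst (ch s) - SP)" "V \<subseteq> img (ch s)"
proof
  have fin: "finite (SP - {s})" using SP(1) by simp
  show "open (snd (ch s) ` (fst (ch s) - (SP - {s})))" by (rule open_chart_image_Diff[OF ch(1)[OF s] fin])
  show "cball (ctr s) (e s) \<subseteq> snd (ch s) ` (fst (ch s) - (SP - {s}))"
  proof
    fix z assume z: "z \<in> cball (ctr s) (e s)"
    show "z \<in> snd (ch s) ` (fst (ch s) - (SP - {s}))"
    proof (cases "z = ctr s")
      case True then show ?thesis using ch[OF s] by blast
    next
      case False
      then have "z \<in> snd (ch s) ` (fst (ch s) - SP)" using punctured_disc_img(1)[OF s, of z] z by blast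
      then show ?thesis by blast
    qed
  qed
qed auto

text \<open>Riemann's theorem on removable singularities: a limit of the multiplied function at each
  centre already provides a remainder.\<close>

lemma (in punctured_surface) germs_of_limits:
  assumes h: "holo \<phi>"
    and m: "\<And>s. s \<in> SP \<Longrightarrow> m s holomorphic_on - {ctr s}"
    and lim: "\<And>s. s \<in> SP \<Longrightarrow> ((\<lambda>z. m s z * \<phi> (chart_inv (ch s) z)) \<longlongrightarrow> L s) (at (ctr s))"
  shows "\<exists>G. germs m (\<lambda>_ _. 0) G \<phi> \<and> (\<forall>s\<in>SP. G s (ctr s) = L s)"
proof -
  have "\<exists>g. ext s g \<and> g (ctr s) = L s \<and> (\<forall>z\<in>cball (ctr s) (e s) - {ctr s}. m s z * \<phi> (chart_inv (ch s) z) = g z)" if s: "s \<in> SP" for s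
  proof -
    obtain V where V: "open V" "cball (ctr s) (e s) \<subseteq> V" "V - {ctr s} \<subseteq> snd (ch s) ` (fst (ch s) - SP)"
      using punctured_ball_image[OF s] by metis
    have aV: "ctr s \<in> V" using V(2) e(1)[OF s] by auto
    define w where "w z = m s z * \<phi> (chart_inv (ch s) z)" for z
    have "(\<lambda>z. \<phi> (chart_inv (ch s) z)) holomorphic_on snd (ch s) ` (fst (ch s) - SP)"
      using h ch(1)[OF s] unfolding holo_def by (rule bspec)
    then have wh: "w holomorphic_on V - {ctr s}"
      unfolding w_def by (intro holomorphic_on_mult holomorphic_on_subset[OF m[OF s]]) (use V(3) holomorphic_on_subset in auto)
    have wl: "(w \<longlongrightarrow> L s) (at (ctr s))" unfolding w_def by (rule lim[OF s])
    define g where "g z = (if z = ctr s then L s else w z)" for z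
    have "g holomorphic_on V"
    proof (rule no_isolated_singularity'[of "{ctr s}"])
      show "g holomorphic_on V - {ctr s}" using wh by (rule holomorphic_transform) (auto simp: g_def)
      show "(g \<longlongrightarrow> g z) (at z within V)" if "z \<in> {ctr s}" for z
      proof -
        have "\<forall>\<^sub>F z in at (ctr s). w z = g z"
          using eventually_neq_at_within[of "ctr s" "ctr s"] by eventually_elim (simp add: g_def)
        from Lim_transform_eventually[OF wl this] have "(g \<longlongrightarrow> L s) (at (ctr s))" .
        then show ?thesis using that by (auto simp: g_def intro: tendsto_within_subset)
      qed
    qed (use V(1) in auto)
    then have gc: "g holomorphic_on cball (ctr s) (e s)" using V(2) by (rule holomorphic_on_subset)
    then have "g holomorphic_on ball (ctr s) (e s)" by (rule holomorphic_on_subset) simp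
    with holomorphic_on_imp_continuous_on[OF gc] have "ext s g" by (simp add: ext_def)
    then show ?thesis by (intro exI[of _ g]) (auto simp: g_def w_def)
  qed
  then obtain G where "\<And>s. s \<in> SP \<Longrightarrow> ext s (G s) \<and> G s (ctr s) = L s \<and>
      (\<forall>z\<in>cball (ctr s) (e s) - {ctr s}. m s z * \<phi> (chart_inv (ch s) z) = G s z)" by metis
  then show ?thesis unfolding germs_def using h by (intro exI[of _ G]) auto
qed

lemma (in ba_family) mlt_holomorphic: "mlt u s holomorphic_on - {ctr s}"
  by (cases "s \<in> range P") (auto simp: mlt_def[abs_def] ctr_range intro!: holomorphic_intros)

lemma has_laurent_expansion_imp_limit:
  assumes "f has_laurent_expansion F" "0 \<le> fls_subdegree F"
  shows "(f \<longlongrightarrow> fls_nth F 0) (at 0)"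
  using has_laurent_expansion_imp_tendsto_0[OF assms] .

lemma limit_has_laurent_expansion:
  fixes g :: "complex \<Rightarrow> complex"
  assumes "g holomorphic_on ball 0 r" "0 < r"
    and "\<forall>\<^sub>F z in at 0. f z = g z"
  shows "f has_laurent_expansion fps_to_fls (fps_expansion g 0)"
proof -
  have "g analytic_on {0}" using assms(1,2) by (auto simp: analytic_at intro!: exI[of _ "ball 0 r"])
  then have "g has_fps_expansion fps_expansion g 0" using analytic_at_imp_has_fps_expansion_0 by blast
  then have "g has_laurent_expansion fps_to_fls (fps_expansion g 0)" by (rule has_laurent_expansion_fps)
  then show ?thesis using has_laurent_expansion_cong[OF assms(3) refl] by simp
qed

lemma injective_quotient_limit:
  assumes T: "T holomorphic_on V" "open V" "inj_on T V" and b: "b \<in> V"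
  shows "((\<lambda>z. (z - b) / (T z - T b)) \<longlongrightarrow> 1 / deriv T b) (at b)" "deriv T b \<noteq> 0"
proof -
  show nz: "deriv T b \<noteq> 0" by (rule holomorphic_injective_imp_regular[OF T(1,2,3) b])
  have "((\<lambda>z. (T z - T b) / (z - b)) \<longlongrightarrow> deriv T b) (at b)"
    using holomorphic_derivI[OF T(1,2) b, of UNIV] by (simp add: has_field_derivative_iff)
  from tendsto_inverse[OF this nz] show "((\<lambda>z. (z - b) / (T z - T b)) \<longlongrightarrow> 1 / deriv T b) (at b)"
    by (simp add: inverse_eq_divide)
qed

locale ba_surface =
  fixes X :: "'a topology" and \<A> :: "'a chart set" and g :: nat
    and P :: "'n::finite \<Rightarrow> 'a" and \<kappa> :: "'n \<Rightarrow> 'a chart"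
    and Q :: "'n option \<Rightarrow> 'a" and \<gamma>s rs :: "'a list" and r :: 'a
    and h :: real and U :: "(real ^ 'n) set" and \<psi> :: "real ^ 'n \<Rightarrow> 'a \<Rightarrow> complex"
    and \<sigma> \<tau> :: "'a \<Rightarrow> 'a" and \<Omega> :: "'a form"
    and A :: "'n option \<Rightarrow> real" and B :: complex and C :: "'n \<Rightarrow> complex"
    and f :: "'n \<Rightarrow> real ^ 'n \<Rightarrow> complex" and H :: "'n \<Rightarrow> real ^ 'n \<Rightarrow> real"
  assumes surface: "compact_riemann_surface X \<A> g"
    and points: "range P \<union> range Q \<union> set (\<gamma>s @ r # rs) \<subseteq> topspace X"
    and distinct_points: "inj P" "inj Q" "distinct (\<gamma>s @ r # rs)" "range P \<inter> range Q = {}"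
      "(range P \<union> range Q) \<inter> set (\<gamma>s @ r # rs) = {}"
    and degree: "length \<gamma>s = g + length rs"
    and parameters: "\<And>i. local_parameter \<A> (P i) (\<kappa> i)"
    and domain: "open U" "connected U"
    and h_nonzero: "h \<noteq> 0"
    and BA: "baker_akhiezer X \<A> P \<kappa> \<gamma>s r rs (of_real h) U \<psi>"
    and sigma: "holomorphic_involution X \<A> \<sigma>"
    and sigma_fixed: "\<And>p. p \<in> range Q \<union> range P \<union> {r} \<Longrightarrow> \<sigma> p = p"
    and sigma_local: "\<And>i. \<forall>\<^sub>F p in nhdsin X (P i). snd (\<kappa> i) (\<sigma> p) = - snd (\<kappa> i) p"
    and form: "meromorphic_form \<A> \<Omega>"
    and form_divisor: "has_divisor \<A> \<Omega>
      (divisor_of \<gamma>s + push_divisor \<sigma> (divisor_of \<gamma>s) + (\<Sum>i\<in>UNIV. frag_of (P i))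
        - (\<Sum>i\<in>UNIV. frag_of (Q i)) - divisor_of (r # rs) - push_divisor \<sigma> (divisor_of rs))"
    and tau: "antiholomorphic_involution X \<A> \<tau>"
    and tau_fixed: "\<And>p. p \<in> range P \<union> range Q \<union> set (\<gamma>s @ r # rs) \<Longrightarrow> \<tau> p = p"
    and tau_local: "\<And>i. \<forall>\<^sub>F p in nhdsin X (P i). snd (\<kappa> i) (\<tau> p) = cnj (snd (\<kappa> i) p)"
    and A_eq: "\<And>i. of_real (A i) = form_residue \<A> \<Omega> (Q i)"
    and B_eq: "B = form_residue \<A> \<Omega> r"
    and C_eq: "\<And>i. - C i = fls_nth (laurent_expansion (\<Omega> (\<kappa> i)) 0) 1"
    and f_eq: "\<And>j u. f j u = leading_coeff (\<kappa> j) (u $ j) (\<psi> u)"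
    and A_neg: "\<And>i. A (Some i) < 0" and A_pos: "0 < A None"
    and hB: "(of_real h)\<^sup>2 * B = -1"
    and H_eq: "\<And>i u. H i u = sqrt (cmod (- (f i u)\<^sup>2 * C i))"
begin

abbreviation "SP \<equiv> range P \<union> set \<gamma>s"
abbreviation "Z \<equiv> insert r (set rs)"

lemma compact_surface: "compact_surface X \<A>"
  using surface by (auto simp: compact_surface_def compact_riemann_surface_def)

text \<open>At \<open>P j\<close> the chart must be the given local parameter, since the exponential
  in \<open>mlt\<close> is written in its coordinate; at the other points any chart will do.\<close>

definition ch :: "'a \<Rightarrow> 'a chart" where
  "ch s = (if s \<in> range P then \<kappa> (inv_into UNIV P s) else SOME c. c \<in> \<A> \<and> s \<in> fst c)"

definition rad :: "'a \<Rightarrow> real" where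
  "rad = (SOME e. punctured_surface X \<A> SP ch e)"

lemma SP_topspace: "SP \<subseteq> topspace X" using points by auto

lemma some_chart: "p \<in> topspace X \<Longrightarrow> (SOME c. c \<in> \<A> \<and> p \<in> fst c) \<in> \<A> \<and> p \<in> fst (SOME c. c \<in> \<A> \<and> p \<in> fst c)"
  using compact_surface.chart_exists[OF compact_surface, of p] someI_ex[of "\<lambda>c. c \<in> \<A> \<and> p \<in> fst c"] by blast

lemma ch_P [simp]: "ch (P j) = \<kappa> j" using distinct_points(1) by (simp add: ch_def)

lemma ch_chart: "s \<in> SP \<Longrightarrow> ch s \<in> \<A> \<and> s \<in> fst (ch s)"
proof -
  assume s: "s \<in> SP"
  show "ch s \<in> \<A> \<and> s \<in> fst (ch s)"
  proof (cases "s \<in> range P")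
    case True
    then obtain j where "s = P j" by blast
    then show ?thesis using parameters[of j] by (simp add: local_parameter_def)
  next
    case False
    then show ?thesis using some_chart[of s] s SP_topspace by (auto simp: ch_def)
  qed
qed

lemma P_center: "snd (\<kappa> j) (P j) = 0" using parameters[of j] by (simp add: local_parameter_def)

lemma punctured: "punctured_surface X \<A> SP ch rad"
  unfolding rad_def
  by (rule someI_ex[of "punctured_surface X \<A> SP ch"], rule compact_surface.exists_radii[OF compact_surface _ SP_topspace ch_chart]) auto

lemma Z_regular: "Z \<subseteq> topspace X - SP"
  using points distinct_points by auto

lemma ba_family: "ba_family X \<A> SP ch rad P Z U"
proof -
  interpret punctured_surface X \<A> SP ch rad by (rule punctured)
  show ?thesis
    by unfold_locales (use distinct_points(1) P_center Z_regular domain in auto)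
qed

end

sublocale ba_surface \<subseteq> ba_family X \<A> SP ch rad P Z U
  by (rule ba_family)

context ba_surface
begin

lemma regular_set_eq: "fst c - range P - set \<gamma>s = fst c - SP" by auto

lemma BA_at: "u \<in> U \<Longrightarrow> baker_akhiezer_at \<A> P \<kappa> \<gamma>s r rs (of_real h) u (\<psi> u)"
  and BA_unique: "u \<in> U \<Longrightarrow> baker_akhiezer_at \<A> P \<kappa> \<gamma>s r rs (of_real h) u \<phi> \<Longrightarrow> p \<in> topspace X - SP \<Longrightarrow> \<phi> p = \<psi> u p"
  using BA unfolding baker_akhiezer_def by auto

lemma P_not_gamma: "s \<in> set \<gamma>s \<Longrightarrow> s \<notin> range P"
  using distinct_points(5) by auto

lemma mlt_P: "mlt u (P j) z = exp (- of_real (u $ j) / z)" by (simp add: mlt_def)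
lemma mlt_gamma: "s \<notin> range P \<Longrightarrow> mlt u s z = z - ctr s" by (simp add: mlt_def)

text \<open>The Laurent conditions become limits of the multiplied function, and the leading
  coefficient becomes the value of the remainder at 0.\<close>

lemma BA_germs:
  assumes "baker_akhiezer_at \<A> P \<kappa> \<gamma>s r rs h0 u \<phi>"
  shows "\<exists>G. germs (mlt u) (\<lambda>_ _. 0) G \<phi> \<and> (\<forall>j. G (P j) 0 = leading_coeff (\<kappa> j) (u $ j) \<phi>)"
proof -
  have hol: "holo \<phi>" using assms unfolding baker_akhiezer_at_def holo_def regular_set_eq by blast
  have ex: "\<exists>l. ((\<lambda>z. mlt u s z * \<phi> (chart_inv (ch s) z)) \<longlongrightarrow> l) (at (ctr s)) \<and> (\<forall>j. s = P j \<longrightarrow> l = leading_coeff (\<kappa> j) (u $ j) \<phi>)" if s: "s \<in> SP" for s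
  proof (cases "s \<in> range P")
    case True
    then obtain j where j: "s = P j" by blast
    obtain F where F: "regular_factor (\<kappa> j) (u $ j) \<phi> has_laurent_expansion fps_to_fls F"
      using assms unfolding baker_akhiezer_at_def by blast
    have "leading_coeff (\<kappa> j) (u $ j) \<phi> = fls_nth (fps_to_fls F) 0"
      using laurent_expansion_0_eqI[OF F] by (simp add: leading_coeff_def)
    moreover have "((\<lambda>z. mlt u s z * \<phi> (chart_inv (ch s) z)) \<longlongrightarrow> fls_nth (fps_to_fls F) 0) (at (ctr s))"
      using has_laurent_expansion_imp_limit[OF F] j P_center by (simp add: mlt_P regular_factor_def fls_subdegree_fls_to_fps_gt0)
    moreover have "j' = j" if "s = P j'" for j' using j that distinct_points(1) by (auto dest: injD)
    ultimately show ?thesis by (intro exI[of _ "fls_nth (fps_to_fls F) 0"]) auto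
  next
    case False
    then have g: "s \<in> fst (ch s) \<inter> set \<gamma>s" "ch s \<in> \<A>" using s ch_chart[OF s] by auto
    then obtain F where F: "(\<lambda>z. \<phi> (chart_inv (ch s) (ctr s + z))) has_laurent_expansion F" "-1 \<le> fls_subdegree F"
      using assms unfolding baker_akhiezer_at_def by blast
    have "(\<lambda>z. z * \<phi> (chart_inv (ch s) (ctr s + z))) has_laurent_expansion fls_X * F"
      by (intro laurent_expansion_intros F(1))
    moreover have "0 \<le> fls_subdegree (fls_X * F)"
      using F(2) by (cases "F = 0") auto
    ultimately have "((\<lambda>z. z * \<phi> (chart_inv (ch s) (ctr s + z))) \<longlongrightarrow> fls_nth (fls_X * F) 0) (at 0)"
      by (rule has_laurent_expansion_imp_limit)
    then have "((\<lambda>z. (z - ctr s) * \<phi> (chart_inv (ch s) z)) \<longlongrightarrow> fls_nth (fls_X * F) 0) (at (ctr s))"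
      by (subst at_to_0) (simp add: filterlim_filtermap add.commute)
    then show ?thesis using False by (auto simp: mlt_gamma)
  qed
  define L where "L s = (SOME l. ((\<lambda>z. mlt u s z * \<phi> (chart_inv (ch s) z)) \<longlongrightarrow> l) (at (ctr s)) \<and>
    (\<forall>j. s = P j \<longrightarrow> l = leading_coeff (\<kappa> j) (u $ j) \<phi>))" for s
  have L: "((\<lambda>z. mlt u s z * \<phi> (chart_inv (ch s) z)) \<longlongrightarrow> L s) (at (ctr s)) \<and> (\<forall>j. s = P j \<longrightarrow> L s = leading_coeff (\<kappa> j) (u $ j) \<phi>)" if s: "s \<in> SP" for s
    unfolding L_def by (rule someI_ex[OF ex[OF s]])
  have "\<exists>G. germs (mlt u) (\<lambda>_ _. 0) G \<phi> \<and> (\<forall>s\<in>SP. G s (ctr s) = L s)"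
    by (rule germs_of_limits[OF hol mlt_holomorphic]) (use L in simp)
  then obtain G where "germs (mlt u) (\<lambda>_ _. 0) G \<phi>" "\<forall>s\<in>SP. G s (ctr s) = L s" by (elim exE conjE)
  moreover have "L (P j) = leading_coeff (\<kappa> j) (u $ j) \<phi>" for j using L[OF P_SP, of j] by blast
  ultimately show ?thesis using P_center by (intro exI[of _ G]) (auto simp: ctrP dest: bspec[OF _ P_SP])
qed

text \<open>The way back, which brings linear combinations of solutions under the uniqueness clause
  of \<open>baker_akhiezer\<close>. Poles on \<open>\<gamma>s\<close> have to be examined in every
  chart, not only in \<open>ch\<close>.\<close>

lemma germs_BA:
  assumes g: "germs (mlt u) (\<lambda>_ _. 0) G \<phi>"
  shows "\<exists>F. regular_factor (\<kappa> j) (u $ j) \<phi> has_laurent_expansion fps_to_fls F"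
    and "c \<in> \<A> \<Longrightarrow> p \<in> fst c \<inter> set \<gamma>s \<Longrightarrow>
      \<exists>F. (\<lambda>z. \<phi> (chart_inv c (snd c p + z))) has_laurent_expansion F \<and> -1 \<le> fls_subdegree F"
proof -
  have Gh: "G s holomorphic_on ball (ctr s) (rad s)" if "s \<in> SP" for s by (rule ext_holomorphic_ball[OF germsD(2)[OF g that]])
  have "\<forall>\<^sub>F z in at 0. regular_factor (\<kappa> j) (u $ j) \<phi> z = G (P j) z"
  proof -
    have "\<forall>\<^sub>F z in at 0. z \<in> ball (ctr (P j)) (rad (P j))" by (rule eventually_at_in_open'[OF open_ball zero_in_ball])
    then show ?thesis using eventually_neq_at_within[of "0::complex" 0]
    proof eventually_elim
      case (elim z)
      then show ?case using germsD(3)[OF g P_SP, of z j] P_center by (simp add: mlt_P regular_factor_def)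
    qed
  qed
  then show "\<exists>F. regular_factor (\<kappa> j) (u $ j) \<phi> has_laurent_expansion fps_to_fls F"
    using limit_has_laurent_expansion[of "G (P j)" "rad (P j)"] Gh[OF P_SP, of j] P_center zero_in_ball[of j] by (auto intro!: exI)
  assume c: "c \<in> \<A>" and p: "p \<in> fst c \<inter> set \<gamma>s"
  have pS: "p \<in> SP" and pP: "p \<notin> range P" using p P_not_gamma by auto
  define T where "T = transition c (ch p)"
  define V where "V = snd c ` (fst c \<inter> odisc p)"
  have od: "odisc p \<subseteq> fst (ch p)" using odisc_eq[OF pS] by blast
  have V: "open V" "snd c p \<in> V" unfolding V_def using open_chart_image[OF c openin_odisc[OF pS]] p self_odisc[OF pS] by auto
  have Th: "T holomorphic_on V"
    unfolding T_def transition_def comp_def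
    by (rule holomorphic_on_subset[OF transition_holomorphic[OF c ch(1)[OF pS]]]) (use od V_def in auto)
  have TV: "T z \<in> ball (ctr p) (rad p)" "chart_inv c z = chart_inv (ch p) (T z)" if zV: "z \<in> V" for z
  proof -
    obtain q where q: "q \<in> fst c" "q \<in> odisc p" "z = snd c q" using zV unfolding V_def by blast
    then have "T z = snd (ch p) q" "chart_inv c z = q" using chart_inv_simps(3)[OF c] by (auto simp: T_def transition_def)
    then show "T z \<in> ball (ctr p) (rad p)" "chart_inv c z = chart_inv (ch p) (T z)"
      using q odisc_eq[OF pS] chart_inv_simps(3)[OF ch(1)[OF pS]] by auto
  qed
  have inj: "inj_on T V"
  proof (rule inj_onI)
    fix z w assume zw: "z \<in> V" "w \<in> V" "T z = T w"
    then have "chart_inv c z = chart_inv c w" using TV(2) by simp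
    moreover have "z \<in> img c" "w \<in> img c" using zw V_def by auto
    ultimately show "z = w" using chart_inv_simps(2)[OF c] by metis
  qed
  have Tb: "T (snd c p) = ctr p" using chart_inv_simps(3)[OF c] p by (auto simp: T_def transition_def)
  \<comment> \<open>The quotient of the two coordinates centred at \<open>p\<close>. It has a finite
    nonzero limit, so an at most simple pole in one chart is one in the other.\<close>
  define k where "k w = (w - snd c p) / (T w - ctr p)" for w
  have kl: "(k \<longlongrightarrow> 1 / deriv T (snd c p)) (at (snd c p))"
    using injective_quotient_limit(1)[OF Th V(1) inj V(2)] unfolding k_def Tb .
  have "isCont (G p) (ctr p)" 
    using Gh[OF pS] e(1)[OF pS] by (meson centre_in_ball continuous_on_eq_continuous_at holomorphic_on_imp_continuous_on open_ball)
  moreover have "isCont T (snd c p)" using Th V by (meson continuous_on_eq_continuous_at holomorphic_on_imp_continuous_on)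
  ultimately have "((\<lambda>w. G p (T w)) \<longlongrightarrow> G p (ctr p)) (at (snd c p))"
    using Tb by (metis isCont_tendsto_compose isCont_def)
  from tendsto_mult[OF kl this]
  have lim: "((\<lambda>w. k w * G p (T w)) \<longlongrightarrow> 1 / deriv T (snd c p) * G p (ctr p)) (at (snd c p))" .
  obtain \<rho> where \<rho>: "0 < \<rho>" "ball (snd c p) \<rho> \<subseteq> V" using V open_contains_ball_eq by metis
  define gg where "gg w = (if w = snd c p then 1 / deriv T (snd c p) * G p (ctr p) else k w * G p (T w))" for w
  have ggh: "gg holomorphic_on ball (snd c p) \<rho>"
  proof (rule no_isolated_singularity'[of "{snd c p}"])
    have "(\<lambda>w. k w * G p (T w)) holomorphic_on ball (snd c p) \<rho> - {snd c p}"
      unfolding k_def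
    proof (intro holomorphic_intros)
      show "T holomorphic_on ball (snd c p) \<rho> - {snd c p}" using holomorphic_on_subset[OF Th] \<rho>(2) by blast
      show "T w - ctr p \<noteq> 0" if "w \<in> ball (snd c p) \<rho> - {snd c p}" for w
        using inj_onD[OF inj, of w "snd c p"] Tb V(2) \<rho>(2) that by auto
      show "(\<lambda>w. G p (T w)) holomorphic_on ball (snd c p) \<rho> - {snd c p}"
      proof (rule holomorphic_on_compose_gen[OF _ Gh[OF pS], unfolded comp_def])
        show "T holomorphic_on ball (snd c p) \<rho> - {snd c p}" by (rule holomorphic_on_subset[OF Th]) (use \<rho>(2) in auto)
        show "T ` (ball (snd c p) \<rho> - {snd c p}) \<subseteq> ball (ctr p) (rad p)" using \<rho>(2) TV(1) by blast
      qed
    qed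
    then show "gg holomorphic_on ball (snd c p) \<rho> - {snd c p}"
      by (rule holomorphic_transform) (auto simp: gg_def)
    have "\<forall>\<^sub>F w in at (snd c p). k w * G p (T w) = gg w"
      using eventually_neq_at_within[of "snd c p" "snd c p"] by eventually_elim (simp add: gg_def)
    from Lim_transform_eventually[OF lim this]
    have "(gg \<longlongrightarrow> gg (snd c p)) (at (snd c p))" by (simp add: gg_def[of "snd c p"])
    then show "(gg \<longlongrightarrow> gg z) (at z within ball (snd c p) \<rho>)" if "z \<in> {snd c p}" for z
      unfolding singletonD[OF that] by (rule Lim_at_imp_Lim_at_within)
  qed auto
  have eq: "\<phi> (chart_inv c w) = gg w / (w - snd c p)" if w: "w \<in> ball (snd c p) \<rho>" "w \<noteq> snd c p" for w
  proof -
    have wV: "w \<in> V" using w \<rho>(2) by blast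
    have Tn: "T w \<noteq> ctr p" using inj_onD[OF inj _ wV V(2)] Tb w(2) by auto
    have "(T w - ctr p) * \<phi> (chart_inv (ch p) (T w)) = G p (T w)"
      using germsD(3)[OF g pS, of "T w"] TV(1)[OF wV] Tn pP by (simp add: mlt_gamma)
    then have "\<phi> (chart_inv c w) = G p (T w) / (T w - ctr p)" using TV(2)[OF wV] Tn by (simp add: field_simps)
    then show ?thesis using w(2) by (simp add: gg_def k_def)
  qed
  define g0 where "g0 z = gg (snd c p + z)" for z
  have g0h: "g0 holomorphic_on ball 0 \<rho>"
    unfolding g0_def
    by (rule holomorphic_on_compose_gen[OF _ ggh, unfolded comp_def]) (auto intro!: holomorphic_intros simp: dist_norm)
  have "(\<lambda>z. z * \<phi> (chart_inv c (snd c p + z))) has_laurent_expansion fps_to_fls (fps_expansion g0 0)"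
  proof (rule limit_has_laurent_expansion[OF g0h \<rho>(1)])
    have "\<forall>\<^sub>F z in at 0. z \<in> ball (0::complex) \<rho>" by (rule eventually_at_in_open') (use \<rho> in auto)
    then show "\<forall>\<^sub>F z in at 0. z * \<phi> (chart_inv c (snd c p + z)) = g0 z"
      using eventually_neq_at_within[of "0::complex" 0]
    proof eventually_elim
      case (elim z)
      then show ?case using eq[of "snd c p + z"] by (simp add: g0_def dist_norm)
    qed
  qed
  then have "(\<lambda>z. inverse z * (z * \<phi> (chart_inv c (snd c p + z)))) has_laurent_expansion inverse fls_X * fps_to_fls (fps_expansion g0 0)"
    by (intro has_laurent_expansion_mult has_laurent_expansion_inverse has_laurent_expansion_fps_X)
  then have "(\<lambda>z. \<phi> (chart_inv c (snd c p + z))) has_laurent_expansion inverse fls_X * fps_to_fls (fps_expansion g0 0)"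
  proof (rule has_laurent_expansion_cong[THEN iffD1, rotated 2])
    show "\<forall>\<^sub>F z in at 0. inverse z * (z * \<phi> (chart_inv c (snd c p + z))) = \<phi> (chart_inv c (snd c p + z))"
      using eventually_neq_at_within[of "0::complex" 0] by eventually_elim simp
  qed simp
  moreover have "-1 \<le> fls_subdegree (inverse fls_X * fps_to_fls (fps_expansion g0 0))"
    by (cases "fps_expansion g0 0 = 0") (auto simp: fls_subdegree_fls_to_fps)
  ultimately show "\<exists>F. (\<lambda>z. \<phi> (chart_inv c (snd c p + z))) has_laurent_expansion F \<and> -1 \<le> fls_subdegree F" by blast
qed

end

section \<open>Leading Laurent coefficients\<close>

text \<open>Since \<open>v = 0\<close> is allowed, \<open>k\<close> is only a lower bound for the order of \<open>F\<close> at \<open>a\<close>.\<close>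

definition lead :: "(complex \<Rightarrow> complex) \<Rightarrow> complex \<Rightarrow> int \<Rightarrow> complex \<Rightarrow> bool" where
  "lead F a k v \<longleftrightarrow> (\<exists>g. g analytic_on {a} \<and> g a = v \<and> (\<forall>\<^sub>F z in at a. F z = g z * (z - a) powi k))"

lemma lead_cong: 
  assumes "lead F a k v" "\<forall>\<^sub>F z in at a. F z = F' z" shows "lead F' a k v"
proof -
  obtain g where g: "g analytic_on {a}" "g a = v" "\<forall>\<^sub>F z in at a. F z = g z * (z - a) powi k"
    using assms(1) by (auto simp: lead_def)
  have "\<forall>\<^sub>F z in at a. F' z = g z * (z - a) powi k" using g(3) assms(2) by eventually_elim simp
  then show ?thesis using g by (auto simp: lead_def)
qed

lemma lead_analytic: "F analytic_on {a} \<Longrightarrow> lead F a 0 (F a)"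
  unfolding lead_def by (intro exI[of _ F]) simp

lemma lead_mult:
  assumes "lead F a k v" "lead F' a k' v'" shows "lead (\<lambda>z. F z * F' z) a (k + k') (v * v')"
proof -
  obtain g where g: "g analytic_on {a}" "g a = v" "\<forall>\<^sub>F z in at a. F z = g z * (z - a) powi k"
    using assms(1) by (auto simp: lead_def)
  obtain g' where g': "g' analytic_on {a}" "g' a = v'" "\<forall>\<^sub>F z in at a. F' z = g' z * (z - a) powi k'"
    using assms(2) by (auto simp: lead_def)
  have "\<forall>\<^sub>F z in at a. F z * F' z = g z * g' z * (z - a) powi (k + k')"
    using g(3) g'(3) eventually_neq_at_within[of a a] by eventually_elim (simp add: power_int_add)
  then show ?thesis unfolding lead_def
    by (intro exI[of _ "\<lambda>z. g z * g' z"]) (use g g' in \<open>auto intro: analytic_intros\<close>)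
qed

lemma analytic_quotient:
  fixes g :: "complex \<Rightarrow> complex"
  assumes "g analytic_on {a}"
  shows "(\<lambda>z. if z = a then deriv g a else (g z - g a) / (z - a)) analytic_on {a}"
  using assms pole_lemma_open unfolding analytic_at by blast

lemma lead_raise:
  assumes "lead F a k 0" shows "\<exists>v. lead F a (k + 1) v"
proof -
  obtain g where g: "g analytic_on {a}" "g a = 0" "\<forall>\<^sub>F z in at a. F z = g z * (z - a) powi k"
    using assms(1) by (auto simp: lead_def)
  let ?q = "\<lambda>z. if z = a then deriv g a else (g z - g a) / (z - a)"
  have "\<forall>\<^sub>F z in at a. F z = ?q z * (z - a) powi (k + 1)"
    using g(3) eventually_neq_at_within[of a a] by eventually_elim (simp add: power_int_add_1' g(2))
  then show ?thesis unfolding lead_def using analytic_quotient[OF g(1)] by blast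
qed

lemma lead_tendsto:
  assumes "lead F a k v" shows "((\<lambda>z. (z - a) powi (- k) * F z) \<longlongrightarrow> v) (at a)"
proof -
  obtain g where g: "g analytic_on {a}" "g a = v" "\<forall>\<^sub>F z in at a. F z = g z * (z - a) powi k"
    using assms(1) by (auto simp: lead_def)
  have "(g \<longlongrightarrow> v) (at a)" using analytic_at_imp_isCont[OF g(1)] g(2) by (simp add: isCont_def)
  then show ?thesis
  proof (rule Lim_transform_eventually)
    show "\<forall>\<^sub>F z in at a. g z = (z - a) powi (- k) * F z"
      using g(3) eventually_neq_at_within[of a a] by eventually_elim (simp add: power_int_minus)
  qed
qed

text \<open>T z - T a = q z * (z - a) with q a the derivative of \<open>T\<close> at
  \<open>a\<close>: the order is kept and the coefficient picks up a power of that
  derivative.\<close>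

lemma lead_compose:
  assumes T: "T analytic_on {a}" "deriv T a \<noteq> 0" and F: "lead F (T a) k v"
  shows "lead (\<lambda>z. F (T z)) a k (v * deriv T a powi k)"
proof -
  obtain g where g: "g analytic_on {T a}" "g (T a) = v" "\<forall>\<^sub>F z in at (T a). F z = g z * (z - T a) powi k"
    using F by (auto simp: lead_def)
  define q where "q z = (if z = a then deriv T a else (T z - T a) / (z - a))" for z
  have q: "q analytic_on {a}" "q a = deriv T a" unfolding q_def[abs_def] using analytic_quotient[OF T(1)] by simp_all
  have "isCont q a" by (rule analytic_at_imp_isCont[OF q(1)])
  then have "(q \<longlongrightarrow> deriv T a) (at a)" using q(2) by (simp add: isCont_def)
  then have nz: "\<forall>\<^sub>F z in at a. q z \<noteq> 0" by (rule tendsto_imp_eventually_ne[OF _ T(2)])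
  have ne: "\<forall>\<^sub>F z in at a. T z \<noteq> T a"
    using nz eventually_neq_at_within[of a a] by eventually_elim (auto simp: q_def)
  have "(T \<longlongrightarrow> T a) (at a)" using analytic_at_imp_isCont[OF T(1)] by (simp add: isCont_def)
  then have "filterlim T (at (T a)) (at a)" using ne by (simp add: filterlim_at)
  from eventually_compose_filterlim[OF g(3) this]
  have "\<forall>\<^sub>F z in at a. F (T z) = g (T z) * q z powi k * (z - a) powi k"
    using eventually_neq_at_within[of a a]
  proof eventually_elim
    case (elim z)
    then have "T z - T a = q z * (z - a)" by (simp add: q_def)
    then show ?case using elim by (simp add: power_int_mult_distrib)
  qed
  moreover have "(\<lambda>z. g (T z)) analytic_on {a}"
    using analytic_on_compose[OF T(1), of g] g(1) by (simp add: comp_def)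
  then have "(\<lambda>z. g (T z) * q z powi k) analytic_on {a}"
    using q T(2) by (auto intro!: analytic_intros)
  ultimately show ?thesis unfolding lead_def
    by (intro exI[of _ "\<lambda>z. g (T z) * q z powi k"]) (simp add: q(2) g(2))
qed

lemma analytic_cnj_cnj:
  assumes "F analytic_on {a}" shows "(\<lambda>z. cnj (F (cnj z))) analytic_on {cnj a}"
proof -
  obtain V where V: "open V" "a \<in> V" "F holomorphic_on V" using assms by (auto simp: analytic_at)
  have o: "open (cnj ` V)" unfolding image_cnj_conv_vimage_cnj using V(1) by (intro open_vimage) auto
  have "cnj ` cnj ` V = V" by (auto simp: image_image)
  then have "cnj \<circ> F \<circ> cnj holomorphic_on cnj ` V" using holomorphic_on_compose_cnj_cnj[OF _ o] V(3) by simp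
  then show ?thesis unfolding analytic_at using o V(2) by (intro exI[of _ "cnj ` V"]) (auto simp: comp_def)
qed

lemma filterlim_cnj: "filterlim cnj (at a) (at (cnj a))"
  unfolding filterlim_at
proof
  show "\<forall>\<^sub>F x in at (cnj a). cnj x \<in> UNIV \<and> cnj x \<noteq> a"
    using eventually_neq_at_within[of "cnj a" "cnj a"] by eventually_elim auto
  show "(cnj \<longlongrightarrow> a) (at (cnj a))" using tendsto_cnj[OF tendsto_ident_at, of "cnj a" UNIV] by simp
qed

lemma lead_cnj: 
  assumes "lead F a k v" shows "lead (\<lambda>z. cnj (F (cnj z))) (cnj a) k (cnj v)"
proof -
  obtain g where g: "g analytic_on {a}" "g a = v" "\<forall>\<^sub>F z in at a. F z = g z * (z - a) powi k"
    using assms(1) by (auto simp: lead_def)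
  from eventually_compose_filterlim[OF g(3) filterlim_cnj]
  have "\<forall>\<^sub>F z in at (cnj a). cnj (F (cnj z)) = cnj (g (cnj z)) * (z - cnj a) powi k"
    by eventually_elim simp
  then show ?thesis unfolding lead_def using analytic_cnj_cnj[OF g(1)] g(2) by (intro exI[of _ "\<lambda>z. cnj (g (cnj z))"]) simp
qed

lemma lead_residue: 
  assumes "lead F a (-1) v" shows "residue F a = v"
proof -
  obtain g where g: "g analytic_on {a}" "g a = v" "\<forall>\<^sub>F z in at a. F z = g z * (z - a) powi (-1)"
    using assms(1) by (auto simp: lead_def)
  obtain V where V: "open V" "a \<in> V" "g holomorphic_on V" using g(1) by (auto simp: analytic_at)
  have "residue F a = residue (\<lambda>z. g z / (z - a)) a"
    by (rule residue_cong[OF _ refl]) (use g(3) in eventually_elim, simp add: field_simps)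
  then show ?thesis using residue_simple[OF V] g(2) by simp
qed

lemma lead_zorder:
  assumes "F meromorphic_on {a}" "\<exists>\<^sub>F z in at a. F z \<noteq> 0"
  shows "\<exists>v. v \<noteq> 0 \<and> lead F a (zorder F a) v"
proof -
  obtain r where r: "zor_poly F a a \<noteq> 0" "0 < r" "zor_poly F a holomorphic_on cball a r"
    "\<forall>w\<in>cball a r - {a}. F w = zor_poly F a w * (w - a) powi zorder F a"
    using zorder_exist[OF meromorphic_on_isolated_singularity meromorphic_on_not_essential, OF assms(1,1,2)] by blast
  have an: "zor_poly F a analytic_on {a}"
    unfolding analytic_at using r(2) by (intro exI[of _ "ball a r"]) (use r(3) in \<open>auto intro: holomorphic_on_subset\<close>)
  have "\<forall>\<^sub>F w in at a. w \<in> ball a r" by (rule eventually_at_in_open') (use r(2) in auto)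
  then have "\<forall>\<^sub>F w in at a. F w = zor_poly F a w * (w - a) powi zorder F a"
    using eventually_neq_at_within[of a a] by eventually_elim (use r(4) in auto)
  then show ?thesis unfolding lead_def using an r(1) by (intro exI[of _ "zor_poly F a a"]) auto
qed

lemma lead_laurent_nth_1:
  assumes "lead F 0 1 v" shows "fls_nth (laurent_expansion F 0) 1 = v"
proof -
  obtain g where g: "g analytic_on {0}" "g 0 = v" "\<forall>\<^sub>F z in at 0. F z = g z * (z - 0) powi 1"
    using assms(1) by (auto simp: lead_def)
  have "g has_fps_expansion fps_expansion g 0" using g(1) analytic_at_imp_has_fps_expansion_0 by blast
  then have L: "g has_laurent_expansion fps_to_fls (fps_expansion g 0)" by (rule has_laurent_expansion_fps)
  have "(\<lambda>z. g z * z) has_laurent_expansion fps_to_fls (fps_expansion g 0) * fls_X"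
    by (intro laurent_expansion_intros L)
  moreover have "\<forall>\<^sub>F z in at 0. F z = g z * z" using g(3) by simp
  ultimately have "F has_laurent_expansion fps_to_fls (fps_expansion g 0) * fls_X"
    using has_laurent_expansion_cong[of F "\<lambda>z. g z * z", OF _ refl] by simp
  from laurent_expansion_0_eqI[OF this] show ?thesis using g(2)
    by (simp add: fls_X_times_conv_shift fps_expansion_def)
qed

lemma lead_isolated: 
  assumes "lead F a k v" shows "isolated_singularity_at F a"
proof -
  obtain g where g: "g analytic_on {a}" "\<forall>\<^sub>F z in at a. F z = g z * (z - a) powi k"
    using assms(1) by (auto simp: lead_def)
  obtain V where V: "open V" "a \<in> V" "g holomorphic_on V" using g(1) by (auto simp: analytic_at)
  obtain r where r: "0 < r" "\<And>z. z \<noteq> a \<Longrightarrow> dist z a < r \<Longrightarrow> F z = g z * (z - a) powi k"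
    using g(2) unfolding eventually_at by auto
  obtain \<rho> where \<rho>: "0 < \<rho>" "ball a \<rho> \<subseteq> V" using V open_contains_ball_eq by metis
  have "(\<lambda>z. g z * (z - a) powi k) holomorphic_on ball a (min r \<rho>) - {a}"
    by (intro holomorphic_intros holomorphic_on_subset[OF V(3)]) (use \<rho>(2) in auto)
  then have "F holomorphic_on ball a (min r \<rho>) - {a}"
    by (rule holomorphic_transform) (use r(2) in \<open>auto simp: dist_commute\<close>)
  then have "F analytic_on ball a (min r \<rho>) - {a}" by (simp add: analytic_on_open open_delete)
  then show ?thesis unfolding isolated_singularity_at_def using r(1) \<rho>(1) by (intro exI[of _ "min r \<rho>"]) simp
qed

lemma lead_remove_sings: "lead F a k v \<Longrightarrow> lead (remove_sings F) a k v"
  by (rule lead_cong) (auto intro: eventually_mono[OF eventually_remove_sings_eq_at[OF lead_isolated]])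

lemma lead_0_remove_sings_analytic: 
  assumes "lead F a 0 v" shows "remove_sings F analytic_on {a}"
proof -
  obtain g where g: "g analytic_on {a}" "g a = v" "\<forall>\<^sub>F z in at a. F z = g z * (z - a) powi 0"
    using assms(1) by (auto simp: lead_def)
  have ev: "\<forall>\<^sub>F z in at a. remove_sings F z = g z"
    using g(3) eventually_remove_sings_eq_at[OF lead_isolated[OF assms]] by eventually_elim simp
  have "remove_sings F a = g a"
    using lead_tendsto[OF assms] g(2) by (intro remove_sings_eqI) simp
  then have "\<forall>\<^sub>F z in nhds a. remove_sings F z = g z" using ev by (simp add: eventually_nhds_conv_at)
  then show ?thesis using g(1) analytic_at_cong by blast
qed

section \<open>The residue theorem for leading coefficients, and involutions in charts\<close>

context compact_surface
begin

lemma eventually_at_chart: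
  assumes "c \<in> \<A>" "p \<in> fst c" "openin X W" "p \<in> W"
  shows "\<forall>\<^sub>F z in nhds (snd c p). z \<in> img c \<and> chart_inv c z \<in> W"
proof -
  have "\<forall>\<^sub>F z in nhds (snd c p). z \<in> snd c ` (fst c \<inter> W)"
    by (rule eventually_nhds_in_open[OF open_chart_image[OF assms(1,3)]]) (use assms in auto)
  then show ?thesis by eventually_elim (use chart_inv_simps(3)[OF assms(1)] in auto)
qed

text \<open>Coefficients of a form may take arbitrary values on sparse sets, where the
  transformation law may fail too. Passing to \<open>remove_sings\<close> restores holomorphy and
  the law at every regular point, as \<open>residue_theorem\<close> demands.\<close>

lemma residue_theorem_lead:
  fixes \<omega> :: "'a form" and ch :: "'a \<Rightarrow> 'a chart"
  assumes S: "finite S" "S \<subseteq> topspace X"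
    and reg: "\<And>c p. c \<in> \<A> \<Longrightarrow> p \<in> fst c - S \<Longrightarrow> \<exists>v. lead (\<omega> c) (snd c p) 0 v"
    and trans: "\<And>c d p. c \<in> \<A> \<Longrightarrow> d \<in> \<A> \<Longrightarrow> p \<in> fst c \<inter> fst d - S \<Longrightarrow>
       \<forall>\<^sub>F z in at (snd c p). \<omega> c z = \<omega> d (transition c d z) * deriv (transition c d) z"
    and ch: "\<And>s. s \<in> S \<Longrightarrow> ch s \<in> \<A> \<and> s \<in> fst (ch s)"
    and sing: "\<And>s. s \<in> S \<Longrightarrow> lead (\<omega> (ch s)) (snd (ch s) s) (-1) (v s)"
  shows "(\<Sum>s\<in>S. v s) = 0"
proof -
  define \<eta> where "\<eta> c = remove_sings (\<omega> c)" for c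
  have an: "\<eta> c analytic_on {snd c p}" if "c \<in> \<A>" "p \<in> fst c - S" for c p
    using reg[OF that] lead_0_remove_sings_analytic unfolding \<eta>_def by blast
  have hol: "\<eta> c holomorphic_on snd c ` (fst c - S)" if "c \<in> \<A>" for c
    by (rule analytic_imp_holomorphic, subst analytic_on_analytic_at) (use an[OF that] in auto)
  have tr: "\<eta> c z = \<eta> d (transition c d z) * deriv (transition c d) z"
    if c: "c \<in> \<A>" and d: "d \<in> \<A>" and z: "z \<in> snd c ` (fst c \<inter> fst d - S)" for c d z
  proof -
    obtain p where p: "p \<in> fst c" "p \<in> fst d" "p \<notin> S" "z = snd c p" using z by blast
    define T where "T = transition c d"
    define V where "V = snd c ` (fst c \<inter> fst d)"
    have V: "open V" "z \<in> V" unfolding V_def using open_overlap[OF c d] p by auto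
    have Th: "T holomorphic_on V" using transition_holomorphic[OF c d] unfolding T_def V_def transition_def comp_def .
    have inj: "inj_on T V"
      unfolding T_def V_def transition_def comp_def
      using chart_inv_simps(3)[OF c] inj_chart[OF d] by (auto simp: inj_on_def)
    have Tz: "T z = snd d p" using chart_inv_simps(3)[OF c p(1)] p(4) by (simp add: T_def transition_def)
    have dT: "deriv T z \<noteq> 0" by (rule holomorphic_injective_imp_regular[OF Th V(1) inj V(2)])
    have Ta: "T analytic_on {z}" using Th V analytic_at by blast
    have "(T \<longlongrightarrow> T z) (at z)" using analytic_at_imp_isCont[OF Ta] by (simp add: isCont_def)
    moreover have "\<forall>\<^sub>F w in at z. T w \<noteq> T z"
      using eventually_at_in_open'[OF V] eventually_neq_at_within[of z z]
      by eventually_elim (use inj V(2) in \<open>auto dest: inj_onD\<close>)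
    ultimately have fl: "filterlim T (at (snd d p)) (at z)" by (simp add: filterlim_at Tz)
    have iso: "isolated_singularity_at (\<omega> c) z" "isolated_singularity_at (\<omega> d) (snd d p)"
      using reg[OF c, of p] reg[OF d, of p] p lead_isolated by blast+
    have "\<forall>\<^sub>F w in at z. \<eta> c w = \<eta> d (T w) * deriv T w"
    proof -
      have 1: "\<forall>\<^sub>F w in at z. \<omega> c w = \<omega> d (T w) * deriv T w" using trans[OF c d, of p] p by (simp add: T_def)
      have 2: "\<forall>\<^sub>F w in at z. \<eta> c w = \<omega> c w" unfolding \<eta>_def by (rule eventually_remove_sings_eq_at[OF iso(1)])
      have 3: "\<forall>\<^sub>F w in at z. \<eta> d (T w) = \<omega> d (T w)"
        unfolding \<eta>_def by (rule eventually_compose_filterlim[OF eventually_remove_sings_eq_at[OF iso(2)] fl])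
      show ?thesis using 1 2 3 by eventually_elim simp
    qed
    moreover have "\<eta> c analytic_on {z}" using an[OF c] p by auto
    then have "(\<eta> c \<longlongrightarrow> \<eta> c z) (at z)" using analytic_at_imp_isCont by (auto simp: isCont_def)
    moreover have "(\<lambda>w. \<eta> d (T w)) analytic_on {z}"
      using analytic_on_compose[OF Ta, of "\<eta> d"] an[OF d, of p] p Tz by (simp add: comp_def)
    then have "(\<lambda>w. \<eta> d (T w) * deriv T w) analytic_on {z}" using Ta by (intro analytic_intros)
    then have "((\<lambda>w. \<eta> d (T w) * deriv T w) \<longlongrightarrow> \<eta> d (T z) * deriv T z) (at z)"
      using analytic_at_imp_isCont by (auto simp: isCont_def)
    ultimately have "\<eta> c z = \<eta> d (T z) * deriv T z"
      by (intro tendsto_unique[OF at_neq_bot Lim_transform_eventually])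
    then show ?thesis by (simp add: T_def)
  qed
  have "\<exists>r h. 0 < r \<and> h holomorphic_on ball (snd (ch s) s) r \<and> h (snd (ch s) s) = v s \<and>
      (\<forall>z\<in>ball (snd (ch s) s) r - {snd (ch s) s}. \<eta> (ch s) z = h z / (z - snd (ch s) s))" if s: "s \<in> S" for s
  proof -
    define a where "a = snd (ch s) s"
    obtain h where h: "h analytic_on {a}" "h a = v s" "\<forall>\<^sub>F z in at a. \<eta> (ch s) z = h z * (z - a) powi (-1)"
      using lead_remove_sings[OF sing[OF s]] unfolding lead_def a_def[symmetric] \<eta>_def by blast
    obtain V where V: "open V" "a \<in> V" "h holomorphic_on V" using h(1) by (auto simp: analytic_at)
    obtain r where r: "0 < r" "\<And>z. z \<noteq> a \<Longrightarrow> dist z a < r \<Longrightarrow> \<eta> (ch s) z = h z * (z - a) powi (-1)"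
      using h(3) unfolding eventually_at by auto
    obtain \<rho> where \<rho>: "0 < \<rho>" "ball a \<rho> \<subseteq> V" using V open_contains_ball_eq by metis
    show ?thesis unfolding a_def[symmetric]
    proof (intro exI[of _ "min r \<rho>"] exI[of _ h] conjI ballI)
      show "h holomorphic_on ball a (min r \<rho>)" by (rule holomorphic_on_subset[OF V(3)]) (use \<rho>(2) in auto)
      show "\<eta> (ch s) z = h z / (z - a)" if "z \<in> ball a (min r \<rho>) - {a}" for z
        using r(2)[of z] that by (simp add: dist_commute power_int_minus divide_inverse)
    qed (use r \<rho> h in auto)
  qed
  then have "\<forall>s\<in>S. \<exists>r h. 0 < r \<and> h holomorphic_on ball (snd (ch s) s) r \<and> h (snd (ch s) s) = v s \<and>
      (\<forall>z\<in>ball (snd (ch s) s) r - {snd (ch s) s}. \<eta> (ch s) z = h z / (z - snd (ch s) s))" by (rule ballI)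
  from bchoice[OF this] obtain r where "\<forall>s\<in>S. \<exists>h. 0 < r s \<and> h holomorphic_on ball (snd (ch s) s) (r s) \<and> h (snd (ch s) s) = v s \<and>
      (\<forall>z\<in>ball (snd (ch s) s) (r s) - {snd (ch s) s}. \<eta> (ch s) z = h z / (z - snd (ch s) s))" by (rule exE)
  from bchoice[OF this] obtain h where rh: "\<forall>s\<in>S. 0 < r s \<and> h s holomorphic_on ball (snd (ch s) s) (r s) \<and> h s (snd (ch s) s) = v s \<and>
      (\<forall>z\<in>ball (snd (ch s) s) (r s) - {snd (ch s) s}. \<eta> (ch s) z = h s z / (z - snd (ch s) s))" by (rule exE)
  have "(\<Sum>s\<in>S. h s (snd (ch s) s)) = 0"
    by (rule residue_theorem[OF S, of \<eta> ch r h]) (use hol tr ch rh in auto)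
  then show ?thesis using rh by simp
qed

end

text \<open>\<open>J\<close> treats both kinds of involution at once: the identity for a holomorphic
  one, conjugation to make an antiholomorphic one holomorphic in charts. An involution is injective,
  so the derivative cannot vanish.\<close>

lemma (in compact_surface) involution_transition:
  fixes J :: "complex \<Rightarrow> complex"
  assumes \<rho>: "continuous_map X X \<rho>" "\<forall>p\<in>topspace X. \<rho> (\<rho> p) = p" and c: "c \<in> \<A>" "p \<in> fst c" and d: "d \<in> \<A>" "\<rho> p \<in> fst d"
    and hol: "(\<lambda>z. J (snd d (\<rho> (chart_inv c z)))) holomorphic_on snd c ` {q \<in> fst c. \<rho> q \<in> fst d}" and J: "inj J"
  shows "(\<lambda>z. J (snd d (\<rho> (chart_inv c z)))) analytic_on {snd c p}"
    and "deriv (\<lambda>z. J (snd d (\<rho> (chart_inv c z)))) (snd c p) \<noteq> 0"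
    and "\<forall>\<^sub>F z in nhds (snd c p). z \<in> img c \<and> \<rho> (chart_inv c z) \<in> fst d"
proof -
  let ?T = "\<lambda>z. J (snd d (\<rho> (chart_inv c z)))"
  define W where "W = {q \<in> topspace X. \<rho> q \<in> fst d}"
  have W: "openin X W" unfolding W_def by (rule openin_continuous_map_preimage[OF \<rho>(1) openin_fst[OF d(1)]])
  have eq: "{q \<in> fst c. \<rho> q \<in> fst d} = fst c \<inter> W" using fst_subset[OF c(1)] by (auto simp: W_def)
  have pW: "p \<in> W" using fst_subset[OF c(1)] c(2) d(2) by (auto simp: W_def)
  have V: "open (snd c ` {q \<in> fst c. \<rho> q \<in> fst d})" unfolding eq by (rule open_chart_image[OF c(1) W])
  have pV: "snd c p \<in> snd c ` {q \<in> fst c. \<rho> q \<in> fst d}" using c(2) d(2) by blast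
  have inj: "inj_on ?T (snd c ` {q \<in> fst c. \<rho> q \<in> fst d})"
  proof (rule inj_onI)
    fix z w assume z: "z \<in> snd c ` {q \<in> fst c. \<rho> q \<in> fst d}" and w: "w \<in> snd c ` {q \<in> fst c. \<rho> q \<in> fst d}" and eq: "?T z = ?T w"
    obtain q where q: "q \<in> fst c" "\<rho> q \<in> fst d" "z = snd c q" using z by blast
    obtain q' where q': "q' \<in> fst c" "\<rho> q' \<in> fst d" "w = snd c q'" using w by blast
    have "snd d (\<rho> q) = snd d (\<rho> q')" using eq injD[OF J] q q' chart_inv_simps(3)[OF c(1)] by simp
    then have "\<rho> q = \<rho> q'" using inj_onD[OF inj_chart[OF d(1)]] q(2) q'(2) by blast
    moreover have "q \<in> topspace X" "q' \<in> topspace X" using fst_subset[OF c(1)] q(1) q'(1) by auto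
    ultimately have "q = q'" using \<rho>(2) by metis
    then show "z = w" using q q' by simp
  qed
  show "?T analytic_on {snd c p}" using hol V pV analytic_at by blast
  show "deriv ?T (snd c p) \<noteq> 0" by (rule holomorphic_injective_imp_regular[OF hol V inj pV])
  show "\<forall>\<^sub>F z in nhds (snd c p). z \<in> img c \<and> \<rho> (chart_inv c z) \<in> fst d"
    using eventually_at_chart[OF c W pW] by eventually_elim (simp add: W_def)
qed

lemma (in compact_surface) eventually_nhdsin_chart:
  assumes "\<forall>\<^sub>F q in nhdsin X p. R q" "c \<in> \<A>" "p \<in> fst c"
  shows "\<forall>\<^sub>F z in nhds (snd c p). z \<in> img c \<and> R (chart_inv c z)"
proof -
  have "p \<in> topspace X" using fst_subset[OF assms(2)] assms(3) by blast
  then obtain S where S: "openin X S" "p \<in> S" "\<forall>q\<in>S. R q" using assms(1) by (auto simp: eventually_nhdsin)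
  from eventually_at_chart[OF assms(2,3) S(1,2)] show ?thesis by eventually_elim (use S(3) in blast)
qed

section \<open>The homogeneous problem and the derivatives of \<open>\<psi>\<close>\<close>

context ba_surface
begin

lemma BA_of_germs:
  assumes g: "germs (mlt u) (\<lambda>_ _. 0) G \<phi>" and "\<phi> r = h0" "\<forall>q\<in>set rs. \<phi> q = 0"
  shows "baker_akhiezer_at \<A> P \<kappa> \<gamma>s r rs h0 u \<phi>"
  using germs_BA[OF g] assms(2,3) germsD(1)[OF g] unfolding baker_akhiezer_at_def holo_def regular_set_eq by simp

text \<open>Subtracting a homogeneous solution from \<open>\<psi> u\<close> leaves a Baker-Akhiezer
  function for the same data, so uniqueness of the normalised problem forces the solution to
  vanish.\<close>

lemma germs_zero:
  assumes u: "u \<in> U" and g: "germs (mlt u) (\<lambda>_ _. 0) G \<phi>" and Z: "\<forall>q\<in>Z. \<phi> q = 0"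
  shows "\<forall>p\<in>topspace X - SP. \<phi> p = 0"
proof
  fix p assume p: "p \<in> topspace X - SP"
  obtain G' where G': "germs (mlt u) (\<lambda>_ _. 0) G' (\<psi> u)" using BA_germs[OF BA_at[OF u]] by blast
  have \<psi>Z: "\<psi> u r = of_real h" "\<forall>q\<in>set rs. \<psi> u q = 0" using BA_at[OF u] by (simp_all add: baker_akhiezer_at_def)
  have "baker_akhiezer_at \<A> P \<kappa> \<gamma>s r rs (of_real h) u (\<lambda>p. \<psi> u p - \<phi> p)"
    by (rule BA_of_germs[OF germs_diff[OF G' g]]) (use \<psi>Z Z in auto)
  from BA_unique[OF u this p] show "\<phi> p = 0" by simp
qed

end

sublocale ba_surface \<subseteq> ba_unique X \<A> SP ch rad P Z U
  by unfold_locales (rule germs_zero)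

context ba_surface
begin

definition G\<psi> :: "real^'n \<Rightarrow> 'a \<Rightarrow> complex \<Rightarrow> complex" where
  "G\<psi> u = (SOME G. germs (mlt u) (\<lambda>_ _. 0) G (\<psi> u) \<and> (\<forall>j. G (P j) 0 = leading_coeff (\<kappa> j) (u $ j) (\<psi> u)))"

lemma G\<psi>:
  assumes "u \<in> U" shows "germs (mlt u) (\<lambda>_ _. 0) (G\<psi> u) (\<psi> u)" "G\<psi> u (P j) 0 = f j u"
  using someI_ex[OF BA_germs[OF BA_at[OF assms]]] unfolding G\<psi>_def[symmetric] f_eq by simp_all

lemma \<psi>_Z: "u \<in> U \<Longrightarrow> \<psi> u r = of_real h" "u \<in> U \<Longrightarrow> q \<in> set rs \<Longrightarrow> \<psi> u q = 0"
  using BA_at by (simp_all add: baker_akhiezer_at_def)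

lemma fam_\<psi>: "fam 0 (\<lambda>_ _ _. 0) (\<lambda>q u. if q = r then of_real h else 0) G\<psi> \<psi>"
proof -
  have pp0: "pp 0 a = (\<lambda>_ _. 0)" for a by (intro ext) (simp add: pp_def)
  show ?thesis unfolding fam_def pp0 using G\<psi>(1) \<psi>_Z by auto
qed

lemma Ck_\<psi>: "p \<in> topspace X - SP \<Longrightarrow> Ck_on k U (\<lambda>u. \<psi> u p)"
  using fam_Ck[OF fam_\<psi>, of k] by simp_all

text \<open>\<open>\<psi>\<close> has no principal parts and constant values on \<open>Z\<close>.
  Its derivative therefore vanishes on \<open>Z\<close> and has a single singular coefficient,
  \<open>f i u\<close> at \<open>P i\<close>; this is how the leading coefficients enter the
  metric.\<close>

lemma \<psi>_partial:
  assumes u: "u \<in> U"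
  shows "\<exists>\<xi> G'. germs (mlt u) (pp 1 (\<lambda>j _. if j = i then f i u else 0)) G' \<xi> \<and> (\<forall>q\<in>Z. \<xi> q = 0) \<and>
    (\<forall>p\<in>topspace X - SP. ((\<lambda>t. \<psi> (u + t *\<^sub>R axis i 1) p) has_vector_derivative \<xi> p) (at 0)) \<and>
    (\<forall>j m. ((\<lambda>t. (deriv ^^ m) (G\<psi> (u + t *\<^sub>R axis i 1) (P j)) 0) has_vector_derivative
        (deriv ^^ m) (G' (P j)) 0 - (if j = i then (deriv ^^ Suc m) (G\<psi> u (P i)) 0 / of_nat (Suc m) else 0)) (at 0))"
proof -
  have "pp (Suc 0) (shift_data 0 i (\<lambda>_ _. 0) (\<lambda>_ _. 0) (G\<psi> u (P i) 0)) = pp 1 (\<lambda>j _. if j = i then f i u else 0)"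
    by (intro ext) (simp add: pp_def shift_data_def G\<psi>(2)[OF u])
  moreover have "continuous_on U (\<lambda>u. if q = r then of_real h else (0::complex))" for q by simp
  ultimately show ?thesis
    using fam_partial[OF fam_\<psi> _ _ u, where a' = "\<lambda>_ _. 0" and b' = "\<lambda>_. 0" and i = i] by simp
qed

lemma holo_analytic:
  assumes "holo \<phi>" "c \<in> \<A>" "p \<in> fst c" "p \<notin> SP"
  shows "(\<lambda>z. \<phi> (chart_inv c z)) analytic_on {snd c p}"
proof -
  have "(\<lambda>z. \<phi> (chart_inv c z)) holomorphic_on snd c ` (fst c - SP)"
    using assms(1,2) unfolding holo_def by (rule bspec)
  then show ?thesis unfolding analytic_at using open_regular_img[OF assms(2)] assms(3,4)
    by (intro exI[of _ "snd c ` (fst c - SP)"]) auto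
qed

lemma germ_analytic: "germs m T G \<phi> \<Longrightarrow> s \<in> SP \<Longrightarrow> G s analytic_on {ctr s}"
  unfolding analytic_at using ext_holomorphic_ball[OF germsD(2)] e(1) by (intro exI[of _ "ball (ctr s) (rad s)"]) auto

lemma germs_eventually:
  assumes "germs m T G \<phi>" "s \<in> SP"
  shows "\<forall>\<^sub>F z in at (ctr s). m s z * \<phi> (chart_inv (ch s) z) = T s z + G s z"
proof -
  have "\<forall>\<^sub>F z in at (ctr s). z \<in> ball (ctr s) (rad s)" by (rule eventually_at_in_open') (use e(1)[OF assms(2)] in auto)
  then show ?thesis using eventually_neq_at_within[of "ctr s" "ctr s"]
    by eventually_elim (use germsD(3)[OF assms] in auto)
qed

lemma germs_lead_P:
  assumes g: "germs (mlt u) (pp 1 (\<lambda>j _. \<alpha> j)) G \<phi>"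
  shows "lead (\<lambda>z. exp (- of_real (u $ j) / z) * \<phi> (chart_inv (\<kappa> j) z)) 0 (-1) (\<alpha> j)"
proof -
  have an: "G (P j) analytic_on {0}" using germ_analytic[OF g P_SP, of j] P_center by simp
  have "lead (\<lambda>z. (\<alpha> j + z * G (P j) z) * z powi (-1)) 0 (-1) (\<alpha> j)"
    unfolding lead_def using an by (intro exI[of _ "\<lambda>z. \<alpha> j + z * G (P j) z"]) (auto intro!: analytic_intros)
  then show ?thesis
  proof (rule lead_cong)
    show "\<forall>\<^sub>F z in at 0. (\<alpha> j + z * G (P j) z) * z powi (-1) = exp (- of_real (u $ j) / z) * \<phi> (chart_inv (\<kappa> j) z)"
      using germs_eventually[OF g P_SP, of j] eventually_neq_at_within[of "0::complex" 0] unfolding ch_P P_center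
      by eventually_elim (simp add: mlt_P pp_def field_simps power_int_minus)
  qed
qed

lemma germs_lead_gamma:
  assumes g: "germs (mlt u) (pp N a) G \<phi>" and s: "s \<in> set \<gamma>s"
  shows "lead (\<lambda>z. \<phi> (chart_inv (ch s) z)) (ctr s) (-1) (G s (ctr s))"
proof -
  have sS: "s \<in> SP" using s by simp
  have "lead (\<lambda>z. G s z * (z - ctr s) powi (-1)) (ctr s) (-1) (G s (ctr s))"
    unfolding lead_def using germ_analytic[OF g sS] by (intro exI[of _ "G s"]) auto
  then show ?thesis
  proof (rule lead_cong)
    show "\<forall>\<^sub>F z in at (ctr s). G s z * (z - ctr s) powi (-1) = \<phi> (chart_inv (ch s) z)"
      using germs_eventually[OF g sS] eventually_neq_at_within[of "ctr s" "ctr s"] 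
      by eventually_elim (use P_not_gamma[OF s] in \<open>simp add: mlt_gamma pp_def field_simps power_int_minus\<close>)
  qed
qed

section \<open>Reality\<close>

lemma tau_props: "continuous_map X X \<tau>" "p \<in> topspace X \<Longrightarrow> \<tau> (\<tau> p) = p"
  "c \<in> \<A> \<Longrightarrow> d \<in> \<A> \<Longrightarrow> (\<lambda>z. cnj (snd d (\<tau> (chart_inv c z)))) holomorphic_on snd c ` {p \<in> fst c. \<tau> p \<in> fst d}"
  using tau by (simp_all add: antiholomorphic_involution_def antiholomorphic_self_map_def)

lemma sigma_props: "continuous_map X X \<sigma>" "p \<in> topspace X \<Longrightarrow> \<sigma> (\<sigma> p) = p"
  "c \<in> \<A> \<Longrightarrow> d \<in> \<A> \<Longrightarrow> (\<lambda>z. snd d (\<sigma> (chart_inv c z))) holomorphic_on snd c ` {p \<in> fst c. \<sigma> p \<in> fst d}"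
  using sigma by (simp_all add: holomorphic_involution_def holomorphic_self_map_def)

lemma inj_cnj: "inj cnj" by (auto simp: inj_on_def)

lemma tau_transition:
  assumes "c \<in> \<A>" "p \<in> fst c" "d \<in> \<A>" "\<tau> p \<in> fst d"
  shows "(\<lambda>z. cnj (snd d (\<tau> (chart_inv c z)))) analytic_on {snd c p}"
    and "deriv (\<lambda>z. cnj (snd d (\<tau> (chart_inv c z)))) (snd c p) \<noteq> 0"
    and "\<forall>\<^sub>F z in nhds (snd c p). z \<in> img c \<and> \<tau> (chart_inv c z) \<in> fst d"
  using involution_transition[OF tau_props(1) _ assms tau_props(3)[OF assms(1,3)] inj_cnj] tau_props(2) by blast+

lemma sigma_transition:
  assumes "c \<in> \<A>" "p \<in> fst c" "d \<in> \<A>" "\<sigma> p \<in> fst d"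
  shows "(\<lambda>z. snd d (\<sigma> (chart_inv c z))) analytic_on {snd c p}"
    and "deriv (\<lambda>z. snd d (\<sigma> (chart_inv c z))) (snd c p) \<noteq> 0"
    and "\<forall>\<^sub>F z in nhds (snd c p). z \<in> img c \<and> \<sigma> (chart_inv c z) \<in> fst d"
  using involution_transition[OF sigma_props(1) _ assms, of "\<lambda>z. z"] sigma_props(2) sigma_props(3)[OF assms(1,3)] by auto

lemma \<kappa>: "\<kappa> j \<in> \<A>" "P j \<in> fst (\<kappa> j)"
  using parameters[of j] by (auto simp: local_parameter_def)

lemma tau_near_P: "\<forall>\<^sub>F z in nhds 0. \<tau> (chart_inv (\<kappa> j) z) = chart_inv (\<kappa> j) (cnj z)"
proof -
  have t: "\<tau> (P j) = P j" by (rule tau_fixed) simp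
  have "\<forall>\<^sub>F z in nhds (snd (\<kappa> j) (P j)). z \<in> img (\<kappa> j) \<and> \<tau> (chart_inv (\<kappa> j) z) \<in> fst (\<kappa> j)"
    by (rule tau_transition(3)[OF \<kappa> \<kappa>(1)]) (simp add: t \<kappa>)
  moreover have "\<forall>\<^sub>F z in nhds (snd (\<kappa> j) (P j)). z \<in> img (\<kappa> j) \<and>
      snd (\<kappa> j) (\<tau> (chart_inv (\<kappa> j) z)) = cnj (snd (\<kappa> j) (chart_inv (\<kappa> j) z))"
    by (rule eventually_nhdsin_chart[OF tau_local \<kappa>])
  ultimately show ?thesis unfolding P_center
  proof eventually_elim
    case (elim z)
    have "\<tau> (chart_inv (\<kappa> j) z) = chart_inv (\<kappa> j) (snd (\<kappa> j) (\<tau> (chart_inv (\<kappa> j) z)))"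
      by (rule chart_inv_simps(3)[OF \<kappa>(1) elim(1)[THEN conjunct2], symmetric])
    also have "snd (\<kappa> j) (\<tau> (chart_inv (\<kappa> j) z)) = cnj z" using elim chart_inv_simps(2)[OF \<kappa>(1), of z j] by simp
    finally show ?case .
  qed
qed

lemma sigma_near_P: "\<forall>\<^sub>F z in nhds 0. \<sigma> (chart_inv (\<kappa> j) z) = chart_inv (\<kappa> j) (- z)"
proof -
  have t: "\<sigma> (P j) = P j" by (rule sigma_fixed) simp
  have "\<forall>\<^sub>F z in nhds (snd (\<kappa> j) (P j)). z \<in> img (\<kappa> j) \<and> \<sigma> (chart_inv (\<kappa> j) z) \<in> fst (\<kappa> j)"
    by (rule sigma_transition(3)[OF \<kappa> \<kappa>(1)]) (simp add: t \<kappa>)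
  moreover have "\<forall>\<^sub>F z in nhds (snd (\<kappa> j) (P j)). z \<in> img (\<kappa> j) \<and>
      snd (\<kappa> j) (\<sigma> (chart_inv (\<kappa> j) z)) = - snd (\<kappa> j) (chart_inv (\<kappa> j) z)"
    by (rule eventually_nhdsin_chart[OF sigma_local \<kappa>])
  ultimately show ?thesis unfolding P_center
  proof eventually_elim
    case (elim z)
    have "\<sigma> (chart_inv (\<kappa> j) z) = chart_inv (\<kappa> j) (snd (\<kappa> j) (\<sigma> (chart_inv (\<kappa> j) z)))"
      by (rule chart_inv_simps(3)[OF \<kappa>(1) elim(1)[THEN conjunct2], symmetric])
    also have "snd (\<kappa> j) (\<sigma> (chart_inv (\<kappa> j) z)) = - z" using elim chart_inv_simps(2)[OF \<kappa>(1), of z j] by simp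
    finally show ?case .
  qed
qed

lemma tau_eventually_chart:
  assumes "c \<in> \<A>" "p \<in> fst c" "d \<in> \<A>" "\<tau> p \<in> fst d"
  shows "\<forall>\<^sub>F z in nhds (snd c p). cnj (\<phi> (chart_inv d (cnj (cnj (snd d (\<tau> (chart_inv c z))))))) = cnj (\<phi> (\<tau> (chart_inv c z)))"
  using tau_transition(3)[OF assms] by eventually_elim (use chart_inv_simps(3)[OF assms(3)] in simp)

text \<open>Reflection preserves the singular problem: \<open>\<tau>\<close> conjugates the local
  parameter at \<open>P j\<close> and \<open>u\<close> is real, so the exponential is reproduced;
  the other poles are fixed by \<open>\<tau>\<close> and stay at most simple.\<close>

lemma \<psi>_reflected_germs:
  assumes u: "u \<in> U" shows "\<exists>G. germs (mlt u) (\<lambda>_ _. 0) G (\<lambda>p. cnj (\<psi> u (\<tau> p)))"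
proof -
  let ?\<phi> = "\<lambda>p. cnj (\<psi> u (\<tau> p))"
  have h: "holo (\<psi> u)" by (rule germsD(1)[OF G\<psi>(1)[OF u]])
  have fixed: "\<tau> s = s" if "s \<in> SP" for s using tau_fixed[of s] that by auto
  have hol: "holo ?\<phi>"
  proof (rule holo_localI)
    fix p assume p: "p \<in> topspace X - SP"
    have q: "\<tau> p \<in> topspace X" using continuous_map_funspace[OF tau_props(1)] p by auto
    have qS: "\<tau> p \<notin> SP"
    proof
      assume "\<tau> p \<in> SP"
      then have "\<tau> (\<tau> p) \<in> SP" using fixed by simp
      then show False using tau_props(2)[of p] p by simp
    qed
    obtain c where c: "c \<in> \<A>" "p \<in> fst c" using chart_exists[of p] p by blast
    obtain d where d: "d \<in> \<A>" "\<tau> p \<in> fst d" using chart_exists[OF q] by blast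
    \<comment> \<open>\<open>\<tau>\<close> read in charts is antiholomorphic. One conjugation makes
      it the holomorphic \<open>T\<close>; conjugating \<open>\<psi> u\<close> and its argument
      compensates for this.\<close>
    define T where "T z = cnj (snd d (\<tau> (chart_inv c z)))" for z
    have T: "T analytic_on {snd c p}" unfolding T_def[abs_def] by (rule tau_transition(1)[OF c d])
    have Tp: "T (snd c p) = cnj (snd d (\<tau> p))" using chart_inv_simps(3)[OF c] by (simp add: T_def)
    have "(\<lambda>z. cnj (\<psi> u (chart_inv d (cnj z)))) analytic_on T ` {snd c p}"
      using analytic_cnj_cnj[OF holo_analytic[OF h d qS]] Tp by simp
    from analytic_on_compose[OF T this]
    have "(\<lambda>z. cnj (\<psi> u (chart_inv d (cnj (T z))))) analytic_on {snd c p}" by (simp add: comp_def)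
    then have "(\<lambda>z. ?\<phi> (chart_inv c z)) analytic_on {snd c p}"
      using analytic_at_cong[OF tau_eventually_chart[OF c d, of "\<psi> u"] refl] unfolding T_def by simp
    then obtain V where V: "open V" "snd c p \<in> V" "(\<lambda>z. ?\<phi> (chart_inv c z)) holomorphic_on V" unfolding analytic_at by blast
    have "open (V \<inter> img c)" using V(1) open_img[OF c(1)] by blast
    moreover have "snd c p \<in> V \<inter> img c" using V(2) c(2) by blast
    ultimately obtain \<rho> where "0 < \<rho>" "ball (snd c p) \<rho> \<subseteq> V \<inter> img c" using open_contains_ball_eq by metis
    then show "\<exists>c\<in>\<A>. \<exists>\<rho>>0. p \<in> fst c \<and> ball (snd c p) \<rho> \<subseteq> img c \<and> (\<lambda>z. ?\<phi> (chart_inv c z)) holomorphic_on ball (snd c p) \<rho>"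
      using c V(3) by (intro bexI[OF _ c(1)] exI[of _ \<rho>]) (auto intro: holomorphic_on_subset)
  qed
  have "\<exists>l. ((\<lambda>z. mlt u s z * ?\<phi> (chart_inv (ch s) z)) \<longlongrightarrow> l) (at (ctr s))" if s: "s \<in> SP" for s
  proof (cases "s \<in> range P")
    case True
    then obtain j where j: "s = P j" by blast
    have an: "G\<psi> u (P j) analytic_on {0}" using germ_analytic[OF G\<psi>(1)[OF u] P_SP, of j] P_center by simp
    have "(\<lambda>z. cnj (G\<psi> u (P j) (cnj z))) analytic_on {0}" using analytic_cnj_cnj[OF an] by simp
    from analytic_at_imp_isCont[OF this]
    have "((\<lambda>z. cnj (G\<psi> u (P j) (cnj z))) \<longlongrightarrow> cnj (G\<psi> u (P j) (cnj 0))) (at 0)"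
      unfolding isCont_def .
    moreover have "\<forall>\<^sub>F z in at 0. cnj (G\<psi> u (P j) (cnj z)) = mlt u (P j) z * ?\<phi> (chart_inv (\<kappa> j) z)"
    proof -
      have "\<forall>\<^sub>F z in at 0. exp (- of_real (u $ j) / z) * \<psi> u (chart_inv (\<kappa> j) z) = G\<psi> u (P j) z"
        using germs_eventually[OF G\<psi>(1)[OF u] P_SP, of j] by (simp add: mlt_P P_center)
      moreover have "filterlim cnj (at 0) (at 0)" using filterlim_cnj[of 0] by simp
      ultimately have "\<forall>\<^sub>F z in at 0. exp (- of_real (u $ j) / cnj z) * \<psi> u (chart_inv (\<kappa> j) (cnj z)) = G\<psi> u (P j) (cnj z)"
        by (rule eventually_compose_filterlim)
      moreover have "\<forall>\<^sub>F z in at 0. \<tau> (chart_inv (\<kappa> j) z) = chart_inv (\<kappa> j) (cnj z)"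
        using tau_near_P by (simp add: eventually_nhds_conv_at)
      ultimately show ?thesis
      proof eventually_elim
        case (elim z)
        then show ?case by (simp add: mlt_P elim(1)[symmetric] exp_cnj)
      qed
    qed
    ultimately have "((\<lambda>z. mlt u (P j) z * ?\<phi> (chart_inv (\<kappa> j) z)) \<longlongrightarrow> cnj (G\<psi> u (P j) (cnj 0))) (at 0)"
      by (rule Lim_transform_eventually)
    then show ?thesis using P_center by (auto simp: j)
  next
    case False
    then have sg: "s \<in> set \<gamma>s" using s by blast
    define T where "T z = cnj (snd (ch s) (\<tau> (chart_inv (ch s) z)))" for z
    note cs = ch[OF s] and ts = fixed[OF s]
    have tc: "\<tau> s \<in> fst (ch s)" using cs ts by simp
    have T: "T analytic_on {ctr s}" "deriv T (ctr s) \<noteq> 0"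
      unfolding T_def[abs_def] by (rule tau_transition(1,2)[OF cs cs(1) tc])+
    have Ts: "T (ctr s) = cnj (ctr s)" using chart_inv_simps(3)[OF cs] ts by (simp add: T_def)
    have "pp 0 (\<lambda>_ _. 0) = (\<lambda>_ _. 0)" by (intro ext) (simp add: pp_def)
    then have "lead (\<lambda>z. \<psi> u (chart_inv (ch s) z)) (ctr s) (-1) (G\<psi> u s (ctr s))"
      using germs_lead_gamma[of u 0 "\<lambda>_ _. 0", OF _ sg] G\<psi>(1)[OF u] by simp
    from lead_cnj[OF this]
    have "lead (\<lambda>z. cnj (\<psi> u (chart_inv (ch s) (cnj z)))) (T (ctr s)) (-1) (cnj (G\<psi> u s (ctr s)))" by (simp add: Ts)
    from lead_compose[OF T this]
    have "lead (\<lambda>z. cnj (\<psi> u (chart_inv (ch s) (cnj (T z))))) (ctr s) (-1) (cnj (G\<psi> u s (ctr s)) * deriv T (ctr s) powi (-1))" .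
    then have "lead (\<lambda>z. ?\<phi> (chart_inv (ch s) z)) (ctr s) (-1) (cnj (G\<psi> u s (ctr s)) * deriv T (ctr s) powi (-1))"
      by (rule lead_cong) (use tau_eventually_chart[OF cs cs(1) tc, of "\<psi> u"] in \<open>simp add: eventually_nhds_conv_at T_def\<close>)
    from lead_tendsto[OF this] show ?thesis using False by (auto simp: mlt_gamma)
  qed
  then have "\<forall>s\<in>SP. \<exists>l. ((\<lambda>z. mlt u s z * ?\<phi> (chart_inv (ch s) z)) \<longlongrightarrow> l) (at (ctr s))" by (rule ballI)
  from bchoice[OF this] obtain L where L: "\<forall>s\<in>SP. ((\<lambda>z. mlt u s z * ?\<phi> (chart_inv (ch s) z)) \<longlongrightarrow> L s) (at (ctr s))" by (rule exE)
  have "\<exists>G. germs (mlt u) (\<lambda>_ _. 0) G ?\<phi> \<and> (\<forall>s\<in>SP. G s (ctr s) = L s)"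
    by (rule germs_of_limits[OF hol mlt_holomorphic bspec[OF L]])
  then show ?thesis by (elim exE conjE) (rule exI)
qed

text \<open>\<open>h\<close> is real and \<open>\<tau>\<close> fixes the points of \<open>Z\<close>,
  so the reflected function takes the same prescribed values there.\<close>

lemma \<psi>_real:
  assumes u: "u \<in> U" and p: "p \<in> topspace X - SP" "\<tau> p = p" shows "cnj (\<psi> u p) = \<psi> u p"
proof -
  obtain G where G: "germs (mlt u) (\<lambda>_ _. 0) G (\<lambda>p. cnj (\<psi> u (\<tau> p)))" using \<psi>_reflected_germs[OF u] by (rule exE)
  have "\<tau> q = q" if "q \<in> Z" for q using tau_fixed[of q] that by auto
  then have "\<forall>q\<in>Z. cnj (\<psi> u (\<tau> q)) = \<psi> u q" using \<psi>_Z[OF u] by auto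
  from germs_unique(1)[OF u G G\<psi>(1)[OF u] this p(1)] show ?thesis by (simp add: p(2))
qed

end

section \<open>The bilinear identity\<close>

lemma lookup_divisor_of: "distinct ps \<Longrightarrow> Poly_Mapping.lookup (divisor_of ps) p = of_bool (p \<in> set ps)"
  by (induction ps) (auto simp: divisor_of_def lookup_add lookup_single)

lemma push_divisor_of: "push_divisor \<sigma> (divisor_of ps) = divisor_of (map \<sigma> ps)"
  by (induction ps) (simp_all add: push_divisor_def divisor_of_def frag_extend_add)

lemma lookup_sum_frag_of:
  fixes P :: "'n::finite \<Rightarrow> 'a"
  assumes "inj P" shows "Poly_Mapping.lookup (\<Sum>i\<in>UNIV. frag_of (P i)) p = of_bool (p \<in> range P)"
proof (cases "p \<in> range P")
  case True
  then obtain j where "p = P j" by blast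
  then have "Poly_Mapping.lookup (frag_of (P i)) p = (if i = j then 1 else 0)" for i
    using injD[OF assms] by (auto simp: lookup_single)
  then show ?thesis using True by (simp add: lookup_sum)
next
  case False
  then show ?thesis by (auto simp: lookup_sum lookup_single intro!: sum.neutral)
qed

text \<open>With the identity for \<open>\<rho>\<close> this is a change of charts. The order is
  invariant; the coefficient is so at order 0.\<close>

lemma (in compact_surface) lead_pullback:
  assumes \<rho>: "continuous_map X X \<rho>" "\<forall>p\<in>topspace X. \<rho> (\<rho> p) = p" and c: "c \<in> \<A>" "p \<in> fst c" and d: "d \<in> \<A>" "\<rho> p \<in> fst d"
    and hol: "(\<lambda>z. snd d (\<rho> (chart_inv c z))) holomorphic_on snd c ` {q \<in> fst c. \<rho> q \<in> fst d}"
    and l: "lead (\<lambda>z. \<phi> (chart_inv d z)) (snd d (\<rho> p)) k v"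
  shows "\<exists>w. lead (\<lambda>z. \<phi> (\<rho> (chart_inv c z))) (snd c p) k w \<and> (k = 0 \<longrightarrow> w = v)"
proof -
  define T where "T z = snd d (\<rho> (chart_inv c z))" for z
  have T: "T analytic_on {snd c p}" "deriv T (snd c p) \<noteq> 0" "\<forall>\<^sub>F z in nhds (snd c p). z \<in> img c \<and> \<rho> (chart_inv c z) \<in> fst d"
    using involution_transition[OF \<rho> c d, of "\<lambda>z. z", OF hol] unfolding T_def[abs_def] by simp_all
  have Tp: "T (snd c p) = snd d (\<rho> p)" using chart_inv_simps(3)[OF c] by (simp add: T_def)
  have "lead (\<lambda>z. \<phi> (chart_inv d (T z))) (snd c p) k (v * deriv T (snd c p) powi k)"
    by (rule lead_compose[OF T(1,2)]) (use l Tp in simp)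
  moreover have "\<forall>\<^sub>F z in at (snd c p). \<phi> (chart_inv d (T z)) = \<phi> (\<rho> (chart_inv c z))"
    using T(3) unfolding eventually_nhds_conv_at
    by (elim conjE eventually_mono) (use chart_inv_simps(3)[OF d(1)] in \<open>simp add: T_def\<close>)
  ultimately have "lead (\<lambda>z. \<phi> (\<rho> (chart_inv c z))) (snd c p) k (v * deriv T (snd c p) powi k)" by (rule lead_cong)
  then show ?thesis by (intro exI conjI) auto
qed

context ba_surface
begin

lemma sigma_topspace: "p \<in> topspace X \<Longrightarrow> \<sigma> p \<in> topspace X"
  using continuous_map_funspace[OF sigma_props(1)] by auto

lemma sigma_range_P: "p \<in> topspace X \<Longrightarrow> \<sigma> p \<in> range P \<Longrightarrow> p \<in> range P"
  using sigma_props(2)[of p] sigma_fixed by (metis UnI1 UnI2)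

text \<open>A lower bound for the order of a solution off \<open>range P\<close>: zeros at
  \<open>rs\<close>, at most simple poles at \<open>\<gamma>s\<close>.\<close>

definition div_ord :: "'a \<Rightarrow> int" where "div_ord p = of_bool (p \<in> set rs) - of_bool (p \<in> set \<gamma>s)"

text \<open>The divisor of \<open>\<Omega>\<close> is arranged so that it cancels
  \<open>div_ord p + div_ord (\<sigma> p)\<close>, the order of one solution times the reflection of
  another. As \<open>\<sigma>\<close> is an involution, p lies in the image of a divisor exactly
  when \<open>\<sigma> p\<close> lies in the divisor.\<close>

lemma form_lead:
  assumes c: "c \<in> \<A>" "p \<in> fst c"
  shows "\<exists>v. v \<noteq> 0 \<and> lead (\<Omega> c) (snd c p)
    (of_bool (p \<in> range P) - of_bool (p \<in> range Q) - of_bool (p = r) - div_ord p - div_ord (\<sigma> p)) v"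
proof -
  have pX: "p \<in> topspace X" using fst_subset[OF c(1)] c(2) by blast
  have inj: "inj_on \<sigma> (set xs)" if "set xs \<subseteq> topspace X" for xs
    by (rule inj_on_inverseI[of _ \<sigma>]) (use that sigma_props(2) in blast)
  have mem: "p \<in> set (map \<sigma> xs) \<longleftrightarrow> \<sigma> p \<in> set xs" if "set xs \<subseteq> topspace X" for xs
  proof
    assume "p \<in> set (map \<sigma> xs)"
    then show "\<sigma> p \<in> set xs" using that sigma_props(2) by auto
  next
    assume "\<sigma> p \<in> set xs"
    then have "\<sigma> (\<sigma> p) \<in> set (map \<sigma> xs)" by simp
    then show "p \<in> set (map \<sigma> xs)" using sigma_props(2)[OF pX] by simp
  qed
  have push: "Poly_Mapping.lookup (push_divisor \<sigma> (divisor_of xs)) p = of_bool (\<sigma> p \<in> set xs)"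
    if "distinct xs" "set xs \<subseteq> topspace X" for xs
    unfolding push_divisor_of using that inj[OF that(2)] mem[OF that(2)] by (simp add: lookup_divisor_of distinct_map)
  have X: "set \<gamma>s \<subseteq> topspace X" "set rs \<subseteq> topspace X" using points by auto
  have dist: "distinct \<gamma>s" "distinct (r # rs)" "distinct rs" using distinct_points(3) by auto
  have r: "r \<notin> set rs" using distinct_points(3) by auto
  have "zorder (\<Omega> c) (snd c p) = of_bool (p \<in> set \<gamma>s) + of_bool (\<sigma> p \<in> set \<gamma>s) + of_bool (p \<in> range P)
      - of_bool (p \<in> range Q) - of_bool (p \<in> set (r # rs)) - of_bool (\<sigma> p \<in> set rs)"
    using form_divisor c unfolding has_divisor_def
    by (simp add: lookup_add lookup_minus push X dist lookup_divisor_of[OF dist(1)] lookup_divisor_of[OF dist(2)]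
        lookup_sum_frag_of distinct_points(1,2) del: list.set)
  also have "\<dots> = of_bool (p \<in> range P) - of_bool (p \<in> range Q) - of_bool (p = r) - div_ord p - div_ord (\<sigma> p)"
    using r by (auto simp: div_ord_def)
  finally have z: "zorder (\<Omega> c) (snd c p) = of_bool (p \<in> range P) - of_bool (p \<in> range Q) - of_bool (p = r) - div_ord p - div_ord (\<sigma> p)" .
  have "\<Omega> c meromorphic_on img c" using form c(1) by (simp add: meromorphic_form_def)
  then have m: "\<Omega> c meromorphic_on {snd c p}" by (rule meromorphic_on_subset) (use c(2) in auto)
  have "\<exists>\<^sub>F z in at (snd c p). \<Omega> c z \<noteq> 0" using form_divisor c by (simp add: has_divisor_def)
  from lead_zorder[OF m this] show ?thesis unfolding z .
qed

text \<open>No other part of the divisor meets \<open>P j\<close>, so the zero of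
  \<open>\<Omega>\<close> there is exactly simple and its leading coefficient is the Laurent
  coefficient that defines \<open>C j\<close>.\<close>

lemma form_lead_P: "lead (\<Omega> (\<kappa> j)) 0 1 (- C j)" and C_nonzero: "C j \<noteq> 0"
proof -
  have "P j \<notin> set (\<gamma>s @ r # rs)" using distinct_points(5) rangeI[of P j] by blast
  then have "P j \<notin> set \<gamma>s" "P j \<notin> set rs" "P j \<noteq> r" by auto
  moreover have "P j \<notin> range Q" using distinct_points(4) by blast
  moreover have "\<sigma> (P j) = P j" using sigma_fixed[of "P j"] by simp
  moreover have "div_ord (P j) = 0" using calculation by (simp add: div_ord_def)
  ultimately obtain v where v: "v \<noteq> 0" "lead (\<Omega> (\<kappa> j)) 0 1 v"
    using form_lead[OF \<kappa>, of j] P_center by auto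
  have "v = - C j" using lead_laurent_nth_1[OF v(2)] C_eq by simp
  then show "lead (\<Omega> (\<kappa> j)) 0 1 (- C j)" "C j \<noteq> 0" using v by auto
qed

lemma germs_lead:
  assumes g: "germs (mlt u) (pp 1 (\<lambda>j _. \<alpha> j)) G \<phi>" and Z: "\<forall>q\<in>set rs. \<phi> q = 0"
    and c: "c \<in> \<A>" "p \<in> fst c" and p: "p \<notin> range P"
  shows "\<exists>v. lead (\<lambda>z. \<phi> (chart_inv c z)) (snd c p) (div_ord p) v \<and> (p \<notin> set \<gamma>s \<union> set rs \<longrightarrow> v = \<phi> p)"
proof (cases "p \<in> set \<gamma>s")
  case True
  then have pS: "p \<in> SP" and prs: "p \<notin> set rs" using distinct_points(3) by auto
  have "(\<lambda>z. snd (ch p) (chart_inv c z)) holomorphic_on snd c ` {q \<in> fst c. q \<in> fst (ch p)}"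
    using transition_holomorphic[OF c(1) ch(1)[OF pS]] by (simp add: Int_def)
  then have "\<exists>w. lead (\<lambda>z. \<phi> (chart_inv c z)) (snd c p) (-1) w \<and> (-1 = (0::int) \<longrightarrow> w = G p (ctr p))"
    using lead_pullback[of "\<lambda>x. x", OF continuous_map_id[unfolded id_def] _ c ch[OF pS], of \<phi> "-1" "G p (ctr p)"] germs_lead_gamma[OF g True]
    by simp
  then show ?thesis using True prs by (auto simp: div_ord_def)
next
  case False
  then have an: "(\<lambda>z. \<phi> (chart_inv c z)) analytic_on {snd c p}"
    using p by (intro holo_analytic[OF germsD(1)[OF g] c]) auto
  have l: "lead (\<lambda>z. \<phi> (chart_inv c z)) (snd c p) 0 (\<phi> p)"
    using lead_analytic[OF an] chart_inv_simps(3)[OF c] by simp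
  show ?thesis
  proof (cases "p \<in> set rs")
    case True
    then have "lead (\<lambda>z. \<phi> (chart_inv c z)) (snd c p) 0 0" using l Z by simp
    from lead_raise[OF this] show ?thesis using True False by (simp add: div_ord_def)
  next
    case prs: False
    then show ?thesis using l False by (auto simp: div_ord_def)
  qed
qed

lemma product_lead:
  assumes g: "germs (mlt u) (pp 1 (\<lambda>j _. \<alpha> j)) G \<phi>" "germs (mlt u) (pp 1 (\<lambda>j _. \<alpha>' j)) G' \<phi>'"
    and Z: "\<forall>q\<in>set rs. \<phi> q = 0" "\<forall>q\<in>set rs. \<phi>' q = 0"
    and c: "c \<in> \<A>" "p \<in> fst c" and p: "p \<notin> range P"
  shows "\<exists>v. lead (\<lambda>z. \<phi> (chart_inv c z) * \<phi>' (\<sigma> (chart_inv c z)) * \<Omega> c z) (snd c p)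
      (- of_bool (p \<in> range Q \<union> {r})) v \<and> (p \<in> range Q \<union> {r} \<longrightarrow> v = \<phi> p * \<phi>' p * residue (\<Omega> c) (snd c p))"
proof -
  have pX: "p \<in> topspace X" using fst_subset[OF c(1)] c(2) by blast
  obtain d where d: "d \<in> \<A>" "\<sigma> p \<in> fst d" using chart_exists[OF sigma_topspace[OF pX]] by blast
  have \<sigma>p: "\<sigma> p \<notin> range P" using sigma_range_P[OF pX] p by blast
  obtain v1 where v1: "lead (\<lambda>z. \<phi> (chart_inv c z)) (snd c p) (div_ord p) v1" "p \<notin> set \<gamma>s \<union> set rs \<longrightarrow> v1 = \<phi> p"
    using germs_lead[OF g(1) Z(1) c p] by (elim exE conjE)
  obtain v2 where v2: "lead (\<lambda>z. \<phi>' (chart_inv d z)) (snd d (\<sigma> p)) (div_ord (\<sigma> p)) v2" "\<sigma> p \<notin> set \<gamma>s \<union> set rs \<longrightarrow> v2 = \<phi>' (\<sigma> p)"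
    using germs_lead[OF g(2) Z(2) d \<sigma>p] by (elim exE conjE)
  have inv: "\<forall>p\<in>topspace X. \<sigma> (\<sigma> p) = p" using sigma_props(2) by blast
  obtain v2' where v2': "lead (\<lambda>z. \<phi>' (\<sigma> (chart_inv c z))) (snd c p) (div_ord (\<sigma> p)) v2'" "div_ord (\<sigma> p) = 0 \<longrightarrow> v2' = v2"
    using lead_pullback[OF sigma_props(1) inv c d sigma_props(3)[OF c(1) d(1)] v2(1)] by (elim exE conjE)
  obtain v3 where v3: "lead (\<Omega> c) (snd c p) (of_bool (p \<in> range P) - of_bool (p \<in> range Q) - of_bool (p = r) - div_ord p - div_ord (\<sigma> p)) v3"
    using form_lead[OF c] by (elim exE conjE)
  have rQ: "r \<notin> range Q" using distinct_points(5) by auto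
  \<comment> \<open>All orders from \<open>rs\<close>, \<open>\<gamma>s\<close> and their
    reflections cancel; what is left are the simple poles of the form at the \<open>Q l\<close> and
    at \<open>r\<close>.\<close>
  have "div_ord p + div_ord (\<sigma> p) + (of_bool (p \<in> range P) - of_bool (p \<in> range Q) - of_bool (p = r) - div_ord p - div_ord (\<sigma> p))
      = - of_bool (p \<in> range Q \<union> {r})"
    using p rQ by auto
  with lead_mult[OF lead_mult[OF v1(1) v2'(1)] v3]
  have l: "lead (\<lambda>z. \<phi> (chart_inv c z) * \<phi>' (\<sigma> (chart_inv c z)) * \<Omega> c z) (snd c p) (- of_bool (p \<in> range Q \<union> {r})) (v1 * v2' * v3)" 
    by (simp only:)
  \<comment> \<open>These points are fixed by \<open>\<sigma>\<close> and lie outside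
    \<open>rs\<close> and \<open>\<gamma>s\<close>, so both leading coefficients are plain values at
    \<open>p\<close>.\<close>
  have "v1 * v2' * v3 = \<phi> p * \<phi>' p * residue (\<Omega> c) (snd c p)" if pQ: "p \<in> range Q \<union> {r}"
  proof -
    have \<sigma>: "\<sigma> p = p" using sigma_fixed[of p] pQ by blast
    have np: "p \<notin> set \<gamma>s \<union> set rs" using pQ distinct_points(3,5) by auto
    then have z: "div_ord p = 0" by (simp add: div_ord_def)
    have "of_bool (p \<in> range P) - of_bool (p \<in> range Q) - of_bool (p = r) - div_ord p - div_ord (\<sigma> p) = (-1 :: int)"
      using p pQ rQ z \<sigma> by auto
    then have "residue (\<Omega> c) (snd c p) = v3" using lead_residue v3 by simp
    then show ?thesis using v1(2) v2(2) v2'(2) np z \<sigma> by simp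
  qed
  then show ?thesis using l by blast
qed

text \<open>The exponentials at z and at -z are inverse to each other. Two simple poles meet the
  simple zero of \<open>\<Omega>\<close>, and two signs cancel: one from the pole read at -z, one
  from the sign in the definition of \<open>C\<close>.\<close>

lemma product_lead_P:
  assumes g: "germs (mlt u) (pp 1 (\<lambda>j _. \<alpha> j)) G \<phi>" "germs (mlt u) (pp 1 (\<lambda>j _. \<alpha>' j)) G' \<phi>'"
  shows "lead (\<lambda>z. \<phi> (chart_inv (\<kappa> j) z) * \<phi>' (\<sigma> (chart_inv (\<kappa> j) z)) * \<Omega> (\<kappa> j) z) 0 (-1) (C j * \<alpha> j * \<alpha>' j)"
proof -
  let ?F = "\<lambda>\<phi> z. exp (- of_real (u $ j) / z) * \<phi> (chart_inv (\<kappa> j) z)"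
  have dT: "deriv uminus (0::complex) = -1" by (rule DERIV_imp_deriv) (auto intro!: derivative_eq_intros)
  have an: "uminus analytic_on {0::complex}" using analytic_on_neg[OF analytic_on_ident] by simp
  have "lead (\<lambda>z. ?F \<phi>' (- z)) 0 (-1) (\<alpha>' j * deriv uminus (0::complex) powi (-1))"
    by (rule lead_compose[OF an]) (use germs_lead_P[OF g(2), of j] dT in simp_all)
  from lead_mult[OF lead_mult[OF germs_lead_P[OF g(1), of j] this] form_lead_P[of j]]
  have "lead (\<lambda>z. ?F \<phi> z * ?F \<phi>' (- z) * \<Omega> (\<kappa> j) z) 0 (-1) (C j * \<alpha> j * \<alpha>' j)"
    by (simp add: dT power_int_minus mult_ac)
  then show ?thesis
  proof (rule lead_cong)
    have "\<forall>\<^sub>F z in at 0. \<sigma> (chart_inv (\<kappa> j) z) = chart_inv (\<kappa> j) (- z)"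
      using sigma_near_P by (simp add: eventually_nhds_conv_at)
    then show "\<forall>\<^sub>F z in at 0. ?F \<phi> z * ?F \<phi>' (- z) * \<Omega> (\<kappa> j) z
        = \<phi> (chart_inv (\<kappa> j) z) * \<phi>' (\<sigma> (chart_inv (\<kappa> j) z)) * \<Omega> (\<kappa> j) z"
      by eventually_elim (simp add: exp_minus field_simps)
  qed
qed

text \<open>The residue theorem for \<open>\<phi> (\<phi>' \<circ> \<sigma>) \<Omega>\<close>: the essential singularities cancel because \<open>\<sigma>\<close> changes
  the sign of the local parameters, and the zeros of \<open>\<Omega>\<close> cancel the poles on \<open>\<gamma>s\<close>.\<close>

theorem bilinear_identity:
  assumes g: "germs (mlt u) (pp 1 (\<lambda>j _. \<alpha> j)) G \<phi>" "germs (mlt u) (pp 1 (\<lambda>j _. \<alpha>' j)) G' \<phi>'"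
    and Z: "\<forall>q\<in>set rs. \<phi> q = 0" "\<forall>q\<in>set rs. \<phi>' q = 0"
  shows "(\<Sum>j\<in>UNIV. C j * \<alpha> j * \<alpha>' j) + (\<Sum>l\<in>UNIV. of_real (A l) * \<phi> (Q l) * \<phi>' (Q l)) + B * \<phi> r * \<phi>' r = 0"
proof -
  define \<omega> where "\<omega> c z = \<phi> (chart_inv c z) * \<phi>' (\<sigma> (chart_inv c z)) * \<Omega> c z" for c z
  define S where "S = range P \<union> (range Q \<union> {r})"
  define ch1 where "ch1 p = (if p \<in> range P then \<kappa> (inv_into UNIV P p) else SOME c. c \<in> \<A> \<and> p \<in> fst c)" for p
  define v where "v s = (if s \<in> range P then C (inv_into UNIV P s) * \<alpha> (inv_into UNIV P s) * \<alpha>' (inv_into UNIV P s)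
    else \<phi> s * \<phi>' s * form_residue \<A> \<Omega> s)" for s
  have SX: "S \<subseteq> topspace X" using points by (auto simp: S_def)
  have "(\<Sum>s\<in>S. v s) = 0"
  proof (rule residue_theorem_lead[of S \<omega> ch1])
    show "finite S" by (simp add: S_def)
    show "S \<subseteq> topspace X" by (rule SX)
    show ch1: "ch1 s \<in> \<A> \<and> s \<in> fst (ch1 s)" if "s \<in> S" for s
      using some_chart[of s] that SX \<kappa> by (auto simp: ch1_def)
    show "\<exists>v. lead (\<omega> c) (snd c p) 0 v" if "c \<in> \<A>" "p \<in> fst c - S" for c p
      using product_lead[OF g Z, of c p] that unfolding \<omega>_def[abs_def] S_def by auto
    show "lead (\<omega> (ch1 s)) (snd (ch1 s) s) (-1) (v s)" if s: "s \<in> S" for s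
    proof (cases "s \<in> range P")
      case True
      then obtain j where j: "s = P j" by blast
      show ?thesis using product_lead_P[OF g, of j] P_center distinct_points(1)
        unfolding j \<omega>_def[abs_def] v_def ch1_def by simp
    next
      case False
      then have sQ: "s \<in> range Q \<union> {r}" using s by (auto simp: S_def)
      have "form_residue \<A> \<Omega> s = residue (\<Omega> (ch1 s)) (snd (ch1 s) s)"
        using False by (simp add: form_residue_def ch1_def Let_def)
      moreover obtain w where "lead (\<omega> (ch1 s)) (snd (ch1 s) s) (- of_bool (s \<in> range Q \<union> {r})) w"
        "s \<in> range Q \<union> {r} \<longrightarrow> w = \<phi> s * \<phi>' s * residue (\<Omega> (ch1 s)) (snd (ch1 s) s)"
        using product_lead[OF g Z ch1[OF s, THEN conjunct1] ch1[OF s, THEN conjunct2] False] unfolding \<omega>_def[abs_def] by (elim exE conjE)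
      ultimately show ?thesis using sQ False by (auto simp: v_def)
    qed
    show "\<forall>\<^sub>F z in at (snd c p). \<omega> c z = \<omega> d (transition c d z) * deriv (transition c d) z"
      if c: "c \<in> \<A>" and d: "d \<in> \<A>" and p: "p \<in> fst c \<inter> fst d - S" for c d p
    proof -
      have pV: "snd c p \<in> snd c ` (fst c \<inter> fst d)" using p by blast
      have "\<forall>\<^sub>\<approx>z\<in>snd c ` (fst c \<inter> fst d). \<Omega> c z = \<Omega> d (transition c d z) * deriv (transition c d) z"
        using form c d by (simp add: meromorphic_form_def)
      then have "\<forall>\<^sub>F z in at (snd c p). \<Omega> c z = \<Omega> d (transition c d z) * deriv (transition c d) z"
        using pV by (rule eventually_cosparse_imp_eventually_at)
      moreover have "\<forall>\<^sub>F z in at (snd c p). z \<in> snd c ` (fst c \<inter> fst d)"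
        by (rule eventually_at_in_open'[OF open_overlap[OF c d] pV])
      ultimately show ?thesis
      proof eventually_elim
        case (elim z)
        obtain q where q: "q \<in> fst c" "q \<in> fst d" "z = snd c q" using elim(2) by blast
        have "chart_inv c z = q" "chart_inv d (transition c d z) = q"
          using q chart_inv_simps(3)[OF c] chart_inv_simps(3)[OF d] by (simp_all add: transition_def)
        then show ?case using elim(1) by (simp add: \<omega>_def)
      qed
    qed
  qed
  also have "(\<Sum>s\<in>S. v s) = (\<Sum>s\<in>range P. v s) + ((\<Sum>s\<in>range Q. v s) + v r)"
  proof -
    have "range P \<inter> (range Q \<union> {r}) = {}" "range Q \<inter> {r} = {}" using distinct_points(4,5) by auto
    then show ?thesis unfolding S_def by (subst sum.union_disjoint, simp, simp, simp)+ simp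
  qed
  also have "(\<Sum>s\<in>range P. v s) = (\<Sum>j\<in>UNIV. C j * \<alpha> j * \<alpha>' j)"
    using distinct_points(1) by (subst sum.reindex) (simp_all add: v_def)
  also have "(\<Sum>s\<in>range Q. v s) = (\<Sum>l\<in>UNIV. of_real (A l) * \<phi> (Q l) * \<phi>' (Q l))"
  proof -
    have "Q l \<notin> range P" for l using distinct_points(4) by auto
    then show ?thesis using distinct_points(2) by (subst sum.reindex) (simp_all add: v_def A_eq mult_ac)
  qed
  also have "v r = B * \<phi> r * \<phi>' r"
  proof -
    have "r \<notin> range P" using distinct_points(5) by auto
    then show ?thesis by (simp add: v_def B_eq mult_ac)
  qed
  finally show ?thesis by (simp add: add.assoc)
qed

end

section \<open>The identity theorem on the surface\<close>

context punctured_surface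
begin

text \<open>A disc stays connected when its singular centre is removed, so analytic continuation
  works on it and vanishing spreads around a puncture.\<close>

lemma locally_zero_or_not:
  assumes h: "holo \<phi>" and p: "p \<in> topspace X"
  shows "\<exists>D. openin X D \<and> p \<in> D \<and> ((\<exists>q\<in>D. \<exists>W. openin X W \<and> q \<in> W \<and> (\<forall>q'\<in>W - SP. \<phi> q' = 0)) \<longrightarrow> (\<forall>q\<in>D - SP. \<phi> q = 0))"
proof -
  obtain c where c: "c \<in> \<A>" "p \<in> fst c" using chart_exists[OF p] by blast
  define a where "a = snd c p"
  have fin: "finite (SP - {p})" using SP(1) by simp
  have "open (snd c ` (fst c - (SP - {p})))" by (rule open_chart_image_Diff[OF c(1) fin])
  moreover have "a \<in> snd c ` (fst c - (SP - {p}))" using c(2) by (simp add: a_def)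
  ultimately obtain \<rho> where \<rho>: "0 < \<rho>" "ball a \<rho> \<subseteq> snd c ` (fst c - (SP - {p}))" using open_contains_ball_eq by metis
  define D where "D = chart_inv c ` ball a \<rho>"
  have sub: "ball a \<rho> \<subseteq> img c" using \<rho>(2) by blast
  have D: "openin X D" "D = {q \<in> fst c. snd c q \<in> ball a \<rho>}"
    unfolding D_def by (rule openin_chart_inv_image[OF c(1) open_ball sub], rule chart_inv_image_eq[OF c(1) sub])
  have pD: "p \<in> D" using D(2) c(2) \<rho>(1) by (simp add: a_def)
  define K where "K = ball a \<rho> - (if p \<in> SP then {a} else {})"
  have K: "open K" "connected K" unfolding K_def by (auto intro: connected_open_delete)
  have Ks: "K \<subseteq> snd c ` (fst c - SP)"
  proof
    fix z assume z: "z \<in> K"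
    then obtain q where q: "q \<in> fst c" "q \<notin> SP - {p}" "z = snd c q" using \<rho>(2) unfolding K_def by blast
    then have "q \<notin> SP" using z unfolding K_def a_def by (auto split: if_splits)
    then show "z \<in> snd c ` (fst c - SP)" using q by blast
  qed
  have "(\<lambda>z. \<phi> (chart_inv c z)) holomorphic_on snd c ` (fst c - SP)" using h c(1) unfolding holo_def by (rule bspec)
  then have hol: "(\<lambda>z. \<phi> (chart_inv c z)) holomorphic_on K" using Ks by (rule holomorphic_on_subset)
  have "\<forall>q\<in>D - SP. \<phi> q = 0" if q: "q \<in> D" "openin X W" "q \<in> W" "\<forall>q'\<in>W - SP. \<phi> q' = 0" for q W
  proof -
    define O1 where "O1 = snd c ` (fst c \<inter> W) \<inter> ball a \<rho>"
    have O1: "open O1" "snd c q \<in> O1" unfolding O1_def using open_chart_image[OF c(1) q(2)] q(1,3) D(2) by auto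
    have O2: "open (O1 - {a})" using O1(1) by (rule open_delete)
    have ne: "O1 - {a} \<noteq> {}"
    proof
      assume "O1 - {a} = {}"
      then have "O1 = {a}" using O1(2) by blast
      then show False using O1(1) not_open_singleton[of a] by simp
    qed
    have OK: "O1 - {a} \<subseteq> K" unfolding O1_def K_def by auto
    have zero: "\<phi> (chart_inv c z) = 0" if z: "z \<in> O1 - {a}" for z
    proof -
      obtain q' where q': "q' \<in> fst c" "q' \<in> W" "z = snd c q'" using z unfolding O1_def by blast
      have "z \<in> snd c ` (fst c - SP)" using z OK Ks by blast
      then have "q' \<notin> SP" using q' inj_onD[OF inj_chart[OF c(1)]] by blast
      then show ?thesis using q(4) q' chart_inv_simps(3)[OF c(1)] by simp
    qed
    have K0: "\<phi> (chart_inv c z) = 0" if "z \<in> K" for z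
      by (rule analytic_continuation_open[OF O2 K(1) ne K(2) OK hol _ _ that, of "\<lambda>_. 0"]) (use zero in auto)
    show ?thesis
    proof
      fix q' assume q': "q' \<in> D - SP"
      then have "q' \<in> fst c" "snd c q' \<in> ball a \<rho>" using D(2) by auto
      moreover have "snd c q' \<noteq> a" if "p \<in> SP"
        using q' that inj_onD[OF inj_chart[OF c(1)], of q' p] c(2) calculation(1) unfolding a_def by blast
      ultimately have "snd c q' \<in> K" unfolding K_def by auto
      then show "\<phi> q' = 0" using K0 chart_inv_simps(3)[OF c(1) \<open>q' \<in> fst c\<close>] by force
    qed
  qed
  then show ?thesis using D(1) pD by blast
qed

text \<open>By the local dichotomy, the points with a neighbourhood on which \<open>\<phi>\<close>
  vanishes off \<open>SP\<close> form an open and closed subset of a connected surface.\<close>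

lemma identity_theorem:
  assumes h: "holo \<phi>" and V: "openin X V" "V \<noteq> {}" "\<forall>q\<in>V - SP. \<phi> q = 0" and p: "p \<in> topspace X - SP"
  shows "\<phi> p = 0"
proof -
  define N where "N = {q \<in> topspace X. \<exists>W. openin X W \<and> q \<in> W \<and> (\<forall>q'\<in>W - SP. \<phi> q' = 0)}"
  have VN: "V \<subseteq> N" unfolding N_def using V(1,3) openin_subset[OF V(1)] by blast
  have "openin X N"
  proof (subst openin_subopen, rule ballI)
    fix q assume "q \<in> N"
    then obtain W where W: "openin X W" "q \<in> W" "\<forall>q'\<in>W - SP. \<phi> q' = 0" unfolding N_def by blast
    then have "W \<subseteq> N" unfolding N_def using openin_subset[OF W(1)] by blast
    then show "\<exists>T. openin X T \<and> q \<in> T \<and> T \<subseteq> N" using W by blast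
  qed
  moreover have "closedin X N"
    unfolding closedin_def
  proof
    show "N \<subseteq> topspace X" by (auto simp: N_def)
    show "openin X (topspace X - N)"
    proof (subst openin_subopen, rule ballI)
      fix q assume q: "q \<in> topspace X - N"
      obtain D where D: "openin X D" "q \<in> D"
        "(\<exists>q\<in>D. \<exists>W. openin X W \<and> q \<in> W \<and> (\<forall>q'\<in>W - SP. \<phi> q' = 0)) \<longrightarrow> (\<forall>q\<in>D - SP. \<phi> q = 0)"
        using locally_zero_or_not[OF h, of q] q by blast
      have "D \<inter> N = {}"
      proof (rule ccontr)
        assume "D \<inter> N \<noteq> {}"
        then have "\<forall>q\<in>D - SP. \<phi> q = 0" using D(3) unfolding N_def by blast
        then have "q \<in> N" unfolding N_def using D(1,2) q by blast
        then show False using q by blast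
      qed
      then show "\<exists>T. openin X T \<and> q \<in> T \<and> T \<subseteq> topspace X - N" using D openin_subset[OF D(1)] by blast
    qed
  qed
  moreover have "connected_space X" using rs by (simp add: riemann_surface_def)
  ultimately have "N = topspace X" using VN V(2) unfolding connected_space_clopen_in by blast
  then obtain W where "p \<in> W" "\<forall>q'\<in>W - SP. \<phi> q' = 0" using p unfolding N_def by blast
  then show ?thesis using p by blast
qed

end

context ba_surface
begin

section \<open>Density of the regular set\<close>

text \<open>Where \<open>f i\<close> vanishes on an open set, the derivative loses its only singular
  coefficient and is zero with zero remainder. By the formula in \<open>\<psi>_partial\<close>,
  differentiating a Taylor coefficient at \<open>P i\<close> in direction i then gives minus a
  multiple of the next one, so all of them vanish inductively.\<close>

lemma leading_coeff_dense:
  assumes V: "open V" "V \<subseteq> U" "V \<noteq> {}" shows "\<exists>u\<in>V. f i u \<noteq> 0"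
proof (rule ccontr)
  assume "\<not> (\<exists>u\<in>V. f i u \<noteq> 0)"
  then have f0: "f i u = 0" if "u \<in> V" for u using that by blast
  have der: "\<forall>u\<in>V. (deriv ^^ m) (G\<psi> u (P i)) 0 = 0" for m
  proof (induction m)
    case 0
    then show ?case using G\<psi>(2) V(2) f0 by auto
  next
    case (Suc m)
    show ?case
    proof
      fix u assume u: "u \<in> V"
      then have uU: "u \<in> U" using V(2) by blast
      obtain \<xi> G' where \<xi>: "germs (mlt u) (pp 1 (\<lambda>j _. if j = i then f i u else 0)) G' \<xi>" "\<forall>q\<in>Z. \<xi> q = 0"
        and d: "\<forall>j m. ((\<lambda>t. (deriv ^^ m) (G\<psi> (u + t *\<^sub>R axis i 1) (P j)) 0) has_vector_derivative
          (deriv ^^ m) (G' (P j)) 0 - (if j = i then (deriv ^^ Suc m) (G\<psi> u (P i)) 0 / of_nat (Suc m) else 0)) (at 0)"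
        using \<psi>_partial[OF uU, of i] by (elim exE conjE)
      have "pp 1 (\<lambda>j _. if j = i then f i u else 0) = (\<lambda>_ _. 0)" by (intro ext) (simp add: pp_def f0[OF u])
      then have g: "germs (mlt u) (\<lambda>_ _. 0) G' \<xi>" using \<xi>(1) by simp
      have "germs (mlt u) (\<lambda>_ _. 0) (\<lambda>_ _. 0) (\<lambda>_. 0)" by (simp add: germs_def holo_def ext_def)
      then have G0: "G' (P i) z = 0" if "z \<in> cball (ctr (P i)) (rad (P i))" for z
        using germs_unique(2)[OF uU g _ _ P_SP that, of "\<lambda>_ _. 0" "\<lambda>_. 0"] \<xi>(2) by simp
      have "\<forall>\<^sub>F z in nhds 0. z \<in> ball (ctr (P i)) (rad (P i))" by (rule eventually_nhds_in_open[OF open_ball zero_in_ball])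
      then have "\<forall>\<^sub>F z in nhds 0. G' (P i) z = 0" by eventually_elim (simp add: G0)
      then have "(deriv ^^ m) (G' (P i)) 0 = (deriv ^^ m) (\<lambda>_. 0) 0" by (rule higher_deriv_cong_ev) simp
      then have "(deriv ^^ m) (G' (P i)) 0 = 0" by simp
      with d[rule_format, where j = i and m = m] have "((\<lambda>t. (deriv ^^ m) (G\<psi> (u + t *\<^sub>R axis i 1) (P i)) 0) has_vector_derivative
          - ((deriv ^^ Suc m) (G\<psi> u (P i)) 0 / of_nat (Suc m))) (at 0)" by simp
      from partial_eqI[OF this] have "partial i (\<lambda>u. (deriv ^^ m) (G\<psi> u (P i)) 0) u = - ((deriv ^^ Suc m) (G\<psi> u (P i)) 0 / of_nat (Suc m))" .
      moreover have "partial i (\<lambda>u. (deriv ^^ m) (G\<psi> u (P i)) 0) u = partial i (\<lambda>_. 0) u"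
        by (rule partial_cong_open[OF V(1) u]) (use Suc.IH in blast)
      moreover have "partial i (\<lambda>_. 0::complex) u = 0" by (rule partial_eqI) simp
      ultimately have "(deriv ^^ Suc m) (G\<psi> u (P i)) 0 / of_nat (Suc m) = 0" by simp
      then show "(deriv ^^ Suc m) (G\<psi> u (P i)) 0 = 0" unfolding divide_eq_0_iff of_nat_eq_0_iff by simp
    qed
  qed
  obtain u where u: "u \<in> V" using V(3) by blast
  then have uU: "u \<in> U" using V(2) by blast
  note g = G\<psi>(1)[OF uU]
  have G0: "G\<psi> u (P i) z = 0" if "z \<in> ball 0 (rad (P i))" for z
  proof (rule holomorphic_fun_eq_0_on_ball[OF _ that])
    show "G\<psi> u (P i) holomorphic_on ball 0 (rad (P i))"
      using ext_holomorphic_ball[OF germsD(2)[OF g P_SP, of i]] P_center by simp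
  qed (use der u in blast)
  have "\<forall>q\<in>odisc (P i) - SP. \<psi> u q = 0"
  proof
    fix q assume q: "q \<in> odisc (P i) - SP"
    then have "q \<in> fst (\<kappa> i)" and b: "snd (\<kappa> i) q \<in> ball 0 (rad (P i))"
      using odisc_eq[OF P_SP, of i] P_center by auto
    then have n: "chart_inv (\<kappa> i) (snd (\<kappa> i) q) = q" using chart_inv_simps(3)[OF \<kappa>(1)] by blast
    have "q \<noteq> P i" using q P_SP[of i] by blast
    then have "snd (\<kappa> i) q \<noteq> 0" using inj_onD[OF inj_chart[OF \<kappa>(1)[of i]], of q "P i"] \<open>q \<in> fst (\<kappa> i)\<close> \<kappa>(2)[of i] P_center[of i] by metis
    then have "mlt u (P i) (snd (\<kappa> i) q) * \<psi> u (chart_inv (\<kappa> i) (snd (\<kappa> i) q)) = 0"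
      using germsD(3)[OF g P_SP, of "snd (\<kappa> i) q" i] b G0[OF b] P_center by simp
    then show "\<psi> u q = 0" unfolding n by (simp add: mlt_P)
  qed
  moreover have "odisc (P i) \<noteq> {}" using self_odisc[OF P_SP, of i] by blast
  moreover have "r \<in> topspace X - SP" using Z_regular by blast
  ultimately have "\<psi> u r = 0"
    using identity_theorem[OF germsD(1)[OF g] openin_odisc[OF P_SP]] by blast
  then show False using \<psi>_Z(1)[OF uU] h_nonzero by simp
qed

section \<open>The immersion\<close>

text \<open>Real parts make \<open>x\<close> a real vector for every parameter; on \<open>U\<close>
  they change nothing, because there the values at \<open>Q l\<close> are real by
  \<open>\<psi>_real\<close>.\<close>

definition x :: "real^'n \<Rightarrow> real^('n option)" where
  "x u = (\<chi> l. sqrt \<bar>A l\<bar> * Re (\<psi> u (Q l)))"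

lemma Q_regular: "Q l \<in> topspace X - SP"
proof -
  have "Q l \<in> topspace X" using points by blast
  moreover have "Q l \<notin> range P" using distinct_points(4) by auto
  moreover have "Q l \<notin> set (\<gamma>s @ r # rs)" using distinct_points(5) rangeI[of Q l] by blast
  ultimately show ?thesis by simp
qed

lemma \<psi>_Q_real: "u \<in> U \<Longrightarrow> of_real (Re (\<psi> u (Q l))) = \<psi> u (Q l)"
  using \<psi>_real[OF _ Q_regular, of u l] tau_fixed[of "Q l"] by (simp add: complex_eq_iff)

lemma x_eq: "u \<in> U \<Longrightarrow> of_real (x u $ l) = of_real (sqrt \<bar>A l\<bar>) * \<psi> u (Q l)"
  using \<psi>_Q_real[of u l] by (simp add: x_def)

lemma smooth_x: "smooth_on U x"
  unfolding smooth_on_def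
proof
  fix k
  have bl: "bounded_linear (\<lambda>w. (sqrt \<bar>A l\<bar> * Re w) *\<^sub>R axis l (1::real))" for l
    by (intro bounded_linear_scaleR_const bounded_linear_const_mult bounded_linear_Re)
  have eq: "x = (\<lambda>u. \<Sum>l\<in>UNIV. (sqrt \<bar>A l\<bar> * Re (\<psi> u (Q l))) *\<^sub>R axis l 1)"
    by (intro ext) (simp add: x_def vec_eq_iff axis_def if_distrib[of "\<lambda>x. _ * x"] cong: if_cong)
  show "Ck_on k U x" unfolding eq
    by (intro Ck_on_sum domain(1) Ck_on_bounded_linear[OF domain(1) bl] Ck_\<psi>[OF Q_regular])
qed

text \<open>The signs of the residues reproduce the Minkowski signature, so the product of two
  weighted vectors is the \<open>Q\<close> part of the bilinear identity.\<close>

lemma minkowski_weighted: "minkowski (\<chi> l. sqrt \<bar>A l\<bar> * a l) (\<chi> l. sqrt \<bar>A l\<bar> * b l) = (\<Sum>l\<in>UNIV. A l * a l * b l)"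
proof -
  have s: "sqrt \<bar>A l\<bar> * a l * (sqrt \<bar>A l\<bar> * b l) = \<bar>A l\<bar> * a l * b l" for l
  proof -
    have "sqrt \<bar>A l\<bar> * a l * (sqrt \<bar>A l\<bar> * b l) = (sqrt \<bar>A l\<bar> * sqrt \<bar>A l\<bar>) * a l * b l" by (simp only: mult_ac)
    then show ?thesis by simp
  qed
  have "(\<Sum>l\<in>UNIV. A l * a l * b l) = A None * a None * b None + (\<Sum>i\<in>UNIV. A (Some i) * a (Some i) * b (Some i))"
    by (simp add: UNIV_option_conv sum.reindex)
  also have "\<dots> = \<bar>A None\<bar> * a None * b None - (\<Sum>i\<in>UNIV. \<bar>A (Some i)\<bar> * a (Some i) * b (Some i))"
    using A_pos A_neg by (simp add: abs_of_neg sum_negf)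
  finally show ?thesis by (simp add: minkowski_def s)
qed

lemma \<psi>_pp: "u \<in> U \<Longrightarrow> germs (mlt u) (pp 1 (\<lambda>_ _. 0)) (G\<psi> u) (\<psi> u)"
proof -
  have "pp 1 (\<lambda>_ _. 0) = (\<lambda>_ _. 0)" by (intro ext) (simp add: pp_def)
  then show "u \<in> U \<Longrightarrow> ?thesis" using G\<psi>(1) by simp
qed

lemma x_unit: assumes u: "u \<in> U" shows "minkowski (x u) (x u) = 1"
proof -
  have "of_real (minkowski (x u) (x u)) = (\<Sum>l\<in>UNIV. of_real (A l) * \<psi> u (Q l) * \<psi> u (Q l))"
    unfolding x_def minkowski_weighted by (simp add: \<psi>_Q_real[OF u])
  also have "\<dots> = - (B * of_real h * of_real h)"
    using bilinear_identity[OF \<psi>_pp[OF u] \<psi>_pp[OF u]] \<psi>_Z[OF u] by (simp add: add_eq_0_iff2)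
  also have "\<dots> = 1" using hB by (simp add: power2_eq_square algebra_simps)
  finally show ?thesis by simp
qed

text \<open>The function \<open>\<xi>\<close> is \<open>\<partial>\<^sub>i \<psi>\<close>.\<close>

lemma partial_x_ex:
  assumes u: "u \<in> U"
  shows "\<exists>\<xi> G'. germs (mlt u) (pp 1 (\<lambda>j _. if j = i then f i u else 0)) G' \<xi> \<and> (\<forall>q\<in>Z. \<xi> q = 0) \<and>
    (\<forall>l. of_real (Re (\<xi> (Q l))) = \<xi> (Q l)) \<and> partial i x u = (\<chi> l. sqrt \<bar>A l\<bar> * Re (\<xi> (Q l)))"
proof -
  obtain \<xi> G' where \<xi>: "germs (mlt u) (pp 1 (\<lambda>j _. if j = i then f i u else 0)) G' \<xi>" "\<forall>q\<in>Z. \<xi> q = 0"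
    and d: "\<forall>p\<in>topspace X - SP. ((\<lambda>t. \<psi> (u + t *\<^sub>R axis i 1) p) has_vector_derivative \<xi> p) (at 0)"
    using \<psi>_partial[OF u, of i] by (elim exE conjE)
  have dQ: "((\<lambda>t. \<psi> (u + t *\<^sub>R axis i 1) (Q l)) has_vector_derivative \<xi> (Q l)) (at 0)" for l
    using d Q_regular by blast
  have dR: "((\<lambda>t. Re (\<psi> (u + t *\<^sub>R axis i 1) (Q l))) has_vector_derivative Re (\<xi> (Q l))) (at 0)" for l
    by (rule bounded_linear.has_vector_derivative[OF bounded_linear_Re dQ])
  have real: "of_real (Re (\<xi> (Q l))) = \<xi> (Q l)" for l
  proof -
    have "partial i (\<lambda>u. \<psi> u (Q l)) u = partial i (\<lambda>u. of_real (Re (\<psi> u (Q l)))) u"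
      by (rule partial_cong_open[OF domain(1) u]) (simp add: \<psi>_Q_real)
    moreover have "partial i (\<lambda>u. \<psi> u (Q l)) u = \<xi> (Q l)" by (rule partial_eqI[OF dQ])
    moreover have "partial i (\<lambda>u. of_real (Re (\<psi> u (Q l))) :: complex) u = of_real (Re (\<xi> (Q l)))"
      by (rule partial_eqI, rule bounded_linear.has_vector_derivative[OF bounded_linear_of_real dR])
    ultimately show ?thesis by simp
  qed
  have "partial i x u $ l = sqrt \<bar>A l\<bar> * Re (\<xi> (Q l))" for l
  proof -
    have "((\<lambda>t. x (u + t *\<^sub>R axis i 1) $ l) has_vector_derivative partial i x u $ l) (at 0)"
      by (rule bounded_linear.has_vector_derivative[OF bounded_linear_vec_nth
        differentiable_has_partial[OF smooth_on_differentiable[OF smooth_x u]]])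
    moreover have "((\<lambda>t. x (u + t *\<^sub>R axis i 1) $ l) has_vector_derivative sqrt \<bar>A l\<bar> * Re (\<xi> (Q l))) (at 0)"
      unfolding x_def vec_lambda_beta by (rule bounded_linear.has_vector_derivative[OF bounded_linear_mult_right dR])
    ultimately show ?thesis by (rule vector_derivative_unique_at)
  qed
  then have "partial i x u = (\<chi> l. sqrt \<bar>A l\<bar> * Re (\<xi> (Q l)))" by (simp add: vec_eq_iff)
  then show ?thesis using \<xi> real by blast
qed

text \<open>The derivatives vanish at \<open>r\<close>, so only the terms at the points of
  \<open>P\<close> balance the Minkowski product. The singular coefficients of the two derivatives
  sit at \<open>P i\<close> and at \<open>P j\<close>, and they meet only if i = j.\<close>

lemma x_gram:
  assumes u: "u \<in> U"
  shows "of_real (minkowski (partial i x u) (partial j x u)) = (if i = j then - (f i u)\<^sup>2 * C i else 0)"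
    and "minkowski (x u) (partial i x u) = 0"
proof -
  obtain \<xi> G where \<xi>: "germs (mlt u) (pp 1 (\<lambda>j _. if j = i then f i u else 0)) G \<xi>" "\<forall>q\<in>Z. \<xi> q = 0"
    "\<forall>l. of_real (Re (\<xi> (Q l))) = \<xi> (Q l)" "partial i x u = (\<chi> l. sqrt \<bar>A l\<bar> * Re (\<xi> (Q l)))"
    using partial_x_ex[OF u, of i] by (elim exE conjE)
  obtain \<xi>' G' where \<xi>': "germs (mlt u) (pp 1 (\<lambda>k _. if k = j then f j u else 0)) G' \<xi>'" "\<forall>q\<in>Z. \<xi>' q = 0"
    "\<forall>l. of_real (Re (\<xi>' (Q l))) = \<xi>' (Q l)" "partial j x u = (\<chi> l. sqrt \<bar>A l\<bar> * Re (\<xi>' (Q l)))"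
    using partial_x_ex[OF u, of j] by (elim exE conjE)
  have "of_real (minkowski (partial i x u) (partial j x u)) = (\<Sum>l\<in>UNIV. of_real (A l) * \<xi> (Q l) * \<xi>' (Q l))"
    unfolding \<xi>(4) \<xi>'(4) minkowski_weighted by (simp add: \<xi>(3) \<xi>'(3))
  also have "\<dots> = - (\<Sum>k\<in>UNIV. C k * (if k = i then f i u else 0) * (if k = j then f j u else 0))"
    using bilinear_identity[OF \<xi>(1) \<xi>'(1)] \<xi>(2) \<xi>'(2) by (simp add: add_eq_0_iff2 add_eq_0_iff)
  also have "(\<Sum>k\<in>UNIV. C k * (if k = i then f i u else 0) * (if k = j then f j u else 0))
      = (\<Sum>k\<in>UNIV. if k = i then (if i = j then C i * f i u * f i u else 0) else 0)"
    by (rule sum.cong) auto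
  also have "\<dots> = (if i = j then C i * f i u * f i u else 0)" by simp
  finally show "of_real (minkowski (partial i x u) (partial j x u)) = (if i = j then - (f i u)\<^sup>2 * C i else 0)"
    by (simp add: power2_eq_square)
  have "of_real (minkowski (x u) (partial i x u)) = (\<Sum>l\<in>UNIV. of_real (A l) * \<psi> u (Q l) * \<xi> (Q l))"
    unfolding \<xi>(4) x_def minkowski_weighted by (simp add: \<xi>(3) \<psi>_Q_real[OF u])
  also have "\<dots> = (0::complex)"
    using bilinear_identity[OF \<psi>_pp[OF u] \<xi>(1)] \<xi>(2) \<psi>_Z[OF u] by simp
  finally show "minkowski (x u) (partial i x u) = 0" by simp
qed

text \<open>The number under the modulus in \<open>H_eq\<close> is the Minkowski square of a vector
  orthogonal to the timelike \<open>x u\<close>, hence real and nonpositive; the modulus reverses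
  its sign.\<close>

lemma H_sqrt: 
  assumes u: "u \<in> U" 
  shows "H i u = sqrt (- minkowski (partial i x u) (partial i x u))" "(H i u)\<^sup>2 = - minkowski (partial i x u) (partial i x u)"
proof -
  have le: "minkowski (partial i x u) (partial i x u) \<le> 0"
    by (rule minkowski_orthogonal_spacelike[OF x_unit[OF u] x_gram(2)[OF u]])
  have "- (f i u)\<^sup>2 * C i = of_real (minkowski (partial i x u) (partial i x u))" using x_gram(1)[OF u, of i i] by simp
  then have "H i u = sqrt (cmod (of_real (minkowski (partial i x u) (partial i x u))))" by (simp only: H_eq)
  then show "H i u = sqrt (- minkowski (partial i x u) (partial i x u))" using le by simp
  then show "(H i u)\<^sup>2 = - minkowski (partial i x u) (partial i x u)" using le by simp
qed

lemma H_nonneg: "0 \<le> H i u" by (simp add: H_eq)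

lemma H_nonzero_iff: "H i u \<noteq> 0 \<longleftrightarrow> f i u \<noteq> 0"
  using C_nonzero by (simp add: H_eq)

lemma continuous_on_H: "continuous_on U (H i)"
proof -
  have c: "continuous_on U (partial i x)"
    using smooth_onD[OF smooth_on_partial[OF smooth_x], of 0] by simp
  have "continuous_on U (\<lambda>u. sqrt (- minkowski (partial i x u) (partial i x u)))"
    by (intro continuous_intros bounded_bilinear.continuous_on[OF bounded_bilinear_minkowski] c)
  then show ?thesis by (rule continuous_on_eq) (simp add: H_sqrt(1))
qed

abbreviation "regular_part \<equiv> {u \<in> U. \<forall>i. H i u \<noteq> 0}"

lemma open_nonzero: "open {u \<in> U. H i u \<noteq> 0}"
proof -
  have "open (U \<inter> H i -` (- {0}))" by (rule continuous_open_preimage[OF continuous_on_H domain(1)]) auto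
  then show ?thesis by (simp add: vimage_def Int_def)
qed

lemma open_regular_part: "open regular_part"
proof -
  have "regular_part = U \<inter> (\<Inter>i. {u \<in> U. H i u \<noteq> 0})" by auto
  then show ?thesis using open_nonzero domain(1) by (simp add: open_INT open_Int)
qed

text \<open>Each \<open>f i\<close> is nonzero somewhere in every nonempty open subset of
  \<open>U\<close>, and nonvanishing is an open condition, so the finitely many conditions are
  imposed one after another on shrinking open sets.\<close>

lemma regular_part_dense: "U \<subseteq> closure regular_part"
proof
  fix u assume u: "u \<in> U"
  show "u \<in> closure regular_part"
    unfolding closure_iff_nhds_not_empty
  proof (intro allI impI)
    fix N V assume V: "V \<subseteq> N" "open V" "u \<in> V"
    have "\<exists>V'. open V' \<and> V' \<noteq> {} \<and> V' \<subseteq> V \<inter> U \<and> (\<forall>v\<in>V'. \<forall>i\<in>I. H i v \<noteq> 0)" if "finite I" for I :: "'n set"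
      using that
    proof (induction I)
      case empty
      show ?case using V(2,3) domain(1) u by (intro exI[of _ "V \<inter> U"]) auto
    next
      case (insert i I)
      from insert.IH obtain V' where V': "open V'" "V' \<noteq> {}" "V' \<subseteq> V \<inter> U" "\<forall>v\<in>V'. \<forall>i\<in>I. H i v \<noteq> 0" by (elim exE conjE)
      obtain v where v: "v \<in> V'" "f i v \<noteq> 0" using leading_coeff_dense[OF V'(1) _ V'(2), of i] V'(3) by blast
      then have "v \<in> V' \<inter> {u \<in> U. H i u \<noteq> 0}" using V'(3) H_nonzero_iff by blast
      moreover have "open (V' \<inter> {u \<in> U. H i u \<noteq> 0})" using V'(1) open_nonzero by blast
      ultimately show ?case using V'(3,4) by (intro exI[of _ "V' \<inter> {u \<in> U. H i u \<noteq> 0}"]) auto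
    qed
    from this[OF finite[of UNIV]] obtain V' where "V' \<noteq> {}" "V' \<subseteq> V \<inter> U" "\<forall>v\<in>V'. \<forall>i\<in>UNIV. H i v \<noteq> 0" by (elim exE conjE)
    then show "regular_part \<inter> N \<noteq> {}" using V(1) by blast
  qed
qed

lemma regular_net: "hyperbolic_net regular_part x H"
proof
  show "open regular_part" by (rule open_regular_part)
  show "smooth_on regular_part x" using smooth_x unfolding smooth_on_def by (blast intro: Ck_on_subset)
  show "minkowski (x u) (x u) = 1" if "u \<in> regular_part" for u using x_unit that by blast
  show "minkowski (partial i x u) (partial j x u) = (if i = j then - (H i u)\<^sup>2 else 0)" if "u \<in> regular_part" for u i j
    using x_gram(1)[of u i j] H_sqrt(2)[of u i] that by (cases "i = j") auto
  show "0 < H i u" if "u \<in> regular_part" for u i using H_nonneg[of i u] that by (simp add: less_le)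
qed

text \<open>On the hyperboloid the time component has square at least 1; being continuous on the
  connected set \<open>U\<close>, it keeps its sign.\<close>

lemma single_sheet: "\<exists>s\<in>{1, -1}. \<forall>u\<in>U. x u \<in> hyperbolic_space s"
proof -
  have ge: "1 \<le> (x u $ None)\<^sup>2" if "u \<in> U" for u
  proof -
    have "0 \<le> (\<Sum>i\<in>UNIV. x u $ Some i * x u $ Some i)" by (intro sum_nonneg) simp
    then show ?thesis using x_unit[OF that] unfolding minkowski_def power2_eq_square by linarith
  qed
  have nz: "x u $ None \<noteq> 0" if "u \<in> U" for u using ge[OF that] by auto
  have "continuous_on U x" using smooth_onD[OF smooth_x, of 0] by simp
  then have "continuous_on U (\<lambda>u. x u $ None)" by (intro continuous_intros)
  then have con: "connected ((\<lambda>u. x u $ None) ` U)" using domain(2) by (rule connected_continuous_image)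
  have same: "sgn (x u $ None) = sgn (x v $ None)" if uv: "u \<in> U" "v \<in> U" for u v
  proof (rule ccontr)
    assume ne: "sgn (x u $ None) \<noteq> sgn (x v $ None)"
    have "0 \<in> (\<lambda>u. x u $ None) ` U"
    proof (cases "x u $ None < 0")
      case True
      then have "0 < x v $ None" using ne nz[OF uv(2)] by (auto simp: sgn_if split: if_splits)
      then show ?thesis using connectedD_interval[OF con imageI[OF uv(1)] imageI[OF uv(2)], of 0] True by simp
    next
      case False
      then have "0 < x u $ None" using nz[OF uv(1)] by simp
      then have "x v $ None < 0" "0 < x u $ None" using ne nz[OF uv(2)] by (auto simp: sgn_if split: if_splits)
      then show ?thesis using connectedD_interval[OF con imageI[OF uv(2)] imageI[OF uv(1)], of 0] by simp
    qed
    then show False using nz by auto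
  qed
  show ?thesis
  \<comment> \<open>For empty \<open>U\<close> either sign will do; otherwise the sign is read off
    at one point.\<close>
  proof (cases "U = {}")
    case False
    then obtain u where u: "u \<in> U" by blast
    then have "sgn (x u $ None) \<in> {1, -1}" using nz by (auto simp: sgn_if)
    moreover have "\<forall>v\<in>U. x v \<in> hyperbolic_space (sgn (x u $ None))"
      using same[OF u] x_unit by (simp add: hyperbolic_space_def)
    ultimately show ?thesis by blast
  qed auto
qed

end

theorem corollary2:
  fixes X :: "'a topology" and \<A> :: "'a chart set" and g :: nat
    and P :: "'n::finite \<Rightarrow> 'a" and \<kappa> :: "'n \<Rightarrow> 'a chart"
    and Q :: "'n option \<Rightarrow> 'a" and \<gamma>s rs :: "'a list" and r :: 'a
    and h :: real and U :: "(real ^ 'n) set" and \<psi> :: "real ^ 'n \<Rightarrow> 'a \<Rightarrow> complex"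
    and \<sigma> \<tau> :: "'a \<Rightarrow> 'a" and \<Omega> :: "'a form"
    and A :: "'n option \<Rightarrow> real" and B :: complex and C :: "'n \<Rightarrow> complex"
    and f :: "'n \<Rightarrow> real ^ 'n \<Rightarrow> complex" and H :: "'n \<Rightarrow> real ^ 'n \<Rightarrow> real"
  assumes surface: "compact_riemann_surface X \<A> g"
    and points: "range P \<union> range Q \<union> set (\<gamma>s @ r # rs) \<subseteq> topspace X"
    and distinct_points: "inj P" "inj Q" "distinct (\<gamma>s @ r # rs)" "range P \<inter> range Q = {}"
      "(range P \<union> range Q) \<inter> set (\<gamma>s @ r # rs) = {}"
    and degree: "length \<gamma>s = g + length rs"
    and parameters: "\<And>i. local_parameter \<A> (P i) (\<kappa> i)"
    and domain: "open U" "connected U"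
    and h_nonzero: "h \<noteq> 0"
    and BA: "baker_akhiezer X \<A> P \<kappa> \<gamma>s r rs (of_real h) U \<psi>"
    and sigma: "holomorphic_involution X \<A> \<sigma>"
    and sigma_fixed: "\<And>p. p \<in> range Q \<union> range P \<union> {r} \<Longrightarrow> \<sigma> p = p"
    and sigma_local: "\<And>i. \<forall>\<^sub>F p in nhdsin X (P i). snd (\<kappa> i) (\<sigma> p) = - snd (\<kappa> i) p"
    and form: "meromorphic_form \<A> \<Omega>"
    and form_divisor: "has_divisor \<A> \<Omega>
      (divisor_of \<gamma>s + push_divisor \<sigma> (divisor_of \<gamma>s) + (\<Sum>i\<in>UNIV. frag_of (P i))
        - (\<Sum>i\<in>UNIV. frag_of (Q i)) - divisor_of (r # rs) - push_divisor \<sigma> (divisor_of rs))"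
    and tau: "antiholomorphic_involution X \<A> \<tau>"
    and tau_fixed: "\<And>p. p \<in> range P \<union> range Q \<union> set (\<gamma>s @ r # rs) \<Longrightarrow> \<tau> p = p"
    and tau_local: "\<And>i. \<forall>\<^sub>F p in nhdsin X (P i). snd (\<kappa> i) (\<tau> p) = cnj (snd (\<kappa> i) p)"
    and A_eq: "\<And>i. of_real (A i) = form_residue \<A> \<Omega> (Q i)"
    and B_eq: "B = form_residue \<A> \<Omega> r"
    and C_eq: "\<And>i. - C i = fls_nth (laurent_expansion (\<Omega> (\<kappa> i)) 0) 1"
    and f_eq: "\<And>j u. f j u = leading_coeff (\<kappa> j) (u $ j) (\<psi> u)"
    and A_neg: "\<And>i. A (Some i) < 0" and A_pos: "0 < A None"
    and hB: "(of_real h)\<^sup>2 * B = -1"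
    and H_eq: "\<And>i u. H i u = sqrt (cmod (- (f i u)\<^sup>2 * C i))"
  shows "\<exists>x :: real ^ 'n \<Rightarrow> real ^ ('n option). \<exists>s \<in> {1, -1}.
    (\<forall>u\<in>U. \<forall>i. of_real (x u $ i) = of_real (sqrt \<bar>A i\<bar>) * \<psi> u (Q i)) \<and>
    smooth_on U x \<and> (\<forall>u\<in>U. x u \<in> hyperbolic_space s) \<and>
    (\<forall>u\<in>U. \<forall>i j. of_real (minkowski (partial i x u) (partial j x u)) =
      (if i = j then - (f i u)\<^sup>2 * C i else 0)) \<and>
    (let W = {u \<in> U. \<forall>i. H i u \<noteq> 0} in
      U \<subseteq> closure W \<and>
      orthogonal_coordinates (hyperbolic_space s) W x H \<and>
      lame_equations (-1) W H)"
proof -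
  interpret ba_surface X \<A> g P \<kappa> Q \<gamma>s rs r h U \<psi> \<sigma> \<tau> \<Omega> A B C f H
    by unfold_locales (fact assms)+
  obtain s where s: "s \<in> {1, -1}" "\<forall>u\<in>U. x u \<in> hyperbolic_space s" using single_sheet by (rule bexE)
  have "orthogonal_coordinates (hyperbolic_space s) regular_part x H"
    by (rule hyperbolic_net.orthogonal_coordinates[OF regular_net]) (use s in blast)
  moreover have "lame_equations (-1) regular_part H" by (rule hyperbolic_net.lame[OF regular_net])
  ultimately show ?thesis
    unfolding Let_def using s x_eq smooth_x x_gram(1) regular_part_dense by (intro exI[of _ x] bexI[of _ s] conjI) auto
qed

end
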